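(* Let $(B^\epsilon)_{\epsilon>0}$ be the family of collision kernels built from $\gamma\in[-4,0)$ and $\beta$ as in the context. Let $(f^\epsilon)_{\epsilon>0}$ be probability densities on $\mathbb{R}^3$ with $$\sup_{\epsilon>0}\int_{\mathbb{R}^3}|v|^2f^\epsilon(v)\,dv<+\infty,\qquad\sup_{\epsilon>0}\int_{\mathbb{R}^3}f^\epsilon\log f^\epsilon\,dv<+\infty,$$ and suppose that, as $\epsilon\downarrow0$, $f^\epsilon$ converges to a probability density $f$ weak-* against bounded continuous functions. Then $$\liminf_{\epsilon\downarrow0}D_B^\epsilon(f^\epsilon)\ge D_L(f).$$
   Context: For $v,v_*\in\mathbb{R}^3$, $\sigma\in\mathbb{S}^2$: $k=\frac{v-v_*}{|v-v_*|}$, $\cos\theta=k\cdot\sigma$, $v'=\frac{v+v_*}{2}+\frac{|v-v_*|}{2}\sigma$, $v_*'=\frac{v+v_*}{2}-\frac{|v-v_*|}{2}\sigma$; $f=f(v)$, $f_*=f(v_* )$, $f'=f(v')$, $f'_*=f(v'_* )$. Kernels are supported in $\theta\in[0,\pi/2]$. Kernel: $B^\epsilon(r,\theta)\sin\theta=r^\gamma\beta^\epsilon(\theta)$ with $\gamma\in[-4,0)$, $\beta^\epsilon(\theta)=\frac{\pi^3}{\epsilon^3}\beta\left(\frac{\pi\theta}{\epsilon}\right)$ for $\theta\in(0,\epsilon/2)$ and $\beta^\epsilon(\theta)=0$ otherwise. The function $\beta\ge0$ satisfies: $\operatorname{supp}\beta\subset[0,\pi/2]$; $\sup_{[\delta,\pi/2]}\beta<\infty$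 for every $\delta>0$; there are $\nu\in(0,2)$, $c_1>0$ with $c_1\theta^{-1-\nu}\le\beta(\theta)$ for $\theta\in(0,\pi/2]$; and $\int_0^{\pi/2}\theta^2\beta(\theta)\,d\theta=\frac8\pi$. Dissipations: $$D_B^\epsilon(f)=\frac14\iint_{\mathbb{R}^6}\int_{\mathbb{S}^2}[f'f'_*-ff_*](\log f'f'_*-\log ff_* )B^\epsilon(|v-v_*|,\theta)\,d\sigma dv_*dv,$$ $$D_L(f)=2\iint_{\mathbb{R}^6}|v-v_*|^{2+\gamma}\left|\Pi[v-v_*](\nabla_v-\nabla_{v_*})\sqrt{ff_*}\right|^2dv_*dv,\qquad \Pi[z]=I-\frac{z\otimes z}{|z|^2},$$ where $D_L(f)=+\infty$ if $|v-v_*|^{1+\gamma/2}\Pi[v-v_*](\nabla_v-\nabla_{v_*})\sqrt{ff_*}$ (distributional on $v\neq v_*$) is not in $L^2(\mathbb{R}^6)$. *)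

theory Defs
  imports "HOL-Analysis.Analysis"
begin

text \<open>A probability density is given by a nonnegative Borel representative.\<close>

definition prob_density :: "(real^3 \<Rightarrow> real) \<Rightarrow> bool" where
  "prob_density f \<longleftrightarrow>
     f \<in> borel_measurable borel \<and> (\<forall>v. 0 \<le> f v) \<and> (\<integral>\<^sup>+ v. ennreal (f v) \<partial>lborel) = 1"

definition second_moment :: "(real^3 \<Rightarrow> real) \<Rightarrow> ennreal" where
  "second_moment f = (\<integral>\<^sup>+ v. ennreal ((norm v)\<^sup>2 * f v) \<partial>lborel)"

text \<open>
  The integral of \<open>f log f\<close> (with \<open>0 log 0 = 0\<close>, which \<open>ln 0 = 0\<close> yields) as an extended real,
  positive part minus negative part.  For a density with finite second moment the negative part
  is finite, so the difference is never of the form \<open>\<infinity> - \<infinity>\<close>.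
\<close>

definition H_functional :: "(real^3 \<Rightarrow> real) \<Rightarrow> ereal" where
  "H_functional f =
     enn2ereal (\<integral>\<^sup>+ v. ennreal (f v * ln (f v)) \<partial>lborel)
   - enn2ereal (\<integral>\<^sup>+ v. ennreal (- (f v * ln (f v))) \<partial>lborel)"

definition weak_star_conv ::
  "('i \<Rightarrow> real^3 \<Rightarrow> real) \<Rightarrow> (real^3 \<Rightarrow> real) \<Rightarrow> 'i filter \<Rightarrow> bool" where
  "weak_star_conv F f L \<longleftrightarrow>
     (\<forall>\<phi>::real^3 \<Rightarrow> real. continuous_on UNIV \<phi> \<longrightarrow> bounded (range \<phi>) \<longrightarrow>
        ((\<lambda>i. \<integral>v. \<phi> v * F i v \<partial>lborel) \<longlongrightarrow> (\<integral>v. \<phi> v * f v \<partial>lborel)) L)"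

text \<open>
  Surface measure \<open>d\<sigma>\<close> on the unit sphere of \<open>\<real>\<^sup>3\<close> (total mass \<open>4 \<pi>\<close>), as the cone measure
  \<open>A \<mapsto> 3 \<cdot> vol {r x | x \<in> A, 0 < r < 1}\<close>; it is carried by the Borel sets of \<open>real^3\<close>.
\<close>

definition sphere_measure :: "(real^3) measure" where
  "sphere_measure =
     scale_measure 3 (distr (restrict_space lborel (ball 0 1 - {0})) borel (\<lambda>x. x /\<^sub>R norm x))"

definition deviation_angle :: "real^3 \<Rightarrow> real^3 \<Rightarrow> real^3 \<Rightarrow> real" where
  "deviation_angle v w \<sigma> = arccos (((v - w) /\<^sub>R norm (v - w)) \<bullet> \<sigma>)"

definition post_v :: "real^3 \<Rightarrow> real^3 \<Rightarrow> real^3 \<Rightarrow> real^3" where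
  "post_v v w \<sigma> = (1/2) *\<^sub>R (v + w) + (norm (v - w) / 2) *\<^sub>R \<sigma>"

definition post_w :: "real^3 \<Rightarrow> real^3 \<Rightarrow> real^3 \<Rightarrow> real^3" where
  "post_w v w \<sigma> = (1/2) *\<^sub>R (v + w) - (norm (v - w) / 2) *\<^sub>R \<sigma>"

definition beta_eps :: "(real \<Rightarrow> real) \<Rightarrow> real \<Rightarrow> real \<Rightarrow> real" where
  "beta_eps \<beta> \<epsilon> \<theta> =
     (if 0 < \<theta> \<and> \<theta> < \<epsilon> / 2 then pi ^ 3 / \<epsilon> ^ 3 * \<beta> (pi * \<theta> / \<epsilon>) else 0)"

definition collision_kernel :: "real \<Rightarrow> (real \<Rightarrow> real) \<Rightarrow> real \<Rightarrow> real \<Rightarrow> real \<Rightarrow> real" where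
  "collision_kernel \<gamma> \<beta> \<epsilon> r \<theta> = r powr \<gamma> * beta_eps \<beta> \<epsilon> \<theta> / sin \<theta>"

text \<open>
  \<open>(a - b) (log a - log b)\<close> for \<open>a, b \<ge> 0\<close> with values in \<open>[0, \<infinity>]\<close>, using \<open>log 0 = -\<infinity>\<close>:
  it is \<open>0\<close> on the diagonal (including \<open>a = b = 0\<close>) and \<open>\<infinity>\<close> if exactly one argument vanishes.
  The case split is needed because \<open>ln 0 = 0\<close> in the library.
\<close>

definition log_diff_prod :: "real \<Rightarrow> real \<Rightarrow> ennreal" where
  "log_diff_prod a b =
     (if a = b then 0
      else if a = 0 \<or> b = 0 then \<infinity>
      else ennreal ((a - b) * (ln a - ln b)))"

definition boltzmann_dissipation ::
  "(real \<Rightarrow> real \<Rightarrow> real) \<Rightarrow> (real^3 \<Rightarrow> real) \<Rightarrow> ennreal" where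
  "boltzmann_dissipation B f =
     ennreal (1/4) *
     (\<integral>\<^sup>+ (v, w). (\<integral>\<^sup>+ \<sigma>.
          log_diff_prod (f (post_v v w \<sigma>) * f (post_w v w \<sigma>)) (f v * f w)
          * ennreal (B (norm (v - w)) (deviation_angle v w \<sigma>))
        \<partial>sphere_measure) \<partial>lborel)"

text \<open>\<open>C\<^sup>k\<close> on the whole space: all iterated directional derivatives up to order \<open>k\<close> are continuous.\<close>

primrec C_order :: "nat \<Rightarrow> ('a::euclidean_space \<Rightarrow> real) \<Rightarrow> bool" where
  "C_order 0 g \<longleftrightarrow> continuous_on UNIV g"
| "C_order (Suc k) g \<longleftrightarrow>
     (\<forall>x. g differentiable (at x)) \<and> (\<forall>h. C_order k (\<lambda>x. frechet_derivative g (at x) h))"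

definition test_function :: "'a::euclidean_space set \<Rightarrow> ('a \<Rightarrow> real) \<Rightarrow> bool" where
  "test_function \<Omega> \<psi> \<longleftrightarrow>
     (\<forall>k. C_order k \<psi>) \<and> compact (closure {x. \<psi> x \<noteq> 0}) \<and> closure {x. \<psi> x \<noteq> 0} \<subseteq> \<Omega>"

text \<open>
  Distributions on an open set are represented by functionals that are only ever evaluated at
  test functions of that set.  In \<open>dist_mult a T\<close> the factor \<open>a\<close> has to be smooth on that set only.
\<close>

type_synonym 'a dist_fun = "('a \<Rightarrow> real) \<Rightarrow> real"

definition dist_of_fun :: "('a::euclidean_space \<Rightarrow> real) \<Rightarrow> 'a dist_fun" where
  "dist_of_fun F \<psi> = (\<integral>x. F x * \<psi> x \<partial>lborel)"

definition dist_deriv :: "'a::euclidean_space \<Rightarrow> 'a dist_fun \<Rightarrow> 'a dist_fun" where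
  "dist_deriv h T \<psi> = - T (\<lambda>x. frechet_derivative \<psi> (at x) h)"

definition dist_mult :: "('a::euclidean_space \<Rightarrow> real) \<Rightarrow> 'a dist_fun \<Rightarrow> 'a dist_fun" where
  "dist_mult a T \<psi> = T (\<lambda>x. a x * \<psi> x)"

definition Proj :: "real^3 \<Rightarrow> real^3^3" where
  "Proj z = (\<chi> i j. (if i = j then 1 else 0) - z $ i * z $ j / (norm z)\<^sup>2)"

definition off_diagonal :: "((real^3) \<times> (real^3)) set" where
  "off_diagonal = {(v, w). v \<noteq> w}"

text \<open>
  The \<open>i\<close>-th component of the distribution
  \<open>|v - w|\<^bsup>1+\<gamma>/2\<^esup> \<Pi>[v - w] (\<nabla>\<^sub>v - \<nabla>\<^sub>w) \<surd>(f(v) f(w))\<close> on \<open>off_diagonal\<close>.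
\<close>

definition landau_dist :: "real \<Rightarrow> (real^3 \<Rightarrow> real) \<Rightarrow> 3 \<Rightarrow> ((real^3) \<times> (real^3)) dist_fun" where
  "landau_dist \<gamma> f i \<psi> =
     (let F = dist_of_fun (\<lambda>(v, w). sqrt (f v * f w)) in
      \<Sum>j\<in>UNIV.
        dist_mult (\<lambda>(v, w). norm (v - w) powr (1 + \<gamma>/2) * Proj (v - w) $ i $ j)
          (\<lambda>\<phi>. dist_deriv (axis j 1, 0) F \<phi> - dist_deriv (0, axis j 1) F \<phi>) \<psi>)"

text \<open>\<open>G\<close> is a square integrable vector field on \<open>\<real>\<^sup>6\<close> representing that distribution; it is
  unique almost everywhere, since the diagonal is a null set.\<close>

definition landau_L2_rep ::
  "real \<Rightarrow> (real^3 \<Rightarrow> real) \<Rightarrow> ((real^3) \<times> (real^3) \<Rightarrow> real^3) \<Rightarrow> bool" where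
  "landau_L2_rep \<gamma> f G \<longleftrightarrow>
     G \<in> borel_measurable borel \<and>
     (\<integral>\<^sup>+ x. ennreal ((norm (G x))\<^sup>2) \<partial>lborel) < \<infinity> \<and>
     (\<forall>i \<psi>. test_function off_diagonal \<psi> \<longrightarrow>
        landau_dist \<gamma> f i \<psi> = dist_of_fun (\<lambda>x. G x $ i) \<psi>)"

definition landau_dissipation :: "real \<Rightarrow> (real^3 \<Rightarrow> real) \<Rightarrow> ennreal" where
  "landau_dissipation \<gamma> f =
     (if \<exists>G. landau_L2_rep \<gamma> f G
      then 2 * (\<integral>\<^sup>+ x. ennreal ((norm ((SOME G. landau_L2_rep \<gamma> f G) x))\<^sup>2) \<partial>lborel)
      else \<infinity>)"

end

theory Submission
  imports Defs
begin

text \<open>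
  The integrand \<open>(a - b) (log a - log b)\<close> is bounded below by its tangents, which are linear in \<open>a\<close>
  and \<open>b\<close>.  Choosing the tangent slopes as increments of a test field along a collision bounds the
  Boltzmann dissipation from below by a linear functional of \<open>f \<otimes> f\<close>, and a second order expansion
  at grazing collisions passes to the limit using only weak convergence of \<open>f \<otimes> f\<close>.  The resulting
  quadratic inequality for all test fields yields, by the Riesz argument, a square integrable
  derivative of \<open>log (f \<otimes> f)\<close> along rotations of \<open>v - w\<close>.  A chain rule along the measure preserving
  rotation flow turns it into the derivative of \<open>\<surd>(f \<otimes> f)\<close>; these rotational derivatives
  span the projected gradient in the Landau dissipation.
\<close>

section \<open>The surface measure of the sphere\<close>

text \<open>With G = f tensor f and z = v - w, the Landau dissipation is at most the supremum over
  test fields b of -4 INT G div b - 2 INT G |b|^2, where div is \<open>divergence\<close>. Each such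
  expression is linear in G, which is why weak convergence suffices. The constants: the prefactor
  1/4 and two equal tangent terms give 1/2, the angular law on the sphere gives 2 pi, the
  normalisation of \<beta> gives 8 / pi, in total 8; \<open>weighted_symbol\<close> contributes 1/2
  and 1/4, hence 4 and 2. Two obstacles shape the rest. The singularity of \<beta> at grazing angles
  threatens the integrability of the linear functional, so every estimate is made for a truncated
  kernel and the truncation is removed only after the limit in \<epsilon>. The weight |z|^\<gamma>
  is singular on the diagonal. Rotations of z keep |z| fixed, so radial weights commute with
  rotational derivatives; they can be absorbed into test fields, whose supports avoid the
  diagonal.\<close>

lemma lborel_distr_orthogonal:
  fixes R :: "real^3 \<Rightarrow> real^3"
  assumes R: "orthogonal_transformation R"
  shows "distr lborel borel R = lborel"
proof (rule lborel_eqI[symmetric])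
  fix l u :: "real^3" assume lu: "\<And>b. b \<in> Basis \<Longrightarrow> l \<bullet> b \<le> u \<bullet> b"
  have [measurable]: "R \<in> borel_measurable borel"
    using R by (intro borel_measurable_continuous_onI linear_continuous_on linear_conv_bounded_linear[THEN iffD1] orthogonal_transformation_linear)
  have inv: "orthogonal_transformation (inv R)" using R by (rule orthogonal_transformation_inv)
  \<comment> \<open>Lebesgue measure is determined by boxes. The preimage of a box is its image
    under the inverse map, whose measure is known.\<close>
  have img: "R -` box l u = inv R ` box l u"
    using R by (metis bij_vimage_eq_inv_image orthogonal_transformation_bij)
  have m: "inv R ` box l u \<in> lmeasurable" "measure lebesgue (inv R ` box l u) = measure lebesgue (box l u)"
    using measurable_orthogonal_image[OF inv] measure_orthogonal_image[OF inv] by auto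
  have b: "inv R ` box l u \<in> sets borel"
    unfolding img[symmetric] by (rule measurable_sets_borel[where M=borel]) auto
  have "emeasure (distr lborel borel R) (box l u) = emeasure lborel (inv R ` box l u)"
    by (simp add: emeasure_distr img)
  also have "\<dots> = emeasure lebesgue (inv R ` box l u)" using b by simp
  also have "\<dots> = ennreal (measure lebesgue (box l u))"
    using m by (simp add: emeasure_eq_measure2)
  also have "\<dots> = ennreal (\<Prod>b\<in>Basis. (u - l) \<bullet> b)"
    using lu by (simp add: measure_lborel_box_eq)
  finally show "emeasure (distr lborel borel R) (box l u) = ennreal (\<Prod>b\<in>Basis. (u - l) \<bullet> b)" .
qed simp

lemma borel_measurable_orthogonal:
  fixes R :: "'a::euclidean_space \<Rightarrow> 'a"
  assumes "orthogonal_transformation R" shows "R \<in> borel_measurable borel"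
  using assms by (intro borel_measurable_continuous_onI linear_continuous_on linear_conv_bounded_linear[THEN iffD1] orthogonal_transformation_linear)

lemma nn_integral_orthogonal:
  fixes R :: "real^3 \<Rightarrow> real^3"
  assumes R: "orthogonal_transformation R" and [measurable]: "F \<in> borel_measurable borel"
  shows "(\<integral>\<^sup>+x. F (R x) \<partial>lborel) = (\<integral>\<^sup>+x. F x \<partial>lborel)"
  using borel_measurable_orthogonal[OF R]
  by (subst (2) lborel_distr_orthogonal[OF R, symmetric]) (simp add: nn_integral_distr)

lemma nn_integral_scale:
  fixes F :: "'a::euclidean_space \<Rightarrow> ennreal"
  assumes [measurable]: "F \<in> borel_measurable borel" and c: "0 < c"
  shows "(\<integral>\<^sup>+x. F x \<partial>lborel) = ennreal (c ^ DIM('a)) * (\<integral>\<^sup>+x. F (c *\<^sub>R x) \<partial>lborel)"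
  by (subst lborel_affine[of c 0]) (use c in \<open>simp_all add: nn_integral_density nn_integral_distr nn_integral_cmult\<close>)

lemma nn_integral_translate:
  fixes F :: "'a::euclidean_space \<Rightarrow> ennreal"
  assumes [measurable]: "F \<in> borel_measurable borel"
  shows "(\<integral>\<^sup>+x. F (c + x) \<partial>lborel) = (\<integral>\<^sup>+x. F x \<partial>lborel)"
  by (subst (2) lborel_distr_plus[of c, symmetric]) (simp add: nn_integral_distr)

section \<open>Integration over the unit sphere and polar coordinates\<close>

lemma sets_sphere_measure[measurable_cong, simp]: "sets sphere_measure = sets borel"
  by (simp add: sphere_measure_def)

lemma space_sphere_measure[simp]: "space sphere_measure = UNIV"
  using sets_eq_imp_space_eq[OF sets_sphere_measure] by simp

lemma ball_measurable[measurable]: "ball (0::'a::euclidean_space) 1 \<in> sets borel"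
  by simp

text \<open>The cone measure is built on the punctured ball, where normalising makes sense; the
  origin is a null set, so the full ball may be used.\<close>

lemma nn_integral_sphere:
  assumes [measurable]: "F \<in> borel_measurable borel"
  shows "(\<integral>\<^sup>+\<sigma>. F \<sigma> \<partial>sphere_measure) = 3 * (\<integral>\<^sup>+x. F (x /\<^sub>R norm x) * indicator (ball 0 1) x \<partial>lborel)"
proof -
  have "(\<integral>\<^sup>+\<sigma>. F \<sigma> \<partial>sphere_measure) = 3 * (\<integral>\<^sup>+x. F (x /\<^sub>R norm x) * indicator (ball 0 1 - {0}) x \<partial>lborel)"
    unfolding sphere_measure_def
    by (subst nn_integral_scale_measure) (auto simp: nn_integral_distr nn_integral_restrict_space measurable_restrict_space1)
  also have "(\<integral>\<^sup>+x. F (x /\<^sub>R norm x) * indicator (ball 0 1 - {0}) x \<partial>lborel) = (\<integral>\<^sup>+x. F (x /\<^sub>R norm x) * indicator (ball 0 1) x \<partial>lborel)"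
  proof (rule nn_integral_cong_AE, use AE_lborel_singleton[of 0] in eventually_elim)
    case (elim x)
    then show ?case by (simp add: indicator_def)
  qed
  finally show ?thesis .
qed

lemma AE_sphere: "AE \<sigma> in sphere_measure. norm \<sigma> = 1"
proof (rule AE_I')
  let ?N = "{\<sigma>::real^3. norm \<sigma> \<noteq> 1}"
  have "emeasure sphere_measure ?N = (\<integral>\<^sup>+\<sigma>. indicator ?N \<sigma> \<partial>sphere_measure)" by simp
  also have "\<dots> = 3 * (\<integral>\<^sup>+x. indicator ?N (x /\<^sub>R norm x) * indicator (ball 0 1) x \<partial>lborel)"
    by (rule nn_integral_sphere) auto
  also have "(\<integral>\<^sup>+x. indicator ?N (x /\<^sub>R norm x) * indicator (ball 0 1) x \<partial>lborel) = (\<integral>\<^sup>+(x::real^3). 0 \<partial>lborel)"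
    using AE_lborel_singleton[of 0] by (intro nn_integral_cong_AE) (auto simp: indicator_def elim!: eventually_mono)
  finally show "?N \<in> null_sets sphere_measure" by (simp add: null_sets_def)
qed auto

lemma finite_measure_sphere: "finite_measure sphere_measure"
proof
  have "emeasure sphere_measure (space sphere_measure) = (\<integral>\<^sup>+\<sigma>. 1 \<partial>sphere_measure)" by simp
  also have "\<dots> = 3 * (\<integral>\<^sup>+x. 1 * indicator (ball (0::real^3) 1) x \<partial>lborel)" by (rule nn_integral_sphere) auto
  also have "\<dots> < \<infinity>" using emeasure_bounded_finite[of "ball (0::real^3) 1"]
    by (simp add: ennreal_mult_less_top less_top)
  finally show "emeasure sphere_measure (space sphere_measure) \<noteq> \<infinity>" by simp
qed

interpretation sphere: finite_measure sphere_measure by (rule finite_measure_sphere)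
interpretation lborel_sphere: pair_sigma_finite lborel sphere_measure ..
interpretation sphere_lborel: pair_sigma_finite sphere_measure lborel ..
interpretation sphere_sphere: pair_sigma_finite sphere_measure sphere_measure ..

text \<open>The ball and Lebesgue measure are invariant under R, and R commutes with normalisation,
  so the cone measure inherits the invariance.\<close>

lemma nn_integral_sphere_orthogonal:
  assumes R: "orthogonal_transformation R" and [measurable]: "F \<in> borel_measurable borel"
  shows "(\<integral>\<^sup>+\<sigma>. F (R \<sigma>) \<partial>sphere_measure) = (\<integral>\<^sup>+\<sigma>. F \<sigma> \<partial>sphere_measure)"
proof -
  note [measurable] = borel_measurable_orthogonal[OF R]
  have eq: "F (R (x /\<^sub>R norm x)) * indicator (ball 0 1) x = F (R x /\<^sub>R norm (R x)) * indicator (ball 0 1) (R x)" for x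
    using R by (simp add: orthogonal_transformation_norm linear_cmul orthogonal_transformation_linear indicator_def)
  have "(\<integral>\<^sup>+\<sigma>. F (R \<sigma>) \<partial>sphere_measure) = 3 * (\<integral>\<^sup>+x. F (R x /\<^sub>R norm (R x)) * indicator (ball 0 1) (R x) \<partial>lborel)"
    unfolding eq[symmetric] by (rule nn_integral_sphere) simp
  also have "\<dots> = 3 * (\<integral>\<^sup>+x. F (x /\<^sub>R norm x) * indicator (ball 0 1) x \<partial>lborel)"
    by (subst nn_integral_orthogonal[OF R, of "\<lambda>x. F (x /\<^sub>R norm x) * indicator (ball 0 1) x"]) simp_all
  also have "\<dots> = (\<integral>\<^sup>+\<sigma>. F \<sigma> \<partial>sphere_measure)" by (simp add: nn_integral_sphere)
  finally show ?thesis .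
qed

lemma nn_integral_inverse_power4:
  assumes "0 < a" shows "(\<integral>\<^sup>+r. ennreal (3 / r ^ 4) * indicator {a..} r \<partial>lborel) = ennreal (1 / a ^ 3)"
proof -
  have "(\<integral>\<^sup>+r. ennreal (3 / r ^ 4) * indicator {a..} r \<partial>lborel) = ennreal (0 - (- 1 / a ^ 3))"
  proof (rule nn_integral_FTC_atLeast)
    show "((\<lambda>r. - 1 / r ^ 3) has_real_derivative 3 / r ^ 4) (at r)" if "a \<le> r" for r
      using assms that by (auto intro!: derivative_eq_intros simp: field_simps eval_nat_numeral)
    show "((\<lambda>r::real. - 1 / r ^ 3) \<longlongrightarrow> 0) at_top"
      by real_asymp
  qed (use assms in auto)
  then show ?thesis by simp
qed

text \<open>For the cone measure this takes two dilations and Fubini. At fixed x, replacing r by |x|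
  r removes the normalisation; at fixed r, y = r x turns the ball into |y| < r. The integral of 3 /
  r^4 over r > |y| is then |y|^(-3), which cancels the Jacobian factor |y|^3.\<close>

lemma nn_integral_polar:
  fixes F :: "real^3 \<Rightarrow> ennreal"
  assumes [measurable]: "F \<in> borel_measurable borel"
  shows "(\<integral>\<^sup>+z. F z \<partial>lborel) = (\<integral>\<^sup>+r. ennreal (r\<^sup>2) * indicator {0<..} r * (\<integral>\<^sup>+\<sigma>. F (r *\<^sub>R \<sigma>) \<partial>sphere_measure) \<partial>lborel)"
proof -
  have "(\<integral>\<^sup>+r. ennreal (r\<^sup>2) * indicator {0<..} r * (\<integral>\<^sup>+\<sigma>. F (r *\<^sub>R \<sigma>) \<partial>sphere_measure) \<partial>lborel)
      = (\<integral>\<^sup>+r. \<integral>\<^sup>+x. 3 * ennreal (r\<^sup>2) * indicator {0<..} r * F (r *\<^sub>R (x /\<^sub>R norm x)) * indicator (ball 0 1) x \<partial>lborel \<partial>lborel)"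
  proof (rule nn_integral_cong)
    fix r :: real
    have "ennreal (r\<^sup>2) * indicator {0<..} r * (\<integral>\<^sup>+\<sigma>. F (r *\<^sub>R \<sigma>) \<partial>sphere_measure)
      = (3 * ennreal (r\<^sup>2) * indicator {0<..} r) * (\<integral>\<^sup>+x. F (r *\<^sub>R (x /\<^sub>R norm x)) * indicator (ball 0 1) x \<partial>lborel)"
      by (subst nn_integral_sphere) (simp_all add: mult_ac)
    also have "\<dots> = (\<integral>\<^sup>+x. 3 * ennreal (r\<^sup>2) * indicator {0<..} r * (F (r *\<^sub>R (x /\<^sub>R norm x)) * indicator (ball 0 1) x) \<partial>lborel)"
      by (rule nn_integral_cmult[symmetric]) measurable
    finally show "ennreal (r\<^sup>2) * indicator {0<..} r * (\<integral>\<^sup>+\<sigma>. F (r *\<^sub>R \<sigma>) \<partial>sphere_measure)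
      = (\<integral>\<^sup>+x. 3 * ennreal (r\<^sup>2) * indicator {0<..} r * F (r *\<^sub>R (x /\<^sub>R norm x)) * indicator (ball 0 1) x \<partial>lborel)"
      by (simp only: mult.assoc)
  qed
  also have "\<dots> = (\<integral>\<^sup>+x. \<integral>\<^sup>+r. 3 * ennreal (r\<^sup>2) * indicator {0<..} r * F (r *\<^sub>R (x /\<^sub>R norm x)) * indicator (ball 0 1) x \<partial>lborel \<partial>lborel)"
    by (rule lborel_pair.Fubini') measurable
  also have "\<dots> = (\<integral>\<^sup>+x. \<integral>\<^sup>+r. 3 * ennreal (r\<^sup>2) * indicator {0<..} r * F (r *\<^sub>R x) * (ennreal (norm x ^ 3) * indicator (ball 0 1) x) \<partial>lborel \<partial>lborel)"
  proof (rule nn_integral_cong_AE, use AE_lborel_singleton[of 0] in eventually_elim)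
    case (elim x)
    then have "norm x > 0" by simp
    show ?case
      by (subst nn_integral_scale[OF _ \<open>norm x > 0\<close>])
        (use \<open>norm x > 0\<close> in \<open>auto simp: nn_integral_cmult[symmetric] indicator_def zero_less_mult_iff power_mult_distrib ennreal_mult mult_ac eval_nat_numeral intro!: nn_integral_cong\<close>)
  qed
  also have "\<dots> = (\<integral>\<^sup>+r. \<integral>\<^sup>+x. 3 * ennreal (r\<^sup>2) * indicator {0<..} r * F (r *\<^sub>R x) * (ennreal (norm x ^ 3) * indicator (ball 0 1) x) \<partial>lborel \<partial>lborel)"
    by (rule lborel_pair.Fubini') measurable
  also have "\<dots> = (\<integral>\<^sup>+r. \<integral>\<^sup>+y. ennreal (3 / r ^ 4) * (if norm y < r then 1 else 0) * (F y * ennreal (norm y ^ 3)) \<partial>lborel \<partial>lborel)"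
  proof (rule nn_integral_cong)
    fix r :: real
    show "(\<integral>\<^sup>+x. 3 * ennreal (r\<^sup>2) * indicator {0<..} r * F (r *\<^sub>R x) * (ennreal (norm x ^ 3) * indicator (ball 0 1) x) \<partial>lborel)
        = (\<integral>\<^sup>+y. ennreal (3 / r ^ 4) * (if norm y < r then 1 else 0) * (F y * ennreal (norm y ^ 3)) \<partial>lborel)"
    proof (cases "0 < r")
      case True
      have "3 * ennreal (r\<^sup>2) * indicator {0<..} r * F (r *\<^sub>R x) * (ennreal (norm x ^ 3) * indicator (ball 0 1) x)
         = ennreal (r ^ 3) * (ennreal (3 / r ^ 4) * (if norm (r *\<^sub>R x) < r then 1 else 0) * (F (r *\<^sub>R x) * ennreal (norm (r *\<^sub>R x) ^ 3)))" for x
      proof -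
        have "3 * r\<^sup>2 * norm x ^ 3 = r ^ 3 * (3 / r ^ 4) * norm (r *\<^sub>R x) ^ 3"
          using True by (simp add: field_simps power_mult_distrib eval_nat_numeral)
        then have "3 * ennreal (r\<^sup>2) * ennreal (norm x ^ 3) = ennreal (r ^ 3) * ennreal (3 / r ^ 4) * ennreal (norm (r *\<^sub>R x) ^ 3)"
          using True by (simp add: ennreal_mult[symmetric] flip: ennreal_numeral)
        moreover have "indicator (ball 0 1) x = (if norm (r *\<^sub>R x) < r then 1 else (0::ennreal))"
          using True by (auto simp: indicator_def)
        moreover have "3 * ennreal (r\<^sup>2) * indicator {0<..} r * F (r *\<^sub>R x) * (ennreal (norm x ^ 3) * indicator (ball 0 1) x)
            = (3 * ennreal (r\<^sup>2) * ennreal (norm x ^ 3)) * (F (r *\<^sub>R x) * indicator (ball 0 1) x)"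
          using True by (simp add: mult_ac)
        ultimately show ?thesis by (simp only: mult.assoc mult.commute mult.left_commute)
      qed
      note eq = this
      let ?K = "\<lambda>y. ennreal (3 / r ^ 4) * (if norm y < r then 1 else 0) * (F y * ennreal (norm y ^ 3))"
      have K: "?K \<in> borel_measurable borel" by measurable
      have "(\<integral>\<^sup>+x. ennreal (r ^ 3) * ?K (r *\<^sub>R x) \<partial>lborel) = ennreal (r ^ 3) * (\<integral>\<^sup>+x. ?K (r *\<^sub>R x) \<partial>lborel)"
        by (rule nn_integral_cmult) measurable
      also have "\<dots> = (\<integral>\<^sup>+y. ?K y \<partial>lborel)"
        using nn_integral_scale[OF K True] by simp
      finally show ?thesis by (simp only: eq)
    next
      case False
      then have "\<not> norm y < r" for y :: "real^3" using norm_ge_zero[of y] by linarith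
      then show ?thesis using False by simp
    qed
  qed
  also have "\<dots> = (\<integral>\<^sup>+y. \<integral>\<^sup>+r. ennreal (3 / r ^ 4) * (if norm y < r then 1 else 0) * (F y * ennreal (norm y ^ 3)) \<partial>lborel \<partial>lborel)"
    by (rule lborel_pair.Fubini') measurable
  also have "\<dots> = (\<integral>\<^sup>+y. F y \<partial>lborel)"
  proof (rule nn_integral_cong_AE, use AE_lborel_singleton[of 0] in eventually_elim)
    case (elim y)
    then have y: "norm y > 0" by simp
    have "(\<integral>\<^sup>+r. ennreal (3 / r ^ 4) * (if norm y < r then 1 else 0) * (F y * ennreal (norm y ^ 3)) \<partial>lborel)
       = (\<integral>\<^sup>+r. ennreal (3 / r ^ 4) * indicator {norm y..} r \<partial>lborel) * (F y * ennreal (norm y ^ 3))"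
      using AE_lborel_singleton[of "norm y"]
      by (subst nn_integral_multc[symmetric]) (auto intro!: nn_integral_cong_AE simp: indicator_def elim!: eventually_mono)
    also have "\<dots> = F y * (ennreal (1 / norm y ^ 3) * ennreal (norm y ^ 3))"
      using nn_integral_inverse_power4[OF y] by (simp add: mult_ac)
    also have "\<dots> = F y" using y by (simp flip: ennreal_mult)
    finally show ?case .
  qed
  finally show ?thesis ..
qed

text \<open>Exchange of the relative velocities before and after a collision. In polar coordinates
  both sides integrate H over a radius and two independent directions of that same radius, which is
  symmetric in the directions.\<close>

lemma nn_integral_sphere_swap:
  assumes [measurable]: "(\<lambda>(z, y). H z y) \<in> borel_measurable (borel :: ((real^3) \<times> (real^3)) measure)"
  shows "(\<integral>\<^sup>+z. \<integral>\<^sup>+\<sigma>. H z (norm z *\<^sub>R \<sigma>) \<partial>sphere_measure \<partial>lborel)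
       = (\<integral>\<^sup>+z. \<integral>\<^sup>+\<sigma>. H (norm z *\<^sub>R \<sigma>) z \<partial>sphere_measure \<partial>lborel)"
proof -
  have [measurable]: "(\<lambda>x. H (f x) (g x)) \<in> borel_measurable M"
    if [measurable]: "f \<in> borel_measurable M" "g \<in> borel_measurable M" for f g and M :: "'z measure"
    using measurable_compose[OF borel_measurable_Pair[OF that] assms] by simp
  have "(\<integral>\<^sup>+z. \<integral>\<^sup>+\<sigma>. H z (norm z *\<^sub>R \<sigma>) \<partial>sphere_measure \<partial>lborel)
      = (\<integral>\<^sup>+r. ennreal (r\<^sup>2) * indicator {0<..} r * (\<integral>\<^sup>+\<tau>. \<integral>\<^sup>+\<sigma>. H (r *\<^sub>R \<tau>) (norm (r *\<^sub>R \<tau>) *\<^sub>R \<sigma>) \<partial>sphere_measure \<partial>sphere_measure) \<partial>lborel)"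
    by (rule nn_integral_polar) measurable
  also have "\<dots> = (\<integral>\<^sup>+r. ennreal (r\<^sup>2) * indicator {0<..} r * (\<integral>\<^sup>+\<tau>. \<integral>\<^sup>+\<sigma>. H (r *\<^sub>R \<tau>) (r *\<^sub>R \<sigma>) \<partial>sphere_measure \<partial>sphere_measure) \<partial>lborel)"
  proof (rule nn_integral_cong)
    fix r :: real
    have "(\<integral>\<^sup>+\<tau>. \<integral>\<^sup>+\<sigma>. H (r *\<^sub>R \<tau>) (norm (r *\<^sub>R \<tau>) *\<^sub>R \<sigma>) \<partial>sphere_measure \<partial>sphere_measure) = (\<integral>\<^sup>+\<tau>. \<integral>\<^sup>+\<sigma>. H (r *\<^sub>R \<tau>) (r *\<^sub>R \<sigma>) \<partial>sphere_measure \<partial>sphere_measure)"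
      if "0 < r" using AE_sphere that by (intro nn_integral_cong_AE) (auto elim!: eventually_mono)
    then show "ennreal (r\<^sup>2) * indicator {0<..} r * (\<integral>\<^sup>+\<tau>. \<integral>\<^sup>+\<sigma>. H (r *\<^sub>R \<tau>) (norm (r *\<^sub>R \<tau>) *\<^sub>R \<sigma>) \<partial>sphere_measure \<partial>sphere_measure)
      = ennreal (r\<^sup>2) * indicator {0<..} r * (\<integral>\<^sup>+\<tau>. \<integral>\<^sup>+\<sigma>. H (r *\<^sub>R \<tau>) (r *\<^sub>R \<sigma>) \<partial>sphere_measure \<partial>sphere_measure)"
      by (cases "0 < r") auto
  qed
  also have "\<dots> = (\<integral>\<^sup>+r. ennreal (r\<^sup>2) * indicator {0<..} r * (\<integral>\<^sup>+\<tau>. \<integral>\<^sup>+\<sigma>. H (r *\<^sub>R \<sigma>) (r *\<^sub>R \<tau>) \<partial>sphere_measure \<partial>sphere_measure) \<partial>lborel)"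
  proof (rule nn_integral_cong)
    fix r :: real
    have "(\<integral>\<^sup>+\<tau>. \<integral>\<^sup>+\<sigma>. H (r *\<^sub>R \<tau>) (r *\<^sub>R \<sigma>) \<partial>sphere_measure \<partial>sphere_measure) = (\<integral>\<^sup>+\<sigma>. \<integral>\<^sup>+\<tau>. H (r *\<^sub>R \<tau>) (r *\<^sub>R \<sigma>) \<partial>sphere_measure \<partial>sphere_measure)"
      by (rule sphere_sphere.Fubini') measurable
    then show "ennreal (r\<^sup>2) * indicator {0<..} r * (\<integral>\<^sup>+\<tau>. \<integral>\<^sup>+\<sigma>. H (r *\<^sub>R \<tau>) (r *\<^sub>R \<sigma>) \<partial>sphere_measure \<partial>sphere_measure)
      = ennreal (r\<^sup>2) * indicator {0<..} r * (\<integral>\<^sup>+\<tau>. \<integral>\<^sup>+\<sigma>. H (r *\<^sub>R \<sigma>) (r *\<^sub>R \<tau>) \<partial>sphere_measure \<partial>sphere_measure)"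
      by simp
  qed
  also have "\<dots> = (\<integral>\<^sup>+r. ennreal (r\<^sup>2) * indicator {0<..} r * (\<integral>\<^sup>+\<tau>. \<integral>\<^sup>+\<sigma>. H (norm (r *\<^sub>R \<tau>) *\<^sub>R \<sigma>) (r *\<^sub>R \<tau>) \<partial>sphere_measure \<partial>sphere_measure) \<partial>lborel)"
  proof (rule nn_integral_cong)
    fix r :: real
    have "(\<integral>\<^sup>+\<tau>. \<integral>\<^sup>+\<sigma>. H (norm (r *\<^sub>R \<tau>) *\<^sub>R \<sigma>) (r *\<^sub>R \<tau>) \<partial>sphere_measure \<partial>sphere_measure) = (\<integral>\<^sup>+\<tau>. \<integral>\<^sup>+\<sigma>. H (r *\<^sub>R \<sigma>) (r *\<^sub>R \<tau>) \<partial>sphere_measure \<partial>sphere_measure)"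
      if "0 < r" using AE_sphere that by (intro nn_integral_cong_AE) (auto elim!: eventually_mono)
    then show "ennreal (r\<^sup>2) * indicator {0<..} r * (\<integral>\<^sup>+\<tau>. \<integral>\<^sup>+\<sigma>. H (r *\<^sub>R \<sigma>) (r *\<^sub>R \<tau>) \<partial>sphere_measure \<partial>sphere_measure)
      = ennreal (r\<^sup>2) * indicator {0<..} r * (\<integral>\<^sup>+\<tau>. \<integral>\<^sup>+\<sigma>. H (norm (r *\<^sub>R \<tau>) *\<^sub>R \<sigma>) (r *\<^sub>R \<tau>) \<partial>sphere_measure \<partial>sphere_measure)"
      by (cases "0 < r") auto
  qed
  also have "\<dots> = (\<integral>\<^sup>+z. \<integral>\<^sup>+\<sigma>. H (norm z *\<^sub>R \<sigma>) z \<partial>sphere_measure \<partial>lborel)"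
    by (rule nn_integral_polar[symmetric]) measurable
  finally show ?thesis .
qed


section \<open>The law of the deviation angle\<close>

lemma nn_integral_even:
  fixes f :: "real \<Rightarrow> ennreal"
  assumes [measurable]: "f \<in> borel_measurable borel" and even: "\<And>x. f (- x) = f x"
  shows "(\<integral>\<^sup>+x. f x \<partial>lborel) = 2 * (\<integral>\<^sup>+x. f x * indicator {0<..} x \<partial>lborel)"
proof -
  have "(\<integral>\<^sup>+x. f x * indicator {..<0} x \<partial>lborel) = (\<integral>\<^sup>+x. f x * indicator {0<..} x \<partial>lborel)"
    by (subst nn_integral_real_affine[of _ "-1" 0]) (auto simp: even indicator_def intro!: nn_integral_cong)
  moreover have "(\<integral>\<^sup>+x. f x \<partial>lborel) = (\<integral>\<^sup>+x. f x * indicator {..<0} x + f x * indicator {0<..} x \<partial>lborel)"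
  proof (rule nn_integral_cong_AE, use AE_lborel_singleton[of 0] in eventually_elim)
    case (elim x)
    then show ?case by (auto simp: indicator_def)
  qed
  ultimately show ?thesis by (simp add: nn_integral_add mult_2)
qed

lemma nn_integral_inverse_1_plus_square:
  "(\<integral>\<^sup>+s. ennreal (1 / (1 + s\<^sup>2)) * indicator {0<..} s \<partial>lborel) = ennreal (pi / 2)"
proof -
  have "(\<integral>\<^sup>+s. ennreal (1 / (1 + s\<^sup>2)) * indicator {0<..} s \<partial>lborel) = (\<integral>\<^sup>+s. ennreal (1 / (1 + s\<^sup>2)) * indicator {0..} s \<partial>lborel)"
  proof (rule nn_integral_cong_AE, use AE_lborel_singleton[of 0] in eventually_elim)
    case (elim x)
    then show ?case by (auto simp: indicator_def)
  qed
  also have "\<dots> = ennreal (pi / 2 - arctan 0)"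
  proof (rule nn_integral_FTC_atLeast)
    show "(arctan has_real_derivative 1 / (1 + s\<^sup>2)) (at s)" for s
      using DERIV_arctan[of s] by (simp add: divide_inverse)
    show "(arctan \<longlongrightarrow> pi / 2) at_top" by (rule tendsto_arctan_at_top)
  qed auto
  finally show ?thesis by simp
qed

text \<open>The slope s = w / y replaces the angle on the half plane y > 0. Setting y = rho / sqrt
  (1 + s^2) then separates the variables with weight 1 / (1 + s^2), whose integral over the line is
  pi; evenness in y supplies the factor 2.\<close>

lemma nn_integral_polar_plane:
  fixes G :: "real \<Rightarrow> ennreal"
  assumes [measurable]: "G \<in> borel_measurable borel"
  shows "(\<integral>\<^sup>+y. \<integral>\<^sup>+w. G (sqrt (y\<^sup>2 + w\<^sup>2)) \<partial>lborel \<partial>lborel)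
       = ennreal (2 * pi) * (\<integral>\<^sup>+\<rho>. ennreal \<rho> * G \<rho> * indicator {0<..} \<rho> \<partial>lborel)"
proof -
  let ?I = "\<integral>\<^sup>+\<rho>. ennreal \<rho> * G \<rho> * indicator {0<..} \<rho> \<partial>lborel"
  have "(\<integral>\<^sup>+y. \<integral>\<^sup>+w. G (sqrt (y\<^sup>2 + w\<^sup>2)) \<partial>lborel \<partial>lborel)
      = 2 * (\<integral>\<^sup>+y. (\<integral>\<^sup>+w. G (sqrt (y\<^sup>2 + w\<^sup>2)) \<partial>lborel) * indicator {0<..} y \<partial>lborel)"
    by (rule nn_integral_even) auto
  also have "(\<integral>\<^sup>+y. (\<integral>\<^sup>+w. G (sqrt (y\<^sup>2 + w\<^sup>2)) \<partial>lborel) * indicator {0<..} y \<partial>lborel)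
      = (\<integral>\<^sup>+y. \<integral>\<^sup>+s. ennreal y * G (y * sqrt (1 + s\<^sup>2)) * indicator {0<..} y \<partial>lborel \<partial>lborel)"
  proof (rule nn_integral_cong)
    fix y :: real
    show "(\<integral>\<^sup>+w. G (sqrt (y\<^sup>2 + w\<^sup>2)) \<partial>lborel) * indicator {0<..} y
       = (\<integral>\<^sup>+s. ennreal y * G (y * sqrt (1 + s\<^sup>2)) * indicator {0<..} y \<partial>lborel)"
    proof (cases "0 < y")
      case True
      have "sqrt (y\<^sup>2 + (0 + y * s)\<^sup>2) = y * sqrt (1 + s\<^sup>2)" for s
      proof -
        have "y\<^sup>2 + (0 + y * s)\<^sup>2 = y\<^sup>2 * (1 + s\<^sup>2)" by (simp add: power_mult_distrib distrib_left)
        then show ?thesis using True by (simp add: real_sqrt_mult)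
      qed
      moreover have "(\<integral>\<^sup>+w. G (sqrt (y\<^sup>2 + w\<^sup>2)) \<partial>lborel) = ennreal \<bar>y\<bar> * (\<integral>\<^sup>+s. G (sqrt (y\<^sup>2 + (0 + y * s)\<^sup>2)) \<partial>lborel)"
        using True by (intro nn_integral_real_affine) auto
      ultimately show ?thesis using True by (simp add: nn_integral_cmult)
    qed simp
  qed
  also have "\<dots> = (\<integral>\<^sup>+s. \<integral>\<^sup>+y. ennreal y * G (y * sqrt (1 + s\<^sup>2)) * indicator {0<..} y \<partial>lborel \<partial>lborel)"
    by (rule lborel_pair.Fubini') measurable
  also have "\<dots> = (\<integral>\<^sup>+s. ennreal (1 / (1 + s\<^sup>2)) * ?I \<partial>lborel)"
  proof (rule nn_integral_cong)
    fix s :: real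
    define c where "c = sqrt (1 + s\<^sup>2)"
    have "1 + s\<^sup>2 > 0" by (simp add: add_pos_nonneg)
    then have c: "c > 0" "c\<^sup>2 = 1 + s\<^sup>2" by (auto simp: c_def)
    let ?J = "\<integral>\<^sup>+y. ennreal y * G (y * c) * indicator {0<..} y \<partial>lborel"
    have "?I = ennreal \<bar>c\<bar> * (\<integral>\<^sup>+y. ennreal (0 + c * y) * G (0 + c * y) * indicator {0<..} (0 + c * y) \<partial>lborel)"
      using c by (intro nn_integral_real_affine) auto
    also have "(\<integral>\<^sup>+y. ennreal (0 + c * y) * G (0 + c * y) * indicator {0<..} (0 + c * y) \<partial>lborel) = (\<integral>\<^sup>+y. ennreal c * (ennreal y * G (y * c) * indicator {0<..} y) \<partial>lborel)"
      using c by (intro nn_integral_cong) (auto simp: indicator_def ennreal_mult mult_ac zero_less_mult_iff)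
    also have "\<dots> = ennreal c * ?J" by (rule nn_integral_cmult) measurable
    finally have "ennreal (1 / c\<^sup>2) * ?I = ennreal (1 / c\<^sup>2) * ennreal c * ennreal c * ?J"
      using c by (simp add: mult.assoc)
    also have "ennreal (1 / c\<^sup>2) * ennreal c * ennreal c = 1"
    proof -
      have "1 / c\<^sup>2 * c * c = 1" using c(1) by (simp add: power2_eq_square)
      then show ?thesis using c(1) by (simp flip: ennreal_mult)
    qed
    finally show "?J = ennreal (1 / (1 + s\<^sup>2)) * ?I" unfolding c(2) by simp
  qed
  also have "\<dots> = (\<integral>\<^sup>+s. ennreal (1 / (1 + s\<^sup>2)) \<partial>lborel) * ?I"
    by (rule nn_integral_multc) auto
  also have "(\<integral>\<^sup>+s. ennreal (1 / (1 + s\<^sup>2)) \<partial>lborel) = ennreal pi"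
    by (subst nn_integral_even) (simp_all add: nn_integral_inverse_1_plus_square flip: ennreal_numeral ennreal_mult)
  finally show ?thesis
    by (simp add: ennreal_mult mult.assoc)
qed

text \<open>Boxes determine Lebesgue measure, so it is enough that the coordinate map pulls a box
  back to a product of three intervals of the same volume.\<close>

lemma nn_integral_real3:
  fixes F :: "real^3 \<Rightarrow> ennreal"
  assumes [measurable]: "F \<in> borel_measurable borel"
  shows "(\<integral>\<^sup>+x. F x \<partial>lborel) = (\<integral>\<^sup>+a. \<integral>\<^sup>+b. \<integral>\<^sup>+c. F (vector [a, b, c]) \<partial>lborel \<partial>lborel \<partial>lborel)"
proof -
  define h :: "real \<times> real \<times> real \<Rightarrow> real^3" where "h = (\<lambda>(a, b, c). vector [a, b, c])"
  have h: "h p = fst p *\<^sub>R axis 1 1 + fst (snd p) *\<^sub>R axis 2 1 + snd (snd p) *\<^sub>R axis 3 1" for p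
    by (cases p) (simp add: h_def vec_eq_iff forall_3 axis_def)
  have [measurable]: "h \<in> borel_measurable borel"
    unfolding h by (intro borel_measurable_continuous_onI continuous_intros)
  have "distr lborel borel h = lborel"
  proof (rule lborel_eqI[symmetric])
    fix l u :: "real^3" assume "\<And>b. b \<in> Basis \<Longrightarrow> l \<bullet> b \<le> u \<bullet> b"
    then have lu: "l $ i \<le> u $ i" for i by (simp add: cart_eq_inner_axis axis_in_Basis_iff)
    have "h -` box l u = {l$1<..<u$1} \<times> {l$2<..<u$2} \<times> {l$3<..<u$3}"
      by (auto simp: h_def mem_box_cart forall_3)
    then have "emeasure (distr lborel borel h) (box l u) = emeasure (lborel \<Otimes>\<^sub>M (lborel \<Otimes>\<^sub>M lborel)) ({l$1<..<u$1} \<times> {l$2<..<u$2} \<times> {l$3<..<u$3})"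
      by (simp add: emeasure_distr lborel_prod)
    also have "\<dots> = ennreal (u$1 - l$1) * (ennreal (u$2 - l$2) * ennreal (u$3 - l$3))"
    proof -
      have "emeasure (lborel \<Otimes>\<^sub>M lborel) ({l$2<..<u$2} \<times> {l$3<..<u$3}) = emeasure lborel {l$2<..<u$2} * emeasure lborel {l$3<..<u$3}"
        by (rule lborel.emeasure_pair_measure_Times) auto
      moreover have "emeasure (lborel \<Otimes>\<^sub>M (lborel :: (real \<times> real) measure)) ({l$1<..<u$1} \<times> ({l$2<..<u$2} \<times> {l$3<..<u$3}))
         = emeasure lborel {l$1<..<u$1} * emeasure lborel ({l$2<..<u$2} \<times> {l$3<..<u$3})"
        by (rule lborel.emeasure_pair_measure_Times) (auto intro: borel_Times)
      ultimately show ?thesis using lu by (simp add: lborel_prod)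
    qed
    also have "\<dots> = ennreal (\<Prod>i\<in>UNIV. (u - l) $ i)"
      unfolding UNIV_3 using lu by (simp add: mult.assoc flip: ennreal_mult)
    also have "(\<Prod>i\<in>UNIV. (u - l) $ i) = (\<Prod>b\<in>Basis. (u - l) \<bullet> b)"
    proof -
      have "(Basis :: (real^3) set) = (\<lambda>i. axis i 1) ` UNIV" by (auto simp: Basis_vec_def)
      show ?thesis
        unfolding \<open>Basis = _\<close> by (simp add: prod.reindex inj_on_def axis_eq_axis inner_axis)
    qed
    finally show "emeasure (distr lborel borel h) (box l u) = ennreal (\<Prod>b\<in>Basis. (u - l) \<bullet> b)" .
  qed simp
  then have "(\<integral>\<^sup>+x. F x \<partial>lborel) = (\<integral>\<^sup>+x. F x \<partial>distr lborel borel h)" by simp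
  also have "\<dots> = (\<integral>\<^sup>+p. F (h p) \<partial>(lborel \<Otimes>\<^sub>M (lborel \<Otimes>\<^sub>M lborel)))"
    by (simp add: nn_integral_distr lborel_prod)
  also have "\<dots> = (\<integral>\<^sup>+a. \<integral>\<^sup>+q. F (h (a, q)) \<partial>(lborel \<Otimes>\<^sub>M lborel) \<partial>lborel)"
    by (subst lborel_pair.nn_integral_fst[symmetric]) (simp_all add: lborel_prod lborel.nn_integral_fst)
  also have "\<dots> = (\<integral>\<^sup>+a. \<integral>\<^sup>+b. \<integral>\<^sup>+c. F (h (a, b, c)) \<partial>lborel \<partial>lborel \<partial>lborel)"
    by (intro nn_integral_cong, subst lborel.nn_integral_fst[symmetric]) (simp_all add: lborel_prod)
  finally show ?thesis by (simp add: h_def)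
qed

text \<open>\<open>arccos\<close> is a definite description. Outside [-1, 1] no angle has the
  required cosine, so the value there is one and the same unspecified number; inside, the function
  is continuous.\<close>

lemma borel_measurable_arccos[measurable]: "arccos \<in> borel_measurable borel"
proof -
  have eq: "arccos x = (if x \<in> {-1..1} then arccos (max (-1) (min 1 x)) else arccos 2)" for x :: real
  proof (cases "x \<in> {-1..1}")
    case False
    have "cos t \<noteq> x" for t
      using False cos_le_one[of t] cos_ge_minus_one[of t] by auto
    moreover have "cos t \<noteq> 2" for t :: real
      using cos_le_one[of t] by linarith
    ultimately have "(cos t = x) = (cos t = 2)" for t by blast
    then show ?thesis using False by (simp add: arccos_def)
  next
    case True
    then have "max (-1) (min 1 x) = x" by auto
    with True show ?thesis by simp
  qed
  have "(\<lambda>x. if x \<in> {-1..1} then arccos (max (-1) (min 1 x)) else arccos 2) \<in> borel_measurable borel"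
    by (intro measurable_If_set borel_measurable_continuous_onI continuous_intros) auto
  then show ?thesis
    by (rule measurable_cong[THEN iffD1, rotated]) (use eq in simp)
qed

text \<open>Gnomonic projection onto the tangent plane: the deviation angle has density \<open>2 \<pi> sin \<theta>\<close>.\<close>

lemma nn_integral_sphere_angle:
  fixes g :: "real \<Rightarrow> ennreal"
  assumes k: "norm k = 1" and [measurable]: "g \<in> borel_measurable borel"
    and T: "0 < T" "T < pi / 2" and supp: "\<And>\<theta>. T \<le> \<theta> \<Longrightarrow> g \<theta> = 0"
  shows "(\<integral>\<^sup>+\<sigma>. g (arccos (k \<bullet> \<sigma>)) \<partial>sphere_measure)
       = ennreal (2 * pi) * (\<integral>\<^sup>+\<theta>. g \<theta> * ennreal (sin \<theta>) * indicator {0..T} \<theta> \<partial>lborel)"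
proof -
  let ?e = "axis 1 1 :: real^3"
  \<comment> \<open>By rotation invariance it suffices to treat the first coordinate axis.\<close>
  obtain R where R: "orthogonal_transformation R" "R ?e = k"
    using orthogonal_transformation_exists[of ?e k] k by auto
  have "(\<integral>\<^sup>+\<sigma>. g (arccos (k \<bullet> \<sigma>)) \<partial>sphere_measure) = (\<integral>\<^sup>+\<sigma>. g (arccos (k \<bullet> R \<sigma>)) \<partial>sphere_measure)"
    by (rule nn_integral_sphere_orthogonal[OF R(1), symmetric]) simp
  also have "\<dots> = (\<integral>\<^sup>+\<sigma>. g (arccos (\<sigma> $ 1)) \<partial>sphere_measure)"
    using R unfolding orthogonal_transformation_def
    by (metis (no_types, lifting) cart_eq_inner_axis inner_commute)
  finally have step1: "(\<integral>\<^sup>+\<sigma>. g (arccos (k \<bullet> \<sigma>)) \<partial>sphere_measure) = (\<integral>\<^sup>+\<sigma>. g (arccos (\<sigma> $ 1)) \<partial>sphere_measure)" .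
  \<comment> \<open>The cubed cosine compensates the radial integral below: on the ray through
    \<sigma> with first coordinate t the slab condition reads r t < 1, and r^2 integrates to 1 / (3
    t^3).\<close>
  define G :: "real \<Rightarrow> ennreal" where "G \<tau> = g (arctan \<tau>) * ennreal (cos (arctan \<tau>) ^ 3)" for \<tau>
  have [measurable]: "G \<in> borel_measurable borel" unfolding G_def by measurable
  \<comment> \<open>F is constant along rays inside the slab 0 < z1 < 1. Slicing at z1 = a produces
    a planar integral, polar coordinates produce the spherical one, and both come with a factor
    1/3.\<close>
  define F :: "real^3 \<Rightarrow> ennreal" where "F z = G (sqrt ((z$2)\<^sup>2 + (z$3)\<^sup>2) / z$1) * indicator {0<..<1} (z$1)" for z
  have [measurable]: "F \<in> borel_measurable borel" unfolding F_def by measurable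
  have "(\<integral>\<^sup>+z. F z \<partial>lborel) = (\<integral>\<^sup>+a. ennreal (a\<^sup>2) * indicator {0<..<1} a * (ennreal (2 * pi) * (\<integral>\<^sup>+\<rho>. ennreal \<rho> * G \<rho> * indicator {0<..} \<rho> \<partial>lborel)) \<partial>lborel)"
    unfolding nn_integral_real3[OF \<open>F \<in> _\<close>] nn_integral_polar_plane[OF \<open>G \<in> _\<close>, symmetric]
  proof (rule nn_integral_cong)
    fix a :: real
    show "(\<integral>\<^sup>+b. \<integral>\<^sup>+c. F (vector [a, b, c]) \<partial>lborel \<partial>lborel) = ennreal (a\<^sup>2) * indicator {0<..<1} a * (\<integral>\<^sup>+b. \<integral>\<^sup>+c. G (sqrt (b\<^sup>2 + c\<^sup>2)) \<partial>lborel \<partial>lborel)"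
    proof (cases "0 < a \<and> a < 1")
      case True
      then have a: "0 < a" "a < 1" by auto
      have inner: "(\<integral>\<^sup>+c. F (vector [a, a * b, c]) \<partial>lborel) = ennreal a * (\<integral>\<^sup>+c. G (sqrt (b\<^sup>2 + c\<^sup>2)) \<partial>lborel)" for b
      proof -
        have "sqrt ((a * b)\<^sup>2 + (0 + a * c)\<^sup>2) / a = sqrt (b\<^sup>2 + c\<^sup>2)" for c
        proof -
          have "(a * b)\<^sup>2 + (0 + a * c)\<^sup>2 = a\<^sup>2 * (b\<^sup>2 + c\<^sup>2)" by (simp add: power_mult_distrib distrib_left)
          then show ?thesis using a by (simp add: real_sqrt_mult)
        qed
        then have "F (vector [a, a * b, 0 + a * c]) = G (sqrt (b\<^sup>2 + c\<^sup>2))" for c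
          using a by (simp add: F_def)
        moreover have "(\<integral>\<^sup>+c. F (vector [a, a * b, c]) \<partial>lborel) = ennreal \<bar>a\<bar> * (\<integral>\<^sup>+c. F (vector [a, a * b, 0 + a * c]) \<partial>lborel)"
          using a by (intro nn_integral_real_affine) (auto simp: F_def)
        ultimately show ?thesis using a by simp
      qed
      have "(\<integral>\<^sup>+b. \<integral>\<^sup>+c. F (vector [a, b, c]) \<partial>lborel \<partial>lborel) = ennreal \<bar>a\<bar> * (\<integral>\<^sup>+b. \<integral>\<^sup>+c. F (vector [a, 0 + a * b, c]) \<partial>lborel \<partial>lborel)"
        using a by (intro nn_integral_real_affine) (auto simp: F_def)
      also have "\<dots> = ennreal a * (ennreal a * (\<integral>\<^sup>+b. \<integral>\<^sup>+c. G (sqrt (b\<^sup>2 + c\<^sup>2)) \<partial>lborel \<partial>lborel))"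
        using a by (simp add: inner nn_integral_cmult)
      also have "\<dots> = ennreal (a\<^sup>2) * (\<integral>\<^sup>+b. \<integral>\<^sup>+c. G (sqrt (b\<^sup>2 + c\<^sup>2)) \<partial>lborel \<partial>lborel)"
        using a by (simp add: power2_eq_square ennreal_mult mult.assoc)
      finally show ?thesis using a by simp
    next
      case False
      then have "F (vector [a, b, c]) = 0" for b c by (auto simp: F_def)
      then show ?thesis using False by simp
    qed
  qed
  also have "\<dots> = (\<integral>\<^sup>+a. ennreal (a\<^sup>2) * indicator {0<..<1} a \<partial>lborel) * (ennreal (2 * pi) * (\<integral>\<^sup>+\<rho>. ennreal \<rho> * G \<rho> * indicator {0<..} \<rho> \<partial>lborel))"
    by (rule nn_integral_multc) simp
  finally have L: "(\<integral>\<^sup>+z. F z \<partial>lborel) = (\<integral>\<^sup>+a. ennreal (a\<^sup>2) * indicator {0<..<1} a \<partial>lborel) * (ennreal (2 * pi) * (\<integral>\<^sup>+\<rho>. ennreal \<rho> * G \<rho> * indicator {0<..} \<rho> \<partial>lborel))" .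
  have third: "(\<integral>\<^sup>+a. ennreal (a\<^sup>2) * indicator {0<..<1} a \<partial>lborel) = ennreal (1/3)"
  proof -
    have "(\<integral>\<^sup>+a. ennreal (a\<^sup>2) * indicator {0<..<1} a \<partial>lborel) = (\<integral>\<^sup>+a. ennreal (a\<^sup>2) * indicator {0..1} a \<partial>lborel)"
    proof (rule nn_integral_cong_AE, use AE_lborel_singleton[of 0] AE_lborel_singleton[of 1] in eventually_elim)
      case (elim x)
      then show ?case by (auto simp: indicator_def)
    qed
    also have "\<dots> = ennreal (1 ^ 3 / 3 - 0 ^ 3 / 3)"
      by (rule nn_integral_FTC_Icc) (auto intro!: derivative_eq_intros)
    finally show ?thesis by simp
  qed
  have R: "(\<integral>\<^sup>+z. F z \<partial>lborel) = ennreal (1/3) * (\<integral>\<^sup>+\<sigma>. g (arccos (\<sigma> $ 1)) \<partial>sphere_measure)"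
  proof -
    have "(\<integral>\<^sup>+z. F z \<partial>lborel) = (\<integral>\<^sup>+r. \<integral>\<^sup>+\<sigma>. ennreal (r\<^sup>2) * indicator {0<..} r * F (r *\<^sub>R \<sigma>) \<partial>sphere_measure \<partial>lborel)"
      by (subst nn_integral_polar) (simp_all add: nn_integral_cmult)
    also have "\<dots> = (\<integral>\<^sup>+\<sigma>. \<integral>\<^sup>+r. ennreal (r\<^sup>2) * indicator {0<..} r * F (r *\<^sub>R \<sigma>) \<partial>lborel \<partial>sphere_measure)"
      by (rule sphere_lborel.Fubini') measurable
    also have "\<dots> = (\<integral>\<^sup>+\<sigma>. ennreal (1/3) * g (arccos (\<sigma> $ 1)) \<partial>sphere_measure)"
    proof (rule nn_integral_cong_AE, use AE_sphere in eventually_elim)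
      case (elim \<sigma>)
      have sq: "(\<sigma>$1)\<^sup>2 + ((\<sigma>$2)\<^sup>2 + (\<sigma>$3)\<^sup>2) = 1"
        using elim by (simp add: norm_eq_1 inner_vec_def sum_3 power2_eq_square)
      show ?case
      proof (cases "0 < \<sigma> $ 1")
        case True
        define t where "t = \<sigma> $ 1"
        have t: "0 < t" "t \<le> 1" using True component_le_norm_cart[of \<sigma> 1] elim by (auto simp: t_def)
        have tan: "sqrt ((r * \<sigma>$2)\<^sup>2 + (r * \<sigma>$3)\<^sup>2) / (r * t) = tan (arccos t)" if "r > 0" for r
        proof -
          have "(\<sigma>$2)\<^sup>2 + (\<sigma>$3)\<^sup>2 = 1 - t\<^sup>2" using sq by (simp add: t_def)
          then have "(r * \<sigma>$2)\<^sup>2 + (r * \<sigma>$3)\<^sup>2 = r\<^sup>2 * (1 - t\<^sup>2)"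
            by (simp add: power_mult_distrib flip: distrib_left)
          then show ?thesis using that t by (simp add: tan_def real_sqrt_mult sin_arccos)
        qed
        have acos: "arctan (tan (arccos t)) = arccos t"
        proof (rule arctan_tan)
          show "arccos t < pi / 2" using t arccos_less_mono[of t 0] by simp
          show "- (pi / 2) < arccos t" using t arccos_lbound[of t] pi_gt_zero by linarith
        qed
        have "(\<integral>\<^sup>+r. ennreal (r\<^sup>2) * indicator {0<..} r * F (r *\<^sub>R \<sigma>) \<partial>lborel) = (\<integral>\<^sup>+r. ennreal (t * (t * r)\<^sup>2) * indicator {0<..<1} (t * r) * g (arccos t) \<partial>lborel)"
        proof (rule nn_integral_cong)
          fix r :: real
          show "ennreal (r\<^sup>2) * indicator {0<..} r * F (r *\<^sub>R \<sigma>) = ennreal (t * (t * r)\<^sup>2) * indicator {0<..<1} (t * r) * g (arccos t)"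
          proof (cases "r > 0")
            case True
            have "ennreal (r\<^sup>2) * ennreal (t ^ 3) = ennreal (t * (t * r)\<^sup>2)"
              using t by (simp add: power_mult_distrib eval_nat_numeral mult_ac flip: ennreal_mult)
            then show ?thesis
              using True t tan[OF True] acos
              by (simp add: F_def G_def t_def[symmetric] mult_ac indicator_def)
          qed (use t in \<open>auto simp: indicator_def zero_less_mult_iff\<close>)
        qed
        also have "\<dots> = (\<integral>\<^sup>+r. ennreal (t * (t * r)\<^sup>2) * indicator {0<..<1} (t * r) \<partial>lborel) * g (arccos t)"
          by (rule nn_integral_multc) simp
        also have "(\<integral>\<^sup>+r. ennreal (t * (t * r)\<^sup>2) * indicator {0<..<1} (t * r) \<partial>lborel) = (\<integral>\<^sup>+r. ennreal (r\<^sup>2) * indicator {0<..<1} r \<partial>lborel)"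
          using nn_integral_real_affine[of "\<lambda>r. ennreal (r\<^sup>2) * indicator {0<..<1} r" t 0] t
          by (simp add: ennreal_mult nn_integral_cmult mult.assoc)
        finally show ?thesis by (simp add: third t_def)
      next
        \<comment> \<open>The projection does not see the back hemisphere. There the angle is at
          least pi / 2, beyond T, so g vanishes as well.\<close>
        case False
        then have "F (r *\<^sub>R \<sigma>) = 0" if "r > 0" for r
          using that by (auto simp: F_def indicator_def zero_less_mult_iff)
        then have "(\<integral>\<^sup>+r. ennreal (r\<^sup>2) * indicator {0<..} r * F (r *\<^sub>R \<sigma>) \<partial>lborel) = (\<integral>\<^sup>+(r::real). 0 \<partial>lborel)"
          by (intro nn_integral_cong) (auto simp: indicator_def)
        moreover have "\<bar>\<sigma> $ 1\<bar> \<le> 1" using component_le_norm_cart[of \<sigma> 1] elim by simp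
        then have "pi / 2 \<le> arccos (\<sigma> $ 1)" using False arccos_le_mono[of 0 "\<sigma> $ 1"] by simp
        then have "g (arccos (\<sigma> $ 1)) = 0" using T supp by simp
        ultimately show ?thesis by simp
      qed
    qed
    also have "\<dots> = ennreal (1/3) * (\<integral>\<^sup>+\<sigma>. g (arccos (\<sigma> $ 1)) \<partial>sphere_measure)"
      by (rule nn_integral_cmult) simp
    finally show ?thesis .
  qed
  have "ennreal (1/3) * (\<integral>\<^sup>+\<sigma>. g (arccos (\<sigma> $ 1)) \<partial>sphere_measure) = ennreal (1/3) * (ennreal (2 * pi) * (\<integral>\<^sup>+\<rho>. ennreal \<rho> * G \<rho> * indicator {0<..} \<rho> \<partial>lborel))"
    using L R third by simp
  then have "ennreal 3 * ennreal (1/3) * (\<integral>\<^sup>+\<sigma>. g (arccos (\<sigma> $ 1)) \<partial>sphere_measure) = ennreal 3 * ennreal (1/3) * (ennreal (2 * pi) * (\<integral>\<^sup>+\<rho>. ennreal \<rho> * G \<rho> * indicator {0<..} \<rho> \<partial>lborel))"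
    by (simp only: mult.assoc)
  moreover have "ennreal 3 * ennreal (1/3) = 1"
  proof -
    have "ennreal 3 * ennreal (1/3) = ennreal (3 * (1/3))" by (rule ennreal_mult[symmetric]) auto
    then show ?thesis by (simp only: ennreal_1[symmetric]) simp
  qed
  ultimately have step2: "(\<integral>\<^sup>+\<sigma>. g (arccos (\<sigma> $ 1)) \<partial>sphere_measure) = ennreal (2 * pi) * (\<integral>\<^sup>+\<rho>. ennreal \<rho> * G \<rho> * indicator {0<..} \<rho> \<partial>lborel)"
    by simp
  have "(\<integral>\<^sup>+\<rho>. ennreal \<rho> * G \<rho> * indicator {0<..} \<rho> \<partial>lborel) = (\<integral>\<^sup>+\<rho>. ennreal \<rho> * G \<rho> * indicator {tan 0..tan T} \<rho> \<partial>lborel)"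
  proof (rule nn_integral_cong)
    fix \<rho> :: real
    show "ennreal \<rho> * G \<rho> * indicator {0<..} \<rho> = ennreal \<rho> * G \<rho> * indicator {tan 0..tan T} \<rho>"
    proof (cases "\<rho> > tan T")
      case True
      then have "arctan \<rho> \<ge> T" using T arctan_tan[of T] by (smt (verit) arctan_le_iff pi_gt_zero)
      then show ?thesis using supp by (simp add: G_def)
    qed (auto simp: indicator_def)
  qed
  \<comment> \<open>Substitution rho = tan theta; the factors tan, cos^3 and 1 / cos^2 combine to
    sin.\<close>
  also have "\<dots> = (\<integral>\<^sup>+\<theta>. ennreal (tan \<theta>) * G (tan \<theta>) * ennreal (inverse ((cos \<theta>)\<^sup>2)) * indicator {0..T} \<theta> \<partial>lborel)"
  proof (rule nn_integral_substitution_aux)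
    fix x assume x: "x \<in> {0..T}"
    then have "cos x \<noteq> 0" using T cos_gt_zero_pi[of x] by auto
    then show "(tan has_real_derivative inverse ((cos x)\<^sup>2)) (at x)" by (rule DERIV_tan)
  next
    show "continuous_on {0..T} (\<lambda>x. inverse ((cos x)\<^sup>2))"
    proof (intro continuous_intros ballI)
      fix x assume "x \<in> {0..T}"
      then show "(cos x)\<^sup>2 \<noteq> 0" using T cos_gt_zero_pi[of x] by auto
    qed
  qed (use T in auto)
  also have "\<dots> = (\<integral>\<^sup>+\<theta>. g \<theta> * ennreal (sin \<theta>) * indicator {0..T} \<theta> \<partial>lborel)"
  proof (rule nn_integral_cong)
    fix \<theta> :: real
    show "ennreal (tan \<theta>) * G (tan \<theta>) * ennreal (inverse ((cos \<theta>)\<^sup>2)) * indicator {0..T} \<theta> = g \<theta> * ennreal (sin \<theta>) * indicator {0..T} \<theta>"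
    proof (cases "\<theta> \<in> {0..T}")
      case True
      then have c: "cos \<theta> > 0" "arctan (tan \<theta>) = \<theta>" "tan \<theta> \<ge> 0" "sin \<theta> \<ge> 0"
        using T cos_gt_zero_pi[of \<theta>] by (auto intro!: arctan_tan tan_pos_pi2_le sin_ge_zero)
      have "ennreal (tan \<theta>) * ennreal (cos \<theta> ^ 3) * ennreal (inverse ((cos \<theta>)\<^sup>2)) = ennreal (sin \<theta>)"
        using c by (simp add: tan_def eval_nat_numeral field_simps flip: ennreal_mult)
      then show ?thesis using c by (simp add: G_def mult_ac)
    qed simp
  qed
  finally show ?thesis using step1 step2 by simp
qed

section \<open>Rotations of the relative velocity\<close>

abbreviation rel :: "(real^3) \<times> (real^3) \<Rightarrow> real^3" where "rel x \<equiv> fst x - snd x"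

text \<open>Rodrigues' formula for the rotation by the angle t about the j-th coordinate
  axis.\<close>

definition zrot :: "3 \<Rightarrow> real \<Rightarrow> real^3 \<Rightarrow> real^3" where
  "zrot j t z = cos t *\<^sub>R z + sin t *\<^sub>R cross3 (axis j 1) z + ((1 - cos t) * z $ j) *\<^sub>R axis j 1"

text \<open>Keeping the centre of mass and rotating the relative velocity stays among the pairs that
  a collision can produce, and off the diagonal.\<close>

definition flow :: "3 \<Rightarrow> real \<Rightarrow> (real^3) \<times> (real^3) \<Rightarrow> (real^3) \<times> (real^3)" where
  "flow j t x = (fst x + (1/2) *\<^sub>R (zrot j t (rel x) - rel x), snd x - (1/2) *\<^sub>R (zrot j t (rel x) - rel x))"

text \<open>Generator of \<open>flow\<close>. The halves come from v = c + z / 2 and w = c - z /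
  2.\<close>

definition rotfield :: "3 \<Rightarrow> (real^3) \<times> (real^3) \<Rightarrow> (real^3) \<times> (real^3)" where
  "rotfield j x = ((1/2) *\<^sub>R cross3 (axis j 1) (rel x), - ((1/2) *\<^sub>R cross3 (axis j 1) (rel x)))"

lemma zrot_components:
  "zrot 1 t z = vector [z$1, cos t * z$2 - sin t * z$3, cos t * z$3 + sin t * z$2]"
  "zrot 2 t z = vector [cos t * z$1 + sin t * z$3, z$2, cos t * z$3 - sin t * z$1]"
  "zrot 3 t z = vector [cos t * z$1 - sin t * z$2, cos t * z$2 + sin t * z$1, z$3]"
  by (simp_all add: zrot_def cross3_def vec_eq_iff forall_3 axis_def algebra_simps)

lemma zrot_zrot: "zrot j s (zrot j t z) = zrot j (s + t) z"
  using exhaust_3[of j]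
  by (elim disjE) (simp_all add: zrot_components vec_eq_iff forall_3 cos_add sin_add algebra_simps)

lemma zrot_0[simp]: "zrot j 0 z = z"
  by (simp add: zrot_def)

lemma norm_zrot[simp]: "norm (zrot j t z) = norm z"
proof -
  have *: "(cos t * a - sin t * b)\<^sup>2 + (cos t * b + sin t * a)\<^sup>2 = a\<^sup>2 + b\<^sup>2" for a b :: real
    using sin_cos_squared_add[of t] by algebra
  show ?thesis
    using exhaust_3[of j] *[of "z$2" "z$3"] *[of "z$3" "z$1"] *[of "z$1" "z$2"]
    by (elim disjE) (simp_all add: zrot_components norm_vec_def L2_set_def sum_3 algebra_simps)
qed

lemma linear_zrot: "linear (zrot j t)"
  using exhaust_3[of j]
  by (elim disjE) (auto intro!: linearI simp: zrot_components vec_eq_iff forall_3 algebra_simps)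

lemma orthogonal_zrot: "orthogonal_transformation (zrot j t)"
  by (simp add: orthogonal_transformation linear_zrot)

text \<open>A rotation fixes its own axis and hence commutes with the cross product by that axis.
  This makes the generator invariant under its flow.\<close>

lemma zrot_cross: "cross3 (axis j 1) (zrot j t z) = zrot j t (cross3 (axis j 1) z)"
  using exhaust_3[of j]
  by (elim disjE) (simp_all add: zrot_components cross3_def vec_eq_iff forall_3 axis_def algebra_simps)

lemma zrot_has_vector_derivative:
  "((\<lambda>t. zrot j t z) has_vector_derivative cross3 (axis j 1) (zrot j t z)) (at t)"
proof -
  have "((\<lambda>t. zrot j t z) has_vector_derivative
      (- sin t) *\<^sub>R z + cos t *\<^sub>R cross3 (axis j 1) z + (sin t * z $ j) *\<^sub>R axis j 1) (at t)"
    unfolding zrot_def has_vector_derivative_def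
    by (auto intro!: derivative_eq_intros simp: algebra_simps)
  also have "(- sin t) *\<^sub>R z + cos t *\<^sub>R cross3 (axis j 1) z + (sin t * z $ j) *\<^sub>R axis j 1 = cross3 (axis j 1) (zrot j t z)"
    using exhaust_3[of j]
    by (elim disjE) (simp_all add: zrot_components cross3_def vec_eq_iff forall_3 axis_def algebra_simps)
  finally show ?thesis .
qed

lemma rel_flow[simp]: "rel (flow j t x) = zrot j t (rel x)"
  by (simp add: flow_def vec_eq_iff field_simps)

lemma flow_flow: "flow j s (flow j t x) = flow j (s + t) x"
  unfolding flow_def[of j s] rel_flow zrot_zrot
  by (simp add: flow_def vec_eq_iff field_simps)

lemma flow_0[simp]: "flow j 0 x = x"
  by (simp add: flow_def)

lemma linear_flow: "linear (flow j t)"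
  by (rule linearI) (simp_all add: flow_def linear_add[OF linear_zrot] linear_diff[OF linear_zrot] linear_cmul[OF linear_zrot] algebra_simps)

lemma flow_rotfield: "flow j t (rotfield j x) = rotfield j (flow j t x)"
proof -
  have "rel (rotfield j x) = cross3 (axis j 1) (rel x)"
    by (simp add: rotfield_def flip: scaleR_left.add)
  then show ?thesis
    unfolding rotfield_def[of j "flow j t x"] rel_flow zrot_cross
    by (simp add: flow_def rotfield_def algebra_simps)
qed

lemma flow_has_vector_derivative:
  "((\<lambda>t. flow j t x) has_vector_derivative rotfield j (flow j t x)) (at t)"
proof -
  have "((\<lambda>t. flow j t x) has_vector_derivative
     (0 + (1/2) *\<^sub>R (cross3 (axis j 1) (zrot j t (rel x)) - 0), 0 - (1/2) *\<^sub>R (cross3 (axis j 1) (zrot j t (rel x)) - 0))) (at t)"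
    unfolding flow_def
    by (intro has_vector_derivative_Pair derivative_intros zrot_has_vector_derivative
        bounded_linear.has_vector_derivative[OF bounded_linear_scaleR_right] has_vector_derivative_diff has_vector_derivative_const
        has_vector_derivative_add)
  then show ?thesis unfolding rotfield_def rel_flow by simp
qed

lemma continuous_on_flow: "continuous_on UNIV (\<lambda>p. flow j (fst p) (snd p))"
  unfolding flow_def zrot_def by (intro continuous_intros continuous_on_cross)

lemma measurable_flow[measurable (raw)]:
  assumes "f \<in> borel_measurable M" "g \<in> borel_measurable M"
  shows "(\<lambda>x. flow j (f x) (g x)) \<in> borel_measurable M"
  using measurable_compose[OF borel_measurable_Pair[OF assms] borel_measurable_continuous_onI[OF continuous_on_flow]]
  by simp

section \<open>Measure preservation of the rotation flow\<close>

lemma nn_integral_relative: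
  fixes F :: "(real^3) \<times> (real^3) \<Rightarrow> ennreal"
  assumes [measurable]: "F \<in> borel_measurable borel"
  shows "(\<integral>\<^sup>+x. F x \<partial>lborel) = (\<integral>\<^sup>+c. \<integral>\<^sup>+z. F (c + (1/2) *\<^sub>R z, c - (1/2) *\<^sub>R z) \<partial>lborel \<partial>lborel)"
proof -
  have "(\<integral>\<^sup>+x. F x \<partial>lborel) = (\<integral>\<^sup>+w. \<integral>\<^sup>+v. F (v, w) \<partial>lborel \<partial>lborel)"
    unfolding lborel_prod[symmetric] by (rule lborel_pair.nn_integral_snd[symmetric]) (simp add: lborel_prod)
  \<comment> \<open>Two shears, v = w + z at fixed w and then w = c - z / 2 at fixed z. Each is a
    translation, so passing to centre of mass and relative velocity has Jacobian one.\<close>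
  also have "\<dots> = (\<integral>\<^sup>+w. \<integral>\<^sup>+z. F (w + z, w) \<partial>lborel \<partial>lborel)"
    by (intro nn_integral_cong nn_integral_translate[symmetric]) simp
  also have "\<dots> = (\<integral>\<^sup>+z. \<integral>\<^sup>+w. F (w + z, w) \<partial>lborel \<partial>lborel)"
    by (rule lborel_pair.Fubini') measurable
  also have "\<dots> = (\<integral>\<^sup>+z. \<integral>\<^sup>+c. F (c + (1/2) *\<^sub>R z, c - (1/2) *\<^sub>R z) \<partial>lborel \<partial>lborel)"
  proof (rule nn_integral_cong)
    fix z :: "real^3"
    have "(\<integral>\<^sup>+c. F ((- (1/2) *\<^sub>R z + c) + z, - (1/2) *\<^sub>R z + c) \<partial>lborel) = (\<integral>\<^sup>+w. F (w + z, w) \<partial>lborel)"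
      by (rule nn_integral_translate) simp
    moreover have "(- (1/2) *\<^sub>R z + c) + z = c + (1/2) *\<^sub>R z" "- (1/2) *\<^sub>R z + c = c - (1/2) *\<^sub>R z" for c
      by (simp_all add: vec_eq_iff)
    ultimately show "(\<integral>\<^sup>+w. F (w + z, w) \<partial>lborel) = (\<integral>\<^sup>+c. F (c + (1/2) *\<^sub>R z, c - (1/2) *\<^sub>R z) \<partial>lborel)"
      by (simp only:)
  qed
  also have "\<dots> = (\<integral>\<^sup>+c. \<integral>\<^sup>+z. F (c + (1/2) *\<^sub>R z, c - (1/2) *\<^sub>R z) \<partial>lborel \<partial>lborel)"
    by (rule lborel_pair.Fubini') measurable
  finally show ?thesis .
qed

text \<open>In centre of mass coordinates the flow acts on z alone, and there by an orthogonal
  map.\<close>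

lemma nn_integral_flow:
  assumes [measurable]: "F \<in> borel_measurable borel"
  shows "(\<integral>\<^sup>+x. F (flow j t x) \<partial>lborel) = (\<integral>\<^sup>+x. F x \<partial>lborel)"
proof -
  have "flow j t (c + (1/2) *\<^sub>R z, c - (1/2) *\<^sub>R z) = (c + (1/2) *\<^sub>R zrot j t z, c - (1/2) *\<^sub>R zrot j t z)" for c z
  proof -
    have "c + (1/2) *\<^sub>R z - (c - (1/2) *\<^sub>R z) = z" by (simp add: vec_eq_iff)
    note rel = this
    show ?thesis unfolding flow_def fst_conv snd_conv rel by (simp add: vec_eq_iff field_simps)
  qed
  then have "(\<integral>\<^sup>+x. F (flow j t x) \<partial>lborel) = (\<integral>\<^sup>+c. \<integral>\<^sup>+z. F (c + (1/2) *\<^sub>R zrot j t z, c - (1/2) *\<^sub>R zrot j t z) \<partial>lborel \<partial>lborel)"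
    by (subst nn_integral_relative) simp_all
  also have "\<dots> = (\<integral>\<^sup>+c. \<integral>\<^sup>+z. F (c + (1/2) *\<^sub>R z, c - (1/2) *\<^sub>R z) \<partial>lborel \<partial>lborel)"
    by (intro nn_integral_cong nn_integral_orthogonal[OF orthogonal_zrot]) simp
  also have "\<dots> = (\<integral>\<^sup>+x. F x \<partial>lborel)" by (rule nn_integral_relative[symmetric]) simp
  finally show ?thesis .
qed

lemma distr_flow: "distr lborel borel (flow j t) = lborel"
proof (rule measure_eqI)
  fix A assume "A \<in> sets (distr lborel borel (flow j t))"
  then have [measurable]: "A \<in> sets borel" by simp
  have "emeasure (distr lborel borel (flow j t)) A = (\<integral>\<^sup>+x. indicator A (flow j t x) \<partial>lborel)"
  proof -
    have "emeasure (distr lborel borel (flow j t)) A = (\<integral>\<^sup>+x. indicator A x \<partial>distr lborel borel (flow j t))" by simp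
    also have "\<dots> = (\<integral>\<^sup>+x. indicator A (flow j t x) \<partial>lborel)" by (rule nn_integral_distr) auto
    finally show ?thesis .
  qed
  then show "emeasure (distr lborel borel (flow j t)) A = emeasure lborel A"
    by (simp add: nn_integral_flow)
qed simp

lemma integral_flow:
  fixes F :: "(real^3) \<times> (real^3) \<Rightarrow> real"
  assumes [measurable]: "F \<in> borel_measurable borel"
  shows "(\<integral>x. F (flow j t x) \<partial>lborel) = (\<integral>x. F x \<partial>lborel)"
  by (subst (2) distr_flow[of j t, symmetric]) (simp add: integral_distr)

lemma integrable_flow:
  fixes F :: "(real^3) \<times> (real^3) \<Rightarrow> real"
  assumes "integrable lborel F"
  shows "integrable lborel (\<lambda>x. F (flow j t x))"
  using assms distr_flow[of j t] integrable_distr_eq[of "flow j t" lborel borel F]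
  by (simp add: borel_measurable_integrable)

subsection \<open>Continuously differentiable test functions\<close>

definition nabla :: "('a::euclidean_space \<Rightarrow> real) \<Rightarrow> 'a \<Rightarrow> 'a" where
  "nabla \<psi> x = (\<Sum>i\<in>Basis. frechet_derivative \<psi> (at x) i *\<^sub>R i)"

text \<open>One class for all test objects. With a single derivative to control, stability under the
  flow, radial weights and linear factors is easy to establish; the smooth test functions of the
  Landau dissipation enter through \<open>test_function_C1c\<close>.\<close>

definition C1c :: "'a::euclidean_space set \<Rightarrow> ('a \<Rightarrow> real) \<Rightarrow> bool" where
  "C1c \<Omega> \<psi> \<longleftrightarrow> (\<forall>x. \<psi> differentiable (at x)) \<and> continuous_on UNIV (nabla \<psi>) \<and>
     (\<exists>K. compact K \<and> K \<subseteq> \<Omega> \<and> (\<forall>x. x \<notin> K \<longrightarrow> \<psi> x = 0))"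

lemma frechet_derivative_nabla:
  assumes "\<psi> differentiable (at x)"
  shows "frechet_derivative \<psi> (at x) h = nabla \<psi> x \<bullet> h"
proof -
  interpret l: bounded_linear "frechet_derivative \<psi> (at x)"
    using assms has_derivative_bounded_linear frechet_derivative_works by blast
  have "frechet_derivative \<psi> (at x) h = frechet_derivative \<psi> (at x) (\<Sum>i\<in>Basis. (h \<bullet> i) *\<^sub>R i)"
    by (simp add: euclidean_representation)
  also have "\<dots> = nabla \<psi> x \<bullet> h"
    by (auto intro!: sum.cong simp: l.sum l.scaleR nabla_def inner_sum_left inner_commute[of h])
  finally show ?thesis .
qed

lemma C1c_has_derivative: "C1c \<Omega> \<psi> \<Longrightarrow> (\<psi> has_derivative (\<lambda>h. nabla \<psi> x \<bullet> h)) (at x)"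
proof -
  assume "C1c \<Omega> \<psi>"
  then have d: "\<psi> differentiable (at x)" by (simp add: C1c_def)
  have "frechet_derivative \<psi> (at x) = (\<lambda>h. nabla \<psi> x \<bullet> h)" using frechet_derivative_nabla[OF d] by blast
  with d show ?thesis by (simp add: frechet_derivative_works)
qed

lemma nabla_unique:
  assumes "(\<psi> has_derivative (\<lambda>h. g \<bullet> h)) (at x)" shows "nabla \<psi> x = g"
proof -
  have "frechet_derivative \<psi> (at x) = (\<lambda>h. g \<bullet> h)" using frechet_derivative_at[OF assms] by simp
  then show ?thesis by (simp add: nabla_def euclidean_representation)
qed

lemma C1cI:
  assumes "\<And>x. (\<psi> has_derivative (\<lambda>h. g x \<bullet> h)) (at x)" "continuous_on UNIV g"
    "compact K" "K \<subseteq> \<Omega>" "\<And>x. x \<notin> K \<Longrightarrow> \<psi> x = 0"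
  shows "C1c \<Omega> \<psi>" "nabla \<psi> = g"
proof -
  show "nabla \<psi> = g" using nabla_unique assms(1) by blast
  with assms show "C1c \<Omega> \<psi>" unfolding C1c_def differentiable_def by blast
qed

lemma C1c_continuous: "C1c \<Omega> \<psi> \<Longrightarrow> continuous_on UNIV \<psi>"
  by (meson C1c_has_derivative continuous_at_imp_continuous_on has_derivative_continuous)

lemma C1c_measurable: "C1c \<Omega> \<psi> \<Longrightarrow> \<psi> \<in> borel_measurable borel"
  by (intro borel_measurable_continuous_onI C1c_continuous)

lemma C1c_nabla_continuous: "C1c \<Omega> \<psi> \<Longrightarrow> continuous_on UNIV (nabla \<psi>)"
  by (simp add: C1c_def)

lemma C1c_support:
  assumes "C1c \<Omega> \<psi>"
  obtains K where "compact K" "K \<subseteq> \<Omega>" "\<And>x. x \<notin> K \<Longrightarrow> \<psi> x = 0" "\<And>x. x \<notin> K \<Longrightarrow> nabla \<psi> x = 0"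
proof -
  obtain K where K: "compact K" "K \<subseteq> \<Omega>" "\<And>x. x \<notin> K \<Longrightarrow> \<psi> x = 0" using assms C1c_def by metis
  have "nabla \<psi> x = 0" if "x \<notin> K" for x
  proof (rule nabla_unique)
    have "((\<lambda>x. 0) has_derivative (\<lambda>h. 0 \<bullet> h)) (at x)" by simp
    then show "(\<psi> has_derivative (\<lambda>h. 0 \<bullet> h)) (at x)"
      by (rule has_derivative_transform_within_open[of _ _ _ _ "- K"])
        (use K that in \<open>auto simp: open_Compl compact_imp_closed\<close>)
  qed
  with K that show thesis by blast
qed

lemma compact_support_bounded:
  fixes f :: "'a::euclidean_space \<Rightarrow> 'b::real_normed_vector"
  assumes "continuous_on UNIV f" "compact K" "\<And>x. x \<notin> K \<Longrightarrow> f x = 0"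
  obtains C where "C > 0" "\<And>x. norm (f x) \<le> C"
proof -
  have "compact (f ` K)" using assms by (intro compact_continuous_image continuous_on_subset[OF assms(1)]) auto
  then obtain C where C: "\<And>y. y \<in> f ` K \<Longrightarrow> norm y \<le> C" using compact_imp_bounded bounded_iff by metis
  have "norm (f x) \<le> max C 1" for x using C[of "f x"] assms(3)[of x] by (cases "x \<in> K") auto
  then show thesis by (intro that[of "max C 1"]) auto
qed

lemma test_function_C1c:
  assumes "test_function \<Omega> \<psi>" shows "C1c \<Omega> \<psi>"
proof -
  have 1: "C_order (Suc 0) \<psi>" using assms by (simp add: test_function_def)
  then have d: "\<psi> differentiable (at x)" and c: "continuous_on UNIV (\<lambda>x. frechet_derivative \<psi> (at x) h)" for x h
    by auto
  have "continuous_on UNIV (nabla \<psi>)"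
    unfolding nabla_def by (intro continuous_on_sum continuous_on_scaleR c continuous_on_const)
  moreover have "\<psi> x = 0" if "x \<notin> closure {x. \<psi> x \<noteq> 0}" for x
    using that closure_subset[of "{x. \<psi> x \<noteq> 0}"] by auto
  ultimately show ?thesis using assms d unfolding C1c_def test_function_def by blast
qed

lemma C1c_add_scale:
  assumes "C1c \<Omega> \<psi>" "C1c \<Omega> \<phi>"
  shows "C1c \<Omega> (\<lambda>x. \<psi> x + t * \<phi> x)" "nabla (\<lambda>x. \<psi> x + t * \<phi> x) = (\<lambda>x. nabla \<psi> x + t *\<^sub>R nabla \<phi> x)"
proof -
  obtain K L where K: "compact K" "K \<subseteq> \<Omega>" "\<And>x. x \<notin> K \<Longrightarrow> \<psi> x = 0" and L: "compact L" "L \<subseteq> \<Omega>" "\<And>x. x \<notin> L \<Longrightarrow> \<phi> x = 0"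
    using assms C1c_support by metis
  have d: "((\<lambda>x. \<psi> x + t * \<phi> x) has_derivative (\<lambda>h. (nabla \<psi> x + t *\<^sub>R nabla \<phi> x) \<bullet> h)) (at x)" for x
    using has_derivative_add[OF C1c_has_derivative[OF assms(1)] has_derivative_mult_right[OF C1c_has_derivative[OF assms(2)], of t]]
    by (simp add: inner_add_left)
  have c: "continuous_on UNIV (\<lambda>x. nabla \<psi> x + t *\<^sub>R nabla \<phi> x)"
    using assms by (intro continuous_intros C1c_nabla_continuous)
  show "C1c \<Omega> (\<lambda>x. \<psi> x + t * \<phi> x)" "nabla (\<lambda>x. \<psi> x + t * \<phi> x) = (\<lambda>x. nabla \<psi> x + t *\<^sub>R nabla \<phi> x)"
    by (rule C1cI[OF d c, of "K \<union> L"]; use K L in auto)+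
qed

lemma C1c_zero: "C1c \<Omega> (\<lambda>x. 0)"
  by (rule C1cI(1)[where g="\<lambda>x. 0" and K="{}"]) auto

text \<open>The factor may be singular outside \<Omega>, as |v - w|^p is on the diagonal: off the
  compact support K the product vanishes identically, and \<Omega> and the complement of K form an
  open cover of the space.\<close>

lemma C1c_mult:
  assumes \<psi>: "C1c \<Omega> \<psi>" and \<Omega>: "open \<Omega>"
    and a: "\<And>x. x \<in> \<Omega> \<Longrightarrow> (a has_derivative (\<lambda>h. g x \<bullet> h)) (at x)" and g: "continuous_on \<Omega> g"
  shows "C1c \<Omega> (\<lambda>x. a x * \<psi> x)"
    "\<And>x. nabla (\<lambda>x. a x * \<psi> x) x = (if x \<in> \<Omega> then a x *\<^sub>R nabla \<psi> x + \<psi> x *\<^sub>R g x else 0)"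
proof -
  obtain K where K: "compact K" "K \<subseteq> \<Omega>" "\<And>x. x \<notin> K \<Longrightarrow> \<psi> x = 0" "\<And>x. x \<notin> K \<Longrightarrow> nabla \<psi> x = 0"
    using C1c_support[OF \<psi>] by metis
  let ?g = "\<lambda>x. if x \<in> \<Omega> then a x *\<^sub>R nabla \<psi> x + \<psi> x *\<^sub>R g x else 0"
  have out: "?g x = 0" if "x \<notin> K" for x using K that by simp
  have oK: "open (- K)" using K by (simp add: open_Compl compact_imp_closed)
  have d: "((\<lambda>x. a x * \<psi> x) has_derivative (\<lambda>h. ?g x \<bullet> h)) (at x)" for x
  proof (cases "x \<in> \<Omega>")
    case True
    show ?thesis
      by (rule has_derivative_eq_rhs, rule has_derivative_mult[OF a[OF True] C1c_has_derivative[OF \<psi>]])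
        (use True in \<open>simp add: inner_add_left mult.commute\<close>)
  next
    case False
    then have "x \<in> - K" using K by blast
    have "((\<lambda>x. 0) has_derivative (\<lambda>h. ?g x \<bullet> h)) (at x)" using False by simp
    then show ?thesis
      by (rule has_derivative_transform_within_open[OF _ oK \<open>x \<in> - K\<close>]) (use K in auto)
  qed
  have ca: "continuous_on \<Omega> a"
    by (meson a continuous_at_imp_continuous_on has_derivative_continuous)
  have "continuous_on \<Omega> ?g"
    by (rule continuous_on_eq[of _ "\<lambda>x. a x *\<^sub>R nabla \<psi> x + \<psi> x *\<^sub>R g x"])
      (auto intro!: continuous_intros ca g continuous_on_subset[OF C1c_nabla_continuous[OF \<psi>]] continuous_on_subset[OF C1c_continuous[OF \<psi>]])
  moreover have "continuous_on (- K) ?g"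
    by (rule continuous_on_eq[of _ "\<lambda>x. 0"]) (use out in auto)
  ultimately have "continuous_on (\<Omega> \<union> - K) ?g" by (intro continuous_on_open_Un \<Omega> oK)
  moreover have "\<Omega> \<union> - K = UNIV" using K by blast
  ultimately have c: "continuous_on UNIV ?g" by simp
  show "C1c \<Omega> (\<lambda>x. a x * \<psi> x)" "\<And>x. nabla (\<lambda>x. a x * \<psi> x) x = ?g x"
    using C1cI[OF d c K(1,2)] K(3) by simp_all
qed

section \<open>Derivatives along rotations\<close>

definition rotD :: "3 \<Rightarrow> ((real^3) \<times> (real^3) \<Rightarrow> real) \<Rightarrow> (real^3) \<times> (real^3) \<Rightarrow> real" where
  "rotD j \<psi> x = nabla \<psi> x \<bullet> rotfield j x"

lemma open_off_diagonal: "open off_diagonal"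
proof -
  have eq: "off_diagonal = - {x. rel x = 0}" by (auto simp: off_diagonal_def)
  have "closed {x :: (real^3) \<times> (real^3). rel x = 0}" by (intro closed_Collect_eq continuous_intros)
  then show ?thesis unfolding eq by (rule open_Compl)
qed

lemma off_diagonal_iff: "x \<in> off_diagonal \<longleftrightarrow> rel x \<noteq> 0"
  by (cases x) (simp add: off_diagonal_def)

text \<open>A function of |v - w| is constant along rotations: its gradient is parallel to (z, -z),
  and z is orthogonal to its cross product with the axis. Radial weights thus pass through
  \<open>rotD\<close> without a commutator term.\<close>

lemma C1c_radial:
  fixes \<kappa> :: "real \<Rightarrow> real"
  assumes \<psi>: "C1c off_diagonal \<psi>"
    and \<kappa>: "\<And>r. 0 < r \<Longrightarrow> (\<kappa> has_real_derivative \<kappa>' r) (at r)" and c: "continuous_on {0<..} \<kappa>'"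
  shows "C1c off_diagonal (\<lambda>x. \<kappa> (norm (rel x)) * \<psi> x)"
    "rotD j (\<lambda>x. \<kappa> (norm (rel x)) * \<psi> x) x = \<kappa> (norm (rel x)) * rotD j \<psi> x"
proof -
  define g :: "(real^3) \<times> (real^3) \<Rightarrow> (real^3) \<times> (real^3)"
    where "g x = \<kappa>' (norm (rel x)) *\<^sub>R (rel x /\<^sub>R norm (rel x), - (rel x /\<^sub>R norm (rel x)))" for x
  have d: "((\<lambda>x. \<kappa> (norm (rel x))) has_derivative (\<lambda>h. g x \<bullet> h)) (at x)" if "x \<in> off_diagonal" for x
  proof -
    have ne: "rel x \<noteq> 0" using that off_diagonal_iff by blast
    have 1: "(rel has_derivative rel) (at x)" by (intro derivative_intros)
    have 2: "((\<lambda>x. norm (rel x)) has_derivative (\<lambda>h. inner (sgn (rel x)) (rel h))) (at x)"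
      using has_derivative_compose[OF 1 has_derivative_norm[OF ne]] by (simp add: inner_commute)
    show ?thesis
      by (rule has_derivative_eq_rhs, rule DERIV_compose_FDERIV[OF \<kappa> 2])
        (use ne in \<open>auto simp: g_def sgn_div_norm inner_prod_def inner_diff_right fun_eq_iff algebra_simps\<close>)
  qed
  have gc: "continuous_on off_diagonal g"
    unfolding g_def
    by (intro continuous_intros continuous_on_compose2[OF c]) (auto simp: off_diagonal_iff)
  note m = C1c_mult[OF \<psi> open_off_diagonal d gc]
  show "C1c off_diagonal (\<lambda>x. \<kappa> (norm (rel x)) * \<psi> x)" by (rule m(1))
  have "g x \<bullet> rotfield j x = 0"
    by (simp add: g_def rotfield_def inner_prod_def dot_cross_self)
  moreover have "rotfield j x = 0" if "x \<notin> off_diagonal"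
    using that by (simp add: off_diagonal_iff rotfield_def cross3_def vec_eq_iff forall_3 zero_prod_def)
  ultimately show "rotD j (\<lambda>x. \<kappa> (norm (rel x)) * \<psi> x) x = \<kappa> (norm (rel x)) * rotD j \<psi> x"
    unfolding rotD_def using m(2)[of x] by (cases "x \<in> off_diagonal") (simp_all add: inner_add_left)
qed

lemma C1c_powr:
  assumes \<psi>: "C1c off_diagonal \<psi>"
  shows "C1c off_diagonal (\<lambda>x. norm (rel x) powr p * \<psi> x)"
    "rotD j (\<lambda>x. norm (rel x) powr p * \<psi> x) x = norm (rel x) powr p * rotD j \<psi> x"
proof -
  have d: "((\<lambda>r. r powr p) has_real_derivative p * r powr (p - 1)) (at r)" if "0 < r" for r
    using that by (rule has_real_derivative_powr)
  have c: "continuous_on {0<..} (\<lambda>r. p * r powr (p - 1))" by (auto intro!: continuous_intros)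
  show "C1c off_diagonal (\<lambda>x. norm (rel x) powr p * \<psi> x)"
    "rotD j (\<lambda>x. norm (rel x) powr p * \<psi> x) x = norm (rel x) powr p * rotD j \<psi> x"
    using C1c_radial[OF \<psi> d c] by auto
qed

text \<open>The flow is linear, preserves |v - w| and so the off-diagonal set, and carries its
  generator to itself. The chain rule is therefore free of correction terms.\<close>

lemma flow_C1c:
  assumes \<psi>: "C1c off_diagonal \<psi>"
  shows "C1c off_diagonal (\<lambda>x. \<psi> (flow j t x))"
    "rotD j (\<lambda>x. \<psi> (flow j t x)) x = rotD j \<psi> (flow j t x)"
proof -
  let ?A = "flow j t"
  let ?g = "\<lambda>x. adjoint ?A (nabla \<psi> (?A x))"
  have bl: "bounded_linear (flow j t)" for t using linear_flow linear_conv_bounded_linear by blast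
  have d: "((\<lambda>x. \<psi> (?A x)) has_derivative (\<lambda>h. ?g x \<bullet> h)) (at x)" for x
    by (rule has_derivative_eq_rhs, rule has_derivative_compose[OF bounded_linear_imp_has_derivative[OF bl] C1c_has_derivative[OF \<psi>]])
      (simp add: adjoint_works[OF linear_flow] inner_commute fun_eq_iff)
  have cA: "continuous_on S ?A" for S using bl by (rule linear_continuous_on)
  have c: "continuous_on UNIV ?g"
    by (intro continuous_on_compose2[OF linear_continuous_on[of "adjoint ?A" UNIV]] continuous_on_compose2[OF C1c_nabla_continuous[OF \<psi>]] cA)
      (auto simp: adjoint_linear[OF linear_flow] linear_conv_bounded_linear[symmetric])
  obtain K where K: "compact K" "K \<subseteq> off_diagonal" "\<And>x. x \<notin> K \<Longrightarrow> \<psi> x = 0"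
    using C1c_support[OF \<psi>] by metis
  let ?K = "flow j (- t) ` K"
  have K': "compact ?K" "?K \<subseteq> off_diagonal"
  proof -
    show "compact ?K" by (rule compact_continuous_image[OF linear_continuous_on[OF bl] K(1)])
    show "?K \<subseteq> off_diagonal"
    proof
      fix x assume "x \<in> ?K"
      then obtain y where y: "y \<in> K" "x = flow j (- t) y" by blast
      then have "norm (rel y) \<noteq> 0" using K(2) off_diagonal_iff[of y] by auto
      then have "norm (rel x) \<noteq> 0" unfolding y(2) rel_flow norm_zrot .
      then show "x \<in> off_diagonal" using off_diagonal_iff by simp
    qed
  qed
  have z: "\<psi> (?A x) = 0" if "x \<notin> ?K" for x
  proof (rule K(3))
    show "?A x \<notin> K" using that flow_flow[of j "- t" t x] by (metis add.left_inverse flow_0 image_eqI)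
  qed
  show "C1c off_diagonal (\<lambda>x. \<psi> (flow j t x))" by (rule C1cI(1)[OF d c K' z])
  have n: "nabla (\<lambda>x. \<psi> (?A x)) = ?g" by (rule C1cI(2)[OF d c K' z])
  show "rotD j (\<lambda>x. \<psi> (flow j t x)) x = rotD j \<psi> (flow j t x)"
    unfolding rotD_def n using adjoint_works[OF linear_flow, of "rotfield j x" j t "nabla \<psi> (?A x)"]
    by (simp add: flow_rotfield inner_commute)
qed

lemma flow_DERIV:
  assumes "C1c \<Omega> \<psi>"
  shows "((\<lambda>t. \<psi> (flow j t x)) has_real_derivative rotD j \<psi> (flow j t x)) (at t)"
proof -
  have "((\<lambda>t. \<psi> (flow j t x)) has_vector_derivative nabla \<psi> (flow j t x) \<bullet> rotfield j (flow j t x)) (at t)"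
    using vector_derivative_diff_chain_within[OF flow_has_vector_derivative has_derivative_at_withinI[OF C1c_has_derivative[OF assms]], of j x t]
    by (simp add: o_def)
  then show ?thesis by (simp add: rotD_def has_real_derivative_iff_has_vector_derivative)
qed

lemma continuous_on_rotD:
  assumes "C1c \<Omega> \<psi>" shows "continuous_on UNIV (rotD j \<psi>)"
proof -
  have "continuous_on UNIV (rotfield j)"
    unfolding rotfield_def by (intro continuous_intros continuous_on_cross)
  then show ?thesis
    unfolding rotD_def[abs_def] by (intro continuous_on_inner C1c_nabla_continuous[OF assms])
qed

section \<open>Smooth bump functions and the fundamental lemma\<close>

text \<open>This trades the recursion over the order for a single closure property, so no formula
  for higher derivatives has to be written down.\<close>

lemma C_order_coinduct:
  assumes "g \<in> S"
    and diff: "\<And>g x. g \<in> S \<Longrightarrow> g differentiable (at x)"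
    and der: "\<And>g h. g \<in> S \<Longrightarrow> (\<lambda>x. frechet_derivative g (at x) h) \<in> S"
  shows "C_order k g"
  using assms(1)
proof (induction k arbitrary: g)
  case 0
  then show ?case
    by (simp add: continuous_at_imp_continuous_on diff differentiable_imp_continuous_within)
qed (auto intro: diff der)

text \<open>The functions x^(-n) exp(-1/x), extended by zero. As a family they are closed under
  differentiation up to linear combinations, which a single flat function is not.\<close>

definition exp_bump :: "nat \<Rightarrow> real \<Rightarrow> real" where
  "exp_bump n x = (if 0 < x then (1/x) ^ n * exp (- (1/x)) else 0)"

text \<open>The term of index n + 2 in the exponential series at 1/x is below the whole sum. The
  resulting quadratic decay yields the derivative 0 at the origin.\<close>

lemma exp_bump_bound:
  assumes "0 < x" shows "exp_bump n x \<le> fact (n + 2) * x\<^sup>2"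
proof -
  have "(\<Sum>k\<in>{n+2}. (1/x) ^ k /\<^sub>R fact k) \<le> (\<Sum>k. (1/x) ^ k /\<^sub>R fact k)"
    using assms by (intro sum_le_suminf summable_exp_generic) auto
  then have "(1/x) ^ (n+2) / fact (n+2) \<le> exp (1/x)"
    by (simp add: exp_def divide_inverse mult.commute)
  then show ?thesis
    using assms by (simp add: exp_bump_def exp_minus field_simps power2_eq_square del: fact_Suc)
qed

lemma DERIV_exp_bump:
  "(exp_bump n has_real_derivative (exp_bump (n + 2) x - n * exp_bump (n + 1) x)) (at x)"
proof -
  consider "x > 0" | "x < 0" | "x = 0" by linarith
  then show ?thesis
  proof cases
    case 1
    have "((\<lambda>x. (1/x) ^ n * exp (- (1/x))) has_real_derivative
        (exp_bump (n + 2) x - n * exp_bump (n + 1) x)) (at x)"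
      using 1 by (auto intro!: derivative_eq_intros simp: exp_bump_def field_simps power2_eq_square
          simp flip: power_Suc; cases n; auto simp: field_simps)
    then show ?thesis
      by (rule has_field_derivative_transform_within_open[where S="{0<..}"]) (use 1 in \<open>auto simp: exp_bump_def\<close>)
  next
    case 2
    have "((\<lambda>x. 0) has_real_derivative (exp_bump (n + 2) x - n * exp_bump (n + 1) x)) (at x)"
      using 2 by (auto simp: exp_bump_def)
    then show ?thesis
      by (rule has_field_derivative_transform_within_open[where S="{..<0}"]) (use 2 in \<open>auto simp: exp_bump_def\<close>)
  next
    case 3
    have "((\<lambda>y. exp_bump n y / y) \<longlongrightarrow> 0) (at 0)"
    proof (rule Lim_null_comparison)
      show "\<forall>\<^sub>F y in at 0. norm (exp_bump n y / y) \<le> fact (n+2) * \<bar>y\<bar>"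
      proof (intro always_eventually allI)
        fix y :: real
        show "norm (exp_bump n y / y) \<le> fact (n+2) * \<bar>y\<bar>"
        proof (cases "0 < y")
          case True
          then show ?thesis using exp_bump_bound[of y n]
            by (simp add: exp_bump_def pos_divide_le_eq power2_eq_square mult.assoc del: fact_Suc)
        qed (simp add: exp_bump_def mult_nonneg_nonpos del: fact_Suc)
      qed
      show "((\<lambda>y. fact (n+2) * \<bar>y\<bar>) \<longlongrightarrow> 0) (at (0::real))"
        by (auto intro!: tendsto_eq_intros)
    qed
    then show ?thesis
      using 3 by (simp add: has_field_derivative_iff exp_bump_def)
  qed
qed

text \<open>By the product and chain rules this algebra contains the directional derivatives of its
  members, which is exactly what \<open>C_order_coinduct\<close> asks for.\<close>

inductive_set bump_algebra :: "('a::euclidean_space \<Rightarrow> real) set" where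
  const: "(\<lambda>x. c) \<in> bump_algebra"
| inner: "(\<lambda>x. x \<bullet> b) \<in> bump_algebra"
| add: "g \<in> bump_algebra \<Longrightarrow> h \<in> bump_algebra \<Longrightarrow> (\<lambda>x. g x + h x) \<in> bump_algebra"
| mult: "g \<in> bump_algebra \<Longrightarrow> h \<in> bump_algebra \<Longrightarrow> (\<lambda>x. g x * h x) \<in> bump_algebra"
| bump: "g \<in> bump_algebra \<Longrightarrow> (\<lambda>x. exp_bump n (g x)) \<in> bump_algebra"

lemma bump_algebra_derivative:
  assumes "g \<in> bump_algebra"
  shows "\<exists>g'. (\<forall>x. (g has_derivative g' x) (at x)) \<and> (\<forall>h. (\<lambda>x. g' x h) \<in> bump_algebra)"
  using assms
proof induction
  case (const c)
  show ?case
    by (rule exI[of _ "\<lambda>x h. 0"]) (auto intro: bump_algebra.intros)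
next
  case (inner b)
  show ?case
    by (rule exI[of _ "\<lambda>x h. h \<bullet> b"]) (auto intro!: bump_algebra.intros derivative_eq_intros)
next
  case (add g h)
  then obtain g' h' where "\<forall>x. (g has_derivative g' x) (at x)" "\<forall>u. (\<lambda>x. g' x u) \<in> bump_algebra"
    "\<forall>x. (h has_derivative h' x) (at x)" "\<forall>u. (\<lambda>x. h' x u) \<in> bump_algebra" by blast
  then show ?case
    by (intro exI[of _ "\<lambda>x u. g' x u + h' x u"]) (auto intro!: bump_algebra.intros has_derivative_add)
next
  case (mult g h)
  then obtain g' h' where "\<forall>x. (g has_derivative g' x) (at x)" "\<forall>u. (\<lambda>x. g' x u) \<in> bump_algebra"
    "\<forall>x. (h has_derivative h' x) (at x)" "\<forall>u. (\<lambda>x. h' x u) \<in> bump_algebra" by blast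
  with mult.hyps show ?case
    by (intro exI[of _ "\<lambda>x u. g x * h' x u + g' x u * h x"])
      (auto intro!: bump_algebra.add bump_algebra.mult has_derivative_mult)
next
  case (bump g n)
  then obtain g' where g': "\<forall>x. (g has_derivative g' x) (at x)" "\<forall>u. (\<lambda>x. g' x u) \<in> bump_algebra" by blast
  have "((\<lambda>x. exp_bump n (g x)) has_derivative
       (\<lambda>u. g' x u * (exp_bump (n + 2) (g x) + (- real n) * exp_bump (n + 1) (g x)))) (at x)" for x
    using DERIV_compose_FDERIV[OF DERIV_exp_bump, of g "g' x" x UNIV n] g'(1) by (simp add: mult.commute)
  moreover have "(\<lambda>x. g' x u * (exp_bump (n + 2) (g x) + (- real n) * exp_bump (n + 1) (g x))) \<in> bump_algebra" for u
    using bump.hyps g'(2) by (intro bump_algebra.intros) auto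
  ultimately show ?case
    by (intro exI[of _ "\<lambda>x u. g' x u * (exp_bump (n + 2) (g x) + (- real n) * exp_bump (n + 1) (g x))"] conjI allI)
qed

lemma C_order_bump_algebra: "g \<in> bump_algebra \<Longrightarrow> C_order k g"
proof (erule C_order_coinduct)
  fix g :: "'a \<Rightarrow> real" and x h assume "g \<in> bump_algebra"
  from bump_algebra_derivative[OF this] obtain g' where
    g': "\<And>x. (g has_derivative g' x) (at x)" "\<And>h. (\<lambda>x. g' x h) \<in> bump_algebra" by blast
  show "g differentiable at x" using g'(1) differentiable_def by blast
  have "frechet_derivative g (at x) = g' x" for x using g'(1) frechet_derivative_at by metis
  then show "(\<lambda>x. frechet_derivative g (at x) h) \<in> bump_algebra" using g'(2) by simp
qed

text \<open>Each factor is positive precisely between the two faces of the box in its direction. The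
  multiplier \<open>Suc m\<close> drives the exponent -1/x to zero, so the functions approach the
  indicator of the open box.\<close>

definition box_bump :: "'a::euclidean_space \<Rightarrow> 'a \<Rightarrow> nat \<Rightarrow> 'a \<Rightarrow> real" where
  "box_bump a b m x = (\<Prod>i\<in>Basis. exp_bump 0 (real (Suc m) * ((x \<bullet> i - a \<bullet> i) * (b \<bullet> i - x \<bullet> i))))"

lemma prod_bump_algebra:
  assumes "finite I" "\<And>i. i \<in> I \<Longrightarrow> g i \<in> bump_algebra"
  shows "(\<lambda>x. \<Prod>i\<in>I. g i x) \<in> bump_algebra"
  using assms by (induction I rule: finite_induct) (auto intro: bump_algebra.intros)

lemma box_bump_algebra: "box_bump a b m \<in> bump_algebra"
proof -
  have "(\<lambda>x. exp_bump 0 (real (Suc m) * ((x \<bullet> i + (- (a \<bullet> i))) * (b \<bullet> i + (-1) * (x \<bullet> i))))) \<in> bump_algebra"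
    for i by (intro bump_algebra.intros)
  then show ?thesis
    unfolding box_bump_def by (intro prod_bump_algebra) auto
qed

lemma box_bump_nonzero: "box_bump a b m x \<noteq> 0 \<longleftrightarrow> (\<forall>i\<in>Basis. (x \<bullet> i - a \<bullet> i) * (b \<bullet> i - x \<bullet> i) > 0)"
  by (auto simp: box_bump_def exp_bump_def zero_less_mult_iff split: if_splits)

text \<open>The ordering of the corners matters: for b_i < x_i < a_i both factors are negative and
  their product is positive although the box is empty.\<close>

lemma box_bump_outside:
  assumes "\<And>i. i \<in> Basis \<Longrightarrow> a \<bullet> i \<le> b \<bullet> i" "x \<notin> box a b" shows "box_bump a b m x = 0"
proof (rule ccontr)
  assume "box_bump a b m x \<noteq> 0"
  then have *: "(x \<bullet> i - a \<bullet> i) * (b \<bullet> i - x \<bullet> i) > 0" if "i \<in> Basis" for i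
    using that box_bump_nonzero by blast
  have "x \<in> box a b"
    unfolding mem_box
  proof
    fix i :: 'a assume "i \<in> Basis"
    from *[OF this] assms(1)[OF this] show "a \<bullet> i < x \<bullet> i \<and> x \<bullet> i < b \<bullet> i"
      by (auto simp: zero_less_mult_iff)
  qed
  with assms(2) show False by simp
qed

lemma box_bump_range: "0 \<le> box_bump a b m x" "box_bump a b m x \<le> 1"
  unfolding box_bump_def by (auto intro!: prod_nonneg prod_le_1 simp: exp_bump_def)

lemma box_bump_tendsto:
  assumes "x \<in> box a b" shows "(\<lambda>m. box_bump a b m x) \<longlonglongrightarrow> 1"
proof -
  have "(\<lambda>m. exp_bump 0 (real (Suc m) * ((x \<bullet> i - a \<bullet> i) * (b \<bullet> i - x \<bullet> i)))) \<longlonglongrightarrow> 1" if "i \<in> Basis" for i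
  proof -
    define y where "y = (x \<bullet> i - a \<bullet> i) * (b \<bullet> i - x \<bullet> i)"
    have y: "y > 0" using assms that by (auto simp: mem_box y_def)
    have "(\<lambda>m. exp (- (inverse (real (Suc m)) * (1 / y)))) \<longlonglongrightarrow> exp (- (0 * (1 / y)))"
      by (intro tendsto_intros LIMSEQ_inverse_real_of_nat)
    then show ?thesis
      unfolding y_def[symmetric] using y by (simp add: exp_bump_def divide_simps)
  qed
  then have "(\<lambda>m. box_bump a b m x) \<longlonglongrightarrow> (\<Prod>i\<in>(Basis::'a set). 1)"
    unfolding box_bump_def by (intro tendsto_prod)
  then show ?thesis by simp
qed

lemma test_function_box_bump:
  assumes "cbox a b \<subseteq> \<Omega>" "\<And>i. i \<in> Basis \<Longrightarrow> a \<bullet> i \<le> b \<bullet> i"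
  shows "test_function \<Omega> (box_bump a b m)"
proof -
  have "closure {x. box_bump a b m x \<noteq> 0} \<subseteq> cbox a b"
    by (rule closure_minimal) (use box_bump_outside[OF assms(2)] box_subset_cbox in blast)+
  moreover have "compact (closure {x. box_bump a b m x \<noteq> 0})"
    using calculation by (meson bounded_cbox bounded_subset closed_closure compact_eq_bounded_closed)
  ultimately show ?thesis
    using assms(1) C_order_bump_algebra[OF box_bump_algebra] unfolding test_function_def by blast
qed

lemma test_function_continuous: "test_function \<Omega> \<psi> \<Longrightarrow> continuous_on UNIV \<psi>"
  unfolding test_function_def by (metis C_order.simps(1))

section \<open>The fundamental lemma of the calculus of variations\<close>

lemma AE_zero_if_box_integrals_zero:
  fixes g :: "'a::euclidean_space \<Rightarrow> real"
  assumes int: "integrable lborel g" and zero: "\<And>a b. (\<integral>x. indicator (box a b) x * g x \<partial>lborel) = 0"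
  shows "AE x in lborel. g x = 0"
proof -
  \<comment> \<open>The positive and negative parts of g are densities of two finite measures that
    agree on boxes. Boxes are stable under intersection and generate the Borel sets, so the measures
    and then their densities coincide.\<close>
  let ?P = "density lborel (\<lambda>x. ennreal (g x))" and ?N = "density lborel (\<lambda>x. ennreal (- g x))"
  have [measurable]: "g \<in> borel_measurable borel" using int by simp
  have fin: "(\<integral>\<^sup>+x. ennreal (g x) \<partial>lborel) < \<infinity>" "(\<integral>\<^sup>+x. ennreal (- g x) \<partial>lborel) < \<infinity>"
    using int by (auto simp: real_integrable_def less_top)
  have box_eq: "emeasure ?P (box a b) = emeasure ?N (box a b)" for a b
  proof -
    have i: "integrable lborel (\<lambda>x. indicator (box a b) x * g x)"
      using integrable_mult_indicator[OF _ int, of "box a b"] by simp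
    have n: "(\<integral>\<^sup>+x. ennreal (indicator (box a b) x * g x) \<partial>lborel) < \<infinity>"
      "(\<integral>\<^sup>+x. ennreal (- (indicator (box a b) x * g x)) \<partial>lborel) < \<infinity>"
      using i by (auto simp: real_integrable_def less_top)
    have "(\<integral>\<^sup>+x. ennreal (indicator (box a b) x * g x) \<partial>lborel) = (\<integral>\<^sup>+x. ennreal (- (indicator (box a b) x * g x)) \<partial>lborel)"
      using zero[of a b] n unfolding real_lebesgue_integral_def[OF i]
      by (metis ennreal_enn2real eq_iff_diff_eq_0 infinity_ennreal_def)
    moreover have "ennreal (g x) * indicator (box a b) x = ennreal (indicator (box a b) x * g x)"
      "ennreal (- g x) * indicator (box a b) x = ennreal (- (indicator (box a b) x * g x))" for x
      by (auto simp: indicator_def)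
    ultimately show ?thesis by (simp add: emeasure_density)
  qed
  have "?P = ?N"
  proof (rule measure_eqI_generator_eq[where E="range (\<lambda>(a, b). box a b)" and \<Omega>=UNIV
        and A="\<lambda>n. box (- real n *\<^sub>R One) (real n *\<^sub>R One)"])
    show "Int_stable (range (\<lambda>(a, b). box a b :: 'a set))"
      by (auto simp: Int_stable_def box_Int_box)
    show "sets ?P = sigma_sets UNIV (range (\<lambda>(a, b). box a b))"
      "sets ?N = sigma_sets UNIV (range (\<lambda>(a, b). box a b))"
      by (simp_all add: borel_eq_box)
    show "(\<Union>i. box (- real i *\<^sub>R One) (real i *\<^sub>R One)) = (UNIV :: 'a set)"
      using UN_box_eq_UNIV by simp
    show "emeasure ?P (box (- real i *\<^sub>R One) (real i *\<^sub>R One)) \<noteq> \<infinity>" for i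
    proof -
      have "emeasure ?P (box (- real i *\<^sub>R One) (real i *\<^sub>R One)) \<le> emeasure ?P (space ?P)"
        by (intro emeasure_mono) auto
      also have "\<dots> < \<infinity>" using fin(1) by (simp add: emeasure_density)
      finally show ?thesis by simp
    qed
  qed (use box_eq in auto)
  then have "AE x in lborel. ennreal (g x) = ennreal (- g x)"
    by (intro sigma_finite_measure.density_unique[OF sigma_finite_lborel]) auto
  then show ?thesis
  proof eventually_elim
    case (elim x)
    then show ?case by (cases "g x \<ge> 0") (auto simp: ennreal_neg ennreal_eq_0_iff)
  qed
qed

lemma fundamental_lemma:
  fixes g :: "'a::euclidean_space \<Rightarrow> real"
  assumes \<Omega>: "open \<Omega>"
    and int: "\<And>a b. cbox a b \<subseteq> \<Omega> \<Longrightarrow> set_integrable lborel (cbox a b) g"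
    and zero: "\<And>\<psi>. test_function \<Omega> \<psi> \<Longrightarrow> (\<integral>x. g x * \<psi> x \<partial>lborel) = 0"
  shows "AE x in lborel. x \<in> \<Omega> \<longrightarrow> g x = 0"
proof -
  have box0: "(\<integral>x. indicator (box a b) x * g x \<partial>lborel) = 0" if sub: "cbox a b \<subseteq> \<Omega>" for a b
  proof (cases "box a b = {}")
    case False
    then have ab: "a \<bullet> i \<le> b \<bullet> i" if "i \<in> Basis" for i using that by (force simp: box_ne_empty)
    have gi: "integrable lborel (\<lambda>x. indicator (cbox a b) x * g x)"
      using int[OF sub] by (simp add: set_integrable_def)
    have [measurable]: "(\<lambda>x. indicator (cbox a b) x * g x) \<in> borel_measurable borel" using gi by auto
    have [measurable]: "box_bump a b m \<in> borel_measurable borel" for m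
      using test_function_continuous[OF test_function_box_bump[OF sub ab]] by (simp add: borel_measurable_continuous_onI)
    have eq: "g x * box_bump a b m x = (indicator (cbox a b) x * g x) * box_bump a b m x" for m x
      using box_bump_outside[OF ab, of x] box_subset_cbox[of a b] by (auto simp: indicator_def)
    have eq2: "indicator (box a b) x * g x = (indicator (cbox a b) x * g x) * indicator (box a b) x" for x
      using box_subset_cbox[of a b] by (auto simp: indicator_def)
    have "(\<lambda>m. \<integral>x. g x * box_bump a b m x \<partial>lborel) \<longlonglongrightarrow> (\<integral>x. indicator (box a b) x * g x \<partial>lborel)"
      unfolding eq eq2
    proof (rule integral_dominated_convergence[where w="\<lambda>x. norm (indicator (cbox a b) x * g x)"])
      show "AE x in lborel. (\<lambda>m. indicator (cbox a b) x * g x * box_bump a b m x) \<longlonglongrightarrow> indicator (cbox a b) x * g x * indicator (box a b) x"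
        using box_bump_tendsto[of _ a b] box_bump_outside[OF ab]
        by (intro AE_I2 tendsto_intros) (auto simp: indicator_def)
      show "AE x in lborel. norm (indicator (cbox a b) x * g x * box_bump a b m x) \<le> norm (indicator (cbox a b) x * g x)" for m
        using box_bump_range[of a b m] by (intro AE_I2) (auto simp: abs_mult intro!: mult_left_le)
    qed (use gi in auto)
    moreover have "(\<integral>x. g x * box_bump a b m x \<partial>lborel) = 0" for m
      by (rule zero[OF test_function_box_bump[OF sub ab]])
    ultimately show ?thesis by (simp add: LIMSEQ_const_iff)
  qed simp
  \<comment> \<open>Localising g to one box keeps all box integrals zero, because the intersection
    of two boxes is a box.\<close>
  have on_box: "AE x in lborel. x \<in> box a b \<longrightarrow> g x = 0" if sub: "cbox a b \<subseteq> \<Omega>" for a b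
  proof -
    have "set_integrable lborel (box a b) g"
      by (rule set_integrable_subset[OF int[OF sub]]) (auto simp: box_subset_cbox)
    then have i: "integrable lborel (\<lambda>x. indicator (box a b) x * g x)" by (simp add: set_integrable_def)
    have "AE x in lborel. indicator (box a b) x * g x = 0"
    proof (rule AE_zero_if_box_integrals_zero[OF i])
      fix c d :: 'a
      obtain e f where ef: "box a b \<inter> box c d = box e f"
        using box_Int_box by blast
      have "indicator (box c d) x * (indicator (box a b) x * g x) = indicator (box e f) x * g x" for x
        unfolding ef[symmetric] by (auto simp: indicator_def)
      then have "(\<integral>x. indicator (box c d) x * (indicator (box a b) x * g x) \<partial>lborel) = (\<integral>x. indicator (box e f) x * g x \<partial>lborel)"
        by presburger
      moreover have "(\<integral>x. indicator (box e f) x * g x \<partial>lborel) = 0"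
      proof (cases "box e f = {}")
        case False
        \<comment> \<open>\<open>box0\<close> asks for the closed box to lie in \<Omega>; for a
          nonempty open box the closure is the closed box, so inclusion survives.\<close>
        then have "cbox e f \<subseteq> cbox a b"
          using closure_mono[of "box e f" "box a b"] ef closure_box[of e f] closure_box[of a b] False by (cases "box a b = {}") auto
        then show ?thesis using box0 sub by auto
      qed simp
      ultimately show "(\<integral>x. indicator (box c d) x * (indicator (box a b) x * g x) \<partial>lborel) = 0" by (rule trans)
    qed
    then show ?thesis by (rule AE_mp) (auto simp: indicator_def)
  qed
  have on_cbox: "AE x in lborel. x \<in> cbox a b \<longrightarrow> g x = 0" if sub: "cbox a b \<subseteq> \<Omega>" for a b
  proof (cases "\<forall>i\<in>Basis. a \<bullet> i \<le> b \<bullet> i")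
    case True
    have "emeasure lborel (cbox a b - box a b) = 0"
      using True by (subst emeasure_Diff)
        (auto simp: box_subset_cbox emeasure_lborel_box_eq emeasure_lborel_cbox_eq less_imp_le)
    then have "AE x in lborel. x \<notin> cbox a b - box a b"
      by (intro AE_not_in) auto
    with on_box[OF sub] show ?thesis by eventually_elim auto
  next
    case False
    then have "cbox a b = {}" by (force simp: box_eq_empty)
    then show ?thesis by simp
  qed
  \<comment> \<open>Countably many closed boxes fill the open set, so the exceptional null sets can
    be united.\<close>
  obtain I where I: "countable I" "I \<subseteq> Pow \<Omega>" "\<And>X. X \<in> I \<Longrightarrow> \<exists>a b. X = cbox a b" "\<Union> I = \<Omega>"
    using open_countable_Union_open_cbox[OF \<Omega>] by metis
  have "AE x in lborel. \<forall>X\<in>I. x \<in> X \<longrightarrow> g x = 0"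
    unfolding AE_ball_countable[OF I(1)]
  proof
    fix X assume "X \<in> I"
    then obtain a b where "X = cbox a b" "X \<subseteq> \<Omega>" using I(2,3) by blast
    then show "AE x in lborel. x \<in> X \<longrightarrow> g x = 0" using on_cbox by blast
  qed
  then show ?thesis by (rule AE_mp) (use I(4) in auto)
qed

section \<open>Representation of bounded functionals on a space of square integrable fields\<close>

lemma sq_norm_add_le: "(norm (x + y))\<^sup>2 \<le> 2 * (norm x)\<^sup>2 + 2 * (norm (y::'a::real_inner))\<^sup>2"
  using zero_le_power2[of "norm (x - y)"]
  by (simp add: power2_norm_eq_inner algebra_simps inner_commute)

lemma norm_add_scale_sq:
  "(norm (x + t *\<^sub>R y))\<^sup>2 = (norm x)\<^sup>2 + 2 * t * (x \<bullet> y) + t\<^sup>2 * (norm (y::'a::real_inner))\<^sup>2"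
  unfolding power2_norm_eq_inner
  by (simp add: inner_add_left inner_add_right inner_commute power2_eq_square algebra_simps)

text \<open>For C > 0 the quadratic is evaluated at its minimum t = -I / C. For C = 0 it is affine,
  and the witness makes it equal to -1 unless I = 0.\<close>

lemma discriminant_le:
  fixes A I C :: real
  assumes q: "\<And>t. 0 \<le> A + 2 * t * I + t\<^sup>2 * C" and "0 \<le> C" shows "I\<^sup>2 \<le> A * C"
proof (cases "C = 0")
  case False
  then have C: "C > 0" using assms(2) by simp
  have "0 \<le> A + 2 * (- I / C) * I + (- I / C)\<^sup>2 * C" by (rule q)
  also have "\<dots> = A - I\<^sup>2 / C" using C by (simp add: power2_eq_square field_simps)
  finally show ?thesis using C by (simp add: pos_divide_le_eq)
next
  case True
  have "I = 0"
  proof (rule ccontr)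
    assume "I \<noteq> 0"
    then show False using q[of "- (A + 1) / (2 * I)"] True by (simp add: field_simps)
  qed
  then show ?thesis using True by simp
qed

lemma inner_le_sq: "\<bar>x \<bullet> y\<bar> \<le> ((norm x)\<^sup>2 + (norm (y::'a::real_inner))\<^sup>2) / 2"
proof -
  have "norm x * norm y \<le> ((norm x)\<^sup>2 + (norm y)\<^sup>2) / 2"
    using sum_squares_bound[of "norm x" "norm y"] by simp
  with Cauchy_Schwarz_ineq2[of x y] show ?thesis by linarith
qed

lemma sq_integrable_inner:
  fixes u v :: "'a \<Rightarrow> 'b::euclidean_space"
  assumes [measurable]: "u \<in> borel_measurable M" "v \<in> borel_measurable M"
    and "integrable M (\<lambda>x. (norm (u x))\<^sup>2)" "integrable M (\<lambda>x. (norm (v x))\<^sup>2)"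
  shows "integrable M (\<lambda>x. u x \<bullet> v x)"
proof (rule Bochner_Integration.integrable_bound)
  show "integrable M (\<lambda>x. ((norm (u x))\<^sup>2 + (norm (v x))\<^sup>2) / 2)"
    using assms by simp
  show "AE x in M. norm (u x \<bullet> v x) \<le> norm (((norm (u x))\<^sup>2 + (norm (v x))\<^sup>2) / 2)"
    unfolding real_norm_def by (intro AE_I2 order_trans[OF inner_le_sq abs_ge_self])
qed auto

lemma sq_integrable_add:
  fixes u v :: "'a \<Rightarrow> 'b::euclidean_space"
  assumes [measurable]: "u \<in> borel_measurable M" "v \<in> borel_measurable M"
    and "integrable M (\<lambda>x. (norm (u x))\<^sup>2)" "integrable M (\<lambda>x. (norm (v x))\<^sup>2)"
  shows "integrable M (\<lambda>x. (norm (u x + v x))\<^sup>2)"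
  using assms sq_integrable_inner[OF assms] sq_integrable_inner[OF assms(2,1,4,3)]
  by (simp add: power2_norm_eq_inner inner_add_left inner_add_right)

text \<open>The Riesz-Fischer argument. The rate 1/16 leaves room for the weights 4^n: the weighted
  series of squared increments is still integrable, hence almost everywhere the n-th increment is at
  most sqrt C / 2^n and the telescoping series converges.\<close>

lemma L2_fast_Cauchy_converges:
  fixes b :: "nat \<Rightarrow> 'a \<Rightarrow> 'b::euclidean_space"
  assumes [measurable]: "\<And>n. b n \<in> borel_measurable M"
    and int: "\<And>n. integrable M (\<lambda>x. (norm (b n x))\<^sup>2)"
    and fast: "\<And>n. (\<integral>x. (norm (b (Suc n) x - b n x))\<^sup>2 \<partial>M) \<le> (1/16) ^ n"
  obtains u where "u \<in> borel_measurable M" "integrable M (\<lambda>x. (norm (u x))\<^sup>2)"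
    "(\<lambda>n. \<integral>x. (norm (b n x - u x))\<^sup>2 \<partial>M) \<longlonglongrightarrow> 0"
proof -
  define d where "d n x = b (Suc n) x - b n x" for n x
  have [measurable]: "d n \<in> borel_measurable M" for n unfolding d_def by measurable
  have dint: "integrable M (\<lambda>x. (norm (d n x))\<^sup>2)" for n
    using sq_integrable_add[of "b (Suc n)" M "\<lambda>x. - b n x"] int unfolding d_def by simp
  have nnd: "(\<integral>\<^sup>+x. ennreal ((norm (d n x))\<^sup>2) \<partial>M) \<le> ennreal ((1/16) ^ n)" for n
    using fast[of n] dint[of n] unfolding d_def[symmetric] by (subst nn_integral_eq_integral) (auto intro: ennreal_leI)
  have "(\<integral>\<^sup>+x. (\<Sum>n. ennreal (4 ^ n * (norm (d n x))\<^sup>2)) \<partial>M) = (\<Sum>n. \<integral>\<^sup>+x. ennreal (4 ^ n * (norm (d n x))\<^sup>2) \<partial>M)"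
    by (intro nn_integral_suminf) auto
  also have "\<dots> \<le> (\<Sum>n. ennreal ((1/4) ^ n))"
  proof (intro suminf_le allI)
    fix n
    have "(\<integral>\<^sup>+x. ennreal (4 ^ n * (norm (d n x))\<^sup>2) \<partial>M) = ennreal (4 ^ n) * (\<integral>\<^sup>+x. ennreal ((norm (d n x))\<^sup>2) \<partial>M)"
      by (subst nn_integral_cmult[symmetric]) (auto simp: ennreal_mult)
    also have "\<dots> \<le> ennreal (4 ^ n) * ennreal ((1/16) ^ n)" by (intro mult_left_mono nnd) auto
    also have "\<dots> = ennreal ((1/4) ^ n)"
      by (simp flip: ennreal_mult power_mult_distrib)
    finally show "(\<integral>\<^sup>+x. ennreal (4 ^ n * (norm (d n x))\<^sup>2) \<partial>M) \<le> ennreal ((1/4) ^ n)" .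
  qed auto
  also have "\<dots> < \<infinity>"
  proof -
    have "(\<lambda>n. (1/4::real) ^ n) sums (1 / (1 - 1/4))" by (rule geometric_sums) simp
    then have "(\<Sum>n. ennreal ((1/4) ^ n)) = ennreal (1 / (1 - 1/4))" by (intro suminf_ennreal_eq) auto
    then show ?thesis by (metis ennreal_less_top infinity_ennreal_def)
  qed
  finally have lt: "(\<integral>\<^sup>+x. (\<Sum>n. ennreal (4 ^ n * (norm (d n x))\<^sup>2)) \<partial>M) < \<infinity>" .
  have "(\<lambda>x. \<Sum>n. ennreal (4 ^ n * (norm (d n x))\<^sup>2)) \<in> borel_measurable M"
    by measurable
  from nn_integral_PInf_AE[OF this less_imp_neq[OF lt]]
  have fin: "AE x in M. (\<Sum>n. ennreal (4 ^ n * (norm (d n x))\<^sup>2)) \<noteq> \<infinity>" .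
  have conv: "AE x in M. convergent (\<lambda>n. b n x)"
    using fin
  proof eventually_elim
    case (elim x)
    define q where "q n = ennreal (4 ^ n * (norm (d n x))\<^sup>2)" for n
    define C where "C = enn2real (\<Sum>n. q n)"
    have C: "(\<Sum>n. q n) = ennreal C"
      unfolding C_def using elim unfolding q_def[symmetric] by (metis ennreal_enn2real infinity_ennreal_def less_top)
    have "C \<ge> 0" by (simp add: C_def)
    have "norm (d n x) \<le> sqrt C * (1/2) ^ n" for n
    proof -
      have "(\<Sum>i\<in>{n}. q i) \<le> (\<Sum>n. q n)"
        by (intro sum_le_suminf summableI) simp_all
      then have "q n \<le> ennreal C" unfolding C by simp
      then have "4 ^ n * (norm (d n x))\<^sup>2 \<le> C" using \<open>C \<ge> 0\<close> unfolding q_def by simp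
      then have "(2 ^ n * norm (d n x))\<^sup>2 \<le> C"
        using power_mult_distrib[of "2::real" 2 n] by (simp add: power_mult_distrib power2_eq_square mult_ac)
      then have "2 ^ n * norm (d n x) \<le> sqrt C" using real_le_rsqrt by blast
      then show ?thesis by (simp add: power_one_over pos_le_divide_eq mult.commute)
    qed
    moreover have "summable (\<lambda>n. sqrt C * (1/2) ^ n)" by (intro summable_mult summable_geometric) simp
    ultimately have "summable (\<lambda>n. d n x)"
      by (blast intro: summable_comparison_test'[where N=0])
    then have "summable (\<lambda>n. b (Suc n) x - b n x)" by (simp add: d_def)
    then show "convergent (\<lambda>n. b n x)"
    proof -
      assume s: "summable (\<lambda>n. b (Suc n) x - b n x)"
      have "(\<lambda>n. b n x - b 0 x) \<longlonglongrightarrow> suminf (\<lambda>n. b (Suc n) x - b n x)"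
        using summable_LIMSEQ[OF s] by (simp add: sum_lessThan_telescope[of "\<lambda>n. b n x"])
      from tendsto_add[OF this tendsto_const[of "b 0 x"]]
      have "(\<lambda>n. b n x) \<longlonglongrightarrow> suminf (\<lambda>n. b (Suc n) x - b n x) + b 0 x" by simp
      then show ?thesis by (auto simp: convergent_def)
    qed
  qed
  define u where "u x = lim (\<lambda>n. b n x)" for x
  have [measurable]: "u \<in> borel_measurable M" unfolding u_def by measurable
  have lim: "AE x in M. (\<lambda>n. b n x) \<longlonglongrightarrow> u x"
    using conv by eventually_elim (simp add: u_def convergent_LIMSEQ_iff)
  define D where "D n = (\<Sum>k. (1/2::real) ^ (n + k))" for n :: nat
  have step: "(\<integral>\<^sup>+x. ennreal ((norm (b (n + k) x - b n x))\<^sup>2) \<partial>M) \<le> ennreal (4 * (1/16) ^ n)" for n k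
  proof -
    \<comment> \<open>Iterating |x + y|^2 <= 2 |x|^2 + 2 |y|^2 costs weights 2^i, which 16^i
      outgrows; the estimate is therefore uniform in k.\<close>
    have sq: "(norm (\<Sum>i<k. d (n + i) x))\<^sup>2 \<le> 2 * (\<Sum>i<k. 2 ^ i * (norm (d (n + i) x))\<^sup>2)" for x n
    proof (induction k arbitrary: n)
      case (Suc k)
      have "(norm (\<Sum>i<Suc k. d (n + i) x))\<^sup>2 = (norm (d n x + (\<Sum>i<k. d (Suc n + i) x)))\<^sup>2"
        by (subst sum.lessThan_Suc_shift) simp
      also have "\<dots> \<le> 2 * (norm (d n x))\<^sup>2 + 2 * (norm (\<Sum>i<k. d (Suc n + i) x))\<^sup>2" by (rule sq_norm_add_le)
      also have "\<dots> \<le> 2 * (norm (d n x))\<^sup>2 + 2 * (2 * (\<Sum>i<k. 2 ^ i * (norm (d (Suc n + i) x))\<^sup>2))"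
        using Suc.IH[of "Suc n"] by simp
      also have "\<dots> = 2 * (\<Sum>i<Suc k. 2 ^ i * (norm (d (n + i) x))\<^sup>2)"
        by (subst sum.lessThan_Suc_shift) (simp add: sum_distrib_left mult.assoc)
      finally show ?case .
    qed simp
    have tel: "b (n + k) x - b n x = (\<Sum>i<k. d (n + i) x)" for x
      using sum_lessThan_telescope[of "\<lambda>i. b (n + i) x" k] by (simp add: d_def)
    have "(\<integral>\<^sup>+x. ennreal ((norm (b (n + k) x - b n x))\<^sup>2) \<partial>M)
        \<le> (\<integral>\<^sup>+x. ennreal (2 * (\<Sum>i<k. 2 ^ i * (norm (d (n + i) x))\<^sup>2)) \<partial>M)"
      unfolding tel by (intro nn_integral_mono ennreal_leI sq)
    also have "\<dots> = (\<integral>x. 2 * (\<Sum>i<k. 2 ^ i * (norm (d (n + i) x))\<^sup>2) \<partial>M)"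
      using dint by (subst nn_integral_eq_integral) (auto intro!: AE_I2 sum_nonneg)
    also have "(\<integral>x. 2 * (\<Sum>i<k. 2 ^ i * (norm (d (n + i) x))\<^sup>2) \<partial>M) = 2 * (\<Sum>i<k. 2 ^ i * (\<integral>x. (norm (d (n + i) x))\<^sup>2 \<partial>M))"
      using dint by (simp add: Bochner_Integration.integral_sum)
    also have "\<dots> \<le> 2 * (\<Sum>i<k. 2 ^ i * (1/16) ^ (n + i))"
      using fast by (intro mult_left_mono sum_mono) (auto simp: d_def)
    also have "\<dots> = 2 * (1/16) ^ n * (\<Sum>i<k. (1/8) ^ i)"
    proof -
      have "(2::real) ^ i * (1/16) ^ (n + i) = (1/16) ^ n * (1/8) ^ i" for i
        using power_mult_distrib[of "2::real" "1/16" i] by (simp add: power_add)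
      then show ?thesis by (simp add: sum_distrib_left mult.assoc)
    qed
    also have "\<dots> \<le> 2 * (1/16) ^ n * 2"
    proof (intro mult_left_mono)
      have "(\<Sum>i<k. (1/8::real) ^ i) = (1 - (1/8) ^ k) / (1 - 1/8)" by (simp add: sum_gp_strict)
      also have "\<dots> = 8/7 - 8/7 * (1/8) ^ k" by simp
      also have "\<dots> \<le> 2" using zero_le_power[of "1/8::real" k] by linarith
      finally show "(\<Sum>i<k. (1/8::real) ^ i) \<le> 2" .
    qed auto
    finally show ?thesis by (simp add: ennreal_leI)
  qed
  have lim2: "(\<integral>\<^sup>+x. ennreal ((norm (b n x - u x))\<^sup>2) \<partial>M) \<le> ennreal (4 * (1/16) ^ n)" for n
  proof -
    \<comment> \<open>Fatou's lemma lets k tend to infinity in the uniform estimate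
      \<open>step\<close>.\<close>
    have "(\<integral>\<^sup>+x. ennreal ((norm (b n x - u x))\<^sup>2) \<partial>M) = (\<integral>\<^sup>+x. liminf (\<lambda>k. ennreal ((norm (b (n + k) x - b n x))\<^sup>2)) \<partial>M)"
    proof (rule nn_integral_cong_AE, use lim in eventually_elim)
      case (elim x)
      have "(\<lambda>k. b (n + k) x) \<longlonglongrightarrow> u x" using LIMSEQ_ignore_initial_segment[OF elim, of n] by (simp add: add.commute)
      then have "(\<lambda>k. ennreal ((norm (b (n + k) x - b n x))\<^sup>2)) \<longlonglongrightarrow> ennreal ((norm (u x - b n x))\<^sup>2)"
        by (intro tendsto_intros)
      from lim_imp_Liminf[OF sequentially_bot this] show ?case
        by (simp only: norm_minus_commute[of "u x"])
    qed
    also have "\<dots> \<le> liminf (\<lambda>k. \<integral>\<^sup>+x. ennreal ((norm (b (n + k) x - b n x))\<^sup>2) \<partial>M)"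
      by (intro nn_integral_liminf) auto
    also have "\<dots> \<le> ennreal (4 * (1/16) ^ n)"
      by (rule order_trans[OF Liminf_le_Limsup Limsup_bounded]) (use step in auto)
    finally show ?thesis .
  qed
  have int2: "integrable M (\<lambda>x. (norm (b n x - u x))\<^sup>2)" for n
    by (rule integrableI_nonneg) (use lim2[of n] in \<open>auto simp: less_top intro: le_less_trans\<close>)
  have int3: "integrable M (\<lambda>x. (norm (u x))\<^sup>2)"
    using sq_integrable_add[of "b 0" M "\<lambda>x. - (b 0 x - u x)"] int int2 by (simp add: norm_minus_commute)
  have "(\<lambda>n. \<integral>x. (norm (b n x - u x))\<^sup>2 \<partial>M) \<longlonglongrightarrow> 0"
  proof (rule Lim_null_comparison)
    show "(\<lambda>n. 4 * (1/16::real) ^ n) \<longlonglongrightarrow> 0"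
      by (intro tendsto_mult_right_zero LIMSEQ_power_zero) simp
    show "\<forall>\<^sub>F n in sequentially. norm (\<integral>x. (norm (b n x - u x))\<^sup>2 \<partial>M) \<le> 4 * (1/16) ^ n"
      using lim2 nn_integral_eq_integral[OF int2] by (intro always_eventually allI) simp
  qed
  then show thesis by (intro that[of u] int3) auto
qed

text \<open>The maximiser of the strictly concave functional \<open>b \<mapsto> 2 \<ell> b - \<parallel>b\<parallel>\<^sup>2\<close> represents \<open>\<ell>\<close>.\<close>

lemma L2_representation:
  fixes V :: "('a \<Rightarrow> 'b::euclidean_space) set" and l :: "('a \<Rightarrow> 'b) \<Rightarrow> real"
  assumes meas: "\<And>b. b \<in> V \<Longrightarrow> b \<in> borel_measurable M"
    and int: "\<And>b. b \<in> V \<Longrightarrow> integrable M (\<lambda>x. (norm (b x))\<^sup>2)"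
    and V0: "(\<lambda>x. 0) \<in> V"
    and Vlin: "\<And>b c t. b \<in> V \<Longrightarrow> c \<in> V \<Longrightarrow> (\<lambda>x. b x + t *\<^sub>R c x) \<in> V"
    and llin: "\<And>b c t. b \<in> V \<Longrightarrow> c \<in> V \<Longrightarrow> l (\<lambda>x. b x + t *\<^sub>R c x) = l b + t * l c"
    and bound: "\<And>b. b \<in> V \<Longrightarrow> 2 * l b - (\<integral>x. (norm (b x))\<^sup>2 \<partial>M) \<le> C"
  obtains u where "u \<in> borel_measurable M" "integrable M (\<lambda>x. (norm (u x))\<^sup>2)"
    "(\<integral>x. (norm (u x))\<^sup>2 \<partial>M) \<le> C" "\<And>b. b \<in> V \<Longrightarrow> l b = (\<integral>x. u x \<bullet> b x \<partial>M)"
proof -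
  define J where "J b = 2 * l b - (\<integral>x. (norm (b x))\<^sup>2 \<partial>M)" for b
  define S where "S = (SUP b\<in>V. J b)"
  have bdd: "bdd_above (J ` V)" using bound unfolding J_def by (auto intro!: bdd_aboveI)
  have JS: "J b \<le> S" if "b \<in> V" for b unfolding S_def using bdd that by (intro cSUP_upper) auto
  have expand: "J (\<lambda>x. b x + t *\<^sub>R c x) = J b + 2 * t * (l c - (\<integral>x. b x \<bullet> c x \<partial>M)) - t\<^sup>2 * (\<integral>x. (norm (c x))\<^sup>2 \<partial>M)"
    if b: "b \<in> V" and c: "c \<in> V" for b c t
  proof -
    have i: "integrable M (\<lambda>x. b x \<bullet> c x)"
      by (rule sq_integrable_inner) (use that meas int in auto)
    have "(norm (b x + t *\<^sub>R c x))\<^sup>2 = (norm (b x))\<^sup>2 + 2 * t * (b x \<bullet> c x) + t\<^sup>2 * (norm (c x))\<^sup>2" for x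
      by (rule norm_add_scale_sq)
    then have "(\<integral>x. (norm (b x + t *\<^sub>R c x))\<^sup>2 \<partial>M) = (\<integral>x. (norm (b x))\<^sup>2 \<partial>M) + 2 * t * (\<integral>x. b x \<bullet> c x \<partial>M) + t\<^sup>2 * (\<integral>x. (norm (c x))\<^sup>2 \<partial>M)"
      using i int[OF b] int[OF c] by simp
    then show ?thesis unfolding J_def using llin[OF b c, of t] by (simp add: algebra_simps)
  qed
  \<comment> \<open>Strict concavity: J at the midpoint cannot exceed the supremum, which forces two
    near-maximisers to be close in L^2.\<close>
  have near: "(\<integral>x. (norm (c x - b x))\<^sup>2 \<partial>M) \<le> 4 * e"
    if b: "b \<in> V" and c: "c \<in> V" and "J b \<ge> S - e" "J c \<ge> S - e" for b c e
  proof -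
    have cb: "(\<lambda>x. c x + (-1) *\<^sub>R b x) \<in> V" using Vlin[OF c b] .
    define N where "N = (\<integral>x. (norm (c x + (-1) *\<^sub>R b x))\<^sup>2 \<partial>M)"
    define p where "p = l (\<lambda>x. c x + (-1) *\<^sub>R b x) - (\<integral>x. b x \<bullet> (c x + (-1) *\<^sub>R b x) \<partial>M)"
    have "J (\<lambda>x. b x + (1/2) *\<^sub>R (c x + (-1) *\<^sub>R b x)) \<le> S" using JS Vlin[OF b cb] by blast
    then have 1: "J b + p - N / 4 \<le> S" using expand[OF b cb, of "1/2"] unfolding N_def[symmetric] p_def[symmetric] by (simp add: power2_eq_square)
    have "(\<lambda>x. b x + 1 *\<^sub>R (c x + (-1) *\<^sub>R b x)) = c" by auto
    then have 2: "J c = J b + 2 * p - N" using expand[OF b cb, of 1] unfolding N_def[symmetric] p_def[symmetric] by simp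
    have "N \<le> 4 * e" using 1 2 that by linarith
    then show ?thesis by (simp add: N_def)
  qed
  \<comment> \<open>With the defect (1/16)^n / 4, \<open>near\<close> returns exactly the rate
    required by \<open>L2_fast_Cauchy_converges\<close>.\<close>
  have ex: "\<exists>b\<in>V. J b \<ge> S - (1/16) ^ n / 4" for n :: nat
  proof -
    have "S - (1/16) ^ n / 4 < S" by simp
    then obtain y where "y \<in> J ` V" "S - (1/16) ^ n / 4 < y"
      unfolding S_def using less_cSup_iff[OF _ bdd] V0 by blast
    then show ?thesis by (auto intro: less_imp_le)
  qed
  then obtain b where b: "\<And>n. b n \<in> V" "\<And>n. J (b n) \<ge> S - (1/16) ^ n / 4" by metis
  have fast: "(\<integral>x. (norm (b (Suc n) x - b n x))\<^sup>2 \<partial>M) \<le> (1/16) ^ n" for n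
  proof -
    have "J (b (Suc n)) \<ge> S - (1/16) ^ n / 4"
      using b(2)[of "Suc n"] power_decreasing[of n "Suc n" "1/16::real"] by linarith
    from near[OF b(1) b(1) b(2)[of n] this] show ?thesis by simp
  qed
  obtain u where u[measurable]: "u \<in> borel_measurable M" and ui: "integrable M (\<lambda>x. (norm (u x))\<^sup>2)"
    and lim: "(\<lambda>n. \<integral>x. (norm (b n x - u x))\<^sup>2 \<partial>M) \<longlonglongrightarrow> 0"
    using L2_fast_Cauchy_converges[OF meas[OF b(1)] int[OF b(1)] fast] by blast
  have bm[measurable]: "b n \<in> borel_measurable M" for n using meas b(1) by auto
  have bui: "integrable M (\<lambda>x. (norm (b n x - u x))\<^sup>2)" for n
    using sq_integrable_add[of "b n" M "\<lambda>x. - u x"] int[OF b(1)] ui by simp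
  have weak: "(\<lambda>n. \<integral>x. b n x \<bullet> c x \<partial>M) \<longlonglongrightarrow> (\<integral>x. u x \<bullet> c x \<partial>M)"
    if cm[measurable]: "c \<in> borel_measurable M" and ci: "integrable M (\<lambda>x. (norm (c x))\<^sup>2)" for c
  proof -
    let ?e = "\<lambda>n. \<integral>x. (norm (b n x - u x))\<^sup>2 \<partial>M" and ?c = "\<integral>x. (norm (c x))\<^sup>2 \<partial>M"
    have est: "\<bar>(\<integral>x. b n x \<bullet> c x \<partial>M) - (\<integral>x. u x \<bullet> c x \<partial>M)\<bar> \<le> sqrt (?e n) * sqrt ?c" for n
    proof -
      let ?i = "\<integral>x. (b n x - u x) \<bullet> c x \<partial>M"
      have i: "integrable M (\<lambda>x. (b n x - u x) \<bullet> c x)"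
        by (rule sq_integrable_inner) (use bui ci in auto)
      have "(\<integral>x. b n x \<bullet> c x \<partial>M) - (\<integral>x. u x \<bullet> c x \<partial>M) = ?i"
        using sq_integrable_inner[of "b n" M c] sq_integrable_inner[of u M c] int[OF b(1)] ui ci
        by (simp add: inner_diff_left)
      moreover
      have "?i\<^sup>2 \<le> ?e n * ?c"
      proof -
        have "0 \<le> ?e n + 2 * t * ?i + t\<^sup>2 * ?c" for t
        proof -
          have "(norm ((b n x - u x) + t *\<^sub>R c x))\<^sup>2 = (norm (b n x - u x))\<^sup>2 + 2 * t * ((b n x - u x) \<bullet> c x) + t\<^sup>2 * (norm (c x))\<^sup>2" for x
            by (rule norm_add_scale_sq)
          then have "(\<integral>x. (norm ((b n x - u x) + t *\<^sub>R c x))\<^sup>2 \<partial>M) = ?e n + 2 * t * ?i + t\<^sup>2 * ?c"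
            using i bui[of n] ci by simp
          moreover have "0 \<le> (\<integral>x. (norm ((b n x - u x) + t *\<^sub>R c x))\<^sup>2 \<partial>M)"
            by (intro integral_nonneg_AE AE_I2) simp
          ultimately show ?thesis by simp
        qed
        then show ?thesis by (rule discriminant_le) simp
      qed
      note le = this
      have "\<bar>?i\<bar> \<le> sqrt (?e n) * sqrt ?c"
        using real_sqrt_le_mono[OF le] unfolding real_sqrt_abs real_sqrt_mult .
      ultimately show ?thesis by simp
    qed
    have "(\<lambda>n. sqrt (?e n) * sqrt ?c) \<longlonglongrightarrow> sqrt 0 * sqrt ?c" by (intro tendsto_intros lim)
    then have z: "(\<lambda>n. sqrt (?e n) * sqrt ?c) \<longlonglongrightarrow> 0" by simp
    have "(\<lambda>n. (\<integral>x. b n x \<bullet> c x \<partial>M) - (\<integral>x. u x \<bullet> c x \<partial>M)) \<longlonglongrightarrow> 0"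
      by (rule Lim_null_comparison[OF always_eventually z]) (use est in simp)
    then show ?thesis by (simp add: LIM_zero_iff)
  qed
  \<comment> \<open>First-order optimality. The limit u may lie outside V, so the inequality J (b_n
    + t c) <= S is used for the approximations and passed to the limit; the discriminant with A = 0
    then kills the linear term.\<close>
  have rep: "l c = (\<integral>x. u x \<bullet> c x \<partial>M)" if c: "c \<in> V" for c
  proof (rule ccontr)
    let ?c = "\<integral>x. (norm (c x))\<^sup>2 \<partial>M" and ?p = "l c - (\<integral>x. u x \<bullet> c x \<partial>M)"
    assume ne: "l c \<noteq> (\<integral>x. u x \<bullet> c x \<partial>M)"
    have le: "2 * t * ?p - t\<^sup>2 * ?c \<le> 0" for t
    proof (rule LIMSEQ_le)
      show "(\<lambda>n. 2 * t * (l c - (\<integral>x. b n x \<bullet> c x \<partial>M)) - t\<^sup>2 * ?c) \<longlonglongrightarrow> 2 * t * ?p - t\<^sup>2 * ?c"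
        by (intro tendsto_intros weak meas int c)
      show "(\<lambda>n. (1/16::real) ^ n / 4) \<longlonglongrightarrow> 0"
        by (intro tendsto_divide_zero LIMSEQ_power_zero) simp
      show "\<exists>N. \<forall>n\<ge>N. 2 * t * (l c - (\<integral>x. b n x \<bullet> c x \<partial>M)) - t\<^sup>2 * ?c \<le> (1/16) ^ n / 4"
        using JS[OF Vlin[OF b(1) c]] expand[OF b(1) c] b(2) by (intro exI allI impI) (smt (verit))
    qed
    have "(- ?p)\<^sup>2 \<le> 0 * ?c"
      by (rule discriminant_le) (use le in \<open>auto simp: algebra_simps\<close>)
    with ne show False by simp
  qed
  \<comment> \<open>Since l b_n is the inner product of u and b_n, the squared norm of u equals J
    b_n plus the squared distance of b_n from u.\<close>
  have ub: "(\<integral>x. (norm (u x))\<^sup>2 \<partial>M) \<le> C + (\<integral>x. (norm (b n x - u x))\<^sup>2 \<partial>M)" for n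
  proof -
    have i: "integrable M (\<lambda>x. b n x \<bullet> u x)"
      by (rule sq_integrable_inner) (use int[OF b(1)] ui in auto)
    have "(norm (b n x - u x))\<^sup>2 = (norm (b n x))\<^sup>2 - 2 * (b n x \<bullet> u x) + (norm (u x))\<^sup>2" for x
      by (simp add: power2_norm_eq_inner algebra_simps inner_commute)
    then have "(\<integral>x. (norm (b n x - u x))\<^sup>2 \<partial>M) = (\<integral>x. (norm (b n x))\<^sup>2 \<partial>M) - 2 * (\<integral>x. b n x \<bullet> u x \<partial>M) + (\<integral>x. (norm (u x))\<^sup>2 \<partial>M)"
      using i int[OF b(1)] ui by simp
    moreover have "2 * (\<integral>x. b n x \<bullet> u x \<partial>M) - (\<integral>x. (norm (b n x))\<^sup>2 \<partial>M) \<le> C"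
      using bound[OF b(1)[of n]] rep[OF b(1)[of n]] by (simp add: inner_commute)
    ultimately show ?thesis by linarith
  qed
  have "(\<lambda>n. C + (\<integral>x. (norm (b n x - u x))\<^sup>2 \<partial>M)) \<longlonglongrightarrow> C + 0"
    by (intro tendsto_intros lim)
  then have lim': "(\<lambda>n. C + (\<integral>x. (norm (b n x - u x))\<^sup>2 \<partial>M)) \<longlonglongrightarrow> C" by simp
  have "(\<integral>x. (norm (u x))\<^sup>2 \<partial>M) \<le> C"
    by (rule LIMSEQ_le_const[OF lim']) (use ub in auto)
  with ui rep show thesis by (intro that[of u]) auto
qed

section \<open>Chain rule along the rotation flow\<close>

lemma AE_off_diagonal: "AE x in lborel. x \<in> off_diagonal"
proof -
  have "emeasure lborel (- off_diagonal) = (\<integral>\<^sup>+x. indicator (- off_diagonal) x \<partial>lborel)"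
    using open_off_diagonal by simp
  also have "\<dots> = (\<integral>\<^sup>+c. \<integral>\<^sup>+z. indicator (- off_diagonal) (c + (1/2) *\<^sub>R z, c - (1/2) *\<^sub>R (z::real^3)) \<partial>lborel \<partial>lborel)"
    using open_off_diagonal by (intro nn_integral_relative) simp
  also have "\<dots> = (\<integral>\<^sup>+(c::real^3). \<integral>\<^sup>+(z::real^3). 0 \<partial>lborel \<partial>lborel)"
  proof (rule nn_integral_cong)
    fix c :: "real^3"
    show "(\<integral>\<^sup>+z. indicator (- off_diagonal) (c + (1/2) *\<^sub>R z, c - (1/2) *\<^sub>R (z::real^3)) \<partial>lborel) = (\<integral>\<^sup>+(z::real^3). 0 \<partial>lborel)"
    proof (rule nn_integral_cong_AE, use AE_lborel_singleton[of 0] in eventually_elim)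
      case (elim z)
      have "c + (1/2) *\<^sub>R z - (c - (1/2) *\<^sub>R z) = z" by (simp add: vec_eq_iff)
      then have "(c + (1/2) *\<^sub>R z, c - (1/2) *\<^sub>R z) \<in> off_diagonal"
        using elim by (metis off_diagonal_iff fst_conv snd_conv)
      then show ?case by (simp add: indicator_def)
    qed
  qed
  finally have "emeasure lborel (- off_diagonal) = 0" by simp
  then have "- off_diagonal \<in> null_sets lborel" using open_off_diagonal by (auto intro!: null_setsI)
  then have "AE x in lborel. x \<notin> - off_diagonal" by (rule AE_not_in)
  then show ?thesis by simp
qed

lemma integrable_indicator_Icc: "integrable lborel (indicator {a..b::real} :: real \<Rightarrow> real)"
  by (rule integrable_real_indicator) (auto simp: emeasure_lborel_Icc_eq)

text \<open>The flow preserves measure, so all time slices of h have the same L^1 norm and the time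
  integral over a bounded interval is finite.\<close>

lemma flow_pair_integrable:
  assumes h: "integrable lborel (h :: (real^3) \<times> (real^3) \<Rightarrow> real)"
    and Y[measurable]: "Y \<in> borel_measurable borel" and bd: "\<And>x. \<bar>Y x\<bar> \<le> C"
  shows "integrable (lborel \<Otimes>\<^sub>M lborel) (\<lambda>(s, x). indicator {0..t} s * (h (flow j s x) * Y x))"
proof (rule lborel_pair.Fubini_integrable)
  have [measurable]: "h \<in> borel_measurable borel" using h by simp
  show "(\<lambda>(s, x). indicator {0..t} s * (h (flow j s x) * Y x)) \<in> borel_measurable (lborel \<Otimes>\<^sub>M lborel)"
    by measurable
  have i: "integrable lborel (\<lambda>x. h (flow j s x) * Y x)" for s
    by (rule Bochner_Integration.integrable_bound[of _ "\<lambda>x. C * h (flow j s x)"])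
      (use integrable_flow[OF h, of j s] bd in \<open>auto simp: abs_mult mult.commute[of "\<bar>h _\<bar>"] intro!: AE_I2 mult_right_mono order_trans[OF bd abs_ge_self]\<close>)
  then show "AE s in lborel. integrable lborel (\<lambda>x. case (s, x) of (s, x) \<Rightarrow> indicator {0..t} s * (h (flow j s x) * Y x))"
    by auto
  have C: "C \<ge> 0" using bd[of 0] by linarith
  show "integrable lborel (\<lambda>s. \<integral>x. norm (case (s, x) of (s, x) \<Rightarrow> indicator {0..t} s * (h (flow j s x) * Y x)) \<partial>lborel)"
  proof (rule Bochner_Integration.integrable_bound)
    show "integrable lborel (\<lambda>s. indicator {0..t} s * (C * (\<integral>x. \<bar>h x\<bar> \<partial>lborel)))"
      by (intro integrable_mult_left integrable_indicator_Icc)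
    show "AE s in lborel. norm (\<integral>x. norm (case (s, x) of (s, x) \<Rightarrow> indicator {0..t} s * (h (flow j s x) * Y x)) \<partial>lborel)
       \<le> norm (indicator {0..t} s * (C * (\<integral>x. \<bar>h x\<bar> \<partial>lborel)))"
    proof (rule AE_I2)
      fix s :: real
      have "(\<integral>x. norm (indicator {0..t} s * (h (flow j s x) * Y x)) \<partial>lborel) \<le> (\<integral>x. indicator {0..t} s * (C * \<bar>h (flow j s x)\<bar>) \<partial>lborel)"
      proof (rule integral_mono)
        show "integrable lborel (\<lambda>x. norm (indicator {0..t} s * (h (flow j s x) * Y x)))" using i[of s] by simp
        show "integrable lborel (\<lambda>x. indicator {0..t} s * (C * \<bar>h (flow j s x)\<bar>))" using integrable_flow[OF h, of j s] by simp
        show "norm (indicator {0..t} s * (h (flow j s x) * Y x)) \<le> indicator {0..t} s * (C * \<bar>h (flow j s x)\<bar>)" for x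
          using mult_right_mono[OF bd[of x] abs_ge_zero[of "h (flow j s x)"]] by (simp add: abs_mult indicator_def mult.commute)
      qed
      also have "\<dots> = indicator {0..t} s * (C * (\<integral>x. \<bar>h x\<bar> \<partial>lborel))"
        using integral_flow[of "\<lambda>x. \<bar>h x\<bar>" j s] by simp
      finally show "norm (\<integral>x. norm (case (s, x) of (s, x) \<Rightarrow> indicator {0..t} s * (h (flow j s x) * Y x)) \<partial>lborel)
       \<le> norm (indicator {0..t} s * (C * (\<integral>x. \<bar>h x\<bar> \<partial>lborel)))"
        using C by simp
    qed
  qed measurable
qed

lemma flow_average_integrable:
  assumes h: "integrable lborel (h :: (real^3) \<times> (real^3) \<Rightarrow> real)"
  shows "integrable lborel (\<lambda>x. \<integral>s. indicator {0..t} s * h (flow j s x) \<partial>lborel)"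
  using lborel_pair.integrable_snd[OF flow_pair_integrable[OF h, of "\<lambda>x. 1" 1 t j]] by simp

text \<open>Fubini and a measure preserving change of variables move the flow from h, which is
  merely integrable, to the bounded factor Y.\<close>

lemma flow_average:
  assumes h: "integrable lborel (h :: (real^3) \<times> (real^3) \<Rightarrow> real)"
    and Y[measurable]: "Y \<in> borel_measurable borel" and bd: "\<And>x. \<bar>Y x\<bar> \<le> C"
  shows "(\<integral>x. (\<integral>s. indicator {0..t} s * h (flow j s x) \<partial>lborel) * Y x \<partial>lborel)
       = (\<integral>s. indicator {0..t} s * (\<integral>x. h x * Y (flow j (- s) x) \<partial>lborel) \<partial>lborel)"
    "integrable lborel (\<lambda>s. indicator {0..t} s * (\<integral>x. h x * Y (flow j (- s) x) \<partial>lborel))"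
proof -
  have [measurable]: "h \<in> borel_measurable borel" using h by simp
  have pi: "integrable (lborel \<Otimes>\<^sub>M lborel) (\<lambda>(s, x). indicator {0..t} s * (h (flow j s x) * Y x))"
    by (rule flow_pair_integrable[OF h Y bd])
  have inner: "(\<integral>x. indicator {0..t} s * (h (flow j s x) * Y x) \<partial>lborel) = indicator {0..t} s * (\<integral>x. h x * Y (flow j (- s) x) \<partial>lborel)" for s
    using integral_flow[of "\<lambda>x. h (flow j s x) * Y x" j "- s"] by (simp add: flow_flow)
  have "(\<integral>x. (\<integral>s. indicator {0..t} s * h (flow j s x) \<partial>lborel) * Y x \<partial>lborel)
      = (\<integral>x. \<integral>s. indicator {0..t} s * (h (flow j s x) * Y x) \<partial>lborel \<partial>lborel)"
    by (simp flip: integral_mult_left_zero mult.assoc)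
  also have "\<dots> = (\<integral>s. \<integral>x. indicator {0..t} s * (h (flow j s x) * Y x) \<partial>lborel \<partial>lborel)"
    by (rule lborel_pair.Fubini_integral[OF pi])
  finally show "(\<integral>x. (\<integral>s. indicator {0..t} s * h (flow j s x) \<partial>lborel) * Y x \<partial>lborel)
       = (\<integral>s. indicator {0..t} s * (\<integral>x. h x * Y (flow j (- s) x) \<partial>lborel) \<partial>lborel)"
    unfolding inner .
  show "integrable lborel (\<lambda>s. indicator {0..t} s * (\<integral>x. h x * Y (flow j (- s) x) \<partial>lborel))"
    using lborel_pair.integrable_fst[OF pi] unfolding prod.case inner .
qed

lemma C1c_bounded:
  assumes "C1c \<Omega> \<psi>"
  obtains C where "C > 0" "\<And>x. \<bar>\<psi> x\<bar> \<le> C"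
proof -
  obtain K where "compact K" "\<And>x. x \<notin> K \<Longrightarrow> \<psi> x = 0" using C1c_support[OF assms] by metis
  then show thesis using compact_support_bounded[OF C1c_continuous[OF assms], of K] that by auto
qed

lemma rotD_bounded:
  assumes "C1c \<Omega> \<psi>"
  obtains C where "C > 0" "\<And>x. \<bar>rotD j \<psi> x\<bar> \<le> C"
proof -
  obtain K where "compact K" "\<And>x. x \<notin> K \<Longrightarrow> nabla \<psi> x = 0" using C1c_support[OF assms] by metis
  then show thesis using compact_support_bounded[OF continuous_on_rotD[OF assms], of K j] that
    by (auto simp: rotD_def)
qed

lemma rotD_measurable: "C1c \<Omega> \<psi> \<Longrightarrow> rotD j \<psi> \<in> borel_measurable borel"
  by (intro borel_measurable_continuous_onI continuous_on_rotD)

lemma integrable_mult_bounded: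
  fixes f g :: "'a \<Rightarrow> real"
  assumes "integrable M f" "g \<in> borel_measurable M" "\<And>x. \<bar>g x\<bar> \<le> C"
  shows "integrable M (\<lambda>x. f x * g x)"
proof (rule Bochner_Integration.integrable_bound[of _ "\<lambda>x. C * f x"])
  show "AE x in M. norm (f x * g x) \<le> norm (C * f x)"
  proof (rule AE_I2)
    fix x
    have "\<bar>g x\<bar> \<le> \<bar>C\<bar>" using assms(3)[of x] by linarith
    then show "norm (f x * g x) \<le> norm (C * f x)"
      using mult_right_mono[of "\<bar>g x\<bar>" "\<bar>C\<bar>" "\<bar>f x\<bar>"] by (simp add: abs_mult mult.commute)
  qed
qed (use assms in auto)

text \<open>A weak derivative is integrated in time by duality. The fundamental theorem of calculus
  is applied to the test function along the backward flow, where it is classical, and the weak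
  identity is used for the test function composed with the flow, which is again a test
  function.\<close>

lemma flow_difference:
  fixes G h :: "(real^3) \<times> (real^3) \<Rightarrow> real"
  assumes G: "integrable lborel G" and h: "integrable lborel h"
    and weak: "\<And>\<psi>. C1c off_diagonal \<psi> \<Longrightarrow> (\<integral>x. G x * rotD j \<psi> x \<partial>lborel) = - (\<integral>x. h x * \<psi> x \<partial>lborel)"
    and t: "0 \<le> t"
  shows "AE x in lborel. G (flow j t x) - G x = (\<integral>s. indicator {0..t} s * h (flow j s x) \<partial>lborel)"
proof -
  have [measurable]: "G \<in> borel_measurable borel" "h \<in> borel_measurable borel" using G h by auto
  define H where "H x = (\<integral>s. indicator {0..t} s * h (flow j s x) \<partial>lborel)" for x
  have Hi: "integrable lborel H" unfolding H_def by (rule flow_average_integrable[OF h])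
  have Di: "integrable lborel (\<lambda>x. G (flow j t x) - G x - H x)"
    using G Hi integrable_flow[OF G] by simp
  have "AE x in lborel. x \<in> off_diagonal \<longrightarrow> G (flow j t x) - G x - H x = 0"
  proof (rule fundamental_lemma[OF open_off_diagonal])
    show "set_integrable lborel (cbox a b) (\<lambda>x. G (flow j t x) - G x - H x)" for a b
      using integrable_mult_indicator[OF _ Di, of "cbox a b"] by (simp add: set_integrable_def)
    fix \<psi> :: "(real^3) \<times> (real^3) \<Rightarrow> real" assume "test_function off_diagonal \<psi>"
    then have \<psi>: "C1c off_diagonal \<psi>" by (rule test_function_C1c)
    note [measurable] = C1c_measurable[OF \<psi>] rotD_measurable[OF \<psi>, of j]
    obtain C where C: "\<And>x. \<bar>\<psi> x\<bar> \<le> C" using C1c_bounded[OF \<psi>] by metis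
    obtain C' where C': "\<And>x. \<bar>rotD j \<psi> x\<bar> \<le> C'" using rotD_bounded[OF \<psi>] by metis
    have mG: "integrable lborel (\<lambda>x. G x * \<psi> (flow j s x))" for s
      by (rule integrable_mult_bounded[OF G, of _ C]) (use C in auto)
    have "(\<integral>x. G (flow j t x) * \<psi> x \<partial>lborel) = (\<integral>x. G x * \<psi> (flow j (- t) x) \<partial>lborel)"
      using integral_flow[of "\<lambda>x. G (flow j t x) * \<psi> x" j "- t"] by (simp add: flow_flow)
    moreover have "(\<integral>x. G x * \<psi> (flow j (- t) x) \<partial>lborel) - (\<integral>x. G x * \<psi> x \<partial>lborel) = (\<integral>x. H x * \<psi> x \<partial>lborel)"
    proof -
      have ftc: "\<psi> (flow j (- t) x) - \<psi> x = - (\<integral>s. indicator {0..t} s * rotD j \<psi> (flow j (- s) x) \<partial>lborel)" for x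
      proof -
        have "(\<integral>s. indicator {0..t} s *\<^sub>R - rotD j \<psi> (flow j (- s) x) \<partial>lborel) = \<psi> (flow j (- t) x) - \<psi> (flow j (- 0) x)"
        proof (rule integral_FTC_Icc[OF t])
          fix s :: real
          have "((\<lambda>s. \<psi> (flow j (- s) x)) has_real_derivative rotD j \<psi> (flow j (- s) x) * (- 1)) (at s)"
            by (rule DERIV_chain'[OF _ flow_DERIV[OF \<psi>]]) (auto intro!: derivative_eq_intros)
          then show "((\<lambda>s. \<psi> (flow j (- s) x)) has_vector_derivative - rotD j \<psi> (flow j (- s) x)) (at s within {0..t})"
            by (simp add: has_real_derivative_iff_has_vector_derivative has_vector_derivative_at_within)
          have "continuous_on UNIV (\<lambda>s. flow j (- s) x)"
          proof -
            have "continuous_on UNIV (\<lambda>s::real. (- s, x))" by (intro continuous_intros)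
            from continuous_on_compose2[OF continuous_on_flow this] show ?thesis by simp
          qed
          then show "continuous_on {0..t} (\<lambda>s. - rotD j \<psi> (flow j (- s) x))"
            by (intro continuous_intros continuous_on_compose2[OF continuous_on_rotD[OF \<psi>]]) (auto intro: continuous_on_subset)
        qed
        then show ?thesis by simp
      qed
      define R where "R x = (\<integral>s. indicator {0..t} s * rotD j \<psi> (flow j (- s) x) \<partial>lborel)" for x
      have pi: "integrable (lborel \<Otimes>\<^sub>M lborel) (\<lambda>(s, x). indicator {0..t} s * (G x * rotD j \<psi> (flow j (- s) x)))"
      proof (rule Bochner_Integration.integrable_bound)
        show "integrable (lborel \<Otimes>\<^sub>M lborel) (\<lambda>(s, x). indicator {0..t} s * (\<bar>G (flow j 0 x)\<bar> * C'))"
        proof (rule lborel_pair.Fubini_integrable)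
          show "integrable lborel (\<lambda>s. \<integral>x. norm (case (s, x) of (s, x) \<Rightarrow> indicator {0..t} s * (\<bar>G (flow j 0 x)\<bar> * C')) \<partial>lborel)"
            using integrable_indicator_Icc by (simp add: abs_mult)
        qed (use G in \<open>auto intro!: AE_I2\<close>)
        show "AE x in lborel \<Otimes>\<^sub>M lborel. norm (case x of (s, x) \<Rightarrow> indicator {0..t} s * (G x * rotD j \<psi> (flow j (- s) x)))
            \<le> norm (case x of (s, x) \<Rightarrow> indicator {0..t} s * (\<bar>G (flow j 0 x)\<bar> * C'))"
        proof (rule AE_I2)
          fix p :: "real \<times> (real^3) \<times> (real^3)"
          have "\<bar>rotD j \<psi> (flow j (- fst p) (snd p))\<bar> \<le> \<bar>C'\<bar>" by (rule order_trans[OF C' abs_ge_self])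
          then show "norm (case p of (s, x) \<Rightarrow> indicator {0..t} s * (G x * rotD j \<psi> (flow j (- s) x)))
            \<le> norm (case p of (s, x) \<Rightarrow> indicator {0..t} s * (\<bar>G (flow j 0 x)\<bar> * C'))"
            by (cases p) (simp add: abs_mult indicator_def mult_left_mono)
        qed
      qed measurable
      have "(\<integral>x. G x * \<psi> (flow j (- t) x) \<partial>lborel) - (\<integral>x. G x * \<psi> x \<partial>lborel) = (\<integral>x. G x * (\<psi> (flow j (- t) x) - \<psi> x) \<partial>lborel)"
        using mG[of "- t"] mG[of 0] by (simp add: right_diff_distrib)
      also have "\<dots> = - (\<integral>x. \<integral>s. indicator {0..t} s * (G x * rotD j \<psi> (flow j (- s) x)) \<partial>lborel \<partial>lborel)"
        unfolding ftc by (simp add: mult.left_commute flip: integral_mult_right_zero)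
      also have "(\<integral>x. \<integral>s. indicator {0..t} s * (G x * rotD j \<psi> (flow j (- s) x)) \<partial>lborel \<partial>lborel)
          = (\<integral>s. \<integral>x. indicator {0..t} s * (G x * rotD j \<psi> (flow j (- s) x)) \<partial>lborel \<partial>lborel)"
        by (rule lborel_pair.Fubini_integral[OF pi])
      also have "\<dots> = (\<integral>s. indicator {0..t} s * (- (\<integral>x. h x * \<psi> (flow j (- s) x) \<partial>lborel)) \<partial>lborel)"
      proof -
        have "(\<integral>x. G x * rotD j \<psi> (flow j s x) \<partial>lborel) = - (\<integral>x. h x * \<psi> (flow j s x) \<partial>lborel)" for s
          using weak[OF flow_C1c(1)[OF \<psi>, of j s]] by (simp add: flow_C1c(2)[OF \<psi>])
        then show ?thesis by simp
      qed
      also have "\<dots> = - (\<integral>x. H x * \<psi> x \<partial>lborel)"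
        using flow_average(1)[OF h C1c_measurable[OF \<psi>] C, of t j] by (simp add: H_def)
      finally show ?thesis by simp
    qed
    moreover have "integrable lborel (\<lambda>x. H x * \<psi> x)" "integrable lborel (\<lambda>x. G (flow j t x) * \<psi> x)"
      by (rule integrable_mult_bounded[of _ _ _ C], use C Hi integrable_flow[OF G] in auto)+
    ultimately show "(\<integral>x. (G (flow j t x) - G x - H x) * \<psi> x \<partial>lborel) = 0"
      using mG[of 0] by (simp add: left_diff_distrib)
  qed
  with AE_off_diagonal show ?thesis unfolding H_def by eventually_elim simp
qed

text \<open>The modulus of the time integral in \<open>flow_difference\<close> is integrated over
  the space; negative times reduce to positive ones because the flow preserves measure.\<close>

lemma flow_L1_continuity:
  fixes G h :: "(real^3) \<times> (real^3) \<Rightarrow> real"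
  assumes G: "integrable lborel G" and h: "integrable lborel h"
    and weak: "\<And>\<psi>. C1c off_diagonal \<psi> \<Longrightarrow> (\<integral>x. G x * rotD j \<psi> x \<partial>lborel) = - (\<integral>x. h x * \<psi> x \<partial>lborel)"
  shows "(\<integral>x. \<bar>G (flow j t x) - G x\<bar> \<partial>lborel) \<le> \<bar>t\<bar> * (\<integral>x. \<bar>h x\<bar> \<partial>lborel)"
proof -
  have [measurable]: "G \<in> borel_measurable borel" "h \<in> borel_measurable borel" using G h by auto
  have pos: "(\<integral>x. \<bar>G (flow j t x) - G x\<bar> \<partial>lborel) \<le> t * (\<integral>x. \<bar>h x\<bar> \<partial>lborel)" if t: "0 \<le> t" for t
  proof -
    have ah: "integrable lborel (\<lambda>x. \<bar>h x\<bar>)" using h by simp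
    have "(\<integral>x. \<bar>G (flow j t x) - G x\<bar> \<partial>lborel) \<le> (\<integral>x. \<integral>s. indicator {0..t} s * \<bar>h (flow j s x)\<bar> \<partial>lborel \<partial>lborel)"
    proof (rule integral_mono_AE)
      show "integrable lborel (\<lambda>x. \<bar>G (flow j t x) - G x\<bar>)" using G integrable_flow[OF G] by simp
      show "integrable lborel (\<lambda>x. \<integral>s. indicator {0..t} s * \<bar>h (flow j s x)\<bar> \<partial>lborel)"
        by (rule flow_average_integrable[OF ah])
      show "AE x in lborel. \<bar>G (flow j t x) - G x\<bar> \<le> (\<integral>s. indicator {0..t} s * \<bar>h (flow j s x)\<bar> \<partial>lborel)"
      proof (rule AE_mp[OF flow_difference[OF G h _ t, of j]], rule weak, assumption, rule AE_I2, rule impI)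
        fix x assume elim: "G (flow j t x) - G x = (\<integral>s. indicator {0..t} s * h (flow j s x) \<partial>lborel)"
        have "\<bar>\<integral>s. indicator {0..t} s * h (flow j s x) \<partial>lborel\<bar> \<le> (\<integral>s. \<bar>indicator {0..t} s * h (flow j s x)\<bar> \<partial>lborel)"
          by (rule integral_abs_bound)
        then show "\<bar>G (flow j t x) - G x\<bar> \<le> (\<integral>s. indicator {0..t} s * \<bar>h (flow j s x)\<bar> \<partial>lborel)"
          unfolding elim by (simp add: abs_mult)
      qed
    qed
    also have "\<dots> = (\<integral>s. indicator {0..t} s * (\<integral>x. \<bar>h x\<bar> \<partial>lborel) \<partial>lborel)"
      using flow_average(1)[OF ah, of "\<lambda>x. 1" 1 t j] by simp
    also have "\<dots> = t * (\<integral>x. \<bar>h x\<bar> \<partial>lborel)" using t by simp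
    finally show ?thesis .
  qed
  show ?thesis
  proof (cases "0 \<le> t")
    case False
    have "(\<integral>x. \<bar>G (flow j t x) - G x\<bar> \<partial>lborel) = (\<integral>x. \<bar>G x - G (flow j (- t) x)\<bar> \<partial>lborel)"
      using integral_flow[of "\<lambda>x. \<bar>G (flow j t x) - G x\<bar>" j "- t"] by (simp add: flow_flow)
    with pos[of "- t"] False show ?thesis by (simp add: abs_minus_commute)
  qed (use pos[of t] in simp)
qed

lemma integral_tail_small:
  fixes h :: "'a \<Rightarrow> real"
  assumes h: "integrable M h" and e: "0 < e"
  obtains m where "m > 0" "(\<integral>x. \<bar>h x\<bar> * indicator {x. \<bar>h x\<bar> > m} x \<partial>M) < e"
proof -
  have [measurable]: "h \<in> borel_measurable M" using h by simp
  have "(\<lambda>n. \<integral>x. \<bar>h x\<bar> * (if \<bar>h x\<bar> > real (Suc n) then 1 else 0) \<partial>M) \<longlonglongrightarrow> (\<integral>x. 0 \<partial>M)"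
  proof (rule integral_dominated_convergence[where w="\<lambda>x. \<bar>h x\<bar>"])
    show "AE x in M. (\<lambda>n. \<bar>h x\<bar> * (if \<bar>h x\<bar> > real (Suc n) then 1 else 0)) \<longlonglongrightarrow> 0"
    proof (intro AE_I2 tendsto_eventually)
      fix x
      obtain N where N: "\<bar>h x\<bar> < real N" using reals_Archimedean2 by blast
      show "\<forall>\<^sub>F n in sequentially. \<bar>h x\<bar> * (if \<bar>h x\<bar> > real (Suc n) then 1 else 0) = 0"
        using eventually_ge_at_top[of N] by eventually_elim (use N in auto)
    qed
  qed (use h in auto)
  then have "\<forall>\<^sub>F n in sequentially. (\<integral>x. \<bar>h x\<bar> * (if \<bar>h x\<bar> > real (Suc n) then 1 else 0) \<partial>M) < e"
    using e by (intro order_tendstoD(2)[where y=0]) auto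
  then obtain n where "(\<integral>x. \<bar>h x\<bar> * (if \<bar>h x\<bar> > real (Suc n) then 1 else 0) \<partial>M) < e"
    using eventually_happens by fastforce
  then show thesis by (intro that[of "real (Suc n)"]) (auto simp: indicator_def of_bool_def)
qed

text \<open>The difference quotient of x -> sqrt (x + \<delta>), in the form that stays meaningful
  for a = b, where it is the derivative.\<close>

definition sqrt_quot :: "real \<Rightarrow> real \<Rightarrow> real \<Rightarrow> real" where
  "sqrt_quot \<delta> a b = 1 / (sqrt (a + \<delta>) + sqrt (b + \<delta>))"

lemma sqrt_quot_bounds:
  assumes "0 < \<delta>" "0 \<le> a" "0 \<le> b"
  shows "0 \<le> sqrt_quot \<delta> a b" "sqrt_quot \<delta> a b \<le> 1 / (2 * sqrt \<delta>)"
    "sqrt (b + \<delta>) - sqrt (a + \<delta>) = (b - a) * sqrt_quot \<delta> a b"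
proof -
  have s: "sqrt \<delta> \<le> sqrt (a + \<delta>)" "sqrt \<delta> \<le> sqrt (b + \<delta>)" "0 < sqrt \<delta>" using assms by auto
  then have S: "2 * sqrt \<delta> \<le> sqrt (a + \<delta>) + sqrt (b + \<delta>)" "0 < sqrt (a + \<delta>) + sqrt (b + \<delta>)" by linarith+
  show "0 \<le> sqrt_quot \<delta> a b" using S(2) unfolding sqrt_quot_def by (intro divide_nonneg_nonneg) linarith+
  show "sqrt_quot \<delta> a b \<le> 1 / (2 * sqrt \<delta>)"
    unfolding sqrt_quot_def by (rule divide_left_mono[OF S(1) zero_le_one mult_pos_pos]) (use S(2) s(3) in linarith)+
  have "(sqrt (b + \<delta>) - sqrt (a + \<delta>)) * (sqrt (a + \<delta>) + sqrt (b + \<delta>)) = (sqrt (b + \<delta>))\<^sup>2 - (sqrt (a + \<delta>))\<^sup>2"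
    by (simp add: power2_eq_square algebra_simps)
  also have "\<dots> = b - a" using assms by simp
  finally show "sqrt (b + \<delta>) - sqrt (a + \<delta>) = (b - a) * sqrt_quot \<delta> a b"
    using S(2) unfolding sqrt_quot_def by (metis less_irrefl mult.right_neutral nonzero_eq_divide_eq times_divide_eq_right)
qed

text \<open>Each root has Lipschitz constant 1 / (2 sqrt \<delta>), and the common denominator is at
  least 4 \<delta>.\<close>

lemma sqrt_quot_lipschitz:
  assumes \<delta>: "0 < \<delta>" and nn: "0 \<le> a" "0 \<le> b" "0 \<le> c"
  shows "\<bar>sqrt_quot \<delta> a b - sqrt_quot \<delta> c c\<bar> \<le> (\<bar>a - c\<bar> + \<bar>b - c\<bar>) / (8 * \<delta> * sqrt \<delta>)"
proof -
  define A B D where "A = sqrt (a + \<delta>)" and "B = sqrt (b + \<delta>)" and "D = sqrt (c + \<delta>)"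
  have s: "sqrt \<delta> \<le> A" "sqrt \<delta> \<le> B" "sqrt \<delta> \<le> D" "0 < sqrt \<delta>" using assms by (auto simp: A_def B_def D_def)
  have l: "\<bar>A - D\<bar> \<le> \<bar>a - c\<bar> / (2 * sqrt \<delta>)" "\<bar>B - D\<bar> \<le> \<bar>b - c\<bar> / (2 * sqrt \<delta>)"
  proof -
    have "\<bar>sqrt (x + \<delta>) - sqrt (c + \<delta>)\<bar> \<le> \<bar>x - c\<bar> / (2 * sqrt \<delta>)" if "0 \<le> x" for x
      unfolding sqrt_quot_bounds(3)[OF \<delta> nn(3) that] abs_mult
      using mult_left_mono[OF sqrt_quot_bounds(2)[OF \<delta> nn(3) that], of "\<bar>x - c\<bar>"] sqrt_quot_bounds(1)[OF \<delta> nn(3) that] by simp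
    then show "\<bar>A - D\<bar> \<le> \<bar>a - c\<bar> / (2 * sqrt \<delta>)" "\<bar>B - D\<bar> \<le> \<bar>b - c\<bar> / (2 * sqrt \<delta>)"
      using nn by (auto simp: A_def B_def D_def)
  qed
  have AB: "A + B > 0" "D + D > 0" using s by linarith+
  have "sqrt_quot \<delta> a b - sqrt_quot \<delta> c c = ((D - A) + (D - B)) / ((A + B) * (D + D))"
    using AB unfolding sqrt_quot_def A_def[symmetric] B_def[symmetric] D_def[symmetric]
    by (simp add: divide_simps; simp add: algebra_simps)
  then have "\<bar>sqrt_quot \<delta> a b - sqrt_quot \<delta> c c\<bar> = \<bar>(D - A) + (D - B)\<bar> / ((A + B) * (D + D))"
    using AB by (simp add: abs_mult)
  also have "\<dots> \<le> (\<bar>a - c\<bar> / (2 * sqrt \<delta>) + \<bar>b - c\<bar> / (2 * sqrt \<delta>)) / ((sqrt \<delta> + sqrt \<delta>) * (sqrt \<delta> + sqrt \<delta>))"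
    using l s less_imp_le[OF AB(1)] by (intro frac_le mult_mono mult_pos_pos) auto
  also have "\<dots> = (\<bar>a - c\<bar> + \<bar>b - c\<bar>) / (8 * \<delta> * sqrt \<delta>)"
    using \<delta> by (simp add: field_simps)
  finally show ?thesis .
qed


text \<open>The difference quotient of the regularised root along the flow, tested against \<psi>,
  is computed twice. Moved onto \<psi> it tends to minus the rotational derivative. Kept on the root
  it factors into the increment of G, an average of h along the flow, times
  \<open>sqrt_quot\<close>, which tends to the derivative of the root.\<close>

lemma chain_rule_regularised:
  fixes G h :: "(real^3) \<times> (real^3) \<Rightarrow> real"
  assumes G: "integrable lborel G" and Gnn: "\<And>x. 0 \<le> G x" and h: "integrable lborel h"
    and weak: "\<And>\<psi>. C1c off_diagonal \<psi> \<Longrightarrow> (\<integral>x. G x * rotD j \<psi> x \<partial>lborel) = - (\<integral>x. h x * \<psi> x \<partial>lborel)"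
    and \<psi>: "C1c off_diagonal \<psi>" and \<delta>: "0 < \<delta>"
  shows "(\<integral>x. (sqrt (G x + \<delta>) - sqrt \<delta>) * rotD j \<psi> x \<partial>lborel)
       = - (\<integral>x. h x * (sqrt_quot \<delta> (G x) (G x) * \<psi> x) \<partial>lborel)"
proof -
  have [measurable]: "G \<in> borel_measurable borel" "h \<in> borel_measurable borel" using G h by auto
  note [measurable] = C1c_measurable[OF \<psi>] rotD_measurable[OF \<psi>, of j]
  obtain C where C: "0 < C" "\<And>x. \<bar>\<psi> x\<bar> \<le> C" using C1c_bounded[OF \<psi>] by metis
  obtain C' where C': "0 < C'" "\<And>x. \<bar>rotD j \<psi> x\<bar> \<le> C'" using rotD_bounded[OF \<psi>] by metis
  have lip: "\<bar>\<psi> (flow j (- s) x) - \<psi> x\<bar> \<le> C' * \<bar>s\<bar>" for s x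
  proof -
    have "norm (\<psi> (flow j (- s) x) - \<psi> (flow j 0 x)) \<le> C' * norm (- s - 0)"
      by (rule field_differentiable_bound[where S=UNIV and f="\<lambda>t. \<psi> (flow j t x)" and f'="\<lambda>t. rotD j \<psi> (flow j t x)"])
        (use flow_DERIV[OF \<psi>] C' in auto)
    then show ?thesis by simp
  qed
  \<comment> \<open>Subtracting sqrt \<delta> bounds this by a multiple of G and so makes it
    integrable over the whole space.\<close>
  define \<Phi> where "\<Phi> x = sqrt (G x + \<delta>) - sqrt \<delta>" for x
  define q where "q = sqrt_quot \<delta>"
  define c1 where "c1 = 1 / (2 * sqrt \<delta>)"
  define c2 where "c2 = 1 / (8 * \<delta> * sqrt \<delta>)"
  have c12: "0 < c1" "0 < c2" using \<delta> by (auto simp: c1_def c2_def)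
  have q_bd: "0 \<le> q (G x) (G y)" "q (G x) (G y) \<le> c1" for x y
    unfolding q_def c1_def using sqrt_quot_bounds(1,2)[OF \<delta> Gnn Gnn] by auto
  have q_lip: "\<bar>q (G x) (G y) - q (G z) (G z)\<bar> \<le> c2 * (\<bar>G x - G z\<bar> + \<bar>G y - G z\<bar>)" for x y z
    unfolding q_def c2_def using sqrt_quot_lipschitz[OF \<delta> Gnn Gnn Gnn, of x y z] by simp
  have [measurable]: "(\<lambda>x. q (f x) (g x)) \<in> borel_measurable M"
    if "f \<in> borel_measurable M" "g \<in> borel_measurable M" for f g and M :: "((real^3) \<times> (real^3)) measure"
    using that unfolding q_def sqrt_quot_def by measurable
  have [measurable]: "\<Phi> \<in> borel_measurable borel" unfolding \<Phi>_def by measurable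
  have \<Phi>_int: "integrable lborel \<Phi>"
  proof (rule Bochner_Integration.integrable_bound[of _ "\<lambda>x. c1 * G x"])
    show "AE x in lborel. norm (\<Phi> x) \<le> norm (c1 * G x)"
    proof (rule AE_I2)
      fix x
      have "\<Phi> x = G x * sqrt_quot \<delta> 0 (G x)"
        using sqrt_quot_bounds(3)[OF \<delta> order_refl Gnn[of x]] by (simp add: \<Phi>_def)
      moreover have "sqrt_quot \<delta> 0 (G x) \<le> c1"
        using sqrt_quot_bounds(2)[OF \<delta> order_refl Gnn[of x]] by (simp add: c1_def)
      ultimately show "norm (\<Phi> x) \<le> norm (c1 * G x)"
        using sqrt_quot_bounds(1,2)[OF \<delta> order_refl Gnn[of x]] Gnn[of x] c12 mult_left_mono[of "sqrt_quot \<delta> 0 (G x)" c1 "G x"]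
        by (simp add: mult.commute)
    qed
  qed (use G in auto)
  define I where "I t = (\<integral>x. \<Phi> x * ((\<psi> (flow j (- t) x) - \<psi> x) / t) \<partial>lborel)" for t
  define L where "L = (\<integral>x. h x * (q (G x) (G x) * \<psi> x) \<partial>lborel)"
  have lim1: "(\<lambda>n. I (1 / real (Suc n))) \<longlonglongrightarrow> (\<integral>x. \<Phi> x * (- rotD j \<psi> x) \<partial>lborel)"
    unfolding I_def
  proof (rule integral_dominated_convergence[where w="\<lambda>x. C' * \<bar>\<Phi> x\<bar>"])
    show "AE x in lborel. (\<lambda>n. \<Phi> x * ((\<psi> (flow j (- (1 / real (Suc n))) x) - \<psi> x) / (1 / real (Suc n)))) \<longlonglongrightarrow> \<Phi> x * - rotD j \<psi> x"
    proof (intro AE_I2 tendsto_mult tendsto_const)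
      fix x
      have "((\<lambda>s. \<psi> (flow j (- s) x)) has_real_derivative rotD j \<psi> (flow j (- 0) x) * (- 1)) (at 0)"
        by (rule DERIV_chain'[OF _ flow_DERIV[OF \<psi>]]) (auto intro!: derivative_eq_intros)
      then have "((\<lambda>s. (\<psi> (flow j (- s) x) - \<psi> x) / s) \<longlongrightarrow> - rotD j \<psi> x) (at 0)"
        by (simp add: has_field_derivative_iff)
      moreover have "filterlim (\<lambda>n. 1 / real (Suc n)) (at 0) sequentially"
        using LIMSEQ_inverse_real_of_nat by (auto simp: filterlim_at inverse_eq_divide)
      ultimately show "(\<lambda>n. (\<psi> (flow j (- (1 / real (Suc n))) x) - \<psi> x) / (1 / real (Suc n))) \<longlonglongrightarrow> - rotD j \<psi> x"
        by (rule filterlim_compose)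
    qed
    show "AE x in lborel. norm (\<Phi> x * ((\<psi> (flow j (- (1 / real (Suc n))) x) - \<psi> x) / (1 / real (Suc n)))) \<le> C' * \<bar>\<Phi> x\<bar>" for n
    proof (rule AE_I2)
      fix x
      have "\<bar>(\<psi> (flow j (- (1 / real (Suc n))) x) - \<psi> x) / (1 / real (Suc n))\<bar> \<le> C'"
      proof -
        define t where "t = 1 / real (Suc n)"
        have "0 < t" by (simp add: t_def)
        then show ?thesis using lip[of t x] unfolding t_def[symmetric] by (simp add: abs_divide pos_divide_le_eq)
      qed
      then show "norm (\<Phi> x * ((\<psi> (flow j (- (1 / real (Suc n))) x) - \<psi> x) / (1 / real (Suc n)))) \<le> C' * \<bar>\<Phi> x\<bar>"
        by (simp only: real_norm_def abs_mult mult.commute[of C'] mult_left_mono abs_ge_zero)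
    qed
  qed (use \<Phi>_int in auto)
  have \<Phi>\<psi>: "integrable lborel (\<lambda>x. \<Phi> x * \<psi> (flow j s x))" for s
    by (rule integrable_mult_bounded[OF \<Phi>_int, of _ C]) (use C in auto)
  \<comment> \<open>The increment of the root is the increment of G times the quotient. After
    \<open>flow_average\<close> the flow acts on the bounded factor only and h appears
    unshifted.\<close>
  have I2: "I t = (\<integral>s. indicator {0..t} s * (\<integral>x. h x * (q (G (flow j (- s) x)) (G (flow j (t - s) x)) * \<psi> (flow j (- s) x)) \<partial>lborel) \<partial>lborel) / t"
    "integrable lborel (\<lambda>s. indicator {0..t} s * (\<integral>x. h x * (q (G (flow j (- s) x)) (G (flow j (t - s) x)) * \<psi> (flow j (- s) x)) \<partial>lborel))"
    if t: "0 < t" for t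
  proof -
    define Y where "Y x = q (G x) (G (flow j t x)) * \<psi> x" for x
    have Ym: "Y \<in> borel_measurable borel" unfolding Y_def by measurable
    have Yb: "\<bar>Y x\<bar> \<le> c1 * C" for x
      unfolding Y_def abs_mult using q_bd[of x "flow j t x"] C(2)[of x] c12 C(1) by (intro mult_mono) auto
    have "I t = (\<integral>x. \<Phi> x * \<psi> (flow j (- t) x) - \<Phi> x * \<psi> x \<partial>lborel) / t"
      unfolding I_def by (simp add: right_diff_distrib diff_divide_distrib flip: integral_divide_zero)
    also have "(\<integral>x. \<Phi> x * \<psi> (flow j (- t) x) - \<Phi> x * \<psi> x \<partial>lborel) = (\<integral>x. \<Phi> x * \<psi> (flow j (- t) x) \<partial>lborel) - (\<integral>x. \<Phi> x * \<psi> x \<partial>lborel)"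
      using \<Phi>\<psi>[of "- t"] \<Phi>\<psi>[of 0] by simp
    also have "(\<integral>x. \<Phi> x * \<psi> (flow j (- t) x) \<partial>lborel) = (\<integral>x. \<Phi> (flow j t x) * \<psi> x \<partial>lborel)"
      using integral_flow[of "\<lambda>x. \<Phi> (flow j t x) * \<psi> x" j "- t"] by (simp add: flow_flow)
    also have "(\<integral>x. \<Phi> (flow j t x) * \<psi> x \<partial>lborel) - (\<integral>x. \<Phi> x * \<psi> x \<partial>lborel) = (\<integral>x. \<Phi> (flow j t x) * \<psi> x - \<Phi> x * \<psi> x \<partial>lborel)"
      using \<Phi>\<psi>[of 0] integrable_mult_bounded[OF integrable_flow[OF \<Phi>_int], of \<psi> C j t] C by simp
    also have "\<dots> = (\<integral>x. (\<integral>s. indicator {0..t} s * h (flow j s x) \<partial>lborel) * Y x \<partial>lborel)"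
    proof (rule integral_cong_AE)
      show "(\<lambda>x. \<Phi> (flow j t x) * \<psi> x - \<Phi> x * \<psi> x) \<in> borel_measurable lborel"
        "(\<lambda>x. (\<integral>s. indicator {0..t} s * h (flow j s x) \<partial>lborel) * Y x) \<in> borel_measurable lborel"
        using Ym by measurable
      show "AE x in lborel. \<Phi> (flow j t x) * \<psi> x - \<Phi> x * \<psi> x = (\<integral>s. indicator {0..t} s * h (flow j s x) \<partial>lborel) * Y x"
      proof (rule AE_mp[OF flow_difference[OF G h _ less_imp_le[OF t], of j]], rule weak, assumption, rule AE_I2, rule impI)
        fix x assume elim: "G (flow j t x) - G x = (\<integral>s. indicator {0..t} s * h (flow j s x) \<partial>lborel)"
        show "\<Phi> (flow j t x) * \<psi> x - \<Phi> x * \<psi> x = (\<integral>s. indicator {0..t} s * h (flow j s x) \<partial>lborel) * Y x"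
        proof -
          have "\<Phi> (flow j t x) * \<psi> x - \<Phi> x * \<psi> x = (sqrt (G (flow j t x) + \<delta>) - sqrt (G x + \<delta>)) * \<psi> x"
            by (simp add: \<Phi>_def algebra_simps)
          also have "\<dots> = (G (flow j t x) - G x) * Y x"
            unfolding sqrt_quot_bounds(3)[OF \<delta> Gnn[of x] Gnn[of "flow j t x"]] Y_def q_def by (rule mult.assoc)
          finally show ?thesis unfolding elim .
        qed
      qed
    qed
    also have "\<dots> = (\<integral>s. indicator {0..t} s * (\<integral>x. h x * Y (flow j (- s) x) \<partial>lborel) \<partial>lborel)"
      by (rule flow_average(1)[OF h Ym Yb])
    finally show "I t = (\<integral>s. indicator {0..t} s * (\<integral>x. h x * (q (G (flow j (- s) x)) (G (flow j (t - s) x)) * \<psi> (flow j (- s) x)) \<partial>lborel) \<partial>lborel) / t"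
      by (simp add: Y_def flow_flow)
    show "integrable lborel (\<lambda>s. indicator {0..t} s * (\<integral>x. h x * (q (G (flow j (- s) x)) (G (flow j (t - s) x)) * \<psi> (flow j (- s) x)) \<partial>lborel))"
      using flow_average(2)[OF h Ym Yb, of t j] by (simp add: Y_def flow_flow)
  qed
  define N where "N = (\<integral>x. \<bar>h x\<bar> \<partial>lborel)"
  have N: "0 \<le> N" unfolding N_def by simp
  \<comment> \<open>The quotient is controlled in L^1 while h is merely integrable, so their product
    is split at |h| = m. Below this level the Lipschitz bound and the L^1 continuity of G along the
    flow apply; above it the quotient is only bounded, and T measures the tail of h. The last term
    is the displacement of \<psi>.\<close>
  have close: "\<bar>(\<integral>x. h x * (q (G (flow j (- s) x)) (G (flow j (t - s) x)) * \<psi> (flow j (- s) x)) \<partial>lborel) - L\<bar>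
      \<le> m * c2 * C * (2 * t * N) + 2 * c1 * C * T + c1 * C' * t * N"
    if s: "0 \<le> s" "s \<le> t" and m: "0 < m" and T: "T = (\<integral>x. \<bar>h x\<bar> * indicator {x. \<bar>h x\<bar> > m} x \<partial>lborel)" for s t m T
  proof -
    let ?a = "\<lambda>x. q (G (flow j (- s) x)) (G (flow j (t - s) x))" and ?b = "\<lambda>x. q (G x) (G x)"
    let ?D = "\<lambda>x. \<bar>G (flow j (- s) x) - G x\<bar> + \<bar>G (flow j (t - s) x) - G x\<bar>"
    let ?T = "\<lambda>x. \<bar>h x\<bar> * indicator {x. \<bar>h x\<bar> > m} x"
    have Gi: "integrable lborel (\<lambda>x. \<bar>G (flow j r x) - G x\<bar>)" for r using G integrable_flow[OF G] by simp
    have Ti: "integrable lborel ?T"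
      by (rule Bochner_Integration.integrable_bound[OF h]) (auto simp: indicator_def)
    have ab1: "\<bar>?a x * \<psi> (flow j (- s) x)\<bar> \<le> c1 * C" for x
      unfolding abs_mult using q_bd[of "flow j (- s) x" "flow j (t - s) x"] C c12 by (intro mult_mono) auto
    have ab2: "\<bar>?b x * \<psi> x\<bar> \<le> c1 * C" for x
      unfolding abs_mult using q_bd[of x x] C c12 by (intro mult_mono) auto
    have i1: "integrable lborel (\<lambda>x. h x * (?a x * \<psi> (flow j (- s) x)))"
      by (rule integrable_mult_bounded[OF h _ ab1]) measurable
    have i2: "integrable lborel (\<lambda>x. h x * (?b x * \<psi> x))"
      by (rule integrable_mult_bounded[OF h _ ab2]) measurable
    have pt: "\<bar>h x * (?a x * \<psi> (flow j (- s) x)) - h x * (?b x * \<psi> x)\<bar> \<le> m * c2 * C * ?D x + 2 * c1 * C * ?T x + c1 * C' * t * \<bar>h x\<bar>" for x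
    proof -
      have e: "?a x * \<psi> (flow j (- s) x) - ?b x * \<psi> x = (?a x - ?b x) * \<psi> (flow j (- s) x) + ?b x * (\<psi> (flow j (- s) x) - \<psi> x)"
        by (simp add: algebra_simps)
      have D0: "0 \<le> ?D x" by simp
      have p1: "\<bar>h x\<bar> * \<bar>(?a x - ?b x) * \<psi> (flow j (- s) x)\<bar> \<le> m * c2 * C * ?D x + 2 * c1 * C * ?T x"
      proof (cases "\<bar>h x\<bar> > m")
        case True
        have "\<bar>?a x - ?b x\<bar> \<le> 2 * c1" using q_bd[of "flow j (- s) x" "flow j (t - s) x"] q_bd[of x x] by linarith
        then have "\<bar>(?a x - ?b x) * \<psi> (flow j (- s) x)\<bar> \<le> 2 * c1 * C"
          unfolding abs_mult using C c12 by (intro mult_mono) auto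
        then have "\<bar>h x\<bar> * \<bar>(?a x - ?b x) * \<psi> (flow j (- s) x)\<bar> \<le> \<bar>h x\<bar> * (2 * c1 * C)" by (intro mult_left_mono) auto
        moreover have "0 \<le> m * c2 * C * ?D x" using m c12 C D0 by (intro mult_nonneg_nonneg) auto
        ultimately show ?thesis using True by (simp add: mult_ac)
      next
        case False
        have "\<bar>(?a x - ?b x) * \<psi> (flow j (- s) x)\<bar> \<le> (c2 * ?D x) * C"
          unfolding abs_mult using q_lip[of "flow j (- s) x" "flow j (t - s) x" x] C c12 D0 by (intro mult_mono mult_nonneg_nonneg) auto
        then have "\<bar>h x\<bar> * \<bar>(?a x - ?b x) * \<psi> (flow j (- s) x)\<bar> \<le> m * ((c2 * ?D x) * C)"
          using False m by (intro mult_mono) auto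
        then show ?thesis using False by (simp add: mult_ac)
      qed
      have "\<bar>?b x * (\<psi> (flow j (- s) x) - \<psi> x)\<bar> \<le> c1 * (C' * t)"
        unfolding abs_mult using q_bd[of x x] lip[of s x] s c12 C' 
        by (intro mult_mono) (auto intro: order_trans[OF lip] mult_left_mono)
      then have p2: "\<bar>h x\<bar> * \<bar>?b x * (\<psi> (flow j (- s) x) - \<psi> x)\<bar> \<le> c1 * C' * t * \<bar>h x\<bar>"
        using mult_left_mono[of "\<bar>?b x * (\<psi> (flow j (- s) x) - \<psi> x)\<bar>" "c1 * (C' * t)" "\<bar>h x\<bar>"] by (simp add: mult_ac)
      have "\<bar>h x * (?a x * \<psi> (flow j (- s) x)) - h x * (?b x * \<psi> x)\<bar> = \<bar>h x\<bar> * \<bar>?a x * \<psi> (flow j (- s) x) - ?b x * \<psi> x\<bar>"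
        by (simp flip: abs_mult right_diff_distrib)
      also have "\<dots> \<le> \<bar>h x\<bar> * (\<bar>(?a x - ?b x) * \<psi> (flow j (- s) x)\<bar> + \<bar>?b x * (\<psi> (flow j (- s) x) - \<psi> x)\<bar>)"
        unfolding e by (intro mult_left_mono abs_triangle_ineq) auto
      finally show ?thesis using p1 p2 by (simp add: distrib_left)
    qed
    have "(\<integral>x. h x * (?a x * \<psi> (flow j (- s) x)) \<partial>lborel) - L = (\<integral>x. h x * (?a x * \<psi> (flow j (- s) x)) - h x * (?b x * \<psi> x) \<partial>lborel)"
      unfolding L_def using i1 i2 by simp
    then have "\<bar>(\<integral>x. h x * (?a x * \<psi> (flow j (- s) x)) \<partial>lborel) - L\<bar> \<le> (\<integral>x. \<bar>h x * (?a x * \<psi> (flow j (- s) x)) - h x * (?b x * \<psi> x)\<bar> \<partial>lborel)"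
      by (simp only: integral_abs_bound)
    also have "\<dots> \<le> (\<integral>x. m * c2 * C * ?D x + 2 * c1 * C * ?T x + c1 * C' * t * \<bar>h x\<bar> \<partial>lborel)"
      by (rule integral_mono) (use i1 i2 Gi Ti h pt in auto)
    also have "\<dots> = m * c2 * C * ((\<integral>x. \<bar>G (flow j (- s) x) - G x\<bar> \<partial>lborel) + (\<integral>x. \<bar>G (flow j (t - s) x) - G x\<bar> \<partial>lborel)) + 2 * c1 * C * T + c1 * C' * t * N"
      using Gi Ti h unfolding T N_def by simp
    also have "\<dots> \<le> m * c2 * C * (2 * t * N) + 2 * c1 * C * T + c1 * C' * t * N"
    proof -
      have "(\<integral>x. \<bar>G (flow j (- s) x) - G x\<bar> \<partial>lborel) \<le> \<bar>- s\<bar> * N" "(\<integral>x. \<bar>G (flow j (t - s) x) - G x\<bar> \<partial>lborel) \<le> \<bar>t - s\<bar> * N"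
        unfolding N_def by (rule flow_L1_continuity[OF G h]; erule weak)+
      moreover have "\<bar>- s\<bar> * N \<le> t * N" "\<bar>t - s\<bar> * N \<le> t * N" using s N by (auto intro!: mult_right_mono)
      ultimately have "(\<integral>x. \<bar>G (flow j (- s) x) - G x\<bar> \<partial>lborel) + (\<integral>x. \<bar>G (flow j (t - s) x) - G x\<bar> \<partial>lborel) \<le> 2 * t * N"
        by linarith
      then show ?thesis using m c12 C(1) by (intro add_right_mono mult_left_mono mult_nonneg_nonneg) auto
    qed
    finally show ?thesis .
  qed
  have lim2: "(\<lambda>n. I (1 / real (Suc n))) \<longlonglongrightarrow> L"
  proof (rule LIMSEQ_I)
    fix e :: real assume e: "0 < e"
    \<comment> \<open>This makes the tail contribution 2 c1 C T smaller than e / 2. The other two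
      terms are linear in t.\<close>
    obtain m where m: "m > 0" and T: "(\<integral>x. \<bar>h x\<bar> * indicator {x. \<bar>h x\<bar> > m} x \<partial>lborel) < e / (4 * c1 * C)"
    proof -
      have "0 < e / (4 * c1 * C)" using e c12 C(1) by simp
      from integral_tail_small[OF h this] show thesis using that by blast
    qed
    define T where "T = (\<integral>x. \<bar>h x\<bar> * indicator {x. \<bar>h x\<bar> > m} x \<partial>lborel)"
    define A where "A = m * c2 * C * (2 * N) + c1 * C' * N"
    have A: "0 \<le> A" unfolding A_def using m c12 C C' N by (intro add_nonneg_nonneg mult_nonneg_nonneg) auto
    obtain n0 where n0: "2 * (A + 1) / e < real n0" using reals_Archimedean2 by blast
    have "norm (I (1 / real (Suc n)) - L) < e" if "n \<ge> n0" for n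
    proof -
      define t where "t = 1 / real (Suc n)"
      have t: "0 < t" unfolding t_def by simp
      have At: "A * t < e / 2"
      proof -
        have "2 * (A + 1) / e < real (Suc n)" using n0 that by linarith
        then have "2 * (A + 1) < real (Suc n) * e" using e by (simp add: pos_divide_less_eq)
        then have "2 * A * t < e" unfolding t_def using e by (simp add: pos_divide_less_eq mult.commute)
        then show ?thesis by simp
      qed
      define J where "J s = (\<integral>x. h x * (q (G (flow j (- s) x)) (G (flow j (t - s) x)) * \<psi> (flow j (- s) x)) \<partial>lborel)" for s
      have Ji: "integrable lborel (\<lambda>s. indicator {0..t} s * J s)" using I2(2)[OF t] by (simp add: J_def)
      have I: "I t = (\<integral>s. indicator {0..t} s * J s \<partial>lborel) / t" using I2(1)[OF t] by (simp add: J_def)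
      have Lt: "L = (\<integral>s. indicator {0..t} s * L \<partial>lborel) / t" using t by simp
      define E where "E = A * t + 2 * c1 * C * T"
      have bd: "\<bar>J s - L\<bar> \<le> E" if "s \<in> {0..t}" for s
        using close[of s t m T] that m unfolding J_def T_def A_def E_def by (simp add: algebra_simps)
      have "I t - L = (\<integral>s. indicator {0..t} s * J s - indicator {0..t} s * L \<partial>lborel) / t"
        using I Lt Ji integrable_indicator_Icc[of 0 t] by (simp add: diff_divide_distrib)
      also have "\<bar>\<dots>\<bar> \<le> (\<integral>s. indicator {0..t} s * E \<partial>lborel) / t"
        unfolding abs_divide using t
      proof (simp only: abs_of_pos, intro divide_right_mono order_trans[OF integral_abs_bound] integral_mono)
        show "integrable lborel (\<lambda>s. \<bar>indicator {0..t} s * J s - indicator {0..t} s * L\<bar>)"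
          using Ji integrable_indicator_Icc[of 0 t] by simp
        show "integrable lborel (\<lambda>s. indicator {0..t} s * E)" using integrable_indicator_Icc[of 0 t] by simp
        show "\<bar>indicator {0..t} s * J s - indicator {0..t} s * L\<bar> \<le> indicator {0..t} s * E" for s
          using bd[of s] by (simp add: indicator_def)
      qed simp
      also have "\<dots> = E" using t by simp
      also have "E < e"
      proof -
        have "2 * c1 * C * T < 2 * c1 * C * (e / (4 * c1 * C))"
          using T c12 C unfolding T_def by (intro mult_strict_left_mono) auto
        also have "\<dots> = e / 2" using c12 C by (simp add: field_simps)
        finally show ?thesis using At unfolding E_def by linarith
      qed
      finally show ?thesis unfolding t_def by simp
    qed
    then show "\<exists>n0. \<forall>n\<ge>n0. norm (I (1 / real (Suc n)) - L) < e" by blast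
  qed
  have "(\<integral>x. \<Phi> x * (- rotD j \<psi> x) \<partial>lborel) = L" by (rule LIMSEQ_unique[OF lim1 lim2])
  then show ?thesis unfolding L_def \<Phi>_def q_def by simp
qed

text \<open>The limit of vanishing regularisation. The factor sqrt G / sqrt (G + \<delta>) is at
  most 1 and tends to 1 where G > 0. Where G = 0 it stays 0, which is the right limit because w
  vanishes there.\<close>

lemma chain_rule_sqrt:
  fixes G w :: "(real^3) \<times> (real^3) \<Rightarrow> real"
  assumes G: "integrable lborel G" and Gnn: "\<And>x. 0 \<le> G x" and w[measurable]: "w \<in> borel_measurable borel"
    and w0: "\<And>x. G x = 0 \<Longrightarrow> w x = 0"
    and h: "integrable lborel (\<lambda>x. 2 * sqrt (G x) * w x)"
    and weak: "\<And>\<psi>. C1c off_diagonal \<psi> \<Longrightarrow> (\<integral>x. G x * rotD j \<psi> x \<partial>lborel) = - (\<integral>x. 2 * sqrt (G x) * w x * \<psi> x \<partial>lborel)"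
    and \<psi>: "C1c off_diagonal \<psi>" and w\<psi>: "integrable lborel (\<lambda>x. w x * \<psi> x)"
  shows "(\<integral>x. sqrt (G x) * rotD j \<psi> x \<partial>lborel) = - (\<integral>x. w x * \<psi> x \<partial>lborel)"
proof -
  have [measurable]: "G \<in> borel_measurable borel" using G by auto
  note [measurable] = C1c_measurable[OF \<psi>] rotD_measurable[OF \<psi>, of j]
  obtain C' where C': "0 < C'" "\<And>x. \<bar>rotD j \<psi> x\<bar> \<le> C'" using rotD_bounded[OF \<psi>] by metis
  obtain K where K: "compact K" "\<And>x. x \<notin> K \<Longrightarrow> nabla \<psi> x = 0" using C1c_support[OF \<psi>] by metis
  have Kb: "K \<in> sets borel" using K(1) by (simp add: compact_imp_closed)
  let ?\<delta> = "\<lambda>n. 1 / real (Suc n)"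
  have d0: "?\<delta> \<longlonglongrightarrow> 0" using LIMSEQ_inverse_real_of_nat by (simp add: inverse_eq_divide)
  \<comment> \<open>The root of an integrable function may fail to be integrable at infinity; on the
    compact support of the derivative sqrt G <= 1 + G is enough.\<close>
  have dom: "integrable lborel (\<lambda>x. sqrt (G x) * rotD j \<psi> x)"
  proof (rule Bochner_Integration.integrable_bound)
    show "integrable lborel (\<lambda>x. C' * (indicator K x + G x))"
      using G emeasure_bounded_finite[OF compact_imp_bounded[OF K(1)]] Kb
      by (intro integrable_mult_right integrable_add integrable_real_indicator) auto
    show "AE x in lborel. norm (sqrt (G x) * rotD j \<psi> x) \<le> norm (C' * (indicator K x + G x))"
    proof (rule AE_I2)
      fix x
      show "norm (sqrt (G x) * rotD j \<psi> x) \<le> norm (C' * (indicator K x + G x))"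
      proof (cases "x \<in> K")
        case True
        have "sqrt (G x) \<le> 1 + G x"
          using Gnn[of x] by (intro real_le_lsqrt) (auto simp: power2_eq_square algebra_simps)
        then have "\<bar>rotD j \<psi> x\<bar> * sqrt (G x) \<le> C' * (1 + G x)" using C' Gnn[of x] by (intro mult_mono) auto
        then show ?thesis using True Gnn[of x] C'(1) by (simp add: abs_mult mult.commute)
      qed (use K Gnn in \<open>simp add: rotD_def\<close>)
    qed
  qed measurable
  have 1: "(\<lambda>n. \<integral>x. (sqrt (G x + ?\<delta> n) - sqrt (?\<delta> n)) * rotD j \<psi> x \<partial>lborel) \<longlonglongrightarrow> (\<integral>x. sqrt (G x) * rotD j \<psi> x \<partial>lborel)"
  proof (rule integral_dominated_convergence[where w="\<lambda>x. \<bar>sqrt (G x) * rotD j \<psi> x\<bar>"])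
    show "AE x in lborel. (\<lambda>n. (sqrt (G x + ?\<delta> n) - sqrt (?\<delta> n)) * rotD j \<psi> x) \<longlonglongrightarrow> sqrt (G x) * rotD j \<psi> x"
    proof (rule AE_I2)
      fix x
      have "(\<lambda>n. (sqrt (G x + ?\<delta> n) - sqrt (?\<delta> n)) * rotD j \<psi> x) \<longlonglongrightarrow> (sqrt (G x + 0) - sqrt 0) * rotD j \<psi> x"
        by (intro tendsto_intros d0)
      then show "(\<lambda>n. (sqrt (G x + ?\<delta> n) - sqrt (?\<delta> n)) * rotD j \<psi> x) \<longlonglongrightarrow> sqrt (G x) * rotD j \<psi> x" by simp
    qed
    show "AE x in lborel. norm ((sqrt (G x + ?\<delta> n) - sqrt (?\<delta> n)) * rotD j \<psi> x) \<le> \<bar>sqrt (G x) * rotD j \<psi> x\<bar>" for n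
    proof (rule AE_I2)
      fix x
      have "sqrt (G x + ?\<delta> n) \<le> sqrt (G x) + sqrt (?\<delta> n)" using Gnn[of x] by (intro sqrt_add_le_add_sqrt) auto
      moreover have "sqrt (?\<delta> n) \<le> sqrt (G x + ?\<delta> n)" using Gnn[of x] by simp
      ultimately have "\<bar>sqrt (G x + ?\<delta> n) - sqrt (?\<delta> n)\<bar> \<le> \<bar>sqrt (G x)\<bar>" using Gnn[of x] by simp
      then show "norm ((sqrt (G x + ?\<delta> n) - sqrt (?\<delta> n)) * rotD j \<psi> x) \<le> \<bar>sqrt (G x) * rotD j \<psi> x\<bar>"
        unfolding real_norm_def abs_mult by (intro mult_right_mono) auto
    qed
  qed (use dom in auto)
  have 2: "(\<lambda>n. \<integral>x. 2 * sqrt (G x) * w x * (sqrt_quot (?\<delta> n) (G x) (G x) * \<psi> x) \<partial>lborel) \<longlonglongrightarrow> (\<integral>x. w x * \<psi> x \<partial>lborel)"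
  proof (rule integral_dominated_convergence[where w="\<lambda>x. \<bar>w x * \<psi> x\<bar>"])
    have e: "2 * sqrt (G x) * w x * (sqrt_quot d (G x) (G x) * \<psi> x) = sqrt (G x) / sqrt (G x + d) * (w x * \<psi> x)" if "0 < d" for d x
      using Gnn[of x] that by (simp add: sqrt_quot_def field_simps)
    show "AE x in lborel. (\<lambda>n. 2 * sqrt (G x) * w x * (sqrt_quot (?\<delta> n) (G x) (G x) * \<psi> x)) \<longlonglongrightarrow> w x * \<psi> x"
    proof (rule AE_I2)
      fix x
      show "(\<lambda>n. 2 * sqrt (G x) * w x * (sqrt_quot (?\<delta> n) (G x) (G x) * \<psi> x)) \<longlonglongrightarrow> w x * \<psi> x"
      proof (cases "G x = 0")
        case False
        then have "G x > 0" using Gnn[of x] by simp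
        then have "(\<lambda>n. sqrt (G x) / sqrt (G x + ?\<delta> n) * (w x * \<psi> x)) \<longlonglongrightarrow> sqrt (G x) / sqrt (G x + 0) * (w x * \<psi> x)"
          by (intro tendsto_intros d0) auto
        then show ?thesis using \<open>G x > 0\<close> by (subst e) auto
      qed (simp add: w0)
    qed
    show "AE x in lborel. norm (2 * sqrt (G x) * w x * (sqrt_quot (?\<delta> n) (G x) (G x) * \<psi> x)) \<le> \<bar>w x * \<psi> x\<bar>" for n
    proof (rule AE_I2)
      fix x
      have p: "0 < G x + ?\<delta> n" using Gnn[of x] by (intro add_nonneg_pos) auto
      then have "\<bar>sqrt (G x) / sqrt (G x + ?\<delta> n)\<bar> \<le> 1" using Gnn[of x] by (simp add: divide_le_eq_1_pos)
      then have "\<bar>sqrt (G x) / sqrt (G x + ?\<delta> n)\<bar> * \<bar>w x * \<psi> x\<bar> \<le> 1 * \<bar>w x * \<psi> x\<bar>" by (intro mult_right_mono) auto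
      then show "norm (2 * sqrt (G x) * w x * (sqrt_quot (?\<delta> n) (G x) (G x) * \<psi> x)) \<le> \<bar>w x * \<psi> x\<bar>"
        by (subst e) (simp_all add: abs_mult)
    qed
    show "(\<lambda>x. 2 * sqrt (G x) * w x * (sqrt_quot (?\<delta> n) (G x) (G x) * \<psi> x)) \<in> borel_measurable lborel" for n
      unfolding sqrt_quot_def by measurable
  qed (use w\<psi> in auto)
  have "(\<integral>x. (sqrt (G x + ?\<delta> n) - sqrt (?\<delta> n)) * rotD j \<psi> x \<partial>lborel) = - (\<integral>x. 2 * sqrt (G x) * w x * (sqrt_quot (?\<delta> n) (G x) (G x) * \<psi> x) \<partial>lborel)" for n
    by (rule chain_rule_regularised[OF G Gnn h _ \<psi>]) (auto intro: weak)
  with 1 tendsto_minus[OF 2] show ?thesis using LIMSEQ_unique by auto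
qed

section \<open>Lower bound by a linear functional of the tensorised density\<close>

definition post :: "(real^3) \<times> (real^3) \<Rightarrow> real^3 \<Rightarrow> (real^3) \<times> (real^3)" where
  "post x \<sigma> = (post_v (fst x) (snd x) \<sigma>, post_w (fst x) (snd x) \<sigma>)"

lemma rel_post: "rel (post x \<sigma>) = norm (rel x) *\<^sub>R \<sigma>"
  by (simp add: post_def post_v_def post_w_def algebra_simps flip: scaleR_left.add)

lemma post_relative:
  "post (c + (1/2) *\<^sub>R z, c - (1/2) *\<^sub>R z) \<sigma> = (c + (1/2) *\<^sub>R (norm z *\<^sub>R \<sigma>), c - (1/2) *\<^sub>R (norm z *\<^sub>R \<sigma>))"
proof -
  have 1: "c + (1/2) *\<^sub>R z - (c - (1/2) *\<^sub>R z) = z" by (simp add: vec_eq_iff)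
  have 2: "(1/2) *\<^sub>R (c + (1/2) *\<^sub>R z + (c - (1/2) *\<^sub>R z)) = c" by (simp add: vec_eq_iff)
  show ?thesis unfolding post_def post_v_def post_w_def fst_conv snd_conv 1 2 by simp
qed

lemma measurable_fst_borel[measurable (raw)]:
  fixes f :: "'a \<Rightarrow> 'b::topological_space \<times> 'c::topological_space"
  assumes "f \<in> borel_measurable M" shows "(\<lambda>x. fst (f x)) \<in> borel_measurable M"
  using measurable_compose[OF assms borel_measurable_continuous_onI[OF continuous_on_fst[OF continuous_on_id]]] by simp

lemma measurable_snd_borel[measurable (raw)]:
  fixes f :: "'a \<Rightarrow> 'b::topological_space \<times> 'c::topological_space"
  assumes "f \<in> borel_measurable M" shows "(\<lambda>x. snd (f x)) \<in> borel_measurable M"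
  using measurable_compose[OF assms borel_measurable_continuous_onI[OF continuous_on_snd[OF continuous_on_id]]] by simp

lemma measurable_post[measurable (raw)]:
  assumes "f \<in> borel_measurable M" "g \<in> borel_measurable M"
  shows "(\<lambda>x. post (f x) (g x)) \<in> borel_measurable M"
proof -
  have "continuous_on UNIV (\<lambda>p. post (fst p) (snd p))"
    unfolding post_def post_v_def post_w_def by (intro continuous_intros) simp_all
  from measurable_compose[OF borel_measurable_Pair[OF assms] borel_measurable_continuous_onI[OF this]]
  show ?thesis by simp
qed

text \<open>Invariance of dv dw d\<sigma> under exchanging the states before and after the
  collision: at fixed centre of mass it is \<open>nn_integral_sphere_swap\<close>.\<close>

lemma nn_integral_post_swap:
  fixes H :: "(real^3) \<times> (real^3) \<Rightarrow> (real^3) \<times> (real^3) \<Rightarrow> ennreal"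
  assumes H: "(\<lambda>p. H (fst p) (snd p)) \<in> borel_measurable (borel :: (((real^3) \<times> (real^3)) \<times> ((real^3) \<times> (real^3))) measure)"
  shows "(\<integral>\<^sup>+x. \<integral>\<^sup>+\<sigma>. H x (post x \<sigma>) \<partial>sphere_measure \<partial>lborel) = (\<integral>\<^sup>+x. \<integral>\<^sup>+\<sigma>. H (post x \<sigma>) x \<partial>sphere_measure \<partial>lborel)"
proof -
  have Hm[measurable (raw)]: "(\<lambda>x. H (f x) (g x)) \<in> borel_measurable M"
    if "f \<in> borel_measurable M" "g \<in> borel_measurable M" for f g and M :: "'z measure"
    using measurable_compose[OF borel_measurable_Pair[OF that] H] by simp
  let ?p = "\<lambda>c z. (c + (1/2) *\<^sub>R z, c - (1/2) *\<^sub>R z)"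
  have "(\<integral>\<^sup>+x. \<integral>\<^sup>+\<sigma>. H x (post x \<sigma>) \<partial>sphere_measure \<partial>lborel)
      = (\<integral>\<^sup>+c. \<integral>\<^sup>+z. \<integral>\<^sup>+\<sigma>. H (?p c z) (?p c (norm z *\<^sub>R \<sigma>)) \<partial>sphere_measure \<partial>lborel \<partial>lborel)"
    unfolding post_relative[symmetric] by (rule nn_integral_relative) measurable
  also have "\<dots> = (\<integral>\<^sup>+c. \<integral>\<^sup>+z. \<integral>\<^sup>+\<sigma>. H (?p c (norm z *\<^sub>R \<sigma>)) (?p c z) \<partial>sphere_measure \<partial>lborel \<partial>lborel)"
  proof (rule nn_integral_cong)
    fix c :: "real^3"
    show "(\<integral>\<^sup>+z. \<integral>\<^sup>+\<sigma>. H (?p c z) (?p c (norm z *\<^sub>R \<sigma>)) \<partial>sphere_measure \<partial>lborel) = (\<integral>\<^sup>+z. \<integral>\<^sup>+\<sigma>. H (?p c (norm z *\<^sub>R \<sigma>)) (?p c z) \<partial>sphere_measure \<partial>lborel)"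
    proof (rule nn_integral_sphere_swap[of "\<lambda>z y. H (?p c z) (?p c y)"])
      have "(\<lambda>q. ?p c (fst q)) \<in> borel_measurable borel" "(\<lambda>q. ?p c (snd q)) \<in> borel_measurable borel"
        by (intro borel_measurable_continuous_onI continuous_intros)+
      from Hm[OF this] show "(\<lambda>(z, y). H (?p c z) (?p c y)) \<in> borel_measurable borel"
        by (simp add: case_prod_beta)
    qed
  qed
  also have "\<dots> = (\<integral>\<^sup>+x. \<integral>\<^sup>+\<sigma>. H (post x \<sigma>) x \<partial>sphere_measure \<partial>lborel)"
    unfolding post_relative[symmetric] by (rule nn_integral_relative[symmetric]) measurable
  finally show ?thesis .
qed

text \<open>The function (a - b) (ln a - ln b) is convex and homogeneous of degree one. At a / b =
  exp s its partial derivatives in a and b are \<open>tangent (- s)\<close> and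
  \<open>tangent s\<close>.\<close>

definition tangent :: "real \<Rightarrow> real" where "tangent t = 1 - t - exp t"

text \<open>By homogeneity the tangent planes pass through the origin, so they have no constant
  term. Negative parts of the coefficients stand on the right, which gives the inequality a meaning
  also when the left factor of the sum is infinite.\<close>

lemma log_diff_prod_tangent:
  assumes "0 \<le> a" "0 \<le> b"
  shows "ennreal a * ennreal (tangent (- s)) + ennreal b * ennreal (tangent s)
    \<le> log_diff_prod a b + (ennreal a * ennreal (- tangent (- s)) + ennreal b * ennreal (- tangent s))"
proof -
  have fin: "ennreal a * ennreal (tangent (- s)) + ennreal b * ennreal (tangent s)
    \<le> ennreal X + (ennreal a * ennreal (- tangent (- s)) + ennreal b * ennreal (- tangent s))"
    if X: "0 \<le> X" "a * tangent (- s) + b * tangent s \<le> X" for X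
  proof -
    define p p' q q' where "p = max 0 (tangent (- s))" "p' = max 0 (- tangent (- s))" "q = max 0 (tangent s)" "q' = max 0 (- tangent s)"
    note d = this
    have e: "ennreal (tangent (- s)) = ennreal p" "ennreal (- tangent (- s)) = ennreal p'" "ennreal (tangent s) = ennreal q" "ennreal (- tangent s) = ennreal q'"
      unfolding d by (auto simp: max_def ennreal_neg)
    have "a * p + b * q \<le> X + (a * p' + b * q')"
    proof -
      have "p - p' = tangent (- s)" "q - q' = tangent s" by (auto simp: d max_def)
      then have "a * (p - p') + b * (q - q') \<le> X" using X by simp
      then show ?thesis by (simp add: algebra_simps)
    qed
    moreover have "0 \<le> p" "0 \<le> p'" "0 \<le> q" "0 \<le> q'" by (auto simp: d)
    ultimately show ?thesis unfolding e using assms X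
      by (simp add: ennreal_mult[symmetric] ennreal_plus[symmetric] ennreal_leI del: ennreal_plus)
  qed
  consider "a = b" | "a \<noteq> b" "a = 0 \<or> b = 0" | "a \<noteq> b" "0 < a" "0 < b" using assms by fastforce
  then show ?thesis
  proof cases
    case 1
    have "tangent (- s) + tangent s \<le> 0"
      using exp_ge_add_one_self[of s] exp_ge_add_one_self[of "- s"] unfolding tangent_def minus_minus by linarith
    then have "a * (tangent (- s) + tangent s) \<le> 0" using assms by (simp add: mult_nonneg_nonpos)
    then show ?thesis using fin[of 0] 1 by (simp add: log_diff_prod_def algebra_simps)
  next
    case 2
    then show ?thesis by (auto simp: log_diff_prod_def)
  next
    case 3
    define t where "t = ln a - ln b"
    have a: "a = b * exp t" using 3 by (simp add: t_def exp_diff)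
    \<comment> \<open>With t the true logarithmic ratio and s the chosen one, the gap is b times a
      sum of two instances of exp x >= 1 + x, at -d and d, the first weighted by exp t.\<close>
    define d where "d = t - s"
    have es: "exp s = exp t * exp (- d)" "exp (- s) = exp d * exp (- t)" by (simp_all add: d_def flip: exp_add)
    have "exp t * (d - 1 + exp (- d)) + (exp d - 1 - d) \<ge> 0"
    proof -
      have "0 \<le> d - 1 + exp (- d)" using exp_ge_add_one_self[of "- d"] by linarith
      from mult_nonneg_nonneg[OF exp_ge_zero this, of t]
      show ?thesis using exp_ge_add_one_self[of d] by linarith
    qed
    then have "exp t * (s + 1 - exp (- s)) + (1 - s - exp s) \<le> (exp t - 1) * t"
      unfolding es by (simp add: d_def algebra_simps flip: exp_add)
    then have "b * (exp t * (s + 1 - exp (- s)) + (1 - s - exp s)) \<le> b * ((exp t - 1) * t)"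
      using 3 by (intro mult_left_mono) auto
    then have "a * tangent (- s) + b * tangent s \<le> (a - b) * (ln a - ln b)"
      unfolding t_def[symmetric] by (simp add: a tangent_def algebra_simps)
    moreover have "0 \<le> (a - b) * (ln a - ln b)"
      using 3 by (cases "a \<le> b") (auto intro: mult_nonneg_nonneg mult_nonpos_nonpos)
    ultimately show ?thesis using fin 3 by (simp add: log_diff_prod_def)
  qed
qed

lemma measurable_log_diff_prod[measurable (raw)]:
  assumes [measurable]: "f \<in> borel_measurable M" "g \<in> borel_measurable M"
  shows "(\<lambda>x. log_diff_prod (f x) (g x)) \<in> borel_measurable M"
  unfolding log_diff_prod_def by measurable

lemma measurable_tangent[measurable (raw)]:
  assumes [measurable]: "f \<in> borel_measurable M"
  shows "(\<lambda>x. tangent (f x)) \<in> borel_measurable M"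
  unfolding tangent_def by measurable

definition tensor :: "(real^3 \<Rightarrow> real) \<Rightarrow> (real^3) \<times> (real^3) \<Rightarrow> real" where
  "tensor f x = f (fst x) * f (snd x)"

lemma tensor_density:
  assumes "prob_density f"
  shows "tensor f \<in> borel_measurable borel" "0 \<le> tensor f x" "integrable lborel (tensor f)" "(\<integral>x. tensor f x \<partial>lborel) = 1"
    "(\<integral>\<^sup>+x. ennreal (tensor f x) \<partial>lborel) = 1"
proof -
  have [measurable]: "f \<in> borel_measurable borel" and nn: "\<And>v. 0 \<le> f v" and 1: "(\<integral>\<^sup>+v. ennreal (f v) \<partial>lborel) = 1"
    using assms by (auto simp: prob_density_def)
  show m[measurable]: "tensor f \<in> borel_measurable borel" unfolding tensor_def[abs_def] by measurable
  show n: "0 \<le> tensor f x" for x using nn by (simp add: tensor_def)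
  have "(\<integral>\<^sup>+x. ennreal (tensor f x) \<partial>lborel) = (\<integral>\<^sup>+x. ennreal (tensor f x) \<partial>(lborel \<Otimes>\<^sub>M lborel))" by (simp add: lborel_prod)
  also have "\<dots> = (\<integral>\<^sup>+v. \<integral>\<^sup>+w. ennreal (tensor f (v, w)) \<partial>lborel \<partial>lborel)"
    by (subst lborel.nn_integral_fst[symmetric]) (simp_all add: lborel_prod)
  also have "\<dots> = (\<integral>\<^sup>+v. ennreal (f v) * (\<integral>\<^sup>+w. ennreal (f w) \<partial>lborel) \<partial>lborel)"
    using nn by (intro nn_integral_cong) (simp add: tensor_def ennreal_mult nn_integral_cmult)
  also have "\<dots> = 1" using 1 by simp
  finally show N: "(\<integral>\<^sup>+x. ennreal (tensor f x) \<partial>lborel) = 1" .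
  show i: "integrable lborel (tensor f)" by (rule integrableI_nonneg) (use N n in auto)
  show "(\<integral>x. tensor f x \<partial>lborel) = 1"
    using nn_integral_eq_integral[OF i] n N by (simp add: ennreal_eq_1)
qed

text \<open>Antisymmetry of S and the exchange of the states before and after the collision fold the
  two tangent terms into twice the same integral against f tensor f; with the prefactor 1/4 this
  leaves 1/2. Boundedness of S and of the minorant kernel makes the functional integrable, and J
  bounds its angular part from above.\<close>

lemma boltzmann_lower_bound:
  fixes B :: "real \<Rightarrow> real \<Rightarrow> real" and f :: "real^3 \<Rightarrow> real"
    and S \<kappa> :: "(real^3) \<times> (real^3) \<Rightarrow> (real^3) \<times> (real^3) \<Rightarrow> real" and J :: "(real^3) \<times> (real^3) \<Rightarrow> real"
  assumes f: "prob_density f"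
    and S: "(\<lambda>p. S (fst p) (snd p)) \<in> borel_measurable (borel :: (((real^3) \<times> (real^3)) \<times> ((real^3) \<times> (real^3))) measure)"
    and \<kappa>: "(\<lambda>p. \<kappa> (fst p) (snd p)) \<in> borel_measurable (borel :: (((real^3) \<times> (real^3)) \<times> ((real^3) \<times> (real^3))) measure)"
    and anti: "\<And>x y. S y x = - S x y" and bS: "\<And>x y. \<bar>tangent (S x y)\<bar> \<le> C"
    and \<kappa>b: "\<And>x y. 0 \<le> \<kappa> x y" "\<And>x y. \<kappa> x y \<le> D"
    and \<kappa>sym: "\<And>x \<sigma>. norm \<sigma> = 1 \<Longrightarrow> \<kappa> (post x \<sigma>) x = \<kappa> x (post x \<sigma>)"
    and \<kappa>B: "\<And>x \<sigma>. norm \<sigma> = 1 \<Longrightarrow> \<kappa> x (post x \<sigma>) \<le> B (norm (rel x)) (deviation_angle (fst x) (snd x) \<sigma>)"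
    and J[measurable]: "J \<in> borel_measurable borel" and Jb: "\<And>x. \<bar>J x\<bar> \<le> C'"
    and JI: "\<And>x. - (\<integral>\<sigma>. tangent (S x (post x \<sigma>)) * \<kappa> x (post x \<sigma>) \<partial>sphere_measure) \<le> J x"
  shows "ennreal (- (1/2) * (\<integral>x. tensor f x * J x \<partial>lborel)) \<le> boltzmann_dissipation B f"
proof -
  note [measurable] = tensor_density(1)[OF f]
  have [measurable]: "f \<in> borel_measurable borel" using f by (simp add: prob_density_def)
  have fnn: "0 \<le> f v" for v using f by (simp add: prob_density_def)
  have [measurable (raw)]: "(\<lambda>x. S (f x) (g x)) \<in> borel_measurable M" "(\<lambda>x. \<kappa> (f x) (g x)) \<in> borel_measurable M"
    if "f \<in> borel_measurable M" "g \<in> borel_measurable M" for f g and M :: "'z measure"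
    using measurable_compose[OF borel_measurable_Pair[OF that] S] measurable_compose[OF borel_measurable_Pair[OF that] \<kappa>] by simp_all
  let ?G = "tensor f"
  note Gnn = tensor_density(2)[OF f]
  define X where "X = (\<integral>\<^sup>+x. \<integral>\<^sup>+\<sigma>. log_diff_prod (?G (post x \<sigma>)) (?G x) * ennreal (\<kappa> x (post x \<sigma>)) \<partial>sphere_measure \<partial>lborel)"
  have XB: "ennreal (1/4) * X \<le> boltzmann_dissipation B f"
    unfolding X_def boltzmann_dissipation_def
  proof (intro mult_left_mono nn_integral_mono)
    fix x :: "(real^3) \<times> (real^3)"
    show "(\<integral>\<^sup>+\<sigma>. log_diff_prod (?G (post x \<sigma>)) (?G x) * ennreal (\<kappa> x (post x \<sigma>)) \<partial>sphere_measure)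
      \<le> (case x of (v, w) \<Rightarrow> \<integral>\<^sup>+\<sigma>. log_diff_prod (f (post_v v w \<sigma>) * f (post_w v w \<sigma>)) (f v * f w) * ennreal (B (norm (v - w)) (deviation_angle v w \<sigma>)) \<partial>sphere_measure)"
      unfolding case_prod_beta
    proof (rule nn_integral_mono_AE, use AE_sphere in eventually_elim)
      case (elim \<sigma>)
      show ?case using \<kappa>B[OF elim, of x] by (intro mult_mono ennreal_leI) (auto simp: tensor_def post_def)
    qed
  qed simp
  define Z where "Z = (\<integral>\<^sup>+x. \<integral>\<^sup>+\<sigma>. ennreal (?G x) * ennreal (tangent (S x (post x \<sigma>))) * ennreal (\<kappa> x (post x \<sigma>)) \<partial>sphere_measure \<partial>lborel)"
  define Y where "Y = (\<integral>\<^sup>+x. \<integral>\<^sup>+\<sigma>. ennreal (?G x) * ennreal (- tangent (S x (post x \<sigma>))) * ennreal (\<kappa> x (post x \<sigma>)) \<partial>sphere_measure \<partial>lborel)"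
  \<comment> \<open>Applied to \<open>tangent\<close> and to its negative, since positive and
    negative parts are integrated separately.\<close>
  have swap: "(\<integral>\<^sup>+x. \<integral>\<^sup>+\<sigma>. ennreal (?G (post x \<sigma>)) * ennreal (\<phi> (- S x (post x \<sigma>))) * ennreal (\<kappa> x (post x \<sigma>)) \<partial>sphere_measure \<partial>lborel)
     = (\<integral>\<^sup>+x. \<integral>\<^sup>+\<sigma>. ennreal (?G x) * ennreal (\<phi> (S x (post x \<sigma>))) * ennreal (\<kappa> x (post x \<sigma>)) \<partial>sphere_measure \<partial>lborel)"
    if [measurable]: "\<phi> \<in> borel_measurable borel" for \<phi> :: "real \<Rightarrow> real"
  proof -
    have "(\<integral>\<^sup>+x. \<integral>\<^sup>+\<sigma>. ennreal (?G (post x \<sigma>)) * ennreal (\<phi> (- S x (post x \<sigma>))) * ennreal (\<kappa> x (post x \<sigma>)) \<partial>sphere_measure \<partial>lborel)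
      = (\<integral>\<^sup>+x. \<integral>\<^sup>+\<sigma>. ennreal (?G (post x \<sigma>)) * ennreal (\<phi> (S (post x \<sigma>) x)) * ennreal (\<kappa> (post x \<sigma>) x) \<partial>sphere_measure \<partial>lborel)"
    proof (rule nn_integral_cong)
      fix x :: "(real^3) \<times> (real^3)"
      show "(\<integral>\<^sup>+\<sigma>. ennreal (?G (post x \<sigma>)) * ennreal (\<phi> (- S x (post x \<sigma>))) * ennreal (\<kappa> x (post x \<sigma>)) \<partial>sphere_measure)
        = (\<integral>\<^sup>+\<sigma>. ennreal (?G (post x \<sigma>)) * ennreal (\<phi> (S (post x \<sigma>) x)) * ennreal (\<kappa> (post x \<sigma>) x) \<partial>sphere_measure)"
      proof (rule nn_integral_cong_AE, use AE_sphere in eventually_elim)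
        case (elim \<sigma>)
        show ?case using \<kappa>sym[OF elim, of x] anti[of "post x \<sigma>" x] by simp
      qed
    qed
    also have "\<dots> = (\<integral>\<^sup>+x. \<integral>\<^sup>+\<sigma>. ennreal (?G x) * ennreal (\<phi> (S x (post x \<sigma>))) * ennreal (\<kappa> x (post x \<sigma>)) \<partial>sphere_measure \<partial>lborel)"
      by (rule nn_integral_post_swap[symmetric, of "\<lambda>x y. ennreal (?G x) * ennreal (\<phi> (S x y)) * ennreal (\<kappa> x y)"]) measurable
    finally show ?thesis .
  qed
  have "Z + Z \<le> X + (Y + Y)"
  proof -
    have Z1: "Z = (\<integral>\<^sup>+x. \<integral>\<^sup>+\<sigma>. ennreal (?G (post x \<sigma>)) * ennreal (tangent (- S x (post x \<sigma>))) * ennreal (\<kappa> x (post x \<sigma>)) \<partial>sphere_measure \<partial>lborel)"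
      unfolding Z_def by (rule swap[symmetric]) measurable
    have Y1: "Y = (\<integral>\<^sup>+x. \<integral>\<^sup>+\<sigma>. ennreal (?G (post x \<sigma>)) * ennreal (- tangent (- S x (post x \<sigma>))) * ennreal (\<kappa> x (post x \<sigma>)) \<partial>sphere_measure \<partial>lborel)"
      unfolding Y_def by (rule swap[symmetric, of "\<lambda>t. - tangent t"]) measurable
    have "Z + Z = (\<integral>\<^sup>+x. \<integral>\<^sup>+\<sigma>. (ennreal (?G (post x \<sigma>)) * ennreal (tangent (- S x (post x \<sigma>))) + ennreal (?G x) * ennreal (tangent (S x (post x \<sigma>)))) * ennreal (\<kappa> x (post x \<sigma>)) \<partial>sphere_measure \<partial>lborel)"
      by (subst (1) Z1) (simp add: Z_def distrib_right nn_integral_add)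
    also have "\<dots> \<le> (\<integral>\<^sup>+x. \<integral>\<^sup>+\<sigma>. (log_diff_prod (?G (post x \<sigma>)) (?G x) + (ennreal (?G (post x \<sigma>)) * ennreal (- tangent (- S x (post x \<sigma>))) + ennreal (?G x) * ennreal (- tangent (S x (post x \<sigma>))))) * ennreal (\<kappa> x (post x \<sigma>)) \<partial>sphere_measure \<partial>lborel)"
      by (intro nn_integral_mono mult_right_mono log_diff_prod_tangent Gnn) simp
    also have "\<dots> = X + (Y + Y)"
      by (subst (1) Y1) (simp add: X_def Y_def distrib_right nn_integral_add)
    finally show ?thesis .
  qed
  note main = this
  define g where "g p = ?G (fst p) * (tangent (S (fst p) (post (fst p) (snd p))) * \<kappa> (fst p) (post (fst p) (snd p)))" for p
  have gm[measurable]: "g \<in> borel_measurable (lborel \<Otimes>\<^sub>M sphere_measure)" unfolding g_def[abs_def] by measurable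
  have D0: "0 \<le> D" using \<kappa>b[of undefined undefined] by linarith
  have C0: "0 \<le> C" using bS[of undefined undefined] by linarith
  have tk: "\<bar>tangent (S x y) * \<kappa> x y\<bar> \<le> C * D" for x y
    unfolding abs_mult using bS \<kappa>b C0 by (intro mult_mono) auto
  have inner_int: "integrable sphere_measure (\<lambda>\<sigma>. tangent (S x (post x \<sigma>)) * \<kappa> x (post x \<sigma>))" for x
    by (rule sphere.integrable_const_bound[of _ "C * D"]) (use tk in auto)
  have gi: "integrable (lborel \<Otimes>\<^sub>M sphere_measure) g"
  proof (rule Bochner_Integration.integrable_bound)
    show "integrable (lborel \<Otimes>\<^sub>M sphere_measure) (\<lambda>p. ?G (fst p) * (C * D))"
    proof (rule lborel_sphere.Fubini_integrable)
      show "integrable lborel (\<lambda>x. \<integral>\<sigma>. norm (?G (fst (x, \<sigma>)) * (C * D)) \<partial>sphere_measure)"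
        using tensor_density(3)[OF f] by (simp add: abs_mult Gnn)
    qed auto
    show "AE p in lborel \<Otimes>\<^sub>M sphere_measure. norm (g p) \<le> norm (?G (fst p) * (C * D))"
      unfolding g_def using tk Gnn C0 D0 by (intro AE_I2) (simp add: abs_mult mult_left_mono)
  qed measurable
  have Zg: "Z = (\<integral>\<^sup>+p. ennreal (g p) \<partial>(lborel \<Otimes>\<^sub>M sphere_measure))" and Yg: "Y = (\<integral>\<^sup>+p. ennreal (- g p) \<partial>(lborel \<Otimes>\<^sub>M sphere_measure))"
  proof -
    have "ennreal (?G x) * ennreal t * ennreal k = ennreal (?G x * (t * k))" if "0 \<le> k" for x t k
      using that Gnn[of x] by (cases "0 \<le> t") (auto simp: ennreal_mult[symmetric] ennreal_neg mult.assoc mult_nonneg_nonpos mult_nonpos_nonneg)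
    note e = this[OF \<kappa>b(1)]
    show "Z = (\<integral>\<^sup>+p. ennreal (g p) \<partial>(lborel \<Otimes>\<^sub>M sphere_measure))"
      unfolding Z_def e by (subst sphere.nn_integral_fst[symmetric]) (simp_all add: g_def)
    show "Y = (\<integral>\<^sup>+p. ennreal (- g p) \<partial>(lborel \<Otimes>\<^sub>M sphere_measure))"
      unfolding Y_def e by (subst sphere.nn_integral_fst[symmetric]) (simp_all add: g_def)
  qed
  have fin: "Z < \<infinity>" "Y < \<infinity>" using gi unfolding Zg Yg real_integrable_def by (auto simp: less_top)
  have "(\<integral>p. g p \<partial>(lborel \<Otimes>\<^sub>M sphere_measure)) = enn2real Z - enn2real Y"
    unfolding Zg Yg by (rule real_lebesgue_integral_def[OF gi])
  moreover have "(\<integral>p. g p \<partial>(lborel \<Otimes>\<^sub>M sphere_measure)) = (\<integral>x. \<integral>\<sigma>. g (x, \<sigma>) \<partial>sphere_measure \<partial>lborel)"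
    by (rule lborel_sphere.integral_fst'[symmetric, OF gi])
  moreover have "- (\<integral>x. ?G x * J x \<partial>lborel) \<le> (\<integral>x. \<integral>\<sigma>. g (x, \<sigma>) \<partial>sphere_measure \<partial>lborel)"
    unfolding Bochner_Integration.integral_minus[symmetric]
  proof (rule integral_mono)
    show "integrable lborel (\<lambda>x. - (?G x * J x))"
      using integrable_mult_bounded[OF tensor_density(3)[OF f] _ Jb] by simp
    show "integrable lborel (\<lambda>x. \<integral>\<sigma>. g (x, \<sigma>) \<partial>sphere_measure)" by (rule lborel_sphere.integrable_fst'[OF gi])
    show "- (?G x * J x) \<le> (\<integral>\<sigma>. g (x, \<sigma>) \<partial>sphere_measure)" for x
      using mult_left_mono[OF JI[of x] Gnn[of x]] by (simp add: g_def)
  qed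
  ultimately have le: "- (\<integral>x. ?G x * J x \<partial>lborel) \<le> enn2real Z - enn2real Y" by simp
  show ?thesis
  \<comment> \<open>An infinite X makes the dissipation infinite. Otherwise X, Y and Z are finite
    and the parts recombine into a real inequality.\<close>
  proof (cases "X = \<infinity>")
    case True
    then show ?thesis using XB by (simp add: ennreal_mult_top top_unique)
  next
    case False
    define x y z where "x = enn2real X" "y = enn2real Y" "z = enn2real Z"
    note xyz = this
    have e: "X = ennreal x" "Y = ennreal y" "Z = ennreal z" and nn: "0 \<le> x" "0 \<le> y" "0 \<le> z"
      using fin False by (auto simp: xyz less_top)
    have "z + z \<le> x + (y + y)"
      using main nn unfolding e by (simp add: ennreal_plus[symmetric] del: ennreal_plus)
    then have "- (1/2) * (\<integral>x. ?G x * J x \<partial>lborel) \<le> 1/4 * x"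
      using le xyz by simp
    then have "ennreal (- (1/2) * (\<integral>x. ?G x * J x \<partial>lborel)) \<le> ennreal (1/4) * X"
      unfolding e using nn by (simp add: ennreal_mult[symmetric] ennreal_leI)
    with XB show ?thesis by (rule order_trans[rotated])
  qed
qed

section \<open>Second order expansion of the collision increment\<close>

lemma compact_support_uniformly_continuous:
  fixes f :: "'a::euclidean_space \<Rightarrow> 'b::real_normed_vector"
  assumes f: "continuous_on UNIV f" and K: "compact K" "\<And>x. x \<notin> K \<Longrightarrow> f x = 0" and e: "0 < e"
  obtains d where "0 < d" "\<And>x y. norm (y - x) < d \<Longrightarrow> norm (f y - f x) < e"
proof -
  obtain R where R: "\<And>x. x \<in> K \<Longrightarrow> norm x \<le> R" using compact_imp_bounded[OF K(1)] bounded_iff by metis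
  have "uniformly_continuous_on (cball 0 (R + 1)) f"
    by (intro compact_uniformly_continuous continuous_on_subset[OF f]) auto
  then obtain d where d: "0 < d" "\<And>x y. x \<in> cball 0 (R + 1) \<Longrightarrow> y \<in> cball 0 (R + 1) \<Longrightarrow> dist y x < d \<Longrightarrow> dist (f y) (f x) < e"
    using e unfolding uniformly_continuous_on_def by metis
  show thesis
  proof (rule that[of "min d 1"])
    fix x y :: 'a assume xy: "norm (y - x) < min d 1"
    show "norm (f y - f x) < e"
    proof (cases "norm x \<le> R + 1 \<and> norm y \<le> R + 1")
      case True
      then show ?thesis using d(2)[of x y] xy by (simp add: dist_norm)
    next
      case False
      have "\<bar>norm y - norm x\<bar> < 1" using xy norm_triangle_ineq3[of y x] by linarith
      then have "norm x > R" "norm y > R" using False by linarith+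
      then have "f x = 0" "f y = 0" using R K(2) by (meson not_le)+
      then show ?thesis using e by simp
    qed
  qed (use d in simp)
qed

text \<open>The mean value inequality applied to \<psi> minus its linear part. The gradient is
  uniformly continuous because it has compact support, so one radius serves all points x.\<close>

lemma C1c_uniformly_differentiable:
  assumes \<psi>: "C1c \<Omega> \<psi>" and e: "0 < e"
  obtains d where "0 < d" "\<And>x y. norm (y - x) < d \<Longrightarrow> \<bar>\<psi> y - \<psi> x - nabla \<psi> x \<bullet> (y - x)\<bar> \<le> e * norm (y - x)"
proof -
  obtain K where K: "compact K" "\<And>x. x \<notin> K \<Longrightarrow> nabla \<psi> x = 0" using C1c_support[OF \<psi>] by metis
  obtain d where d: "0 < d" "\<And>x y. norm (y - x) < d \<Longrightarrow> norm (nabla \<psi> y - nabla \<psi> x) < e"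
    using compact_support_uniformly_continuous[OF C1c_nabla_continuous[OF \<psi>] K e] by metis
  show thesis
  proof (rule that[OF d(1)])
    fix x y :: 'a assume xy: "norm (y - x) < d"
    have "norm ((\<psi> y - nabla \<psi> x \<bullet> y) - (\<psi> x - nabla \<psi> x \<bullet> x)) \<le> e * norm (y - x)"
    proof (rule differentiable_bound[where S="ball x d"])
      fix w assume w: "w \<in> ball x d"
      show "((\<lambda>y. \<psi> y - nabla \<psi> x \<bullet> y) has_derivative (\<lambda>h. (nabla \<psi> w - nabla \<psi> x) \<bullet> h)) (at w within ball x d)"
        unfolding inner_diff_left
        by (intro has_derivative_diff has_derivative_at_withinI[OF C1c_has_derivative[OF \<psi>]] has_derivative_inner_right has_derivative_ident)
      show "onorm (\<lambda>h. (nabla \<psi> w - nabla \<psi> x) \<bullet> h) \<le> e"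
      proof (rule onorm_bound)
        fix h
        have "norm ((nabla \<psi> w - nabla \<psi> x) \<bullet> h) \<le> norm (nabla \<psi> w - nabla \<psi> x) * norm h"
          by (simp add: Cauchy_Schwarz_ineq2)
        also have "\<dots> \<le> e * norm h"
          using d(2)[of w x] w by (intro mult_right_mono) (auto simp: dist_norm norm_minus_commute)
        finally show "norm ((nabla \<psi> w - nabla \<psi> x) \<bullet> h) \<le> e * norm h" .
      qed (use e in simp)
    qed (use xy d in \<open>auto simp: dist_norm norm_minus_commute\<close>)
    then show "\<bar>\<psi> y - \<psi> x - nabla \<psi> x \<bullet> (y - x)\<bar> \<le> e * norm (y - x)"
      by (simp add: inner_diff_right algebra_simps)
  qed
qed

text \<open>A compact subset of the off-diagonal set keeps a positive distance from the diagonal; on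
  the resulting shell every power of |v - w| is bounded.\<close>

lemma C1c_relative_range:
  assumes \<psi>: "C1c off_diagonal \<psi>"
  obtains r R where "0 < r" "\<And>x. \<not> (r \<le> norm (rel x) \<and> norm (rel x) \<le> R) \<Longrightarrow> \<psi> x = 0 \<and> nabla \<psi> x = 0"
proof -
  obtain K where K: "compact K" "K \<subseteq> off_diagonal" "\<And>x. x \<notin> K \<Longrightarrow> \<psi> x = 0" "\<And>x. x \<notin> K \<Longrightarrow> nabla \<psi> x = 0"
    using C1c_support[OF \<psi>] by metis
  have c: "compact ((\<lambda>x. norm (rel x)) ` K)" by (intro compact_continuous_image continuous_intros K(1))
  show thesis
  proof (cases "K = {}")
    case True
    then show thesis using K by (intro that[of 1 0]) auto
  next
    case False
    then obtain x0 where x0: "x0 \<in> K" "\<And>x. x \<in> K \<Longrightarrow> norm (rel x0) \<le> norm (rel x)"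
      using compact_attains_inf[OF c] by auto
    obtain R where R: "\<And>x. x \<in> K \<Longrightarrow> norm (rel x) \<le> R" using compact_imp_bounded[OF c] by (auto simp: bounded_iff)
    have "norm (rel x0) > 0" using x0(1) K(2) off_diagonal_iff[of x0] by auto
    then show thesis using x0 R K by (intro that[of "norm (rel x0)" R]) blast+
  qed
qed

text \<open>A trapezoidal rule along the collision: the cross product of the two relative velocities
  is normal to the plane of the rotation between them. Averaging the field over both ends gives the
  antisymmetry that \<open>boltzmann_lower_bound\<close> demands and supplies the second order term
  from which the divergence of a arises.\<close>

definition increment :: "((real^3) \<times> (real^3) \<Rightarrow> real^3) \<Rightarrow> (real^3) \<times> (real^3) \<Rightarrow> (real^3) \<times> (real^3) \<Rightarrow> real" where
  "increment a x y = (1/2) * (cross3 (rel x) (rel y) \<bullet> (a x + a y))"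

lemma increment_swap: "increment a y x = - increment a x y"
  unfolding increment_def by (subst cross_skew) (simp add: add.commute)

lemma cross_diff_right: "cross3 x (y - z) = cross3 x y - cross3 x z"
  by (simp add: cross3_simps)

text \<open>
  Summing over the four quarter turns of \<open>\<sigma>\<close> about the axis \<open>k\<close> cancels the first order terms and
  replaces the quadratic form of the increment by its trace.
\<close>

definition qturn :: "real^3 \<Rightarrow> real^3 \<Rightarrow> real^3" where
  "qturn k \<sigma> = (k \<bullet> \<sigma>) *\<^sub>R k + cross3 k \<sigma>"

lemma qturn:
  assumes k: "norm k = 1"
  shows "k \<bullet> qturn k \<sigma> = k \<bullet> \<sigma>" "orthogonal_transformation (qturn k)"
    "qturn k (qturn k \<sigma>) = 2 *\<^sub>R ((k \<bullet> \<sigma>) *\<^sub>R k) - \<sigma>"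
    "qturn k (qturn k (qturn k \<sigma>)) = (k \<bullet> \<sigma>) *\<^sub>R k - cross3 k \<sigma>"
proof -
  have kk: "k \<bullet> k = 1" using k by (simp add: norm_eq_1)
  show 1: "k \<bullet> qturn k \<sigma> = k \<bullet> \<sigma>" for \<sigma> by (simp add: qturn_def inner_add_right dot_cross_self kk)
  have cc: "cross3 k (cross3 k \<sigma>) = (k \<bullet> \<sigma>) *\<^sub>R k - \<sigma>" for \<sigma>
    using Lagrange[of k k \<sigma>] kk by simp
  have lin: "linear (qturn k)"
    by (rule linearI) (simp_all add: qturn_def inner_add_right cross_add_right cross_mult_right algebra_simps)
  have "norm (qturn k \<sigma>) = norm \<sigma>" for \<sigma>
  proof -
    have "(norm (qturn k \<sigma>))\<^sup>2 = (k \<bullet> \<sigma>)\<^sup>2 + (norm (cross3 k \<sigma>))\<^sup>2"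
      unfolding power2_norm_eq_inner by (simp add: qturn_def inner_add_left inner_add_right dot_cross_self kk inner_commute power2_eq_square)
    also have "\<dots> = (norm \<sigma>)\<^sup>2" using norm_cross_dot[of k \<sigma>] k by simp
    finally show ?thesis by simp
  qed
  then show "orthogonal_transformation (qturn k)" using lin by (simp add: orthogonal_transformation)
  show 2: "qturn k (qturn k \<sigma>) = 2 *\<^sub>R ((k \<bullet> \<sigma>) *\<^sub>R k) - \<sigma>" for \<sigma>
    unfolding qturn_def[of k "qturn k \<sigma>"] 1 unfolding qturn_def
    by (simp add: cross_add_right cross_mult_right cc vec_eq_iff)
  show "qturn k (qturn k (qturn k \<sigma>)) = (k \<bullet> \<sigma>) *\<^sub>R k - cross3 k \<sigma>"
  proof -
    have "qturn k (qturn k (qturn k \<sigma>)) = (k \<bullet> qturn k (qturn k \<sigma>)) *\<^sub>R k + cross3 k (qturn k (qturn k \<sigma>))"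
      by (simp only: qturn_def[of k "qturn k (qturn k \<sigma>)"])
    then show ?thesis unfolding 1 unfolding 2 by (simp add: cross_diff_right cross_mult_right)
  qed
qed

text \<open>Bessel's inequality for an orthogonal pair of equal length: the part of a orthogonal to
  both vectors has nonnegative square.\<close>

lemma bessel_two:
  fixes u y a :: "'a::real_inner"
  assumes "u \<bullet> y = 0" "norm u = norm y"
  shows "(u \<bullet> a)\<^sup>2 + (y \<bullet> a)\<^sup>2 \<le> (norm y)\<^sup>2 * (norm a)\<^sup>2"
proof (cases "y = 0")
  case True
  then show ?thesis using assms by simp
next
  case False
  define \<rho> where "\<rho> = (norm y)\<^sup>2"
  have \<rho>: "\<rho> > 0" "y \<bullet> y = \<rho>" "u \<bullet> u = \<rho>" using False assms by (auto simp: \<rho>_def power2_norm_eq_inner norm_eq)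
  let ?v = "\<rho> *\<^sub>R a - (u \<bullet> a) *\<^sub>R u - (y \<bullet> a) *\<^sub>R y"
  have "0 \<le> ?v \<bullet> ?v" by simp
  also have "?v \<bullet> ?v = \<rho> * (\<rho> * (a \<bullet> a) - ((u \<bullet> a)\<^sup>2 + (y \<bullet> a)\<^sup>2))"
    using assms(1) \<rho>(2,3) by (simp add: inner_diff_left inner_diff_right inner_commute power2_eq_square algebra_simps)
  finally have "0 \<le> \<rho> * (a \<bullet> a) - ((u \<bullet> a)\<^sup>2 + (y \<bullet> a)\<^sup>2)" using \<rho>(1) by (simp add: zero_le_mult_iff)
  then show ?thesis by (simp add: \<rho>_def power2_norm_eq_inner)
qed

text \<open>Only the skew part of N enters the left side, and in dimension three it pairs with the
  cross product of u = k x y and y, which is -|y|^2 k. This is how two perpendicular directions of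
  \<sigma> already see the full rotational divergence.\<close>

lemma skew_trace:
  fixes N :: "real^3 \<Rightarrow> real^3"
  assumes N: "linear N" and ky: "k \<bullet> y = 0"
  shows "cross3 k y \<bullet> N y - y \<bullet> N (cross3 k y) = (norm y)\<^sup>2 * (\<Sum>j\<in>UNIV. N (cross3 (axis j 1) k) $ j)"
proof -
  define n where "n p q = N (axis q 1) $ p" for p q
  have exp: "N h $ p = n p 1 * h $ 1 + n p 2 * h $ 2 + n p 3 * h $ 3" for h p
  proof -
    have "h = (h $ 1) *\<^sub>R axis 1 1 + (h $ 2) *\<^sub>R axis 2 1 + (h $ 3) *\<^sub>R axis 3 1"
      by (simp add: vec_eq_iff forall_3 axis_def)
    then have "N h = (h $ 1) *\<^sub>R N (axis 1 1) + (h $ 2) *\<^sub>R N (axis 2 1) + (h $ 3) *\<^sub>R N (axis 3 1)"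
      using linear_add[OF N] linear_cmul[OF N] by metis
    then show ?thesis by (simp add: n_def mult.commute)
  qed
  define u where "u = cross3 k y"
  have "cross3 u y = (k \<bullet> y) *\<^sub>R y - (norm y)\<^sup>2 *\<^sub>R k"
    unfolding u_def power2_norm_eq_inner
    by (simp add: cross3_def vec_eq_iff forall_3 inner_vec_def sum_3 algebra_simps)
  then have c: "cross3 u y = - ((norm y)\<^sup>2 *\<^sub>R k)" using ky by simp
  have 1: "u$2 * y$3 - u$3 * y$2 = - ((norm y)\<^sup>2 * k$1)"
    and 2: "u$3 * y$1 - u$1 * y$3 = - ((norm y)\<^sup>2 * k$2)"
    and 3: "u$1 * y$2 - u$2 * y$1 = - ((norm y)\<^sup>2 * k$3)"
    using c by (simp_all add: cross3_def vec_eq_iff forall_3)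
  have "u \<bullet> N y - y \<bullet> N u = (n 1 2 - n 2 1) * (u$1 * y$2 - u$2 * y$1) + (n 2 3 - n 3 2) * (u$2 * y$3 - u$3 * y$2) + (n 3 1 - n 1 3) * (u$3 * y$1 - u$1 * y$3)"
    by (simp add: inner_vec_def sum_3 exp algebra_simps)
  also have "\<dots> = (norm y)\<^sup>2 * (\<Sum>j\<in>UNIV. N (cross3 (axis j 1) k) $ j)"
    unfolding 1 2 3 by (simp add: sum_3 exp cross3_def axis_def algebra_simps)
  finally show ?thesis by (simp add: u_def)
qed

text \<open>The Lagrange remainder has coefficient exp t / 6 with |t| <= 1, at most 1/2 and rounded
  up to 1.\<close>

lemma exp_upper_cubic:
  assumes "\<bar>T\<bar> \<le> (1::real)" shows "exp T - 1 + T \<le> 2 * T + T\<^sup>2 / 2 + \<bar>T\<bar> ^ 3"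
proof -
  obtain t where t: "\<bar>t\<bar> \<le> \<bar>T\<bar>" "exp T = (\<Sum>m<3. T ^ m / fact m) + exp t / fact 3 * T ^ 3"
    using Maclaurin_exp_le[of T 3] by auto
  have "exp t \<le> exp 1" using t(1) assms by simp
  then have "exp t \<le> 3" using exp_le by linarith
  have "exp t / 6 * T ^ 3 \<le> exp t / 6 * \<bar>T\<bar> ^ 3"
    by (intro mult_left_mono) (auto simp flip: power_abs)
  also have "\<dots> \<le> 1 * \<bar>T\<bar> ^ 3" using \<open>exp t \<le> 3\<close> by (intro mult_right_mono) auto
  finally show ?thesis using t(2) by (simp add: numeral_3_eq_3 power2_eq_square)
qed

text \<open>Here p, t and E are the first order, second order and error parts of one increment. The
  term 2 e \<theta>^2 comes from 2 E; of the two cubic terms one is the remainder of the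
  exponential, the other comes from half the mixed terms in the square.\<close>

lemma increment_scalar_bound:
  fixes p t E \<theta> e C1 C2 :: real
  assumes p: "\<bar>p\<bar> \<le> C1 * \<theta>" and t: "\<bar>t\<bar> \<le> C2 * \<theta>\<^sup>2" and E: "\<bar>E\<bar> \<le> e * \<theta>\<^sup>2"
    and \<theta>: "0 \<le> \<theta>" "\<theta> \<le> 1" "(C1 + C2 + 1) * \<theta> \<le> 1" and e: "0 \<le> e" "e \<le> 1" and C: "0 \<le> C1" "0 \<le> C2"
  shows "exp (p + t + E) - 1 + (p + t + E) \<le> 2 * p + 2 * t + p\<^sup>2 / 2 + 2 * e * \<theta>\<^sup>2 + 2 * (C1 + C2 + 1) ^ 3 * \<theta> ^ 3"
proof -
  define M where "M = C1 + C2 + 1"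
  have M: "1 \<le> M" "C1 \<le> M" "C2 + 1 \<le> M" using C by (auto simp: M_def)
  have \<theta>2: "\<theta>\<^sup>2 \<le> \<theta>" using \<theta> by (simp add: power2_eq_square mult_left_le)
  have s: "\<bar>t + E\<bar> \<le> (C2 + 1) * \<theta>\<^sup>2"
  proof -
    have "\<bar>E\<bar> \<le> 1 * \<theta>\<^sup>2" using E mult_right_mono[OF e(2) zero_le_power2[of \<theta>]] by linarith
    then show ?thesis using t abs_triangle_ineq[of t E] by (simp add: distrib_right)
  qed
  have s1: "\<bar>t + E\<bar> \<le> (C2 + 1) * \<theta>" using s mult_left_mono[OF \<theta>2, of "C2 + 1"] C by linarith
  have T: "\<bar>p + t + E\<bar> \<le> M * \<theta>"
    using p s1 abs_triangle_ineq[of p "t + E"] by (simp add: M_def algebra_simps)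
  have T3: "\<bar>p + t + E\<bar> ^ 3 \<le> M ^ 3 * \<theta> ^ 3"
    using power_mono[OF T, of 3] by (simp add: power_mult_distrib)
  have "(p + t + E)\<^sup>2 = p\<^sup>2 + (2 * p + (t + E)) * (t + E)" by (simp add: power2_eq_square algebra_simps)
  also have "(2 * p + (t + E)) * (t + E) \<le> (2 * (C1 * \<theta>) + (C2 + 1) * \<theta>) * ((C2 + 1) * \<theta>\<^sup>2)"
  proof -
    have "\<bar>2 * p + (t + E)\<bar> \<le> 2 * (C1 * \<theta>) + (C2 + 1) * \<theta>" using p s1 by linarith
    then have "\<bar>2 * p + (t + E)\<bar> * \<bar>t + E\<bar> \<le> (2 * (C1 * \<theta>) + (C2 + 1) * \<theta>) * ((C2 + 1) * \<theta>\<^sup>2)"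
      using s C \<theta> by (intro mult_mono) auto
    then show ?thesis using abs_ge_self[of "(2 * p + (t + E)) * (t + E)"] unfolding abs_mult by linarith
  qed
  also have "\<dots> = ((2 * C1 + (C2 + 1)) * (C2 + 1)) * \<theta> ^ 3" by (simp add: eval_nat_numeral algebra_simps)
  also have "\<dots> \<le> (2 * M ^ 3) * \<theta> ^ 3"
  proof (rule mult_right_mono)
    have "(2 * C1 + (C2 + 1)) * (C2 + 1) \<le> (2 * M) * M" using M C by (intro mult_mono) (auto simp: M_def)
    also have "\<dots> \<le> (2 * M) * M * M" using M by (simp add: mult_left_le[of _ _] mult_le_cancel_left1)
    finally show "(2 * C1 + (C2 + 1)) * (C2 + 1) \<le> 2 * M ^ 3" by (simp add: eval_nat_numeral mult.assoc)
  qed (use \<theta> in simp)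
  finally have T2: "(p + t + E)\<^sup>2 \<le> p\<^sup>2 + 2 * M ^ 3 * \<theta> ^ 3" by simp
  have "\<bar>p + t + E\<bar> \<le> 1" using T \<theta>(3) by (simp add: M_def)
  from exp_upper_cubic[OF this] T2 T3 E
  show "exp (p + t + E) - 1 + (p + t + E) \<le> 2 * p + 2 * t + p\<^sup>2 / 2 + 2 * e * \<theta>\<^sup>2 + 2 * (C1 + C2 + 1) ^ 3 * \<theta> ^ 3"
    unfolding M_def[symmetric] by (simp add: field_simps)
qed

text \<open>The direction (h, -h) makes this twice the derivative in the relative velocity at fixed
  centre of mass.\<close>

definition rel_derivative :: "((real^3) \<times> (real^3) \<Rightarrow> real^3) \<Rightarrow> (real^3) \<times> (real^3) \<Rightarrow> real^3 \<Rightarrow> real^3" where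
  "rel_derivative a x h = (\<chi> j. nabla (\<lambda>x. a x $ j) x \<bullet> (h, - h))"

lemma linear_rel_derivative: "linear (rel_derivative a x)"
  by (rule linearI) (simp_all add: rel_derivative_def vec_eq_iff inner_prod_def inner_add_right algebra_simps)

lemma sum_rotD_rel_derivative:
  "(\<Sum>j\<in>UNIV. rel_derivative a x (cross3 (axis j 1) (rel x)) $ j) = 2 * (\<Sum>j\<in>UNIV. rotD j (\<lambda>x. a x $ j) x)"
  by (simp add: rel_derivative_def rotD_def rotfield_def inner_prod_def sum_distrib_left)

text \<open>Up to small errors, the sum over four quarter turns is at most 4 \<theta>^2 times this.
  The divergence stems from the second order part of the increment, the square from its first order
  part.\<close>

definition symbol :: "((real^3) \<times> (real^3) \<Rightarrow> real^3) \<Rightarrow> (real^3) \<times> (real^3) \<Rightarrow> real" where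
  "symbol a x = (norm (rel x))\<^sup>2 / 2 * (\<Sum>j\<in>UNIV. rotD j (\<lambda>x. a x $ j) x) + (norm (rel x)) ^ 4 / 4 * (norm (a x))\<^sup>2"

lemma post_diff:
  assumes "rel x = r *\<^sub>R k" "norm (rel x) = r"
  shows "post x \<sigma> - x = ((r / 2) *\<^sub>R (\<sigma> - k), - ((r / 2) *\<^sub>R (\<sigma> - k)))"
proof -
  have v: "fst x = snd x + r *\<^sub>R k" using assms(1) by (simp add: algebra_simps)
  show ?thesis
    unfolding post_def post_v_def post_w_def assms(2)
    by (rule prod_eqI) (simp_all add: v vec_eq_iff field_simps)
qed

text \<open>The three groups are of order \<theta>, \<theta>^2 and o(\<theta>^2): y has length sin
  \<theta>, 1 - c is of order \<theta>^2, and the remainder of a is o(\<theta>) times a factor of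
  order \<theta>.\<close>

lemma increment_decomposition:
  assumes x: "rel x = r *\<^sub>R k" "norm (rel x) = r" and \<sigma>: "\<sigma> = c *\<^sub>R k + y"
  shows "increment a x (post x \<sigma>) = r\<^sup>2 * (cross3 k y \<bullet> a x) + r ^ 3 / 4 * (cross3 k y \<bullet> rel_derivative a x y)
     + (r\<^sup>2 / 2 * (cross3 k y \<bullet> (a (post x \<sigma>) - a x - (r / 2) *\<^sub>R rel_derivative a x (\<sigma> - k)))
        - r ^ 3 / 4 * (1 - c) * (cross3 k y \<bullet> rel_derivative a x k))"
proof -
  interpret N: linear "rel_derivative a x" by (rule linear_rel_derivative)
  have c: "cross3 (rel x) (rel (post x \<sigma>)) = r\<^sup>2 *\<^sub>R cross3 k y"
    unfolding rel_post x(2) unfolding x(1) \<sigma>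
    by (simp add: cross_mult_left cross_mult_right cross_add_right power2_eq_square)
  have "\<sigma> - k = y - (1 - c) *\<^sub>R k" by (simp add: \<sigma> algebra_simps)
  then have n: "rel_derivative a x (\<sigma> - k) = rel_derivative a x y - (1 - c) *\<^sub>R rel_derivative a x k"
    by (simp add: N.diff N.scale)
  show ?thesis
    unfolding increment_def c n
    by (simp add: inner_add_right inner_diff_right field_simps power2_eq_square power3_eq_cube)
qed

lemma angle_bounds:
  fixes k \<sigma> :: "'a::real_inner"
  assumes k: "norm k = 1" and \<sigma>: "norm \<sigma> = 1"
  defines "\<theta> \<equiv> arccos (k \<bullet> \<sigma>)"
  shows "0 \<le> \<theta>" "cos \<theta> = k \<bullet> \<sigma>" "norm (\<sigma> - k) \<le> \<theta>" "1 - k \<bullet> \<sigma> \<le> \<theta>\<^sup>2 / 2" "0 \<le> 1 - k \<bullet> \<sigma>"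
    "norm (\<sigma> - (k \<bullet> \<sigma>) *\<^sub>R k) = sin \<theta>" "0 \<le> sin \<theta>" "sin \<theta> \<le> \<theta>" "\<theta> \<le> 1 \<Longrightarrow> \<theta>\<^sup>2 - (sin \<theta>)\<^sup>2 \<le> \<theta> ^ 3"
proof -
  have b: "\<bar>k \<bullet> \<sigma>\<bar> \<le> 1" using Cauchy_Schwarz_ineq2[of k \<sigma>] k \<sigma> by simp
  then have b': "-1 \<le> k \<bullet> \<sigma>" "k \<bullet> \<sigma> \<le> 1" by auto
  show t0: "0 \<le> \<theta>" unfolding \<theta>_def by (rule arccos_lbound[OF b'])
  show c: "cos \<theta> = k \<bullet> \<sigma>" unfolding \<theta>_def by (rule cos_arccos[OF b'])
  have "\<theta> \<le> pi" unfolding \<theta>_def by (rule arccos_ubound[OF b'])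
  then show s0: "0 \<le> sin \<theta>" using t0 by (rule sin_ge_zero[rotated])
  show st: "sin \<theta> \<le> \<theta>" by (rule sin_x_le_x[OF t0])
  have "1 - cos \<theta> = 2 * (sin (\<theta> / 2))\<^sup>2" using cos_double_sin[of "\<theta> / 2"] by simp
  also have "\<dots> \<le> 2 * (\<theta> / 2)\<^sup>2"
  proof -
    have "\<bar>sin (\<theta> / 2)\<bar> \<le> \<bar>\<theta> / 2\<bar>" by (rule abs_sin_x_le_abs_x)
    then have "(sin (\<theta> / 2))\<^sup>2 \<le> (\<theta> / 2)\<^sup>2" by (rule abs_le_square_iff[THEN iffD1])
    then show ?thesis by simp
  qed
  finally show h: "1 - k \<bullet> \<sigma> \<le> \<theta>\<^sup>2 / 2" by (simp add: c power2_eq_square)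
  show "0 \<le> 1 - k \<bullet> \<sigma>" using b' by simp
  have kk: "k \<bullet> k = 1" "\<sigma> \<bullet> \<sigma> = 1" using k \<sigma> by (simp_all add: norm_eq_1)
  have "(norm (\<sigma> - k))\<^sup>2 = 2 * (1 - k \<bullet> \<sigma>)"
    unfolding power2_norm_eq_inner by (simp add: inner_diff_left inner_diff_right kk inner_commute)
  also have "\<dots> \<le> \<theta>\<^sup>2" using h by simp
  finally show "norm (\<sigma> - k) \<le> \<theta>" using t0 by (rule power2_le_imp_le)
  have "(norm (\<sigma> - (k \<bullet> \<sigma>) *\<^sub>R k))\<^sup>2 = 1 - (cos \<theta>)\<^sup>2"
    unfolding power2_norm_eq_inner c by (simp add: inner_diff_left inner_diff_right kk inner_commute power2_eq_square)
  also have "\<dots> = (sin \<theta>)\<^sup>2" by (simp add: sin_squared_eq)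
  finally show "norm (\<sigma> - (k \<bullet> \<sigma>) *\<^sub>R k) = sin \<theta>" using s0 by (metis norm_ge_zero power2_eq_imp_eq)
  show "\<theta>\<^sup>2 - (sin \<theta>)\<^sup>2 \<le> \<theta> ^ 3" if "\<theta> \<le> 1"
  proof -
    have "\<bar>sin \<theta> - (\<Sum>m<3. sin_coeff m * \<theta> ^ m)\<bar> \<le> inverse (fact 3) * \<bar>\<theta>\<bar> ^ 3" by (rule Maclaurin_sin_bound)
    moreover have "(\<Sum>m<3. sin_coeff m * \<theta> ^ m) = \<theta>"
      by (simp add: lessThan_nat_numeral lessThan_Suc sin_coeff_def)
    moreover have "inverse (fact 3) * \<bar>\<theta>\<bar> ^ 3 = \<theta> ^ 3 / 6"
      using t0 by (simp add: fact_numeral field_simps)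
    ultimately have "\<bar>sin \<theta> - \<theta>\<bar> \<le> \<theta> ^ 3 / 6" by simp
    moreover have "\<theta> ^ 3 \<le> \<theta>\<^sup>2"
      using that t0 mult_left_le_one_le[of "\<theta>\<^sup>2" \<theta>] by (simp add: power3_eq_cube power2_eq_square mult_ac)
    ultimately have d: "\<theta> - sin \<theta> \<le> \<theta>\<^sup>2 / 6" "0 \<le> \<theta> - sin \<theta>" using st by linarith+
    have "\<theta>\<^sup>2 - (sin \<theta>)\<^sup>2 = (\<theta> - sin \<theta>) * (\<theta> + sin \<theta>)" by (simp add: power2_eq_square algebra_simps)
    also have "\<dots> \<le> (\<theta>\<^sup>2 / 6) * (\<theta> + \<theta>)" using d st t0 s0 by (intro mult_mono) auto
    also have "\<dots> = \<theta> ^ 3 / 3" by (simp add: power2_eq_square power3_eq_cube)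
    also have "\<dots> \<le> \<theta> ^ 3" using t0 by simp
    finally show ?thesis .
  qed
qed

text \<open>With w = k x y, the quarter turns replace y by w, -y and -w. First order terms cancel,
  second order terms combine to w . N y - y . N w and are evaluated by \<open>skew_trace\<close>,
  and the squares meet \<open>bessel_two\<close>. Compact support of the field makes the threshold
  t0 the same for all x.\<close>

lemma increment_expansion:
  fixes a :: "(real^3) \<times> (real^3) \<Rightarrow> real^3"
  assumes a: "\<And>j. C1c off_diagonal (\<lambda>x. a x $ j)" and \<eta>: "0 < \<eta>"
  obtains t0 where "0 < t0" "\<And>x \<sigma>. rel x \<noteq> 0 \<Longrightarrow> norm \<sigma> = 1 \<Longrightarrow> arccos ((rel x /\<^sub>R norm (rel x)) \<bullet> \<sigma>) < t0 \<Longrightarrow>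
    - (tangent (increment a x (post x \<sigma>))
       + tangent (increment a x (post x (qturn (rel x /\<^sub>R norm (rel x)) \<sigma>)))
       + tangent (increment a x (post x (qturn (rel x /\<^sub>R norm (rel x)) (qturn (rel x /\<^sub>R norm (rel x)) \<sigma>))))
       + tangent (increment a x (post x (qturn (rel x /\<^sub>R norm (rel x)) (qturn (rel x /\<^sub>R norm (rel x)) (qturn (rel x /\<^sub>R norm (rel x)) \<sigma>))))))
    \<le> 4 * (arccos ((rel x /\<^sub>R norm (rel x)) \<bullet> \<sigma>))\<^sup>2 * (symbol a x + \<eta>)"
proof -
  have "\<exists>r R. 0 < r \<and> (\<forall>x. \<not> (r \<le> norm (rel x) \<and> norm (rel x) \<le> R) \<longrightarrow> a x $ j = 0 \<and> nabla (\<lambda>x. a x $ j) x = 0)" for j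
    by (rule C1c_relative_range[OF a[of j]]) blast
  then have "\<exists>R. \<forall>x. norm (rel x) > R \<longrightarrow> a x $ j = 0 \<and> nabla (\<lambda>x. a x $ j) x = 0" for j
    by (meson leD)
  then obtain Rj where range: "\<And>j x. norm (rel x) > Rj j \<Longrightarrow> a x $ j = 0 \<and> nabla (\<lambda>x. a x $ j) x = 0"
    by metis
  define R where "R = max 1 (Max (range Rj))"
  have R1: "1 \<le> R" by (simp add: R_def)
  have RR: "Rj j \<le> R" for j unfolding R_def by (rule order_trans[OF Max_ge max.cobounded2]) auto
  have out: "a x = 0 \<and> (\<forall>j. nabla (\<lambda>x. a x $ j) x = 0)" if "norm (rel x) > R" for x
  proof -
    have "norm (rel x) > Rj j" for j using RR[of j] that by linarith
    then show ?thesis using range by (simp add: vec_eq_iff)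
  qed
  have "\<exists>C. 0 < C \<and> (\<forall>x. \<bar>a x $ j\<bar> \<le> C)" for j
    by (rule C1c_bounded[OF a[of j]]) blast
  then obtain Aj where Aj: "\<And>j. 0 < Aj j" "\<And>j x. \<bar>a x $ j\<bar> \<le> Aj j"
    by metis
  define A where "A = (\<Sum>j\<in>UNIV. Aj j)"
  have A: "norm (a x) \<le> A" "0 \<le> A" for x
    unfolding A_def using Aj(2) by (rule order_trans[OF norm_le_l1_cart sum_mono]) (intro sum_nonneg less_imp_le Aj(1))
  have "\<exists>B. 0 < B \<and> (\<forall>x. norm (nabla (\<lambda>x. a x $ j) x) \<le> B)" for j
  proof -
    obtain K where "compact K" "\<And>x. x \<notin> K \<Longrightarrow> nabla (\<lambda>x. a x $ j) x = 0" using C1c_support[OF a[of j]] by metis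
    then show ?thesis using compact_support_bounded[OF C1c_nabla_continuous[OF a[of j]]] by metis
  qed
  then obtain Bj where Bj: "\<And>j. 0 < Bj j" "\<And>j x. norm (nabla (\<lambda>x. a x $ j) x) \<le> Bj j" by metis
  define B where "B = (\<Sum>j\<in>UNIV. Bj j * 2)"
  have B0: "0 \<le> B" unfolding B_def by (intro sum_nonneg) (simp add: less_imp_le[OF Bj(1)])
  have B: "norm (rel_derivative a x h) \<le> B * norm h" for x h
  proof -
    have "norm (h, - h) \<le> 2 * norm h" using norm_Pair_le[of h "- h"] by simp
    then have "\<bar>nabla (\<lambda>x. a x $ j) x \<bullet> (h, - h)\<bar> \<le> Bj j * (2 * norm h)" for j
      using Bj(1)[of j] by (intro order_trans[OF Cauchy_Schwarz_ineq2] mult_mono Bj) auto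
    then have "norm (rel_derivative a x h) \<le> (\<Sum>j\<in>UNIV. Bj j * (2 * norm h))"
      unfolding rel_derivative_def by (intro order_trans[OF norm_le_l1_cart] sum_mono) simp
    also have "\<dots> = B * norm h" by (simp add: B_def sum_distrib_right mult.assoc)
    finally show ?thesis .
  qed
  have "\<exists>D. \<forall>x. \<bar>rotD j (\<lambda>x. a x $ j) x\<bar> \<le> D" for j
    by (rule rotD_bounded[OF a[of j], of j]) blast
  then obtain Dj where Dj: "\<And>j x. \<bar>rotD j (\<lambda>x. a x $ j) x\<bar> \<le> Dj j" by metis
  define Pm where "Pm = R\<^sup>2 / 2 * (\<Sum>j\<in>UNIV. Dj j) + R ^ 4 / 4 * A\<^sup>2"
  have Dn: "0 \<le> (\<Sum>j\<in>UNIV. Dj j)" using Dj[of _ undefined] by (intro sum_nonneg) (meson abs_ge_zero order_trans)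
  have Pm0: "0 \<le> Pm" unfolding Pm_def using Dn by simp
  have Pm: "\<bar>symbol a x\<bar> \<le> Pm" if "norm (rel x) \<le> R" for x
  proof -
    have "\<bar>\<Sum>j\<in>UNIV. rotD j (\<lambda>x. a x $ j) x\<bar> \<le> (\<Sum>j\<in>UNIV. Dj j)"
      using Dj by (intro order_trans[OF sum_abs] sum_mono) auto
    then have "\<bar>(norm (rel x))\<^sup>2 / 2 * (\<Sum>j\<in>UNIV. rotD j (\<lambda>x. a x $ j) x)\<bar> \<le> R\<^sup>2 / 2 * (\<Sum>j\<in>UNIV. Dj j)"
      unfolding abs_mult using that by (intro mult_mono) (auto intro!: power_mono)
    moreover have "\<bar>(norm (rel x)) ^ 4 / 4 * (norm (a x))\<^sup>2\<bar> \<le> R ^ 4 / 4 * A\<^sup>2"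
      unfolding abs_mult using that A(1)[of x] by (intro mult_mono) (auto intro!: power_mono)
    ultimately show ?thesis unfolding symbol_def Pm_def by linarith
  qed
  define C1 C2 M where "C1 = R\<^sup>2 * A" and "C2 = R ^ 3 / 4 * B" and "M = C1 + C2 + 1"
  have C0: "0 \<le> C1" "0 \<le> C2" using R1 A B0 by (auto simp: C1_def C2_def)
  then have M1: "1 \<le> M" by (simp add: M_def)
  \<comment> \<open>Each of the four turns contributes 2 e \<theta>^2; this choice keeps the total
    below \<eta> \<theta>^2.\<close>
  define e where "e = min 1 (\<eta> / 8)"
  have e: "0 < e" "e \<le> 1" "8 * e \<le> \<eta>" using \<eta> by (auto simp: e_def)
  \<comment> \<open>Three components, a displacement of at most R \<theta>, a cross product of
    length at most \<theta> and the prefactor R^2 / 2 turn this rate into e / 2 times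
    \<theta>^2.\<close>
  define \<omega> where "\<omega> = e / (3 * R ^ 3)"
  have \<omega>: "0 < \<omega>" using e R1 by (simp add: \<omega>_def)
  have "\<exists>d>0. \<forall>x y. norm (y - x) < d \<longrightarrow> \<bar>a y $ j - a x $ j - nabla (\<lambda>x. a x $ j) x \<bullet> (y - x)\<bar> \<le> \<omega> * norm (y - x)" for j
    using C1c_uniformly_differentiable[OF a[of j] \<omega>] by metis
  then obtain dj where dj: "\<And>j. 0 < dj j" "\<And>j x y. norm (y - x) < dj j \<Longrightarrow> \<bar>a y $ j - a x $ j - nabla (\<lambda>x. a x $ j) x \<bullet> (y - x)\<bar> \<le> \<omega> * norm (y - x)"
    by metis
  define d where "d = Min (range dj)"
  have d: "0 < d" "d \<le> dj j" for j unfolding d_def using dj(1) by auto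
  \<comment> \<open>In this order the entries ensure \<theta> <= 1, increments of size at most 1, a
    displacement within the Taylor radius, a small term with 1 - c, small cubic remainders, and a
    cheap replacement of sin^2 \<theta> by \<theta>^2.\<close>
  define t0 where "t0 = Min {1, 1 / M, d / R, e / (R ^ 3 * B + 1), \<eta> / (8 * M ^ 3), \<eta> / (4 * Pm + 1)}"
  have t0: "0 < t0"
    unfolding t0_def using M1 d(1) R1 e B0 \<eta> Pm0 by (auto intro!: divide_pos_pos add_nonneg_pos mult_nonneg_nonneg)
  show thesis
  proof (rule that[OF t0])
    fix x :: "(real^3) \<times> (real^3)" and \<sigma> :: "real^3"
    define r k where "r = norm (rel x)" and "k = rel x /\<^sub>R norm (rel x)"
    define \<theta> where "\<theta> = arccos (k \<bullet> \<sigma>)"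
    assume x0: "rel x \<noteq> 0" and \<sigma>: "norm \<sigma> = 1" and "arccos ((rel x /\<^sub>R norm (rel x)) \<bullet> \<sigma>) < t0"
    then have tt: "\<theta> < t0" by (simp add: \<theta>_def k_def)
    have r: "0 < r" "rel x = r *\<^sub>R k" "norm (rel x) = r" and k: "norm k = 1"
      using x0 by (auto simp: r_def k_def)
    note ang = angle_bounds[OF k \<sigma>, folded \<theta>_def]
    have \<theta>0: "0 \<le> \<theta>" by (rule ang(1))
    have small: "\<theta> \<le> 1" "M * \<theta> \<le> 1" "R * \<theta> < d" "(R ^ 3 * B + 1) * \<theta> \<le> e" "8 * M ^ 3 * \<theta> \<le> \<eta>" "(4 * Pm + 1) * \<theta> \<le> \<eta>"
    proof -
      have "\<theta> < 1" "\<theta> < 1 / M" "\<theta> < d / R" "\<theta> < e / (R ^ 3 * B + 1)" "\<theta> < \<eta> / (8 * M ^ 3)" "\<theta> < \<eta> / (4 * Pm + 1)"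
        using tt unfolding t0_def by auto
      moreover have "0 < M" "0 < R" "0 < R ^ 3 * B + 1" "0 < 8 * M ^ 3" "0 < 4 * Pm + 1"
        using M1 R1 B0 Pm0 by (auto intro!: add_nonneg_pos mult_nonneg_nonneg)
      ultimately show "\<theta> \<le> 1" "M * \<theta> \<le> 1" "R * \<theta> < d" "(R ^ 3 * B + 1) * \<theta> \<le> e" "8 * M ^ 3 * \<theta> \<le> \<eta>" "(4 * Pm + 1) * \<theta> \<le> \<eta>"
        by (auto simp: pos_less_divide_eq mult.commute intro: less_imp_le)
    qed
    define c where "c = k \<bullet> \<sigma>"
    define y where "y = \<sigma> - c *\<^sub>R k"
    define w where "w = cross3 k y"
    have kk: "k \<bullet> k = 1" using k by (simp add: norm_eq_1)
    have ky: "k \<bullet> y = 0" by (simp add: y_def c_def inner_diff_right kk)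
    have kw: "k \<bullet> w = 0" by (simp add: w_def dot_cross_self)
    have ww: "cross3 k w = - y" using Lagrange[of k k y] by (simp add: w_def ky kk)
    have ny: "norm y = sin \<theta>" using ang(6) by (simp add: y_def c_def)
    have nw: "norm w = sin \<theta>"
    proof -
      have "(norm w)\<^sup>2 = (norm y)\<^sup>2" using norm_cross_dot[of k y] k ky by (simp add: w_def)
      then show ?thesis using ny by (metis norm_ge_zero power2_eq_imp_eq)
    qed
    have ks: "cross3 k \<sigma> = w" by (simp add: w_def y_def cross_diff_right cross_mult_right)
    have s1: "\<sigma> = c *\<^sub>R k + y" by (simp add: y_def)
    have s2: "qturn k \<sigma> = c *\<^sub>R k + w" by (simp add: qturn_def c_def ks)
    have s3: "qturn k (qturn k \<sigma>) = c *\<^sub>R k + (- y)" unfolding qturn(3)[OF k] by (simp add: y_def c_def vec_eq_iff)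
    have s4: "qturn k (qturn k (qturn k \<sigma>)) = c *\<^sub>R k + (- w)" unfolding qturn(4)[OF k] by (simp add: c_def ks)
    have nq: "norm (qturn k s) = norm s" for s using qturn(2)[OF k] orthogonal_transformation_norm by blast
    have kq: "k \<bullet> qturn k s = k \<bullet> s" for s by (rule qturn(1)[OF k])
    let ?N = "rel_derivative a x"
    interpret N: linear ?N by (rule linear_rel_derivative)
    have one: "- tangent (increment a x (post x s)) \<le> 2 * (r\<^sup>2 * (cross3 k u \<bullet> a x)) + 2 * (r ^ 3 / 4 * (cross3 k u \<bullet> ?N u))
         + (r\<^sup>2 * (cross3 k u \<bullet> a x))\<^sup>2 / 2 + 2 * e * \<theta>\<^sup>2 + 2 * M ^ 3 * \<theta> ^ 3"
      if rR: "r \<le> R" and s: "s = c *\<^sub>R k + u" and ns: "norm s = 1" and ksc: "k \<bullet> s = c" and nu: "norm u = sin \<theta>" "norm (cross3 k u) = sin \<theta>" for s u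
    proof -
      let ?p = "r\<^sup>2 * (cross3 k u \<bullet> a x)" and ?t = "r ^ 3 / 4 * (cross3 k u \<bullet> ?N u)"
      let ?err = "a (post x s) - a x - (r / 2) *\<^sub>R ?N (s - k)"
      let ?E = "r\<^sup>2 / 2 * (cross3 k u \<bullet> ?err) - r ^ 3 / 4 * (1 - c) * (cross3 k u \<bullet> ?N k)"
      have dec: "increment a x (post x s) = ?p + ?t + ?E" by (rule increment_decomposition[OF r(2,3) s])
      have st: "sin \<theta> \<le> \<theta>" "0 \<le> sin \<theta>" by (rule ang)+
      have pw: "r\<^sup>2 \<le> R\<^sup>2" "r ^ 3 \<le> R ^ 3" using rR r(1) by (auto intro!: power_mono)
      have p: "\<bar>?p\<bar> \<le> C1 * \<theta>"
      proof -
        have "\<bar>cross3 k u \<bullet> a x\<bar> \<le> \<theta> * A"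
          using Cauchy_Schwarz_ineq2[of "cross3 k u" "a x"] mult_mono[of "norm (cross3 k u)" \<theta> "norm (a x)" A] nu st A \<theta>0 by simp
        then have "r\<^sup>2 * \<bar>cross3 k u \<bullet> a x\<bar> \<le> R\<^sup>2 * (\<theta> * A)" using pw by (intro mult_mono) auto
        then show ?thesis by (simp add: abs_mult C1_def mult_ac)
      qed
      have t: "\<bar>?t\<bar> \<le> C2 * \<theta>\<^sup>2"
      proof -
        have "norm (?N u) \<le> B * \<theta>" using B[of x u] mult_left_mono[of "norm u" \<theta> B] nu st B0 by simp
        then have "\<bar>cross3 k u \<bullet> ?N u\<bar> \<le> \<theta> * (B * \<theta>)"
          using Cauchy_Schwarz_ineq2[of "cross3 k u" "?N u"] mult_mono[of "norm (cross3 k u)" \<theta> "norm (?N u)" "B * \<theta>"] nu st \<theta>0 by simp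
        then have "r ^ 3 / 4 * \<bar>cross3 k u \<bullet> ?N u\<bar> \<le> R ^ 3 / 4 * (\<theta> * (B * \<theta>))" using pw R1 by (intro mult_mono) auto
        then show ?thesis using r(1) by (simp add: abs_mult C2_def mult_ac power2_eq_square)
      qed
      have E: "\<bar>?E\<bar> \<le> e * \<theta>\<^sup>2"
      proof -
        note angs = angle_bounds[OF k ns]
        have th: "arccos (k \<bullet> s) = \<theta>" by (simp add: ksc \<theta>_def c_def)
        have sk: "norm (s - k) \<le> \<theta>" using angs(3) th by simp
        have pd: "post x s - x = ((r / 2) *\<^sub>R (s - k), - ((r / 2) *\<^sub>R (s - k)))" by (rule post_diff[OF r(2,3)])
        have npd: "norm (post x s - x) \<le> r * \<theta>"
        proof -
          have "norm (post x s - x) \<le> norm ((r / 2) *\<^sub>R (s - k)) + norm (- ((r / 2) *\<^sub>R (s - k)))"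
            unfolding pd by (rule norm_Pair_le)
          also have "\<dots> = r * norm (s - k)" using r(1) by simp
          also have "\<dots> \<le> r * \<theta>" using sk r(1) by (intro mult_left_mono) auto
          finally show ?thesis .
        qed
        have "r * \<theta> \<le> R * \<theta>" using rR \<theta>0 by (intro mult_right_mono)
        then have close: "norm (post x s - x) < dj j" for j using npd small(3) d(2)[of j] by linarith
        have comp: "\<bar>?err $ j\<bar> \<le> \<omega> * (R * \<theta>)" for j
        proof -
          have "(r / 2) *\<^sub>R ?N (s - k) $ j = nabla (\<lambda>x. a x $ j) x \<bullet> (post x s - x)"
            unfolding pd by (simp add: rel_derivative_def inner_prod_def algebra_simps)
          then have "\<bar>?err $ j\<bar> \<le> \<omega> * norm (post x s - x)" using dj(2)[OF close[of j]] by simp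
          also have "\<dots> \<le> \<omega> * (R * \<theta>)" using npd \<open>r * \<theta> \<le> R * \<theta>\<close> \<omega> by (intro mult_left_mono) auto
          finally show ?thesis .
        qed
        have err: "norm ?err \<le> 3 * (\<omega> * (R * \<theta>))"
        proof -
          have "norm ?err \<le> (\<Sum>j\<in>UNIV. \<bar>?err $ j\<bar>)" by (rule norm_le_l1_cart)
          also have "\<dots> \<le> (\<Sum>j\<in>(UNIV::3 set). \<omega> * (R * \<theta>))" by (intro sum_mono comp)
          finally show ?thesis by simp
        qed
        have "\<bar>cross3 k u \<bullet> ?err\<bar> \<le> \<theta> * (3 * (\<omega> * (R * \<theta>)))"
          using Cauchy_Schwarz_ineq2[of "cross3 k u" ?err] mult_mono[of "norm (cross3 k u)" \<theta> "norm ?err" "3 * (\<omega> * (R * \<theta>))"] nu st \<theta>0 err by simp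
        then have "r\<^sup>2 / 2 * \<bar>cross3 k u \<bullet> ?err\<bar> \<le> R\<^sup>2 / 2 * (\<theta> * (3 * (\<omega> * (R * \<theta>))))" using pw by (intro mult_mono) auto
        also have "\<dots> = e / 2 * \<theta>\<^sup>2" using R1 by (simp add: \<omega>_def power2_eq_square power3_eq_cube)
        finally have E1: "\<bar>r\<^sup>2 / 2 * (cross3 k u \<bullet> ?err)\<bar> \<le> e / 2 * \<theta>\<^sup>2" by (simp add: abs_mult)
        have m1: "\<bar>cross3 k u \<bullet> ?N k\<bar> \<le> \<theta> * B"
          using Cauchy_Schwarz_ineq2[of "cross3 k u" "?N k"] mult_mono[of "norm (cross3 k u)" \<theta> "norm (?N k)" B] nu st \<theta>0 B[of x k] k by simp
        have m2: "r ^ 3 / 4 * (1 - c) \<le> R ^ 3 / 4 * (\<theta>\<^sup>2 / 2)" using pw ang(4,5) R1 by (intro mult_mono) (auto simp: c_def)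
        have "(r ^ 3 / 4 * (1 - c)) * \<bar>cross3 k u \<bullet> ?N k\<bar> \<le> (R ^ 3 / 4 * (\<theta>\<^sup>2 / 2)) * (\<theta> * B)"
          using R1 by (intro mult_mono[OF m2 m1]) auto
        also have "\<dots> = (R ^ 3 * B * \<theta>) / 8 * \<theta>\<^sup>2" by (simp add: mult_ac)
        also have "\<dots> \<le> e / 2 * \<theta>\<^sup>2"
        proof (rule mult_right_mono)
          have "R ^ 3 * B * \<theta> \<le> e" using small(4) \<theta>0 by (simp add: distrib_right)
          then show "R ^ 3 * B * \<theta> / 8 \<le> e / 2" using e(1) by linarith
        qed simp
        finally have E2: "\<bar>r ^ 3 / 4 * (1 - c) * (cross3 k u \<bullet> ?N k)\<bar> \<le> e / 2 * \<theta>\<^sup>2"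
          using r(1) ang(5) by (simp add: abs_mult c_def)
        have "\<bar>?E\<bar> \<le> e / 2 * \<theta>\<^sup>2 + e / 2 * \<theta>\<^sup>2" using E1 E2 by linarith
        then show ?thesis by simp
      qed
      have "- tangent (increment a x (post x s)) = exp (?p + ?t + ?E) - 1 + (?p + ?t + ?E)" unfolding dec tangent_def by simp
      also have "\<dots> \<le> 2 * ?p + 2 * ?t + ?p\<^sup>2 / 2 + 2 * e * \<theta>\<^sup>2 + 2 * (C1 + C2 + 1) ^ 3 * \<theta> ^ 3"
        by (rule increment_scalar_bound[OF p t E \<theta>0 small(1) _ less_imp_le[OF e(1)] e(2) C0]) (use small(2) in \<open>simp add: M_def\<close>)
      finally show ?thesis by (simp only: M_def)
    qed
    let ?T = "- (tangent (increment a x (post x \<sigma>)) + tangent (increment a x (post x (qturn k \<sigma>)))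
       + tangent (increment a x (post x (qturn k (qturn k \<sigma>)))) + tangent (increment a x (post x (qturn k (qturn k (qturn k \<sigma>))))))"
    have "?T \<le> 4 * \<theta>\<^sup>2 * (symbol a x + \<eta>)"
    proof (cases "r \<le> R")
      case True
      have cm: "cross3 k (- u) = - cross3 k u" for u using cross_minus_right by blast
      have t1: "- tangent (increment a x (post x \<sigma>)) \<le> 2 * (r\<^sup>2 * (w \<bullet> a x)) + 2 * (r ^ 3 / 4 * (w \<bullet> ?N y))
         + (r\<^sup>2 * (w \<bullet> a x))\<^sup>2 / 2 + 2 * e * \<theta>\<^sup>2 + 2 * M ^ 3 * \<theta> ^ 3"
        using one[OF True s1 \<sigma>] ny nw by (simp add: c_def w_def)
      have t2: "- tangent (increment a x (post x (qturn k \<sigma>))) \<le> 2 * (r\<^sup>2 * (- y \<bullet> a x)) + 2 * (r ^ 3 / 4 * (- y \<bullet> ?N w))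
         + (r\<^sup>2 * (- y \<bullet> a x))\<^sup>2 / 2 + 2 * e * \<theta>\<^sup>2 + 2 * M ^ 3 * \<theta> ^ 3"
        using one[OF True s2] ny nw unfolding ww by (simp add: nq \<sigma> kq c_def)
      have t3: "- tangent (increment a x (post x (qturn k (qturn k \<sigma>)))) \<le> 2 * (r\<^sup>2 * (- w \<bullet> a x)) + 2 * (r ^ 3 / 4 * (- w \<bullet> ?N (- y)))
         + (r\<^sup>2 * (- w \<bullet> a x))\<^sup>2 / 2 + 2 * e * \<theta>\<^sup>2 + 2 * M ^ 3 * \<theta> ^ 3"
        using one[OF True s3] ny nw unfolding cm w_def[symmetric] by (simp add: nq \<sigma> kq c_def)
      have t4: "- tangent (increment a x (post x (qturn k (qturn k (qturn k \<sigma>))))) \<le> 2 * (r\<^sup>2 * (y \<bullet> a x)) + 2 * (r ^ 3 / 4 * (y \<bullet> ?N (- w)))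
         + (r\<^sup>2 * (y \<bullet> a x))\<^sup>2 / 2 + 2 * e * \<theta>\<^sup>2 + 2 * M ^ 3 * \<theta> ^ 3"
        using one[OF True s4] ny nw unfolding cm ww by (simp add: nq \<sigma> kq c_def)
      have tr: "w \<bullet> ?N y - y \<bullet> ?N w = (sin \<theta>)\<^sup>2 * (\<Sum>j\<in>UNIV. ?N (cross3 (axis j 1) k) $ j)"
        using skew_trace[OF linear_rel_derivative ky, of a x] ny by (simp add: w_def)
      have trz: "r * (\<Sum>j\<in>UNIV. ?N (cross3 (axis j 1) k) $ j) = 2 * (\<Sum>j\<in>UNIV. rotD j (\<lambda>x. a x $ j) x)"
        unfolding sum_rotD_rel_derivative[symmetric] r(2) by (simp add: cross_mult_right N.scale sum_distrib_left)
      let ?D = "\<Sum>j\<in>UNIV. rotD j (\<lambda>x. a x $ j) x"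
      \<comment> \<open>Both vectors are orthogonal to k, so the component of a along k is given
        away here.\<close>
      have bes: "(w \<bullet> a x)\<^sup>2 + (y \<bullet> a x)\<^sup>2 \<le> (sin \<theta>)\<^sup>2 * (norm (a x))\<^sup>2"
        using bessel_two[of w y "a x"] ny nw by (simp add: w_def dot_cross_self)
      have "?T \<le> r ^ 3 * (w \<bullet> ?N y - y \<bullet> ?N w) + r ^ 4 * ((w \<bullet> a x)\<^sup>2 + (y \<bullet> a x)\<^sup>2) + 8 * e * \<theta>\<^sup>2 + 8 * M ^ 3 * \<theta> ^ 3"
      proof -
        have pm: "(r\<^sup>2 * X)\<^sup>2 = r ^ 4 * X\<^sup>2" for X by (simp add: power_mult_distrib flip: power_mult)
        show ?thesis using t1 t2 t3 t4 unfolding N.neg inner_minus_left inner_minus_right pm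
          by (simp add: algebra_simps)
      qed
      also have "r ^ 3 * (w \<bullet> ?N y - y \<bullet> ?N w) = 2 * r\<^sup>2 * (sin \<theta>)\<^sup>2 * ?D"
      proof -
        have "r ^ 3 * (w \<bullet> ?N y - y \<bullet> ?N w) = r\<^sup>2 * (sin \<theta>)\<^sup>2 * (r * (\<Sum>j\<in>UNIV. ?N (cross3 (axis j 1) k) $ j))"
          unfolding tr by (simp add: power2_eq_square power3_eq_cube)
        then show ?thesis unfolding trz by simp
      qed
      also have "2 * r\<^sup>2 * (sin \<theta>)\<^sup>2 * ?D + r ^ 4 * ((w \<bullet> a x)\<^sup>2 + (y \<bullet> a x)\<^sup>2) + 8 * e * \<theta>\<^sup>2 + 8 * M ^ 3 * \<theta> ^ 3
         \<le> 4 * (sin \<theta>)\<^sup>2 * symbol a x + 8 * e * \<theta>\<^sup>2 + 8 * M ^ 3 * \<theta> ^ 3"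
        using mult_left_mono[OF bes, of "r ^ 4"] r(1) by (simp add: symbol_def r_def[symmetric] algebra_simps)
      \<comment> \<open>Passing from sin^2 \<theta> to \<theta>^2 costs at most \<theta>^3 times the
        bound \<open>Pm\<close> of the symbol. Together with the errors from e and M this uses three
        of the four available \<eta> \<theta>^2.\<close>
      also have "\<dots> \<le> 4 * \<theta>\<^sup>2 * symbol a x + 4 * Pm * \<theta> * \<theta>\<^sup>2 + \<eta> * \<theta>\<^sup>2 + \<eta> * \<theta>\<^sup>2"
      proof -
        have "0 \<le> \<theta>\<^sup>2 - (sin \<theta>)\<^sup>2" using power_mono[OF ang(8,7), of 2] by simp
        then have "\<bar>((sin \<theta>)\<^sup>2 - \<theta>\<^sup>2) * symbol a x\<bar> \<le> \<theta> ^ 3 * Pm"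
          unfolding abs_mult using ang(9)[OF small(1)] Pm[of x] True r_def Pm0 \<theta>0 by (intro mult_mono) auto
        then have "4 * (sin \<theta>)\<^sup>2 * symbol a x \<le> 4 * \<theta>\<^sup>2 * symbol a x + 4 * Pm * \<theta> * \<theta>\<^sup>2"
          by (simp add: abs_le_iff algebra_simps power2_eq_square power3_eq_cube)
        moreover have "8 * e * \<theta>\<^sup>2 \<le> \<eta> * \<theta>\<^sup>2" using e(3) by (intro mult_right_mono) auto
        moreover have "8 * M ^ 3 * \<theta> ^ 3 \<le> \<eta> * \<theta>\<^sup>2"
          using mult_right_mono[OF small(5), of "\<theta>\<^sup>2"] by (simp add: power2_eq_square power3_eq_cube mult_ac)
        ultimately show ?thesis by linarith
      qed
      also have "4 * Pm * \<theta> * \<theta>\<^sup>2 \<le> \<eta> * \<theta>\<^sup>2"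
        using small(6) \<theta>0 by (intro mult_right_mono) (auto simp: distrib_right)
      finally have "?T \<le> 4 * \<theta>\<^sup>2 * symbol a x + 3 * \<eta> * \<theta>\<^sup>2" by simp
      also have "\<dots> \<le> 4 * \<theta>\<^sup>2 * (symbol a x + \<eta>)" using \<eta> by (simp add: algebra_simps)
      finally show ?thesis .
    next
      \<comment> \<open>Collisions preserve |v - w|, so beyond R the field vanishes before and after
        the collision.\<close>
      case False
      have z: "a x = 0" "\<And>j. nabla (\<lambda>x. a x $ j) x = 0" using out[of x] False r(3) by auto
      have zp: "increment a x (post x s) = 0" if "norm s = 1" for s
        using out[of "post x s"] False r z that unfolding increment_def rel_post by simp
      have "symbol a x = 0" by (simp add: symbol_def z rotD_def)
      moreover have "?T = 0" using zp nq \<sigma> by (simp add: tangent_def)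
      ultimately show ?thesis using \<eta> by simp
    qed
    then show "- (tangent (increment a x (post x \<sigma>))
       + tangent (increment a x (post x (qturn (rel x /\<^sub>R norm (rel x)) \<sigma>)))
       + tangent (increment a x (post x (qturn (rel x /\<^sub>R norm (rel x)) (qturn (rel x /\<^sub>R norm (rel x)) \<sigma>))))
       + tangent (increment a x (post x (qturn (rel x /\<^sub>R norm (rel x)) (qturn (rel x /\<^sub>R norm (rel x)) (qturn (rel x /\<^sub>R norm (rel x)) \<sigma>))))))
      \<le> 4 * (arccos ((rel x /\<^sub>R norm (rel x)) \<bullet> \<sigma>))\<^sup>2 * (symbol a x + \<eta>)"
      unfolding \<theta>_def k_def .
  qed
qed

section \<open>Weak convergence of tensor products\<close>

text \<open>Weak convergence in one factor gives only pointwise convergence of the partial integral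
  \<open>U\<close>. These integrals share the modulus of continuity of \<Phi>, whatever the density,
  and vanish for large v, so a finite net makes the convergence uniform. The other factor is then
  tested against the fixed function \<open>U f\<close>.\<close>

lemma tensor_weak_convergence:
  fixes F :: "'i \<Rightarrow> real^3 \<Rightarrow> real" and \<Phi> :: "(real^3) \<times> (real^3) \<Rightarrow> real"
  assumes dens: "eventually (\<lambda>i. prob_density (F i)) L" and f: "prob_density f" and conv: "weak_star_conv F f L"
    and \<Phi>: "continuous_on UNIV \<Phi>" and K: "compact K" "\<And>x. x \<notin> K \<Longrightarrow> \<Phi> x = 0"
  shows "((\<lambda>i. \<integral>x. tensor (F i) x * \<Phi> x \<partial>lborel) \<longlongrightarrow> (\<integral>x. tensor f x * \<Phi> x \<partial>lborel)) L"
proof -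
  obtain C where C: "C > 0" "\<And>x. \<bar>\<Phi> x\<bar> \<le> C" using compact_support_bounded[OF \<Phi> K] by auto
  obtain R where R: "\<And>x. x \<in> K \<Longrightarrow> norm x \<le> R" using compact_imp_bounded[OF K(1)] bounded_iff by metis
  have [measurable]: "\<Phi> \<in> borel_measurable borel" using \<Phi> by (rule borel_measurable_continuous_onI)
  define U where "U g v = (\<integral>w. \<Phi> (v, w) * g w \<partial>lborel)" for g :: "real^3 \<Rightarrow> real" and v
  have gi: "integrable lborel g" "(\<integral>v. g v \<partial>lborel) = 1" "\<And>v. 0 \<le> g v" if "prob_density g" for g
  proof -
    have m: "g \<in> borel_measurable borel" and n: "\<And>v. 0 \<le> g v" and N: "(\<integral>\<^sup>+v. ennreal (g v) \<partial>lborel) = 1"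
      using that by (auto simp: prob_density_def)
    show i: "integrable lborel g" by (rule integrableI_nonneg) (use m N n in auto)
    show "(\<integral>v. g v \<partial>lborel) = 1" using nn_integral_eq_integral[OF i] n N by (simp add: ennreal_eq_1)
    show "\<And>v. 0 \<le> g v" by (rule n)
  qed
  have \<Phi>c: "continuous_on UNIV (\<lambda>w. \<Phi> (v, w))" for v
    by (rule continuous_on_compose2[OF \<Phi>]) (auto intro!: continuous_intros)
  have \<Phi>m[measurable]: "(\<lambda>w. \<Phi> (v, w)) \<in> borel_measurable borel" for v
    using \<Phi>c by (rule borel_measurable_continuous_onI)
  have ui: "integrable lborel (\<lambda>w. \<Phi> (v, w) * g w)" if "prob_density g" for g v
    using integrable_mult_bounded[OF gi(1)[OF that] _ C(2), of "\<lambda>w. (v, w)"]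
      integrable_mult_bounded[OF gi(1)[OF that], of "\<lambda>w. \<Phi> (v, w)" C] C(2) by (simp add: mult.commute)
  have Ulip: "\<bar>U g v - U g v'\<bar> \<le> e" if g: "prob_density g" and e: "\<And>w. \<bar>\<Phi> (v, w) - \<Phi> (v', w)\<bar> \<le> e" for g v v' e
  proof -
    have "U g v - U g v' = (\<integral>w. (\<Phi> (v, w) - \<Phi> (v', w)) * g w \<partial>lborel)"
      unfolding U_def using ui[OF g] by (simp add: left_diff_distrib)
    also have "\<bar>\<dots>\<bar> \<le> (\<integral>w. \<bar>(\<Phi> (v, w) - \<Phi> (v', w)) * g w\<bar> \<partial>lborel)" by (rule integral_abs_bound)
    also have "\<dots> \<le> (\<integral>w. e * g w \<partial>lborel)"
    proof (rule integral_mono)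
      show "integrable lborel (\<lambda>w. \<bar>(\<Phi> (v, w) - \<Phi> (v', w)) * g w\<bar>)"
        using ui[OF g] by (simp add: left_diff_distrib)
      show "integrable lborel (\<lambda>w. e * g w)" using gi[OF g] by simp
      show "\<bar>(\<Phi> (v, w) - \<Phi> (v', w)) * g w\<bar> \<le> e * g w" for w
        using e[of w] gi(3)[OF g, of w] by (simp add: abs_mult mult_right_mono)
    qed
    also have "\<dots> = e" using gi[OF g] by simp
    finally show ?thesis .
  qed
  have near: "\<exists>d>0. \<forall>g v v'. prob_density g \<longrightarrow> norm (v - v') < d \<longrightarrow> \<bar>U g v - U g v'\<bar> \<le> e" if e: "0 < e" for e
  proof -
    obtain d where d: "0 < d" "\<And>x y. norm (y - x) < d \<Longrightarrow> norm (\<Phi> y - \<Phi> x) < e"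
      using compact_support_uniformly_continuous[OF \<Phi> K e] by metis
    have "\<bar>\<Phi> (v, w) - \<Phi> (v', w)\<bar> \<le> e" if "norm (v - v') < d" for v v' w
      using d(2)[of "(v, w)" "(v', w)"] that by (simp add: norm_Pair less_imp_le)
    then show ?thesis using d(1) Ulip by blast
  qed
  have Uc: "continuous_on UNIV (U g)" if g: "prob_density g" for g
    unfolding continuous_on_iff
  proof (intro ballI allI impI)
    fix v :: "real^3" and e :: real assume "0 < e"
    then obtain d where d: "d > 0" "\<And>v'. norm (v' - v) < d \<Longrightarrow> \<bar>U g v' - U g v\<bar> \<le> e / 2" using near[of "e / 2"] g by auto
    have "dist (U g v') (U g v) < e" if "dist v' v < d" for v'
      using d(2)[of v'] that \<open>0 < e\<close> by (simp add: dist_norm)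
    then show "\<exists>d>0. \<forall>v'\<in>UNIV. dist v' v < d \<longrightarrow> dist (U g v') (U g v) < e" using d(1) by blast
  qed
  have Ub: "\<bar>U g v\<bar> \<le> C" if g: "prob_density g" for g v
  proof -
    have "\<bar>U g v\<bar> \<le> (\<integral>w. \<bar>\<Phi> (v, w) * g w\<bar> \<partial>lborel)" unfolding U_def by (rule integral_abs_bound)
    also have "\<dots> \<le> (\<integral>w. C * g w \<partial>lborel)"
    proof (rule integral_mono)
      show "integrable lborel (\<lambda>w. \<bar>\<Phi> (v, w) * g w\<bar>)" using ui[OF g] by (rule integrable_abs)
      show "integrable lborel (\<lambda>w. C * g w)" using gi[OF g] by simp
      show "\<bar>\<Phi> (v, w) * g w\<bar> \<le> C * g w" for w
        using C(2)[of "(v, w)"] gi(3)[OF g, of w] by (simp add: abs_mult mult_right_mono)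
    qed
    also have "\<dots> = C" using gi[OF g] by simp
    finally show ?thesis .
  qed
  have Uz: "U g v = 0" if "norm v > R" for g v
  proof -
    have "\<Phi> (v, w) = 0" for w
    proof (rule K(2))
      have "norm v \<le> norm (v, w)" by (rule norm_fst_le)
      then show "(v, w) \<notin> K" using R that by force
    qed
    then show ?thesis by (simp add: U_def)
  qed
  have ptw: "((\<lambda>i. U (F i) v) \<longlongrightarrow> U f v) L" for v
  proof -
    have "bounded (range (\<lambda>w. \<Phi> (v, w)))" unfolding bounded_iff using C(2) by auto
    then show ?thesis using conv \<Phi>c[of v] unfolding weak_star_conv_def U_def by blast
  qed
  have unif: "eventually (\<lambda>i. \<forall>v. \<bar>U (F i) v - U f v\<bar> \<le> 3 * e) L" if e: "0 < e" for e
  proof -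
    obtain d where d: "0 < d" "\<And>g v v'. prob_density g \<Longrightarrow> norm (v - v') < d \<Longrightarrow> \<bar>U g v - U g v'\<bar> \<le> e"
      using near[OF e] by blast
    obtain T where T: "finite T" "cball 0 R \<subseteq> (\<Union>c\<in>T. ball (c::real^3) d)"
      using compact_eq_totally_bounded[THEN iffD1, OF compact_cball[of "0::real^3" R]] d(1) by blast
    have "eventually (\<lambda>i. \<bar>U (F i) c - U f c\<bar> < e) L" for c
      using tendstoD[OF ptw e, of c] by (simp add: dist_norm)
    then have "eventually (\<lambda>i. \<forall>c\<in>T. \<bar>U (F i) c - U f c\<bar> < e) L" using T(1) by (simp add: eventually_ball_finite)
    with dens show ?thesis
    proof eventually_elim
      case (elim i)
      show ?case
      proof
        fix v
        show "\<bar>U (F i) v - U f v\<bar> \<le> 3 * e"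
        proof (cases "norm v > R")
          case False
          then obtain c where c: "c \<in> T" "norm (v - c) < d" using T(2) by (force simp: dist_norm norm_minus_commute)
          have "\<bar>U (F i) v - U (F i) c\<bar> \<le> e" "\<bar>U f v - U f c\<bar> \<le> e" "\<bar>U (F i) c - U f c\<bar> < e"
            using d(2)[OF _ c(2)] elim f c(1) by auto
          then show ?thesis by linarith
        qed (use Uz e in simp)
      qed
    qed
  qed
  have tens: "(\<integral>x. tensor g x * \<Phi> x \<partial>lborel) = (\<integral>v. U g v * g v \<partial>lborel)" if g: "prob_density g" for g
  proof -
    have i: "integrable (lborel \<Otimes>\<^sub>M lborel) (\<lambda>x. tensor g x * \<Phi> x)"
      unfolding lborel_prod by (rule integrable_mult_bounded[OF tensor_density(3)[OF g] _ C(2)]) simp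
    have "(\<integral>x. tensor g x * \<Phi> x \<partial>lborel) = (\<integral>v. \<integral>w. tensor g (v, w) * \<Phi> (v, w) \<partial>lborel \<partial>lborel)"
      using lborel_pair.integral_fst'[OF i] by (simp add: lborel_prod)
    also have "\<dots> = (\<integral>v. U g v * g v \<partial>lborel)"
      unfolding U_def tensor_def by (intro Bochner_Integration.integral_cong refl) (simp add: mult_ac flip: integral_mult_right_zero)
    finally show ?thesis .
  qed
  have gU: "integrable lborel (\<lambda>v. U h v * g v)" if g: "prob_density g" and h: "prob_density h" for g h
  proof -
    have m: "U h \<in> borel_measurable lborel" using borel_measurable_continuous_onI[OF Uc[OF h]] by simp
    from integrable_mult_bounded[OF gi(1)[OF g] m Ub[OF h]] show ?thesis by (simp add: mult.commute)
  qed
  have lim1: "((\<lambda>i. \<integral>v. U f v * F i v \<partial>lborel) \<longlongrightarrow> (\<integral>v. U f v * f v \<partial>lborel)) L"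
  proof -
    have "bounded (range (U f))" unfolding bounded_iff using Ub[OF f] by auto
    then show ?thesis using conv Uc[OF f] unfolding weak_star_conv_def by blast
  qed
  \<comment> \<open>Replacing \<open>U (F i)\<close> by \<open>U f\<close> costs at most their
    uniform distance, since \<open>F i\<close> has mass one.\<close>
  have lim2: "((\<lambda>i. (\<integral>x. tensor (F i) x * \<Phi> x \<partial>lborel) - (\<integral>v. U f v * F i v \<partial>lborel)) \<longlongrightarrow> 0) L"
  proof (rule tendstoI)
    fix e :: real assume e: "0 < e"
    have "eventually (\<lambda>i. \<forall>v. \<bar>U (F i) v - U f v\<bar> \<le> 3 * (e / 6)) L" using unif[of "e / 6"] e by simp
    with dens show "eventually (\<lambda>i. dist ((\<integral>x. tensor (F i) x * \<Phi> x \<partial>lborel) - (\<integral>v. U f v * F i v \<partial>lborel)) 0 < e) L"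
    proof eventually_elim
      case (elim i)
      note g = elim(1)
      have "(\<integral>x. tensor (F i) x * \<Phi> x \<partial>lborel) - (\<integral>v. U f v * F i v \<partial>lborel) = (\<integral>v. (U (F i) v - U f v) * F i v \<partial>lborel)"
        unfolding tens[OF g] using gU[OF g g] gU[OF g f] by (simp add: left_diff_distrib)
      also have "\<bar>\<dots>\<bar> \<le> (\<integral>v. \<bar>(U (F i) v - U f v) * F i v\<bar> \<partial>lborel)" by (rule integral_abs_bound)
      also have "\<dots> \<le> (\<integral>v. e / 2 * F i v \<partial>lborel)"
      proof (rule integral_mono)
        show "integrable lborel (\<lambda>v. \<bar>(U (F i) v - U f v) * F i v\<bar>)" using gU[OF g g] gU[OF g f] by (simp add: left_diff_distrib)
        show "integrable lborel (\<lambda>v. e / 2 * F i v)" using gi[OF g] by simp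
        show "\<bar>(U (F i) v - U f v) * F i v\<bar> \<le> e / 2 * F i v" for v
        proof -
          have "\<bar>U (F i) v - U f v\<bar> \<le> e / 2" using elim(2)[rule_format, of v] by simp
          from mult_right_mono[OF this gi(3)[OF g, of v]] show ?thesis
            using gi(3)[OF g, of v] by (simp only: abs_mult abs_of_nonneg)
        qed
      qed
      also have "\<dots> = e / 2" using gi[OF g] by simp
      finally show ?case using e by (simp add: dist_norm)
    qed
  qed
  show ?thesis using tendsto_add[OF lim2 lim1] unfolding tens[OF f] by simp
qed

section \<open>The lower bound in the grazing limit\<close>

lemma distr_sphere_orthogonal:
  assumes R: "orthogonal_transformation R"
  shows "distr sphere_measure borel R = sphere_measure"
proof (rule measure_eqI)
  note [measurable] = borel_measurable_orthogonal[OF R]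
  fix A assume "A \<in> sets (distr sphere_measure borel R)"
  then have [measurable]: "A \<in> sets borel" by simp
  have "emeasure (distr sphere_measure borel R) A = (\<integral>\<^sup>+x. indicator A x \<partial>distr sphere_measure borel R)" by simp
  also have "\<dots> = (\<integral>\<^sup>+x. indicator A (R x) \<partial>sphere_measure)" by (rule nn_integral_distr) auto
  also have "\<dots> = emeasure sphere_measure A" by (subst nn_integral_sphere_orthogonal[OF R]) auto
  finally show "emeasure (distr sphere_measure borel R) A = emeasure sphere_measure A" .
qed simp

lemma integral_sphere_orthogonal:
  fixes F :: "real^3 \<Rightarrow> real"
  assumes R: "orthogonal_transformation R" and [measurable]: "F \<in> borel_measurable borel"
  shows "(\<integral>\<sigma>. F (R \<sigma>) \<partial>sphere_measure) = (\<integral>\<sigma>. F \<sigma> \<partial>sphere_measure)"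
  using borel_measurable_orthogonal[OF R]
  by (subst (2) distr_sphere_orthogonal[OF R, symmetric]) (simp add: integral_distr)

text \<open>The singularity of \<open>\<beta>\<close> at \<open>0\<close> is cut off at \<open>\<delta>\<close>, which makes the kernel bounded.\<close>

definition trunc_mass :: "(real \<Rightarrow> real) \<Rightarrow> real \<Rightarrow> real" where
  "trunc_mass \<beta> \<delta> = enn2real (\<integral>\<^sup>+u. ennreal (u\<^sup>2 * \<beta> u) * indicator {\<delta>..<pi/2} u \<partial>lborel)"

definition trunc_kernel :: "(real \<Rightarrow> real) \<Rightarrow> real \<Rightarrow> real \<Rightarrow> real \<Rightarrow> real" where
  "trunc_kernel \<beta> \<delta> \<epsilon> \<theta> = (if \<epsilon> * \<delta> / pi \<le> \<theta> \<and> \<theta> < \<epsilon> / 2 then pi ^ 3 / \<epsilon> ^ 3 * \<beta> (pi * \<theta> / \<epsilon>) / sin \<theta> else 0)"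

text \<open>The sine cancels against the density of the deviation angle. Under u = pi \<theta> /
  \<epsilon> the factors \<theta>^2, pi^3 / \<epsilon>^3 and d\<theta> balance, so the second
  angular moment does not depend on \<epsilon>: the grazing scaling is chosen for this.\<close>

lemma trunc_kernel_mass:
  assumes [measurable]: "\<beta> \<in> borel_measurable borel" and \<beta>: "\<And>\<theta>. 0 \<le> \<beta> \<theta>"
    and mass: "(\<integral>\<^sup>+ \<theta>\<in>{0..pi/2}. ennreal (\<theta>\<^sup>2 * \<beta> \<theta>) \<partial>lborel) < \<infinity>"
    and \<delta>: "0 < \<delta>" and \<epsilon>: "0 < \<epsilon>" "\<epsilon> \<le> 1" and k: "norm k = 1"
  shows "(\<integral>\<^sup>+\<sigma>. ennreal ((arccos (k \<bullet> \<sigma>))\<^sup>2 * trunc_kernel \<beta> \<delta> \<epsilon> (arccos (k \<bullet> \<sigma>))) \<partial>sphere_measure) = ennreal (2 * pi * trunc_mass \<beta> \<delta>)"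
proof -
  define T where "T = \<epsilon> / 2"
  have T: "0 < T" "T < pi / 2" using \<epsilon> pi_gt3 by (auto simp: T_def)
  have [measurable]: "trunc_kernel \<beta> \<delta> \<epsilon> \<in> borel_measurable borel" unfolding trunc_kernel_def[abs_def] by measurable
  have "(\<integral>\<^sup>+\<sigma>. ennreal ((arccos (k \<bullet> \<sigma>))\<^sup>2 * trunc_kernel \<beta> \<delta> \<epsilon> (arccos (k \<bullet> \<sigma>))) \<partial>sphere_measure)
     = ennreal (2 * pi) * (\<integral>\<^sup>+\<theta>. ennreal (\<theta>\<^sup>2 * trunc_kernel \<beta> \<delta> \<epsilon> \<theta>) * ennreal (sin \<theta>) * indicator {0..T} \<theta> \<partial>lborel)"
    by (rule nn_integral_sphere_angle[OF k _ T, of "\<lambda>\<theta>. ennreal (\<theta>\<^sup>2 * trunc_kernel \<beta> \<delta> \<epsilon> \<theta>)"]) (auto simp: trunc_kernel_def T_def)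
  also have "(\<integral>\<^sup>+\<theta>. ennreal (\<theta>\<^sup>2 * trunc_kernel \<beta> \<delta> \<epsilon> \<theta>) * ennreal (sin \<theta>) * indicator {0..T} \<theta> \<partial>lborel)
     = (\<integral>\<^sup>+\<theta>. ennreal (pi / \<epsilon>) * (ennreal ((0 + pi / \<epsilon> * \<theta>)\<^sup>2 * \<beta> (0 + pi / \<epsilon> * \<theta>)) * indicator {\<delta>..<pi/2} (0 + pi / \<epsilon> * \<theta>)) \<partial>lborel)"
  proof (rule nn_integral_cong)
    fix \<theta> :: real
    show "ennreal (\<theta>\<^sup>2 * trunc_kernel \<beta> \<delta> \<epsilon> \<theta>) * ennreal (sin \<theta>) * indicator {0..T} \<theta>
      = ennreal (pi / \<epsilon>) * (ennreal ((0 + pi / \<epsilon> * \<theta>)\<^sup>2 * \<beta> (0 + pi / \<epsilon> * \<theta>)) * indicator {\<delta>..<pi/2} (0 + pi / \<epsilon> * \<theta>))"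
    proof (cases "\<epsilon> * \<delta> / pi \<le> \<theta> \<and> \<theta> < \<epsilon> / 2")
      case True
      then have "0 < \<epsilon> * \<delta> / pi" using \<epsilon> \<delta> by simp
      then have \<theta>: "0 < \<theta>" "\<theta> < pi" using True T pi_gt_zero by (auto simp: T_def)
      then have s: "0 < sin \<theta>" by (rule sin_gt_zero)
      have u: "\<delta> \<le> pi / \<epsilon> * \<theta>" "pi / \<epsilon> * \<theta> < pi / 2" using True \<epsilon> by (auto simp: field_simps)
      have "\<theta>\<^sup>2 * trunc_kernel \<beta> \<delta> \<epsilon> \<theta> * sin \<theta> = pi / \<epsilon> * ((pi / \<epsilon> * \<theta>)\<^sup>2 * \<beta> (pi / \<epsilon> * \<theta>))"
        using True s \<epsilon> by (simp add: trunc_kernel_def power2_eq_square power3_eq_cube mult_ac)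
      moreover have "0 \<le> trunc_kernel \<beta> \<delta> \<epsilon> \<theta>" using True s \<epsilon> \<beta> by (simp add: trunc_kernel_def)
      ultimately show ?thesis using True \<theta> u s \<epsilon> \<beta> by (simp add: T_def ennreal_mult[symmetric])
    next
      case False
      then have "\<not> (\<delta> \<le> pi / \<epsilon> * \<theta> \<and> pi / \<epsilon> * \<theta> < pi / 2)" using \<epsilon> by (auto simp: field_simps)
      then show ?thesis using False by (auto simp: trunc_kernel_def indicator_def)
    qed
  qed
  also have "\<dots> = ennreal (pi / \<epsilon>) * (\<integral>\<^sup>+\<theta>. ennreal ((0 + pi / \<epsilon> * \<theta>)\<^sup>2 * \<beta> (0 + pi / \<epsilon> * \<theta>)) * indicator {\<delta>..<pi/2} (0 + pi / \<epsilon> * \<theta>) \<partial>lborel)"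
    by (rule nn_integral_cmult) measurable
  also have "\<dots> = (\<integral>\<^sup>+u. ennreal (u\<^sup>2 * \<beta> u) * indicator {\<delta>..<pi/2} u \<partial>lborel)"
    using nn_integral_real_affine[of "\<lambda>u. ennreal (u\<^sup>2 * \<beta> u) * indicator {\<delta>..<pi/2} u" "pi / \<epsilon>" 0] \<epsilon> by simp
  also have "\<dots> = ennreal (trunc_mass \<beta> \<delta>)"
  proof -
    have "(\<integral>\<^sup>+u. ennreal (u\<^sup>2 * \<beta> u) * indicator {\<delta>..<pi/2} u \<partial>lborel) \<le> (\<integral>\<^sup>+ \<theta>\<in>{0..pi/2}. ennreal (\<theta>\<^sup>2 * \<beta> \<theta>) \<partial>lborel)"
      using \<delta> by (intro nn_integral_mono) (auto simp: indicator_def)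
    also have "\<dots> < \<infinity>" by (rule mass)
    finally show ?thesis unfolding trunc_mass_def by (metis ennreal_enn2real infinity_ennreal_def)
  qed
  finally show ?thesis by (simp add: ennreal_mult trunc_mass_def)
qed

text \<open>Monotone convergence. The windows exhaust the open interval from 0 to pi / 2, and its
  two end points are null sets.\<close>

lemma trunc_mass_tendsto:
  assumes [measurable]: "\<beta> \<in> borel_measurable borel" and \<beta>: "\<And>\<theta>. 0 \<le> \<beta> \<theta>"
    and mass: "(\<integral>\<^sup>+ \<theta>\<in>{0..pi/2}. ennreal (\<theta>\<^sup>2 * \<beta> \<theta>) \<partial>lborel) = ennreal m" and m: "0 \<le> m"
  shows "(\<lambda>n. trunc_mass \<beta> (1 / real (Suc n))) \<longlonglongrightarrow> m"
proof -
  let ?f = "\<lambda>n u. ennreal (u\<^sup>2 * \<beta> u) * indicator {1 / real (Suc n)..<pi/2} u"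
  have "(\<lambda>n. \<integral>\<^sup>+u. ?f n u \<partial>lborel) \<longlonglongrightarrow> (\<integral>\<^sup>+u. (SUP n. ?f n u) \<partial>lborel)"
  proof (subst nn_integral_monotone_convergence_SUP)
    show inc: "incseq ?f"
    proof (rule incseq_SucI, rule le_funI)
      fix n :: nat and u :: real
      have "1 / real (Suc (Suc n)) \<le> 1 / real (Suc n)" by (intro divide_left_mono) auto
      then show "?f n u \<le> ?f (Suc n) u" by (auto simp: indicator_def intro!: mult_left_mono)
    qed
    show "(\<lambda>n. \<integral>\<^sup>+u. ?f n u \<partial>lborel) \<longlonglongrightarrow> (SUP n. \<integral>\<^sup>+u. ?f n u \<partial>lborel)"
      by (rule LIMSEQ_SUP) (use inc in \<open>auto simp: incseq_def le_fun_def intro!: nn_integral_mono\<close>)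
  qed measurable
  also have "(\<integral>\<^sup>+u. (SUP n. ?f n u) \<partial>lborel) = (\<integral>\<^sup>+ \<theta>\<in>{0..pi/2}. ennreal (\<theta>\<^sup>2 * \<beta> \<theta>) \<partial>lborel)"
  proof (rule nn_integral_cong_AE, use AE_lborel_singleton[of 0] AE_lborel_singleton[of "pi/2"] in eventually_elim)
    case (elim u)
    show ?case
    proof (cases "0 < u \<and> u < pi / 2")
      case True
      obtain n where n: "1 / real (Suc n) < u" using True reals_Archimedean[of u] by (auto simp: inverse_eq_divide)
      have "(SUP n. ?f n u) = ennreal (u\<^sup>2 * \<beta> u)"
      proof (rule antisym)
        show "(SUP n. ?f n u) \<le> ennreal (u\<^sup>2 * \<beta> u)" by (rule SUP_least) (auto simp: indicator_def)
        have "?f n u = ennreal (u\<^sup>2 * \<beta> u)" using n True by (simp add: indicator_def)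
        moreover have "?f n u \<le> (SUP n. ?f n u)" by (rule SUP_upper) simp
        ultimately show "ennreal (u\<^sup>2 * \<beta> u) \<le> (SUP n. ?f n u)" by (simp only:)
      qed
      then show ?thesis using True by simp
    next
      case False
      have z: "?f n u = 0" for n
      proof -
        have p: "0 < 1 / real (Suc n)" by simp
        have "u \<notin> {1 / real (Suc n)..<pi/2}"
        proof
          assume "u \<in> {1 / real (Suc n)..<pi/2}"
          then have "1 / real (Suc n) \<le> u" "u < pi/2" by (simp_all only: atLeastLessThan_iff)
          with p False show False by linarith
        qed
        then show ?thesis by simp
      qed
      have "u \<notin> {0..pi/2}" using False elim by auto
      then show ?thesis unfolding z by simp
    qed
  qed
  finally have "(\<lambda>n. \<integral>\<^sup>+u. ?f n u \<partial>lborel) \<longlonglongrightarrow> ennreal m" unfolding mass .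
  then have "(\<lambda>n. enn2real (\<integral>\<^sup>+u. ?f n u \<partial>lborel)) \<longlonglongrightarrow> m"
    using m by (rule tendsto_enn2real)
  then show ?thesis by (simp add: trunc_mass_def)
qed

lemma norm_cross3_le: "norm (cross3 x y) \<le> norm x * norm y"
proof (rule power2_le_imp_le)
  show "(norm (cross3 x y))\<^sup>2 \<le> (norm x * norm y)\<^sup>2"
    using norm_cross_dot[of x y] zero_le_power2[of "x \<bullet> y"] by linarith
qed simp

lemma continuous_vec_components:
  fixes b :: "'a::euclidean_space \<Rightarrow> real^3"
  assumes "\<And>j. continuous_on UNIV (\<lambda>x. b x $ j)"
  shows "continuous_on UNIV b"
proof -
  have "continuous_on UNIV (\<lambda>x. \<Sum>i\<in>UNIV. b x $ i *\<^sub>R axis i (1::real))"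
    by (intro continuous_on_sum continuous_on_scaleR assms continuous_on_const)
  moreover have "(\<Sum>i\<in>UNIV. b x $ i *\<^sub>R axis i 1) = b x" for x
    using basis_expansion[of "b x"] by (simp add: scalar_mult_eq_scaleR)
  ultimately show ?thesis by simp
qed

text \<open>The order of the quantifiers is the point: C precedes \<delta> and \<eta>, and the
  smallness of \<epsilon> is uniform over all densities, so the bound may be applied to a density
  that varies with \<epsilon>.\<close>

lemma boltzmann_grazing_bound:
  assumes \<beta>m[measurable]: "\<beta> \<in> borel_measurable borel" and \<beta>: "\<And>\<theta>. 0 \<le> \<beta> \<theta>"
    and bdd: "\<And>\<delta>. 0 < \<delta> \<Longrightarrow> bdd_above (\<beta> ` {\<delta>..pi/2})"
    and mass: "(\<integral>\<^sup>+ \<theta>\<in>{0..pi/2}. ennreal (\<theta>\<^sup>2 * \<beta> \<theta>) \<partial>lborel) < \<infinity>"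
    and a: "\<And>j. C1c off_diagonal (\<lambda>x. a x $ j)"
  shows "\<exists>C. \<forall>\<delta> \<eta>. 0 < \<delta> \<longrightarrow> 0 < \<eta> \<longrightarrow> (\<forall>\<^sub>F \<epsilon> in at_right 0. \<forall>f. prob_density f \<longrightarrow>
     ennreal (- (pi * trunc_mass \<beta> \<delta>) * ((\<integral>x. tensor f x * (norm (rel x) powr \<gamma> * symbol a x) \<partial>lborel) + \<eta> * C))
       \<le> boltzmann_dissipation (collision_kernel \<gamma> \<beta> \<epsilon>) f)"
proof -
  have "\<exists>r R. 0 < r \<and> (\<forall>x. \<not> (r \<le> norm (rel x) \<and> norm (rel x) \<le> R) \<longrightarrow> a x $ j = 0 \<and> nabla (\<lambda>x. a x $ j) x = 0)" for j
    by (rule C1c_relative_range[OF a[of j]]) blast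
  then obtain rj Rj where rj: "\<And>j. 0 < rj j" and rjR: "\<And>j x. \<not> (rj j \<le> norm (rel x) \<and> norm (rel x) \<le> Rj j) \<Longrightarrow> a x $ j = 0 \<and> nabla (\<lambda>x. a x $ j) x = 0"
    by metis
  define r0 R where "r0 = Min (range rj)" and "R = max 1 (Max (range Rj))"
  have r0: "0 < r0" "r0 \<le> rj j" for j unfolding r0_def using rj by auto
  have R1: "1 \<le> R" by (simp add: R_def)
  have RR: "Rj j \<le> R" for j unfolding R_def by (rule order_trans[OF Max_ge max.cobounded2]) auto
  \<comment> \<open>The shell of relative speeds that contains the support of the field. There |v -
    w|^\<gamma> is bounded for either sign of \<gamma>.\<close>
  define A where "A x \<longleftrightarrow> r0 \<le> norm (rel x) \<and> norm (rel x) \<le> R" for x :: "(real^3) \<times> (real^3)"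
  have out: "a x = 0" "nabla (\<lambda>x. a x $ j) x = 0" if "\<not> A x" for x j
  proof -
    have n: "\<not> (rj j \<le> norm (rel x) \<and> norm (rel x) \<le> Rj j)" for j using that r0(2)[of j] RR[of j] unfolding A_def by linarith
    show "a x = 0" using rjR[OF n] by (simp add: vec_eq_iff)
    show "nabla (\<lambda>x. a x $ j) x = 0" using rjR[OF n] by simp
  qed
  have sym0: "symbol a x = 0" if "\<not> A x" for x using out[OF that] by (simp add: symbol_def rotD_def)
  define C where "C = max (r0 powr \<gamma>) (R powr \<gamma>)"
  have C: "norm (rel x) powr \<gamma> \<le> C" if "A x" for x
  proof (cases "0 \<le> \<gamma>")
    case True
    then have "norm (rel x) powr \<gamma> \<le> R powr \<gamma>" using that by (intro powr_mono2) (auto simp: A_def)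
    then show ?thesis by (simp add: C_def)
  next
    case False
    then have "norm (rel x) powr \<gamma> \<le> r0 powr \<gamma>" using that r0 by (intro powr_mono2') (auto simp: A_def)
    then show ?thesis by (simp add: C_def)
  qed
  have C0: "0 \<le> C" unfolding C_def by (simp add: le_max_iff_disj)
  have "\<exists>C. 0 < C \<and> (\<forall>x. \<bar>a x $ j\<bar> \<le> C)" for j by (rule C1c_bounded[OF a[of j]]) blast
  then obtain Aj where Aj: "\<And>j. 0 < Aj j" "\<And>j x. \<bar>a x $ j\<bar> \<le> Aj j" by metis
  define Am where "Am = (\<Sum>j\<in>UNIV. Aj j)"
  have Am: "norm (a x) \<le> Am" for x
    unfolding Am_def using Aj(2) by (intro order_trans[OF norm_le_l1_cart sum_mono])
  have "\<exists>D. \<forall>x. \<bar>rotD j (\<lambda>x. a x $ j) x\<bar> \<le> D" for j by (rule rotD_bounded[OF a[of j], of j]) blast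
  then obtain Dj where Dj: "\<And>j x. \<bar>rotD j (\<lambda>x. a x $ j) x\<bar> \<le> Dj j" by metis
  have am: "a \<in> borel_measurable borel"
    by (rule borel_measurable_continuous_onI[OF continuous_vec_components[OF C1c_continuous[OF a]]])
  note [measurable] = am
  have [measurable]: "symbol a \<in> borel_measurable borel"
    using C1c_measurable[OF a] rotD_measurable[OF a] unfolding symbol_def[abs_def] by measurable
  define Pm where "Pm = R\<^sup>2 / 2 * (\<Sum>j\<in>UNIV. Dj j) + R ^ 4 / 4 * Am\<^sup>2"
  have Pm: "\<bar>symbol a x\<bar> \<le> Pm" if "A x" for x
  proof -
    have "\<bar>\<Sum>j\<in>UNIV. rotD j (\<lambda>x. a x $ j) x\<bar> \<le> (\<Sum>j\<in>UNIV. Dj j)"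
      using Dj by (intro order_trans[OF sum_abs] sum_mono) auto
    then have "\<bar>(norm (rel x))\<^sup>2 / 2 * (\<Sum>j\<in>UNIV. rotD j (\<lambda>x. a x $ j) x)\<bar> \<le> R\<^sup>2 / 2 * (\<Sum>j\<in>UNIV. Dj j)"
      unfolding abs_mult using that by (intro mult_mono) (auto intro!: power_mono simp: A_def)
    moreover have "\<bar>(norm (rel x)) ^ 4 / 4 * (norm (a x))\<^sup>2\<bar> \<le> R ^ 4 / 4 * Am\<^sup>2"
      unfolding abs_mult using that Am[of x] by (intro mult_mono) (auto intro!: power_mono simp: A_def)
    ultimately show ?thesis unfolding symbol_def Pm_def by linarith
  qed
  \<comment> \<open>Discarding pairs of different relative speed bounds S on all pairs, as
    \<open>boltzmann_lower_bound\<close> requires. Collisions preserve the speed, so along them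
    nothing changes.\<close>
  define S where "S x y = (if norm (rel x) = norm (rel y) then increment a x y else 0)" for x y
  have S_post: "S x (post x \<sigma>) = increment a x (post x \<sigma>)" if "norm \<sigma> = 1" for x \<sigma>
    using that by (simp add: S_def rel_post)
  have S_anti: "S y x = - S x y" for x y unfolding S_def using increment_swap[of a y x] by simp
  have cross_m: "(\<lambda>p. cross3 (rel (fst p)) (rel (snd p))) \<in> borel_measurable (borel :: (((real^3) \<times> (real^3)) \<times> ((real^3) \<times> (real^3))) measure)"
    by (intro borel_measurable_continuous_onI continuous_on_cross continuous_intros)
  have Sm: "(\<lambda>p. S (fst p) (snd p)) \<in> borel_measurable (borel :: (((real^3) \<times> (real^3)) \<times> ((real^3) \<times> (real^3))) measure)"
    unfolding S_def increment_def using cross_m by measurable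
  have Sb: "\<bar>S x y\<bar> \<le> R\<^sup>2 * Am" for x y
  proof (cases "norm (rel x) = norm (rel y) \<and> norm (rel x) \<le> R")
    case True
    have "norm (cross3 (rel x) (rel y)) \<le> norm (rel x) * norm (rel y)" by (rule norm_cross3_le)
    also have "\<dots> \<le> R * R" using True R1 by (intro mult_mono) auto
    finally have "norm (cross3 (rel x) (rel y)) \<le> R\<^sup>2" by (simp add: power2_eq_square)
    moreover have "norm (a x + a y) \<le> 2 * Am" using norm_triangle_ineq[of "a x" "a y"] Am[of x] Am[of y] by linarith
    ultimately have "\<bar>cross3 (rel x) (rel y) \<bullet> (a x + a y)\<bar> \<le> R\<^sup>2 * (2 * Am)"
      by (intro order_trans[OF Cauchy_Schwarz_ineq2] mult_mono) auto
    then show ?thesis using True by (simp add: S_def increment_def abs_mult)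
  next
    case False
    have "S x y = 0"
    proof (cases "norm (rel x) = norm (rel y)")
      case True
      then have "\<not> A x" "\<not> A y" using False by (auto simp: A_def)
      then show ?thesis by (simp add: S_def increment_def out(1))
    qed (simp add: S_def)
    moreover have "0 \<le> Am" using Am[of undefined] norm_ge_zero order_trans by blast
    ultimately show ?thesis by simp
  qed
  define tb where "tb = 1 + R\<^sup>2 * Am + exp (R\<^sup>2 * Am)"
  have St: "\<bar>tangent (S x y)\<bar> \<le> tb" for x y
  proof -
    have "exp (S x y) \<le> exp (R\<^sup>2 * Am)" using Sb[of x y] by simp
    moreover have "0 < exp (S x y)" by simp
    ultimately show ?thesis using Sb[of x y] unfolding tangent_def tb_def by linarith
  qed
  show ?thesis
  proof (intro exI[of _ C] allI impI)
    fix \<delta> \<eta> :: real assume \<delta>: "0 < \<delta>" and \<eta>: "0 < \<eta>"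
    obtain t0 where t0: "0 < t0" "\<And>x \<sigma>. rel x \<noteq> 0 \<Longrightarrow> norm \<sigma> = 1 \<Longrightarrow> arccos ((rel x /\<^sub>R norm (rel x)) \<bullet> \<sigma>) < t0 \<Longrightarrow>
      - (tangent (increment a x (post x \<sigma>))
         + tangent (increment a x (post x (qturn (rel x /\<^sub>R norm (rel x)) \<sigma>)))
         + tangent (increment a x (post x (qturn (rel x /\<^sub>R norm (rel x)) (qturn (rel x /\<^sub>R norm (rel x)) \<sigma>))))
         + tangent (increment a x (post x (qturn (rel x /\<^sub>R norm (rel x)) (qturn (rel x /\<^sub>R norm (rel x)) (qturn (rel x /\<^sub>R norm (rel x)) \<sigma>))))))
      \<le> 4 * (arccos ((rel x /\<^sub>R norm (rel x)) \<bullet> \<sigma>))\<^sup>2 * (symbol a x + \<eta>)"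
      using increment_expansion[OF a \<eta>] by blast
    obtain b where b: "\<And>u. u \<in> {\<delta>..pi/2} \<Longrightarrow> \<beta> u \<le> b" using bdd[OF \<delta>] unfolding bdd_above_def by blast
    define M where "M = trunc_mass \<beta> \<delta>"
    have M0: "0 \<le> M" by (simp add: M_def trunc_mass_def)
    \<comment> \<open>The kernel charges only angles below \<epsilon> / 2, which this keeps below
      both t0 and pi / 2.\<close>
    have "\<forall>\<^sub>F \<epsilon> in at_right 0. 0 < \<epsilon> \<and> \<epsilon> < min 1 (2 * t0)"
      using t0(1) by (auto simp: eventually_at_right intro!: exI[of _ "min 1 (2 * t0)"])
    then show "\<forall>\<^sub>F \<epsilon> in at_right 0. \<forall>f. prob_density f \<longrightarrow>
       ennreal (- (pi * trunc_mass \<beta> \<delta>) * ((\<integral>x. tensor f x * (norm (rel x) powr \<gamma> * symbol a x) \<partial>lborel) + \<eta> * C))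
       \<le> boltzmann_dissipation (collision_kernel \<gamma> \<beta> \<epsilon>) f"
    proof eventually_elim
      case (elim \<epsilon>)
      then have \<epsilon>: "0 < \<epsilon>" "\<epsilon> \<le> 1" "\<epsilon> / 2 < t0" by auto
      let ?g = "trunc_kernel \<beta> \<delta> \<epsilon>"
      have lowpos: "0 < \<epsilon> * \<delta> / pi" using \<epsilon> \<delta> by simp
      have small_pi: "\<epsilon> / 2 < pi / 2" using \<epsilon> pi_gt3 by linarith
      have g0: "0 \<le> ?g \<theta>" for \<theta>
      proof (cases "\<epsilon> * \<delta> / pi \<le> \<theta> \<and> \<theta> < \<epsilon> / 2")
        case True
        then have "0 < sin \<theta>" using lowpos small_pi by (intro sin_gt_zero) linarith+
        then show ?thesis using \<beta> \<epsilon> by (simp add: trunc_kernel_def)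
      qed (auto simp: trunc_kernel_def)
      \<comment> \<open>On the truncated window the sine is at least its value at the lower end, and
        the argument of \<beta> is at least \<delta>, where b bounds \<beta>.\<close>
      define D where "D = \<bar>pi ^ 3 / \<epsilon> ^ 3 * b / sin (\<epsilon> * \<delta> / pi)\<bar>"
      have gD: "?g \<theta> \<le> D" for \<theta>
      proof (cases "\<epsilon> * \<delta> / pi \<le> \<theta> \<and> \<theta> < \<epsilon> / 2")
        case True
        note T = conjunct1[OF True] conjunct2[OF True]
        have s: "0 < sin (\<epsilon> * \<delta> / pi)" using lowpos small_pi T pi_gt_zero by (intro sin_gt_zero) linarith+
        have "sin (\<epsilon> * \<delta> / pi) \<le> sin \<theta>" using T small_pi lowpos pi_gt_zero by (subst sin_mono_le_eq) linarith+
        moreover have "pi * \<theta> / \<epsilon> \<in> {\<delta>..pi/2}" using True \<epsilon> by (auto simp: field_simps)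
        then have "pi ^ 3 / \<epsilon> ^ 3 * \<beta> (pi * \<theta> / \<epsilon>) \<le> pi ^ 3 / \<epsilon> ^ 3 * b" using b \<epsilon> by (intro mult_left_mono) auto
        moreover have "0 \<le> pi ^ 3 / \<epsilon> ^ 3 * \<beta> (pi * \<theta> / \<epsilon>)" using \<beta> \<epsilon> by simp
        ultimately have "?g \<theta> \<le> pi ^ 3 / \<epsilon> ^ 3 * b / sin (\<epsilon> * \<delta> / pi)"
          using True s by (simp only: trunc_kernel_def if_True simp_thms) (intro frac_le; linarith)
        then show ?thesis unfolding D_def by linarith
      qed (auto simp: trunc_kernel_def D_def)
      have D0: "0 \<le> D" by (simp add: D_def)
      have gm[measurable]: "?g \<in> borel_measurable borel" unfolding trunc_kernel_def[abs_def] by measurable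
      define \<kappa> where "\<kappa> x y = (if A x then norm (rel x) powr \<gamma> * ?g (arccos ((rel x /\<^sub>R norm (rel x)) \<bullet> (rel y /\<^sub>R norm (rel y)))) else 0)" for x y
      have \<kappa>m: "(\<lambda>p. \<kappa> (fst p) (snd p)) \<in> borel_measurable (borel :: (((real^3) \<times> (real^3)) \<times> ((real^3) \<times> (real^3))) measure)"
        unfolding \<kappa>_def A_def by measurable
      have \<kappa>0: "0 \<le> \<kappa> x y" for x y using g0 by (simp add: \<kappa>_def)
      have \<kappa>D: "\<kappa> x y \<le> C * D" for x y
        using C[of x] g0 gD C0 D0 by (auto simp: \<kappa>_def intro!: mult_mono)
      have hat: "rel (post x \<sigma>) /\<^sub>R norm (rel (post x \<sigma>)) = \<sigma>" if "norm \<sigma> = 1" "rel x \<noteq> 0" for x \<sigma>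
        using that by (simp add: rel_post)
      have Ax: "rel x \<noteq> 0" if "A x" for x using that r0(1) by (auto simp: A_def)
      have \<kappa>post: "\<kappa> x (post x \<sigma>) = (if A x then norm (rel x) powr \<gamma> * ?g (arccos ((rel x /\<^sub>R norm (rel x)) \<bullet> \<sigma>)) else 0)" if "norm \<sigma> = 1" for x \<sigma>
        unfolding \<kappa>_def using hat[OF that Ax] by simp
      have \<kappa>sym: "\<kappa> (post x \<sigma>) x = \<kappa> x (post x \<sigma>)" if "norm \<sigma> = 1" for x \<sigma>
      proof -
        have n: "norm (rel (post x \<sigma>)) = norm (rel x)" using that by (simp add: rel_post)
        then have "A (post x \<sigma>) = A x" by (simp add: A_def)
        then show ?thesis unfolding \<kappa>_def n by (simp add: inner_commute)
      qed
      have \<kappa>B: "\<kappa> x (post x \<sigma>) \<le> collision_kernel \<gamma> \<beta> \<epsilon> (norm (rel x)) (deviation_angle (fst x) (snd x) \<sigma>)" if "norm \<sigma> = 1" for x \<sigma>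
      proof -
        define \<theta> where "\<theta> = deviation_angle (fst x) (snd x) \<sigma>"
        have \<theta>: "\<theta> = arccos ((rel x /\<^sub>R norm (rel x)) \<bullet> \<sigma>)" by (simp add: \<theta>_def deviation_angle_def)
        have "?g \<theta> \<le> beta_eps \<beta> \<epsilon> \<theta> / sin \<theta>"
        proof (cases "\<epsilon> * \<delta> / pi \<le> \<theta> \<and> \<theta> < \<epsilon> / 2")
          case True
          then have "0 < \<theta>" using lowpos by linarith
          then show ?thesis using True by (simp add: trunc_kernel_def beta_eps_def)
        next
          case False
          have "0 \<le> beta_eps \<beta> \<epsilon> \<theta> / sin \<theta>"
          proof (cases "0 < \<theta> \<and> \<theta> < \<epsilon> / 2")
            case True
            then have "0 < sin \<theta>" using small_pi by (intro sin_gt_zero) linarith+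
            then show ?thesis using \<beta> \<epsilon> by (simp add: beta_eps_def)
          qed (auto simp: beta_eps_def)
          then show ?thesis using False by (auto simp: trunc_kernel_def)
        qed
        then have "norm (rel x) powr \<gamma> * ?g \<theta> \<le> norm (rel x) powr \<gamma> * (beta_eps \<beta> \<epsilon> \<theta> / sin \<theta>)" by (intro mult_left_mono) auto
        moreover have "0 \<le> norm (rel x) powr \<gamma> * ?g \<theta>" using g0 by simp
        ultimately show ?thesis unfolding \<kappa>post[OF that] \<theta>_def[symmetric] \<theta>[symmetric] collision_kernel_def by simp
      qed
      \<comment> \<open>The factor 2 pi M is the \<theta>^2 moment of the truncated kernel over the
        sphere, from \<open>trunc_kernel_mass\<close>.\<close>
      define J where "J x = (if A x then 2 * pi * M * (norm (rel x) powr \<gamma> * (symbol a x + \<eta>)) else 0)" for x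
      have Jm: "J \<in> borel_measurable borel" unfolding J_def[abs_def] A_def by measurable
      have Jb: "\<bar>J x\<bar> \<le> 2 * pi * M * (C * (\<bar>Pm\<bar> + \<eta>))" for x
      proof (cases "A x")
        case True
        have "\<bar>symbol a x + \<eta>\<bar> \<le> \<bar>Pm\<bar> + \<eta>" using Pm[OF True] \<eta> by linarith
        then have "norm (rel x) powr \<gamma> * \<bar>symbol a x + \<eta>\<bar> \<le> C * (\<bar>Pm\<bar> + \<eta>)" using C[OF True] C0 by (intro mult_mono) auto
        then have "2 * pi * M * (norm (rel x) powr \<gamma> * \<bar>symbol a x + \<eta>\<bar>) \<le> 2 * pi * M * (C * (\<bar>Pm\<bar> + \<eta>))" using M0 by (intro mult_left_mono) auto
        then show ?thesis using True M0 by (simp add: J_def abs_mult)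
      qed (use C0 M0 \<eta> in \<open>simp add: J_def\<close>)
      have JI: "- (\<integral>\<sigma>. tangent (S x (post x \<sigma>)) * \<kappa> x (post x \<sigma>) \<partial>sphere_measure) \<le> J x" for x
      proof (cases "A x")
        case False
        have "\<kappa> x y = 0" for y using False by (simp add: \<kappa>_def)
        then show ?thesis using False by (simp add: J_def)
      next
        case True
        define k where "k = rel x /\<^sub>R norm (rel x)"
        have k: "norm k = 1" using Ax[OF True] by (simp add: k_def)
        let ?R = "qturn k"
        have R: "orthogonal_transformation ?R" and kR: "\<And>\<sigma>. k \<bullet> ?R \<sigma> = k \<bullet> \<sigma>" using qturn[OF k] by auto
        note [measurable] = borel_measurable_orthogonal[OF R]
        have [measurable]: "(\<lambda>\<sigma>. S x (post x \<sigma>)) \<in> borel_measurable borel"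
          using measurable_compose[OF borel_measurable_Pair[OF _ measurable_post] Sm, of "\<lambda>\<sigma>. x" borel "\<lambda>\<sigma>. x" "\<lambda>\<sigma>. \<sigma>"] by simp
        define I where "I \<sigma> = - tangent (S x (post x \<sigma>)) * ?g (arccos (k \<bullet> \<sigma>))" for \<sigma>
        have Im[measurable]: "I \<in> borel_measurable borel" unfolding I_def by measurable
        have Ib: "\<bar>I \<sigma>\<bar> \<le> tb * D" for \<sigma>
          unfolding I_def abs_mult abs_minus_cancel using St[of x "post x \<sigma>"] g0 gD by (intro mult_mono) (auto intro: order_trans[OF abs_ge_zero St])
        have Ii: "integrable sphere_measure (\<lambda>\<sigma>. I (h \<sigma>))" if "h \<in> borel_measurable borel" for h
          by (rule sphere.integrable_const_bound[of _ "tb * D"]) (use Ib that in \<open>auto intro!: measurable_compose[OF _ Im]\<close>)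
        have i1: "(\<integral>\<sigma>. I (?R \<sigma>) \<partial>sphere_measure) = (\<integral>\<sigma>. I \<sigma> \<partial>sphere_measure)" by (rule integral_sphere_orthogonal[OF R Im])
        have i2: "(\<integral>\<sigma>. I (?R (?R \<sigma>)) \<partial>sphere_measure) = (\<integral>\<sigma>. I \<sigma> \<partial>sphere_measure)"
          using integral_sphere_orthogonal[OF R, of "\<lambda>\<sigma>. I (?R \<sigma>)"] i1 by simp
        have i3: "(\<integral>\<sigma>. I (?R (?R (?R \<sigma>))) \<partial>sphere_measure) = (\<integral>\<sigma>. I \<sigma> \<partial>sphere_measure)"
          using integral_sphere_orthogonal[OF R, of "\<lambda>\<sigma>. I (?R (?R \<sigma>))"] i2 by simp
        have Ri: "integrable sphere_measure (\<lambda>\<sigma>. I \<sigma>)" "integrable sphere_measure (\<lambda>\<sigma>. I (?R \<sigma>))"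
          "integrable sphere_measure (\<lambda>\<sigma>. I (?R (?R \<sigma>)))" "integrable sphere_measure (\<lambda>\<sigma>. I (?R (?R (?R \<sigma>))))"
          by (rule Ii, measurable)+
        let ?\<theta> = "\<lambda>\<sigma>. arccos (k \<bullet> \<sigma>)"
        have nnI: "(\<integral>\<^sup>+\<sigma>. ennreal ((?\<theta> \<sigma>)\<^sup>2 * ?g (?\<theta> \<sigma>)) \<partial>sphere_measure) = ennreal (2 * pi * M)"
          unfolding M_def by (rule trunc_kernel_mass[OF \<beta>m \<beta> mass \<delta> \<epsilon>(1,2) k])
        have \<theta>i: "integrable sphere_measure (\<lambda>\<sigma>. (?\<theta> \<sigma>)\<^sup>2 * ?g (?\<theta> \<sigma>))"
          by (rule integrableI_nonneg) (use nnI g0 in auto)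
        have \<theta>I: "(\<integral>\<sigma>. (?\<theta> \<sigma>)\<^sup>2 * ?g (?\<theta> \<sigma>) \<partial>sphere_measure) = 2 * pi * M"
          using nn_integral_eq_integral[OF \<theta>i] nnI g0 M0 by (simp add: integral_nonneg_AE)
        \<comment> \<open>A quarter turn about k preserves surface measure and the deviation angle,
          hence the kernel; the angular integral may be averaged over the four turns before it is
          estimated pointwise.\<close>
        have "4 * (\<integral>\<sigma>. I \<sigma> \<partial>sphere_measure) = (\<integral>\<sigma>. I \<sigma> + I (?R \<sigma>) + I (?R (?R \<sigma>)) + I (?R (?R (?R \<sigma>))) \<partial>sphere_measure)"
          using Ri i1 i2 i3 by simp
        also have "\<dots> \<le> (\<integral>\<sigma>. 4 * (symbol a x + \<eta>) * ((?\<theta> \<sigma>)\<^sup>2 * ?g (?\<theta> \<sigma>)) \<partial>sphere_measure)"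
        proof (rule integral_mono_AE)
          show "integrable sphere_measure (\<lambda>\<sigma>. I \<sigma> + I (?R \<sigma>) + I (?R (?R \<sigma>)) + I (?R (?R (?R \<sigma>))))" using Ri by simp
          show "integrable sphere_measure (\<lambda>\<sigma>. 4 * (symbol a x + \<eta>) * ((?\<theta> \<sigma>)\<^sup>2 * ?g (?\<theta> \<sigma>)))" using \<theta>i by simp
          show "AE \<sigma> in sphere_measure. I \<sigma> + I (?R \<sigma>) + I (?R (?R \<sigma>)) + I (?R (?R (?R \<sigma>))) \<le> 4 * (symbol a x + \<eta>) * ((?\<theta> \<sigma>)\<^sup>2 * ?g (?\<theta> \<sigma>))"
            using AE_sphere
          proof eventually_elim
            case (elim \<sigma>)
            have nR: "norm (?R s) = norm s" for s using R orthogonal_transformation_norm by blast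
            show ?case
            proof (cases "?\<theta> \<sigma> < \<epsilon> / 2")
              case lt: True
              let ?t = "\<lambda>s. tangent (increment a x (post x s))"
              have "- (?t \<sigma> + ?t (?R \<sigma>) + ?t (?R (?R \<sigma>)) + ?t (?R (?R (?R \<sigma>)))) \<le> 4 * (?\<theta> \<sigma>)\<^sup>2 * (symbol a x + \<eta>)"
                using t0(2)[OF Ax[OF True] elim] lt \<epsilon>(3) unfolding k_def[symmetric] by simp
              then have "- (?t \<sigma> + ?t (?R \<sigma>) + ?t (?R (?R \<sigma>)) + ?t (?R (?R (?R \<sigma>)))) * ?g (?\<theta> \<sigma>) \<le> 4 * (?\<theta> \<sigma>)\<^sup>2 * (symbol a x + \<eta>) * ?g (?\<theta> \<sigma>)"
                using g0 by (intro mult_right_mono) auto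
              then show ?thesis using elim unfolding I_def kR by (simp add: S_post nR algebra_simps)
            next
              case False
              then have "?g (?\<theta> \<sigma>) = 0" by (simp add: trunc_kernel_def)
              then show ?thesis unfolding I_def kR by simp
            qed
          qed
        qed
        also have "\<dots> = 4 * ((symbol a x + \<eta>) * (2 * pi * M))" using \<theta>I by (simp add: mult.assoc)
        finally have le: "(\<integral>\<sigma>. I \<sigma> \<partial>sphere_measure) \<le> (symbol a x + \<eta>) * (2 * pi * M)" by (simp only: mult_le_cancel_left_pos zero_less_numeral)
        have "- (\<integral>\<sigma>. tangent (S x (post x \<sigma>)) * \<kappa> x (post x \<sigma>) \<partial>sphere_measure) = (\<integral>\<sigma>. norm (rel x) powr \<gamma> * I \<sigma> \<partial>sphere_measure)"
          unfolding Bochner_Integration.integral_minus[symmetric]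
        proof (rule integral_cong_AE)
          show "AE \<sigma> in sphere_measure. - (tangent (S x (post x \<sigma>)) * \<kappa> x (post x \<sigma>)) = norm (rel x) powr \<gamma> * I \<sigma>"
            using AE_sphere
          proof eventually_elim
            case (elim \<sigma>)
            show ?case unfolding \<kappa>post[OF elim] I_def k_def using True by (simp add: mult_ac)
          qed
          have "(\<lambda>\<sigma>. \<kappa> x (post x \<sigma>)) \<in> borel_measurable borel"
            using measurable_compose[OF borel_measurable_Pair[OF _ measurable_post] \<kappa>m, of "\<lambda>\<sigma>. x" borel "\<lambda>\<sigma>. x" "\<lambda>\<sigma>. \<sigma>"] by simp
          then show "(\<lambda>\<sigma>. - (tangent (S x (post x \<sigma>)) * \<kappa> x (post x \<sigma>))) \<in> borel_measurable sphere_measure" by measurable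
        qed measurable
        also have "\<dots> = norm (rel x) powr \<gamma> * (\<integral>\<sigma>. I \<sigma> \<partial>sphere_measure)" by simp
        also have "\<dots> \<le> norm (rel x) powr \<gamma> * ((symbol a x + \<eta>) * (2 * pi * M))" using le by (intro mult_left_mono) auto
        also have "\<dots> = J x" using True by (simp add: J_def mult_ac)
        finally show ?thesis .
      qed
      show ?case
      proof (intro allI impI)
        fix f assume f: "prob_density f"
        note ti = tensor_density(3)[OF f] and tn = tensor_density(2)[OF f]
        have "ennreal (- (1/2) * (\<integral>x. tensor f x * J x \<partial>lborel)) \<le> boltzmann_dissipation (collision_kernel \<gamma> \<beta> \<epsilon>) f"
          by (rule boltzmann_lower_bound[OF f Sm \<kappa>m S_anti St \<kappa>0 \<kappa>D \<kappa>sym \<kappa>B Jm Jb JI])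
        moreover have "- (pi * trunc_mass \<beta> \<delta>) * ((\<integral>x. tensor f x * (norm (rel x) powr \<gamma> * symbol a x) \<partial>lborel) + \<eta> * C) \<le> - (1/2) * (\<integral>x. tensor f x * J x \<partial>lborel)"
        proof -
          have qb: "\<bar>norm (rel x) powr \<gamma> * symbol a x\<bar> \<le> C * \<bar>Pm\<bar>" for x
          proof (cases "A x")
            case True
            then show ?thesis unfolding abs_mult using C[OF True] Pm[OF True] C0 by (intro mult_mono) auto
          qed (use sym0 C0 in simp)
          have qi: "integrable lborel (\<lambda>x. tensor f x * (norm (rel x) powr \<gamma> * symbol a x))"
            by (rule integrable_mult_bounded[OF ti _ qb]) measurable
          have "(\<integral>x. tensor f x * J x \<partial>lborel) \<le> (\<integral>x. 2 * pi * M * (tensor f x * (norm (rel x) powr \<gamma> * symbol a x)) + 2 * pi * M * (\<eta> * C) * tensor f x \<partial>lborel)"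
          proof (rule integral_mono)
            show "integrable lborel (\<lambda>x. tensor f x * J x)" by (rule integrable_mult_bounded[OF ti _ Jb]) (use Jm in simp)
            show "integrable lborel (\<lambda>x. 2 * pi * M * (tensor f x * (norm (rel x) powr \<gamma> * symbol a x)) + 2 * pi * M * (\<eta> * C) * tensor f x)" using qi ti by simp
            fix x
            have "J x \<le> 2 * pi * M * (norm (rel x) powr \<gamma> * symbol a x + \<eta> * C)"
            proof (cases "A x")
              case True
              have "norm (rel x) powr \<gamma> * \<eta> \<le> \<eta> * C" using C[OF True] \<eta> by (simp add: mult.commute mult_left_mono)
              then have "norm (rel x) powr \<gamma> * (symbol a x + \<eta>) \<le> norm (rel x) powr \<gamma> * symbol a x + \<eta> * C" by (simp add: distrib_left)
              then have "2 * pi * M * (norm (rel x) powr \<gamma> * (symbol a x + \<eta>)) \<le> 2 * pi * M * (norm (rel x) powr \<gamma> * symbol a x + \<eta> * C)" using M0 by (intro mult_left_mono) auto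
              then show ?thesis using True by (simp add: J_def)
            qed (use M0 C0 \<eta> sym0 in \<open>simp add: J_def\<close>)
            from mult_left_mono[OF this tn[of x]]
            show "tensor f x * J x \<le> 2 * pi * M * (tensor f x * (norm (rel x) powr \<gamma> * symbol a x)) + 2 * pi * M * (\<eta> * C) * tensor f x"
              by (simp add: algebra_simps)
          qed
          also have "\<dots> = 2 * pi * M * ((\<integral>x. tensor f x * (norm (rel x) powr \<gamma> * symbol a x) \<partial>lborel) + \<eta> * C)"
            using qi ti tensor_density(4)[OF f] by (simp add: distrib_left)
          finally show ?thesis unfolding M_def[symmetric] by simp
        qed
        ultimately show "ennreal (- (pi * trunc_mass \<beta> \<delta>) * ((\<integral>x. tensor f x * (norm (rel x) powr \<gamma> * symbol a x) \<partial>lborel) + \<eta> * C))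
          \<le> boltzmann_dissipation (collision_kernel \<gamma> \<beta> \<epsilon>) f"
          by (meson ennreal_leI order_trans)
      qed
    qed
  qed
qed

section \<open>The limit dissipation\<close>

definition test_fields :: "((real^3) \<times> (real^3) \<Rightarrow> real^3) set" where
  "test_fields = {b. \<forall>j. C1c off_diagonal (\<lambda>x. b x $ j)}"

lemma test_field_support:
  assumes "b \<in> test_fields"
  obtains K where "compact K" "K \<subseteq> off_diagonal" "\<And>x. x \<notin> K \<Longrightarrow> b x = 0" "\<And>x j. x \<notin> K \<Longrightarrow> nabla (\<lambda>x. b x $ j) x = 0"
proof -
  have "\<exists>K. compact K \<and> K \<subseteq> off_diagonal \<and> (\<forall>x. x \<notin> K \<longrightarrow> b x $ j = 0 \<and> nabla (\<lambda>x. b x $ j) x = 0)" for j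
  proof -
    have "C1c off_diagonal (\<lambda>x. b x $ j)" using assms by (simp add: test_fields_def)
    then show ?thesis by (rule C1c_support) blast
  qed
  then obtain K where K: "\<And>j. compact (K j)" "\<And>j. K j \<subseteq> off_diagonal" "\<And>j x. x \<notin> K j \<Longrightarrow> b x $ j = 0 \<and> nabla (\<lambda>x. b x $ j) x = 0"
    by metis
  show thesis
  proof (rule that[of "\<Union>j. K j"])
    show "compact (\<Union>j. K j)" using K(1) by (intro compact_UN) auto
  qed (use K in \<open>auto simp: vec_eq_iff\<close>)
qed

lemma test_field_continuous: "b \<in> test_fields \<Longrightarrow> continuous_on UNIV b"
  by (rule continuous_vec_components) (auto simp: test_fields_def intro: C1c_continuous)

text \<open>Minus the formal adjoint of |v - w|^(\<gamma>/2) times the rotational gradient: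
  rotations preserve measure and the weight is constant along them.\<close>

definition divergence :: "real \<Rightarrow> ((real^3) \<times> (real^3) \<Rightarrow> real^3) \<Rightarrow> (real^3) \<times> (real^3) \<Rightarrow> real" where
  "divergence \<gamma> b x = norm (rel x) powr (\<gamma>/2) * (\<Sum>j\<in>UNIV. rotD j (\<lambda>x. b x $ j) x)"

text \<open>The weight blows up at the diagonal. Moved inside the derivative it multiplies a
  function supported away from the diagonal.\<close>

lemma divergence_continuous:
  assumes b: "b \<in> test_fields"
  shows "continuous_on UNIV (divergence \<gamma> b)"
proof -
  have bj: "C1c off_diagonal (\<lambda>x. b x $ j)" for j using b by (simp add: test_fields_def)
  have "divergence \<gamma> b = (\<lambda>x. \<Sum>j\<in>UNIV. rotD j (\<lambda>x. norm (rel x) powr (\<gamma>/2) * b x $ j) x)"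
    unfolding C1c_powr(2)[OF bj] by (simp add: divergence_def[abs_def] sum_distrib_left)
  then show ?thesis by (simp add: continuous_on_sum continuous_on_rotD[OF C1c_powr(1)[OF bj]])
qed

text \<open>The exponent -\<gamma>/2 - 2 is the one that turns |v - w|^\<gamma> |v - w|^4 |a|^2 into
  |b|^2 without a weight. The divergence term is then left with |v - w|^(\<gamma>/2).\<close>

lemma weighted_symbol:
  fixes \<gamma> :: real
  assumes b: "b \<in> test_fields"
  defines "a \<equiv> \<lambda>x. (norm (rel x) powr (- \<gamma>/2 - 2)) *\<^sub>R b x"
  shows "C1c off_diagonal (\<lambda>x. a x $ j)"
    "norm (rel x) powr \<gamma> * symbol a x = divergence \<gamma> b x / 2 + (norm (b x))\<^sup>2 / 4"
proof -
  have bj: "C1c off_diagonal (\<lambda>x. b x $ j)" for j using b by (simp add: test_fields_def)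
  have aj: "(\<lambda>x. a x $ j) = (\<lambda>x. norm (rel x) powr (- \<gamma>/2 - 2) * b x $ j)" for j by (simp add: a_def)
  show "C1c off_diagonal (\<lambda>x. a x $ j)" unfolding aj by (rule C1c_powr(1)[OF bj])
  show "norm (rel x) powr \<gamma> * symbol a x = divergence \<gamma> b x / 2 + (norm (b x))\<^sup>2 / 4"
  proof (cases "rel x = 0")
    case True
    obtain K where K: "K \<subseteq> off_diagonal" "\<And>x. x \<notin> K \<Longrightarrow> b x = 0" using test_field_support[OF b] by metis
    have "x \<notin> K" using K(1) True off_diagonal_iff[of x] by blast
    then have "b x = 0" by (rule K(2))
    then show ?thesis using True by (simp add: divergence_def)
  next
    case False
    define r where "r = norm (rel x)"
    have r: "0 < r" using False by (simp add: r_def)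
    let ?D = "\<Sum>j\<in>UNIV. rotD j (\<lambda>x. b x $ j) x"
    have p: "r powr \<gamma> * (r\<^sup>2 * r powr (- \<gamma>/2 - 2)) = r powr (\<gamma>/2)"
    proof -
      have "r powr \<gamma> * (r powr 2 * r powr (- \<gamma>/2 - 2)) = r powr (\<gamma> + (2 + (- \<gamma>/2 - 2)))" by (simp only: powr_add)
      then show ?thesis using r by (simp add: powr_numeral)
    qed
    have q: "r powr \<gamma> * (r ^ 4 * (r powr (- \<gamma>/2 - 2))\<^sup>2) = 1"
    proof -
      have "r powr \<gamma> * (r powr 4 * (r powr (- \<gamma>/2 - 2) * r powr (- \<gamma>/2 - 2))) = r powr (\<gamma> + (4 + ((- \<gamma>/2 - 2) + (- \<gamma>/2 - 2))))" by (simp only: powr_add)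
      then show ?thesis using r by (simp add: powr_numeral power2_eq_square)
    qed
    have s: "symbol a x = r\<^sup>2 / 2 * (r powr (- \<gamma>/2 - 2) * ?D) + r ^ 4 / 4 * ((r powr (- \<gamma>/2 - 2))\<^sup>2 * (norm (b x))\<^sup>2)"
      unfolding symbol_def aj C1c_powr(2)[OF bj] by (simp add: a_def r_def power_mult_distrib flip: sum_distrib_left)
    have "r powr \<gamma> * symbol a x = (r powr \<gamma> * (r\<^sup>2 * r powr (- \<gamma>/2 - 2))) * ?D / 2 + (r powr \<gamma> * (r ^ 4 * (r powr (- \<gamma>/2 - 2))\<^sup>2)) * (norm (b x))\<^sup>2 / 4"
      unfolding s by (simp add: algebra_simps)
    also have "\<dots> = r powr (\<gamma>/2) * ?D / 2 + (norm (b x))\<^sup>2 / 4" unfolding p q by simp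
    finally show ?thesis by (simp add: divergence_def r_def)
  qed
qed

lemma continuous_compact_integrable:
  fixes g :: "(real^3) \<times> (real^3) \<Rightarrow> real"
  assumes f: "prob_density f" and g: "continuous_on UNIV g" and K: "compact K" "\<And>x. x \<notin> K \<Longrightarrow> g x = 0"
  shows "integrable lborel (\<lambda>x. tensor f x * g x)" "integrable lborel (\<lambda>x. sqrt (tensor f x) * g x)" "integrable lborel (\<lambda>x. (g x)\<^sup>2)"
proof -
  have [measurable]: "g \<in> borel_measurable borel" using g by (rule borel_measurable_continuous_onI)
  note [measurable] = tensor_density(1)[OF f]
  obtain C where C: "C > 0" "\<And>x. \<bar>g x\<bar> \<le> C" using compact_support_bounded[OF g K] by auto
  show "integrable lborel (\<lambda>x. tensor f x * g x)"
    by (rule integrable_mult_bounded[OF tensor_density(3)[OF f] _ C(2)]) measurable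
  have Kb: "K \<in> sets borel" using K(1) by (simp add: compact_imp_closed)
  have Ki: "integrable lborel (indicator K :: _ \<Rightarrow> real)"
    using emeasure_bounded_finite[OF compact_imp_bounded[OF K(1)]] Kb by (intro integrable_real_indicator) auto
  show "integrable lborel (\<lambda>x. (g x)\<^sup>2)"
  proof (rule Bochner_Integration.integrable_bound)
    show "integrable lborel (\<lambda>x. C\<^sup>2 * indicator K x)" using Ki by simp
    show "AE x in lborel. norm ((g x)\<^sup>2) \<le> norm (C\<^sup>2 * indicator K x)"
    proof (rule AE_I2)
      fix x show "norm ((g x)\<^sup>2) \<le> norm (C\<^sup>2 * indicator K x)"
        using power_mono[OF C(2)[of x], of 2] K(2)[of x] by (cases "x \<in> K") auto
    qed
  qed measurable
  show "integrable lborel (\<lambda>x. sqrt (tensor f x) * g x)"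
  proof (rule Bochner_Integration.integrable_bound)
    show "integrable lborel (\<lambda>x. C * (indicator K x + tensor f x))"
      using tensor_density(3)[OF f] Ki by simp
    show "AE x in lborel. norm (sqrt (tensor f x) * g x) \<le> norm (C * (indicator K x + tensor f x))"
    proof (rule AE_I2)
      fix x
      show "norm (sqrt (tensor f x) * g x) \<le> norm (C * (indicator K x + tensor f x))"
      proof (cases "x \<in> K")
        case True
        have t: "0 \<le> tensor f x" by (rule tensor_density(2)[OF f])
        have "sqrt (tensor f x) \<le> 1 + tensor f x"
          using t by (intro real_le_lsqrt) (auto simp: power2_eq_square algebra_simps)
        then have "\<bar>g x\<bar> * sqrt (tensor f x) \<le> C * (1 + tensor f x)" using C t by (intro mult_mono) auto
        then show ?thesis using True t C(1) by (simp add: abs_mult mult.commute)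
      qed (use K tensor_density(2)[OF f] in simp)
    qed
  qed measurable
qed

text \<open>At fixed \<delta> and \<eta> the lower bound depends continuously on the integral of Q
  against f tensor f, and Q is continuous with compact support. Only after the limit in \<epsilon>
  do \<delta> and \<eta> go to zero. The limiting mass 8 / pi produces the factor 8, which meets the
  coefficients 1/2 and 1/4 of Q.\<close>

lemma liminf_bound:
  fixes \<kappa> :: real
  assumes \<beta>m: "\<beta> \<in> borel_measurable borel" and \<beta>: "\<And>\<theta>. 0 \<le> \<beta> \<theta>"
    and bdd: "\<And>\<delta>. 0 < \<delta> \<Longrightarrow> bdd_above (\<beta> ` {\<delta>..pi/2})"
    and mass: "(\<integral>\<^sup>+ \<theta>\<in>{0..pi/2}. ennreal (\<theta>\<^sup>2 * \<beta> \<theta>) \<partial>lborel) = ennreal (8 / pi)"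
    and dens_eps: "\<And>\<epsilon>. 0 < \<epsilon> \<Longrightarrow> prob_density (F \<epsilon>)" and f: "prob_density f"
    and conv: "weak_star_conv F f (at_right 0)"
    and \<kappa>: "0 \<le> \<kappa>" "Liminf (at_right 0) (\<lambda>\<epsilon>. boltzmann_dissipation (collision_kernel \<gamma> \<beta> \<epsilon>) (F \<epsilon>)) = ennreal \<kappa>"
    and b: "b \<in> test_fields"
  shows "- 4 * (\<integral>x. tensor f x * divergence \<gamma> b x \<partial>lborel) - 2 * (\<integral>x. tensor f x * (norm (b x))\<^sup>2 \<partial>lborel) \<le> \<kappa>"
proof -
  define a where "a = (\<lambda>x. (norm (rel x) powr (- \<gamma>/2 - 2)) *\<^sub>R b x)"
  have a: "C1c off_diagonal (\<lambda>x. a x $ j)"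
    "norm (rel x) powr \<gamma> * symbol a x = divergence \<gamma> b x / 2 + (norm (b x))\<^sup>2 / 4" for j x
    unfolding a_def by (rule weighted_symbol[OF b])+
  define Q where "Q x = divergence \<gamma> b x / 2 + (norm (b x))\<^sup>2 / 4" for x
  obtain K where K: "compact K" "\<And>x. x \<notin> K \<Longrightarrow> b x = 0" "\<And>x j. x \<notin> K \<Longrightarrow> nabla (\<lambda>x. b x $ j) x = 0"
    using test_field_support[OF b] by metis
  have Dz: "divergence \<gamma> b x = 0" if "x \<notin> K" for x using K(3)[OF that] by (simp add: divergence_def rotD_def)
  have Qc: "continuous_on UNIV Q"
    unfolding Q_def using divergence_continuous[OF b] test_field_continuous[OF b] by (intro continuous_intros) auto
  have Qz: "Q x = 0" if "x \<notin> K" for x using Dz[OF that] K(2)[OF that] by (simp add: Q_def)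
  have ev: "\<forall>\<^sub>F \<epsilon> in at_right 0. 0 < (\<epsilon>::real)" by (simp add: eventually_at_right_less)
  have lim: "((\<lambda>\<epsilon>. \<integral>x. tensor (F \<epsilon>) x * Q x \<partial>lborel) \<longlongrightarrow> (\<integral>x. tensor f x * Q x \<partial>lborel)) (at_right 0)"
    by (rule tensor_weak_convergence[OF _ f conv Qc K(1) Qz]) (use ev dens_eps in \<open>auto elim: eventually_mono\<close>)
  let ?I = "\<integral>x. tensor f x * Q x \<partial>lborel"
  have fin: "(\<integral>\<^sup>+ \<theta>\<in>{0..pi/2}. ennreal (\<theta>\<^sup>2 * \<beta> \<theta>) \<partial>lborel) < \<infinity>" unfolding mass by simp
  have "\<exists>C. \<forall>\<delta> \<eta>. 0 < \<delta> \<longrightarrow> 0 < \<eta> \<longrightarrow> (\<forall>\<^sub>F \<epsilon> in at_right 0. \<forall>f. prob_density f \<longrightarrow>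
     ennreal (- (pi * trunc_mass \<beta> \<delta>) * ((\<integral>x. tensor f x * (norm (rel x) powr \<gamma> * symbol a x) \<partial>lborel) + \<eta> * C))
       \<le> boltzmann_dissipation (collision_kernel \<gamma> \<beta> \<epsilon>) f)"
    by (rule boltzmann_grazing_bound[OF \<beta>m \<beta> bdd fin a(1)])
  then obtain C where C: "\<And>\<delta> \<eta>. 0 < \<delta> \<Longrightarrow> 0 < \<eta> \<Longrightarrow> \<forall>\<^sub>F \<epsilon> in at_right 0. \<forall>f. prob_density f \<longrightarrow>
     ennreal (- (pi * trunc_mass \<beta> \<delta>) * ((\<integral>x. tensor f x * (norm (rel x) powr \<gamma> * symbol a x) \<partial>lborel) + \<eta> * C))
       \<le> boltzmann_dissipation (collision_kernel \<gamma> \<beta> \<epsilon>) f"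
    by auto
  have le: "- (pi * trunc_mass \<beta> \<delta>) * (?I + \<eta> * C) \<le> \<kappa>" if "0 < \<delta>" "0 < \<eta>" for \<delta> \<eta>
  proof -
    have "((\<lambda>\<epsilon>. ennreal (- (pi * trunc_mass \<beta> \<delta>) * ((\<integral>x. tensor (F \<epsilon>) x * Q x \<partial>lborel) + \<eta> * C))) \<longlongrightarrow> ennreal (- (pi * trunc_mass \<beta> \<delta>) * (?I + \<eta> * C))) (at_right 0)"
      by (intro tendsto_ennrealI tendsto_intros lim)
    then have "ennreal (- (pi * trunc_mass \<beta> \<delta>) * (?I + \<eta> * C)) = Liminf (at_right 0) (\<lambda>\<epsilon>. ennreal (- (pi * trunc_mass \<beta> \<delta>) * ((\<integral>x. tensor (F \<epsilon>) x * Q x \<partial>lborel) + \<eta> * C)))"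
      by (intro lim_imp_Liminf[symmetric]) auto
    also have "\<dots> \<le> Liminf (at_right 0) (\<lambda>\<epsilon>. boltzmann_dissipation (collision_kernel \<gamma> \<beta> \<epsilon>) (F \<epsilon>))"
    proof (rule Liminf_mono)
      show "\<forall>\<^sub>F \<epsilon> in at_right 0. ennreal (- (pi * trunc_mass \<beta> \<delta>) * ((\<integral>x. tensor (F \<epsilon>) x * Q x \<partial>lborel) + \<eta> * C)) \<le> boltzmann_dissipation (collision_kernel \<gamma> \<beta> \<epsilon>) (F \<epsilon>)"
        using C[OF that] ev
      proof eventually_elim
        case (elim \<epsilon>)
        have "prob_density (F \<epsilon>)" using dens_eps elim(2) by blast
        with elim(1) show ?case unfolding a(2) Q_def by blast
      qed
    qed
    finally show ?thesis unfolding \<kappa>(2) using \<kappa>(1) by (simp add: ennreal_le_iff)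
  qed
  have "(\<lambda>n. - (pi * trunc_mass \<beta> (1 / real (Suc n))) * (?I + 1 / real (Suc n) * C)) \<longlonglongrightarrow> - (pi * (8 / pi)) * (?I + 0 * C)"
  proof (intro tendsto_intros)
    show "(\<lambda>n. trunc_mass \<beta> (1 / real (Suc n))) \<longlonglongrightarrow> 8 / pi" by (rule trunc_mass_tendsto[OF \<beta>m \<beta> mass]) simp
    show "(\<lambda>n. 1 / real (Suc n)) \<longlonglongrightarrow> 0" using LIMSEQ_inverse_real_of_nat by (simp add: inverse_eq_divide)
  qed
  then have "- (pi * (8 / pi)) * (?I + 0 * C) \<le> \<kappa>"
    by (rule LIMSEQ_le_const2) (intro exI[of _ 0] allI impI le; simp)
  moreover have "?I = (\<integral>x. tensor f x * divergence \<gamma> b x \<partial>lborel) / 2 + (\<integral>x. tensor f x * (norm (b x))\<^sup>2 \<partial>lborel) / 4"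
  proof -
    have "integrable lborel (\<lambda>x. tensor f x * divergence \<gamma> b x)"
      by (rule continuous_compact_integrable(1)[OF f divergence_continuous[OF b] K(1) Dz])
    moreover have "integrable lborel (\<lambda>x. tensor f x * (norm (b x))\<^sup>2)"
      by (rule continuous_compact_integrable(1)[OF f _ K(1)]) (use K(2) test_field_continuous[OF b] in \<open>auto intro!: continuous_intros\<close>)
    ultimately show ?thesis unfolding Q_def by (simp add: distrib_left)
  qed
  ultimately show ?thesis by simp
qed

text \<open>\<open>u\<close> plays the role of \<open>|v - w|\<^bsup>\<gamma>/2\<^esup> ((v - w) \<times> \<nabla>) log (f(v) f(w))\<close>.\<close>

lemma logarithmic_gradient:
  fixes \<kappa> :: real
  assumes f: "prob_density f"
    and bound: "\<And>b. b \<in> test_fields \<Longrightarrow>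
      - 4 * (\<integral>x. tensor f x * divergence \<gamma> b x \<partial>lborel) - 2 * (\<integral>x. tensor f x * (norm (b x))\<^sup>2 \<partial>lborel) \<le> \<kappa>"
  obtains u where "u \<in> borel_measurable borel" "integrable lborel (\<lambda>x. tensor f x * (norm (u x))\<^sup>2)"
    "2 * (\<integral>x. tensor f x * (norm (u x))\<^sup>2 \<partial>lborel) \<le> \<kappa>"
    "\<And>\<psi> j. C1c off_diagonal \<psi> \<Longrightarrow> (\<integral>x. tensor f x * (norm (rel x) powr (\<gamma>/2) * rotD j \<psi> x) \<partial>lborel) = - (\<integral>x. tensor f x * (u x $ j * \<psi> x) \<partial>lborel)"
proof -
  note [measurable] = tensor_density(1)[OF f]
  have nn: "AE x in lborel. 0 \<le> tensor f x" using tensor_density(2)[OF f] by simp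
  \<comment> \<open>Fields live in L^2 of f tensor f, so u is determined only where f tensor f is
    positive, the region where a logarithmic gradient has a meaning.\<close>
  let ?\<mu> = "density lborel (\<lambda>x. ennreal (tensor f x))"
  have int_\<mu>: "(\<integral>x. g x \<partial>?\<mu>) = (\<integral>x. tensor f x * g x \<partial>lborel)" "integrable ?\<mu> g \<longleftrightarrow> integrable lborel (\<lambda>x. tensor f x * g x)"
    if "g \<in> borel_measurable borel" for g :: "_ \<Rightarrow> real"
    using integral_density[OF _ _ nn, of g] integrable_density[OF _ _ nn, of g] that by simp_all
  define l where "l b = - (\<integral>x. tensor f x * divergence \<gamma> b x \<partial>lborel)" for b
  have sup: "\<exists>K. compact K \<and> (\<forall>x. x \<notin> K \<longrightarrow> b x = 0 \<and> divergence \<gamma> b x = 0)" if b: "b \<in> test_fields" for b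
  proof -
    obtain K where "compact K" "\<And>x. x \<notin> K \<Longrightarrow> b x = 0" "\<And>x j. x \<notin> K \<Longrightarrow> nabla (\<lambda>x. b x $ j) x = 0"
      using test_field_support[OF b] by metis
    then show ?thesis by (intro exI[of _ K]) (simp add: divergence_def rotD_def)
  qed
  have di: "integrable lborel (\<lambda>x. tensor f x * divergence \<gamma> b x)" if b: "b \<in> test_fields" for b
    using sup[OF b] continuous_compact_integrable(1)[OF f divergence_continuous[OF b]] by metis
  have ni: "integrable lborel (\<lambda>x. tensor f x * (norm (b x))\<^sup>2)" if b: "b \<in> test_fields" for b
  proof -
    obtain K where K: "compact K" "\<And>x. x \<notin> K \<Longrightarrow> b x = 0" using sup[OF b] by metis
    show ?thesis
      by (rule continuous_compact_integrable(1)[OF f _ K(1)]) (use K(2) test_field_continuous[OF b] in \<open>auto intro!: continuous_intros\<close>)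
  qed
  have bm: "b \<in> borel_measurable borel" if "b \<in> test_fields" for b
    using test_field_continuous[OF that] by (rule borel_measurable_continuous_onI)
  have lin: "(\<lambda>x. b x + t *\<^sub>R c x) \<in> test_fields" "divergence \<gamma> (\<lambda>x. b x + t *\<^sub>R c x) x = divergence \<gamma> b x + t * divergence \<gamma> c x"
    if "b \<in> test_fields" "c \<in> test_fields" for b c t x
  proof -
    have bj: "C1c off_diagonal (\<lambda>x. b x $ j)" "C1c off_diagonal (\<lambda>x. c x $ j)" for j using that by (auto simp: test_fields_def)
    show "(\<lambda>x. b x + t *\<^sub>R c x) \<in> test_fields" using C1c_add_scale(1)[OF bj] by (simp add: test_fields_def)
    show "divergence \<gamma> (\<lambda>x. b x + t *\<^sub>R c x) x = divergence \<gamma> b x + t * divergence \<gamma> c x"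
      by (simp add: divergence_def rotD_def C1c_add_scale(2)[OF bj] inner_add_left sum.distrib sum_distrib_left algebra_simps)
  qed
  \<comment> \<open>Half of the given inequality is the bound that \<open>L2_representation\<close>
    expects, with constant \<kappa> / 2.\<close>
  obtain u where u: "u \<in> borel_measurable ?\<mu>" "integrable ?\<mu> (\<lambda>x. (norm (u x))\<^sup>2)"
    "(\<integral>x. (norm (u x))\<^sup>2 \<partial>?\<mu>) \<le> \<kappa> / 2" "\<And>b. b \<in> test_fields \<Longrightarrow> l b = (\<integral>x. u x \<bullet> b x \<partial>?\<mu>)"
  proof (rule L2_representation[of test_fields ?\<mu> l "\<kappa> / 2"])
    show "b \<in> borel_measurable ?\<mu>" if "b \<in> test_fields" for b using bm[OF that] by simp
    show "integrable ?\<mu> (\<lambda>x. (norm (b x))\<^sup>2)" if "b \<in> test_fields" for b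
      using ni[OF that] bm[OF that] by (subst int_\<mu>(2)) auto
    show "(\<lambda>x. 0) \<in> test_fields" by (simp add: test_fields_def C1c_zero)
    show "(\<lambda>x. b x + t *\<^sub>R c x) \<in> test_fields" if "b \<in> test_fields" "c \<in> test_fields" for b c t
      by (rule lin(1)[OF that])
    show "l (\<lambda>x. b x + t *\<^sub>R c x) = l b + t * l c" if "b \<in> test_fields" "c \<in> test_fields" for b c t
      unfolding l_def lin(2)[OF that] using di[OF that(1)] di[OF that(2)] by (simp add: distrib_left mult.left_commute)
    show "2 * l b - (\<integral>x. (norm (b x))\<^sup>2 \<partial>?\<mu>) \<le> \<kappa> / 2" if "b \<in> test_fields" for b
    proof -
      have "(\<integral>x. (norm (b x))\<^sup>2 \<partial>?\<mu>) = (\<integral>x. tensor f x * (norm (b x))\<^sup>2 \<partial>lborel)" using bm[OF that] by (intro int_\<mu>(1)) auto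
      then show ?thesis using bound[OF that] by (simp add: l_def)
    qed
  qed blast
  have um[measurable]: "u \<in> borel_measurable borel" using u(1) by simp
  show thesis
  proof (rule that[OF um])
    show "integrable lborel (\<lambda>x. tensor f x * (norm (u x))\<^sup>2)" using u(2) int_\<mu>(2)[of "\<lambda>x. (norm (u x))\<^sup>2"] by simp
    show "2 * (\<integral>x. tensor f x * (norm (u x))\<^sup>2 \<partial>lborel) \<le> \<kappa>" using u(3) int_\<mu>(1)[of "\<lambda>x. (norm (u x))\<^sup>2"] by simp
    fix \<psi> :: "(real^3) \<times> (real^3) \<Rightarrow> real" and j :: 3 assume \<psi>: "C1c off_diagonal \<psi>"
    \<comment> \<open>A scalar test function placed in the j-th slot isolates the j-th component of
      u.\<close>
    let ?b = "\<lambda>x. \<psi> x *\<^sub>R axis j 1 :: real^3"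
    have comp: "(\<lambda>x. ?b x $ i) = (if i = j then \<psi> else (\<lambda>x. 0))" for i by (auto simp: axis_def)
    have b: "?b \<in> test_fields" unfolding test_fields_def mem_Collect_eq comp using \<psi> C1c_zero by auto
    have n0: "nabla (\<lambda>x::(real^3) \<times> (real^3). 0::real) = (\<lambda>x. 0)" using nabla_unique[of "\<lambda>x. 0" 0] by (auto simp: fun_eq_iff)
    have "divergence \<gamma> ?b x = norm (rel x) powr (\<gamma>/2) * rotD j \<psi> x" for x
    proof -
      have "(\<Sum>i\<in>UNIV. rotD i (\<lambda>x. ?b x $ i) x) = (\<Sum>i\<in>UNIV. if i = j then rotD j \<psi> x else 0)"
        unfolding comp by (intro sum.cong refl) (auto simp: rotD_def n0)
      then show ?thesis by (simp add: divergence_def)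
    qed
    then have "- (\<integral>x. tensor f x * (norm (rel x) powr (\<gamma>/2) * rotD j \<psi> x) \<partial>lborel) = (\<integral>x. u x \<bullet> ?b x \<partial>?\<mu>)"
      using u(4)[OF b] by (simp add: l_def)
    also have "\<dots> = (\<integral>x. tensor f x * (u x \<bullet> ?b x) \<partial>lborel)"
      by (rule int_\<mu>(1)[OF borel_measurable_inner[OF um bm[OF b]]])
    also have "\<dots> = (\<integral>x. tensor f x * (u x $ j * \<psi> x) \<partial>lborel)" by (simp add: inner_axis mult.commute)
    finally show "(\<integral>x. tensor f x * (norm (rel x) powr (\<gamma>/2) * rotD j \<psi> x) \<partial>lborel) = - (\<integral>x. tensor f x * (u x $ j * \<psi> x) \<partial>lborel)" by simp
  qed
qed

text \<open>The weight \<open>1 + |v - w|\<^sup>2\<close>, constant along rotations, makes \<open>|v - w|\<^bsup>-\<gamma>/2\<^esup> u f(v) f(w)\<close> integrable.\<close>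

lemma rotD_sqrt_tensor:
  assumes gamma: "- 4 \<le> \<gamma>" "\<gamma> < 0" and f: "prob_density f" and u[measurable]: "u \<in> borel_measurable borel"
    and ui: "integrable lborel (\<lambda>x. tensor f x * (norm (u x))\<^sup>2)"
    and weak: "\<And>\<psi>. C1c off_diagonal \<psi> \<Longrightarrow> (\<integral>x. tensor f x * (norm (rel x) powr (\<gamma>/2) * rotD j \<psi> x) \<partial>lborel) = - (\<integral>x. tensor f x * (u x $ j * \<psi> x) \<partial>lborel)"
    and \<psi>: "C1c off_diagonal \<psi>"
  shows "(\<integral>x. sqrt (tensor f x) * rotD j \<psi> x \<partial>lborel) = - (\<integral>x. sqrt (tensor f x) * (u x $ j * (norm (rel x) powr (- \<gamma>/2) * \<psi> x)) / 2 \<partial>lborel)"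
    "integrable lborel (\<lambda>x. sqrt (tensor f x) * (u x $ j * (norm (rel x) powr (- \<gamma>/2) * \<psi> x)))"
proof -
  note [measurable] = tensor_density(1)[OF f]
  note nn = tensor_density(2)[OF f]
  have [measurable]: "(\<lambda>x. u x $ j) \<in> borel_measurable borel"
    using measurable_compose[OF u, of "\<lambda>v. v $ j" borel] by (simp add: borel_measurable_continuous_onI continuous_on_component)
  let ?d = "\<lambda>x::(real^3) \<times> (real^3). 1 + (norm (rel x))\<^sup>2"
  have d: "0 < ?d x" for x :: "(real^3) \<times> (real^3)" by (simp add: add_pos_nonneg)
  define G where "G x = tensor f x / ?d x" for x
  \<comment> \<open>The expected rotational derivative of sqrt G: one half of sqrt G times the
    logarithmic derivative |v - w|^(-\<gamma>/2) u_j.\<close>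
  define w where "w x = sqrt (G x) * (u x $ j * norm (rel x) powr (- \<gamma>/2)) / 2" for x
  have [measurable]: "G \<in> borel_measurable borel" unfolding G_def by measurable
  have wm: "w \<in> borel_measurable borel" unfolding w_def by measurable
  have Gnn: "0 \<le> G x" for x unfolding G_def using nn d[of x] by simp
  have Gi: "integrable lborel G"
  proof (rule Bochner_Integration.integrable_bound[OF tensor_density(3)[OF f]])
    show "AE x in lborel. norm (G x) \<le> norm (tensor f x)"
    proof (rule AE_I2)
      fix x
      have "G x \<le> tensor f x" unfolding G_def using nn[of x] d[of x] by (simp add: pos_divide_le_eq mult_left_mono algebra_simps)
      then show "norm (G x) \<le> norm (tensor f x)" using Gnn[of x] by simp
    qed
  qed measurable
  have wh: "2 * sqrt (G x) * w x = tensor f x * (u x $ j * (norm (rel x) powr (- \<gamma>/2) / ?d x))" for x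
  proof -
    have "2 * sqrt (G x) * w x = (sqrt (G x) * sqrt (G x)) * (u x $ j * norm (rel x) powr (- \<gamma>/2))" by (simp add: w_def)
    also have "sqrt (G x) * sqrt (G x) = G x" using Gnn by simp
    finally show ?thesis by (simp add: G_def)
  qed
  \<comment> \<open>The exponent -\<gamma>/2 lies in (0, 2] because -4 <= \<gamma> < 0, so the
    quadratic weight dominates this power for small and large r.\<close>
  have pw: "r powr (- \<gamma>/2) \<le> 1 + r\<^sup>2" if "0 \<le> r" for r :: real
  proof (cases "r \<le> 1")
    case True
    have "r powr (- \<gamma>/2) \<le> 1 powr (- \<gamma>/2)" using that True gamma by (intro powr_mono2) auto
    then show ?thesis by (simp add: add_increasing2)
  next
    case False
    have "r powr (- \<gamma>/2) \<le> r powr 2" using False gamma by (intro powr_mono) auto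
    then show ?thesis using False by (simp add: powr_numeral)
  qed
  have hi: "integrable lborel (\<lambda>x. 2 * sqrt (G x) * w x)"
  proof (rule Bochner_Integration.integrable_bound)
    show "integrable lborel (\<lambda>x. tensor f x + tensor f x * (norm (u x))\<^sup>2)" using tensor_density(3)[OF f] ui by simp
    show "(\<lambda>x. 2 * sqrt (G x) * w x) \<in> borel_measurable lborel" using wm by measurable
    show "AE x in lborel. norm (2 * sqrt (G x) * w x) \<le> norm (tensor f x + tensor f x * (norm (u x))\<^sup>2)"
    proof (rule AE_I2)
      fix x
      have "\<bar>u x $ j\<bar> \<le> 1 + (norm (u x))\<^sup>2"
      proof -
        have "\<bar>u x $ j\<bar> \<le> norm (u x)" by (rule component_le_norm_cart)
        also have "\<dots> \<le> 1 + (norm (u x))\<^sup>2"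
          using zero_le_power2[of "norm (u x) - 1/2"] by (simp add: power2_eq_square algebra_simps)
        finally show ?thesis .
      qed
      moreover have "norm (rel x) powr (- \<gamma>/2) / ?d x \<le> 1" using pw[of "norm (rel x)"] d[of x] by (simp add: pos_divide_le_eq)
      ultimately have "\<bar>u x $ j\<bar> * (norm (rel x) powr (- \<gamma>/2) / ?d x) \<le> (1 + (norm (u x))\<^sup>2) * 1"
        using d[of x] by (intro mult_mono) auto
      from mult_left_mono[OF this nn[of x]]
      show "norm (2 * sqrt (G x) * w x) \<le> norm (tensor f x + tensor f x * (norm (u x))\<^sup>2)"
        unfolding wh using nn[of x] d[of x] by (simp add: abs_mult algebra_simps)
    qed
  qed
  have weak': "(\<integral>x. G x * rotD j \<phi> x \<partial>lborel) = - (\<integral>x. 2 * sqrt (G x) * w x * \<phi> x \<partial>lborel)" if \<phi>: "C1c off_diagonal \<phi>" for \<phi>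
  proof -
    let ?k = "\<lambda>r. r powr (- \<gamma>/2) / (1 + r\<^sup>2)"
    let ?k' = "\<lambda>r. ((- \<gamma>/2) * r powr (- \<gamma>/2 - 1) * (1 + r\<^sup>2) - r powr (- \<gamma>/2) * (2 * r)) / ((1 + r\<^sup>2) * (1 + r\<^sup>2))"
    have dk: "(?k has_real_derivative ?k' r) (at r)" if "0 < r" for r
    proof (rule DERIV_divide)
      show "((\<lambda>r. r powr (- \<gamma>/2)) has_real_derivative (- \<gamma>/2) * r powr (- \<gamma>/2 - 1)) (at r)" using that by (rule has_real_derivative_powr)
      show "((\<lambda>r. 1 + r\<^sup>2) has_real_derivative 2 * r) (at r)" by (auto intro!: derivative_eq_intros)
      show "1 + r\<^sup>2 \<noteq> 0" using zero_le_power2[of r] by linarith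
    qed
    have nz: "(1 + r\<^sup>2) * (1 + r\<^sup>2) \<noteq> 0" for r :: real using zero_le_power2[of r] by (metis add_nonneg_eq_0_iff mult_eq_0_iff zero_le_one zero_neq_one)
    have ck: "continuous_on {0<..} ?k'" using nz by (intro continuous_intros) auto
    have R: "C1c off_diagonal (\<lambda>x. ?k (norm (rel x)) * \<phi> x)"
      "rotD j (\<lambda>x. ?k (norm (rel x)) * \<phi> x) x = ?k (norm (rel x)) * rotD j \<phi> x" for x
      by (rule C1c_radial[OF \<phi> dk ck], assumption)+
    have "(\<integral>x. G x * rotD j \<phi> x \<partial>lborel) = (\<integral>x. tensor f x * (norm (rel x) powr (\<gamma>/2) * rotD j (\<lambda>x. ?k (norm (rel x)) * \<phi> x) x) \<partial>lborel)"
    proof (rule integral_cong_AE)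
      show "AE x in lborel. G x * rotD j \<phi> x = tensor f x * (norm (rel x) powr (\<gamma>/2) * rotD j (\<lambda>x. ?k (norm (rel x)) * \<phi> x) x)"
        using AE_off_diagonal
      proof eventually_elim
        case (elim x)
        then have "0 < norm (rel x)" using off_diagonal_iff[of x] by simp
        then have "norm (rel x) powr (\<gamma>/2) * norm (rel x) powr (- \<gamma>/2) = 1" by (simp flip: powr_add)
        then have "norm (rel x) powr (\<gamma>/2) * (?k (norm (rel x)) * rotD j \<phi> x) = rotD j \<phi> x / ?d x" by (simp add: mult.assoc[symmetric])
        then show ?case unfolding R(2) G_def by auto
      qed
    qed (use rotD_measurable[OF \<phi>] rotD_measurable[OF R(1)] in measurable)
    also have "\<dots> = - (\<integral>x. tensor f x * (u x $ j * (?k (norm (rel x)) * \<phi> x)) \<partial>lborel)" by (rule weak[OF R(1)])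
    also have "\<dots> = - (\<integral>x. 2 * sqrt (G x) * w x * \<phi> x \<partial>lborel)" unfolding wh by (simp add: mult.assoc)
    finally show ?thesis .
  qed
  \<comment> \<open>The root of the weight is radial. Placed in the test function it undoes the
    division by 1 + |v - w|^2 under the square root.\<close>
  let ?s = "\<lambda>r::real. sqrt (1 + r\<^sup>2)"
  let ?s' = "\<lambda>r::real. r / sqrt (1 + r\<^sup>2)"
  have p1: "0 < 1 + r\<^sup>2" for r :: real by (simp add: add_pos_nonneg)
  have ds: "(?s has_real_derivative ?s' r) (at r)" if "0 < r" for r
    using p1[of r] by (auto intro!: derivative_eq_intros simp: field_simps)
  have nzs: "sqrt (1 + r\<^sup>2) \<noteq> 0" for r :: real using p1[of r] by simp
  have cs: "continuous_on {0<..} ?s'" using nzs by (intro continuous_intros) auto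
  have S: "C1c off_diagonal (\<lambda>x. ?s (norm (rel x)) * \<psi> x)"
    "rotD j (\<lambda>x. ?s (norm (rel x)) * \<psi> x) x = ?s (norm (rel x)) * rotD j \<psi> x" for x
    by (rule C1c_radial[OF \<psi> ds cs], assumption)+
  have ws: "w x * (?s (norm (rel x)) * \<psi> x) = sqrt (tensor f x) * (u x $ j * (norm (rel x) powr (- \<gamma>/2) * \<psi> x)) / 2" for x
  proof -
    have "sqrt (G x) * ?s (norm (rel x)) = sqrt (tensor f x)" unfolding G_def using d[of x] by (simp add: real_sqrt_divide)
    then show ?thesis unfolding w_def by (simp add: mult_ac)
  qed
  note P = C1c_powr(1)[OF \<psi>, of "- \<gamma>/2"]
  obtain K where K: "compact K" "\<And>x. x \<notin> K \<Longrightarrow> norm (rel x) powr (- \<gamma>/2) * \<psi> x = 0" using C1c_support[OF P] by metis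
  have sq: "integrable lborel (\<lambda>x. (norm (rel x) powr (- \<gamma>/2) * \<psi> x)\<^sup>2)"
    by (rule continuous_compact_integrable(3)[OF f C1c_continuous[OF P] K])
  show int: "integrable lborel (\<lambda>x. sqrt (tensor f x) * (u x $ j * (norm (rel x) powr (- \<gamma>/2) * \<psi> x)))"
  proof (rule Bochner_Integration.integrable_bound)
    show "integrable lborel (\<lambda>x. tensor f x * (norm (u x))\<^sup>2 + (norm (rel x) powr (- \<gamma>/2) * \<psi> x)\<^sup>2)" using ui sq by simp
    show "(\<lambda>x. sqrt (tensor f x) * (u x $ j * (norm (rel x) powr (- \<gamma>/2) * \<psi> x))) \<in> borel_measurable lborel"
      using C1c_measurable[OF P] by measurable
    show "AE x in lborel. norm (sqrt (tensor f x) * (u x $ j * (norm (rel x) powr (- \<gamma>/2) * \<psi> x))) \<le> norm (tensor f x * (norm (u x))\<^sup>2 + (norm (rel x) powr (- \<gamma>/2) * \<psi> x)\<^sup>2)"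
    proof (rule AE_I2)
      fix x
      define A B where "A = sqrt (tensor f x) * norm (u x)" and "B = \<bar>norm (rel x) powr (- \<gamma>/2) * \<psi> x\<bar>"
      have "\<bar>sqrt (tensor f x) * (u x $ j * (norm (rel x) powr (- \<gamma>/2) * \<psi> x))\<bar> = sqrt (tensor f x) * \<bar>u x $ j\<bar> * B"
        using nn[of x] by (simp add: abs_mult B_def)
      also have "\<dots> \<le> A * B" unfolding A_def using nn[of x] component_le_norm_cart[of "u x" j] by (intro mult_right_mono mult_left_mono) (auto simp: B_def)
      also have "\<dots> \<le> A\<^sup>2 + B\<^sup>2"
        using sum_squares_bound[of A B] zero_le_power2[of A] zero_le_power2[of B] by linarith
      also have "A\<^sup>2 = tensor f x * (norm (u x))\<^sup>2" unfolding A_def using nn[of x] by (simp add: power_mult_distrib)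
      also have "B\<^sup>2 = (norm (rel x) powr (- \<gamma>/2) * \<psi> x)\<^sup>2" by (simp add: B_def)
      finally show "norm (sqrt (tensor f x) * (u x $ j * (norm (rel x) powr (- \<gamma>/2) * \<psi> x))) \<le> norm (tensor f x * (norm (u x))\<^sup>2 + (norm (rel x) powr (- \<gamma>/2) * \<psi> x)\<^sup>2)"
        using nn[of x] by simp
    qed
  qed
  have wi: "integrable lborel (\<lambda>x. w x * (?s (norm (rel x)) * \<psi> x))" unfolding ws using int by simp
  have "(\<integral>x. sqrt (G x) * rotD j (\<lambda>x. ?s (norm (rel x)) * \<psi> x) x \<partial>lborel) = - (\<integral>x. w x * (?s (norm (rel x)) * \<psi> x) \<partial>lborel)"
  proof (rule chain_rule_sqrt[OF Gi Gnn wm _ hi _ S(1) wi])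
    show "w x = 0" if "G x = 0" for x using that by (simp add: w_def)
  qed (rule weak')
  moreover have "sqrt (G x) * rotD j (\<lambda>x. ?s (norm (rel x)) * \<psi> x) x = sqrt (tensor f x) * rotD j \<psi> x" for x
    unfolding S(2) G_def using d[of x] by (simp add: real_sqrt_divide)
  ultimately show "(\<integral>x. sqrt (tensor f x) * rotD j \<psi> x \<partial>lborel) = - (\<integral>x. sqrt (tensor f x) * (u x $ j * (norm (rel x) powr (- \<gamma>/2) * \<psi> x)) / 2 \<partial>lborel)"
    unfolding ws by simp
qed

section \<open>The projected gradient in terms of rotational derivatives\<close>

lemma C1c_linear_mult:
  fixes m :: "(real^3) \<times> (real^3) \<Rightarrow> real"
  assumes m: "linear m" and \<psi>: "C1c off_diagonal \<psi>"
  shows "C1c off_diagonal (\<lambda>x. m x * \<psi> x)" "nabla (\<lambda>x. m x * \<psi> x) x \<bullet> h = m x * (nabla \<psi> x \<bullet> h) + \<psi> x * m h"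
proof -
  define g where "g = (\<Sum>i\<in>Basis. m i *\<^sub>R i)"
  have mg: "m h = g \<bullet> h" for h
  proof -
    have "m h = m (\<Sum>i\<in>Basis. (h \<bullet> i) *\<^sub>R i)" by (simp add: euclidean_representation)
    also have "\<dots> = (\<Sum>i\<in>Basis. (h \<bullet> i) * m i)" by (simp only: linear_sum[OF m] linear_scale[OF m] real_scaleR_def)
    also have "\<dots> = g \<bullet> h" unfolding g_def inner_sum_left by (intro sum.cong) (simp_all add: inner_commute)
    finally show ?thesis .
  qed
  have "m = (\<lambda>x. g \<bullet> x)" using mg by auto
  then have d: "(m has_derivative (\<lambda>h. g \<bullet> h)) (at x)" if "x \<in> off_diagonal" for x
    using bounded_linear_imp_has_derivative[OF bounded_linear_inner_right[of g]] by simp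
  have M: "C1c off_diagonal (\<lambda>x. m x * \<psi> x)"
    "nabla (\<lambda>x. m x * \<psi> x) x = (if x \<in> off_diagonal then m x *\<^sub>R nabla \<psi> x + \<psi> x *\<^sub>R g else 0)" for x
    by (rule C1c_mult[OF \<psi> open_off_diagonal d continuous_on_const], assumption)+
  show "C1c off_diagonal (\<lambda>x. m x * \<psi> x)" by (rule M(1))
  obtain K where K: "K \<subseteq> off_diagonal" "\<And>x. x \<notin> K \<Longrightarrow> \<psi> x = 0" "\<And>x. x \<notin> K \<Longrightarrow> nabla \<psi> x = 0"
    using C1c_support[OF \<psi>] by metis
  show "nabla (\<lambda>x. m x * \<psi> x) x \<bullet> h = m x * (nabla \<psi> x \<bullet> h) + \<psi> x * m h"
  proof (cases "x \<in> off_diagonal")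
    case True
    then show ?thesis unfolding M(2) by (simp add: inner_add_left mg)
  next
    case False
    then have "x \<notin> K" using K(1) by auto
    then show ?thesis unfolding M(2) using False K by simp
  qed
qed

lemma linear_cross_rel: "linear (\<lambda>x::(real^3) \<times> (real^3). cross3 a (rel x) $ i)"
  using exhaust_3[of i] by (auto simp: linear_iff cross3_def algebra_simps)

text \<open>The entries of |z|^2 times the projection orthogonal to z, free of division and
  therefore valid at z = 0 too.\<close>

lemma sum_cross_axis:
  fixes z :: "real^3"
  shows "(\<Sum>k\<in>UNIV. cross3 (axis k 1) z $ j * cross3 (axis k 1) z $ i) = (if i = j then (norm z)\<^sup>2 else 0) - z $ i * z $ j"
proof -
  have "(norm z)\<^sup>2 = z $ 1 * z $ 1 + z $ 2 * z $ 2 + z $ 3 * z $ 3"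
    by (simp add: power2_norm_eq_inner inner_vec_def sum_3)
  then show ?thesis
    using exhaust_3[of i] exhaust_3[of j] by (auto simp: sum_3 cross3_def axis_def)
qed

text \<open>Rotation fields are divergence free, written with the direction vectors that occur in
  \<open>landau_rotations\<close>.\<close>

lemma cross_axis_axis: "cross3 (axis k 1) (axis j 1 - - axis j (1::real)) $ j = 0"
  using exhaust_3[of k] exhaust_3[of j] by (auto simp: cross3_def axis_def)

lemma cross_expansion: "cross3 u z $ i = (\<Sum>k\<in>UNIV. u $ k * cross3 (axis k 1) z $ i)"
  using exhaust_3[of i] by (auto simp: sum_3 cross3_def axis_def algebra_simps)

lemma sum_axis_pair: "(\<Sum>j\<in>UNIV. v $ j *\<^sub>R (axis j (1::real), - axis j (1::real))) = (v, - v)"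
proof -
  have "(\<Sum>i\<in>UNIV. v $ i *\<^sub>R axis i 1) = v" using basis_expansion[of v] by (simp add: scalar_mult_eq_scaleR)
  then show ?thesis by (simp add: prod_eq_iff fst_sum snd_sum sum_negf)
qed

text \<open>\<open>r\<^sup>2 \<Pi>[z] = \<Sum>\<^sub>k (e\<^sub>k \<times> z) \<otimes> (e\<^sub>k \<times> z)\<close> turns the projected gradient into derivatives along rotations.\<close>

lemma landau_rotations:
  fixes \<gamma> :: real and i :: 3
  assumes \<phi>: "C1c off_diagonal \<phi>"
  defines "\<psi> \<equiv> \<lambda>k x. cross3 (axis k 1) (rel x) $ i * (norm (rel x) powr (\<gamma>/2 - 1) * \<phi> x)"
  defines "c \<equiv> \<lambda>j x. norm (rel x) powr (1 + \<gamma>/2) * Proj (rel x) $ i $ j * \<phi> x"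
  shows "C1c off_diagonal (\<psi> k)" "C1c off_diagonal (c j)"
    "(\<Sum>j\<in>UNIV. nabla (c j) x \<bullet> (axis j 1, - axis j 1)) = 2 * (\<Sum>k\<in>UNIV. rotD k (\<psi> k) x)"
proof -
  define m where "m k j x = cross3 (axis k 1) (rel x) $ j" for k j :: 3 and x :: "(real^3) \<times> (real^3)"
  have lm: "linear (m k j)" for k j unfolding m_def[abs_def] by (rule linear_cross_rel)
  have \<psi>m: "\<psi> k = (\<lambda>x. m k i x * (norm (rel x) powr (\<gamma>/2 - 1) * \<phi> x))" for k by (simp add: \<psi>_def m_def)
  have C\<psi>: "C1c off_diagonal (\<psi> k)" for k unfolding \<psi>m by (rule C1c_linear_mult(1)[OF lm C1c_powr(1)[OF \<phi>]])
  then show "C1c off_diagonal (\<psi> k)" .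
  define q where "q k j x = m k j x * \<psi> k x" for k j x
  have Q: "C1c off_diagonal (q k j)" "nabla (q k j) x \<bullet> h = m k j x * (nabla (\<psi> k) x \<bullet> h) + \<psi> k x * m k j h" for k j x h
    unfolding q_def[abs_def] by (rule C1c_linear_mult[OF lm C\<psi>])+
  have cx: "c j x = (\<Sum>k\<in>UNIV. q k j x)" for j x
  proof (cases "rel x = 0")
    \<comment> \<open>On the diagonal both sides vanish, the left one by the convention
      \<open>0 powr p = 0\<close>.\<close>
    case True
    then show ?thesis by (simp add: c_def q_def \<psi>_def)
  next
    case False
    define r where "r = norm (rel x)"
    have r: "0 < r" using False by (simp add: r_def)
    have "(\<Sum>k\<in>UNIV. q k j x) = (\<Sum>k\<in>UNIV. m k j x * m k i x) * (r powr (\<gamma>/2 - 1) * \<phi> x)"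
      unfolding sum_distrib_right by (intro sum.cong) (auto simp: q_def \<psi>m r_def)
    also have "\<dots> = ((if i = j then r\<^sup>2 else 0) - rel x $ i * rel x $ j) * (r powr (\<gamma>/2 - 1) * \<phi> x)"
      unfolding m_def sum_cross_axis r_def ..
    also have "(if i = j then r\<^sup>2 else 0) - rel x $ i * rel x $ j = r\<^sup>2 * Proj (rel x) $ i $ j"
    proof -
      have P: "Proj (rel x) $ i $ j = (if i = j then 1 else 0) - rel x $ i * rel x $ j / r\<^sup>2" by (simp add: Proj_def r_def)
      have "r\<^sup>2 * (s - t / r\<^sup>2) = r\<^sup>2 * s - t" for s t using r by (simp add: field_simps)
      then show ?thesis unfolding P by simp
    qed
    also have "r\<^sup>2 * Proj (rel x) $ i $ j * (r powr (\<gamma>/2 - 1) * \<phi> x) = (r powr 2 * r powr (\<gamma>/2 - 1)) * Proj (rel x) $ i $ j * \<phi> x"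
      using r by (simp add: powr_numeral)
    also have "r powr 2 * r powr (\<gamma>/2 - 1) = r powr (1 + \<gamma>/2)" by (simp flip: powr_add)
    finally show ?thesis by (simp add: c_def r_def)
  qed
  have cj: "c j = (\<lambda>x. q 1 j x + 1 * (q 2 j x + 1 * q 3 j x))" for j by (simp add: fun_eq_iff cx sum_3)
  show "C1c off_diagonal (c j)" unfolding cj by (intro C1c_add_scale(1) Q(1))
  have nc: "nabla (c j) x \<bullet> h = (\<Sum>k\<in>UNIV. m k j x * (nabla (\<psi> k) x \<bullet> h) + \<psi> k x * m k j h)" for j h
    unfolding cj C1c_add_scale(2)[OF Q(1) C1c_add_scale(1)[OF Q(1) Q(1)]] C1c_add_scale(2)[OF Q(1) Q(1)]
    by (simp add: inner_add_left sum_3 Q(2))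
  \<comment> \<open>No derivative of the rotation fields survives, so all derivatives fall on the
    test functions \<psi>.\<close>
  have m0: "m k j (axis j 1, - axis j 1) = 0" for k j by (simp only: m_def fst_conv snd_conv cross_axis_axis)
  have "(\<Sum>j\<in>UNIV. nabla (c j) x \<bullet> (axis j 1, - axis j 1)) = (\<Sum>j\<in>UNIV. \<Sum>k\<in>UNIV. m k j x * (nabla (\<psi> k) x \<bullet> (axis j 1, - axis j 1)))"
    unfolding nc m0 by simp
  also have "\<dots> = (\<Sum>k\<in>UNIV. \<Sum>j\<in>UNIV. m k j x * (nabla (\<psi> k) x \<bullet> (axis j 1, - axis j 1)))" by (rule sum.swap)
  also have "\<dots> = (\<Sum>k\<in>UNIV. 2 * rotD k (\<psi> k) x)"
  proof (rule sum.cong[OF refl])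
    fix k :: 3
    have "(\<Sum>j\<in>UNIV. m k j x * (nabla (\<psi> k) x \<bullet> (axis j 1, - axis j 1))) = nabla (\<psi> k) x \<bullet> (\<Sum>j\<in>UNIV. cross3 (axis k 1) (rel x) $ j *\<^sub>R (axis j 1, - axis j 1))"
      unfolding inner_sum_right inner_scaleR_right m_def ..
    also have "(\<Sum>j\<in>UNIV. cross3 (axis k 1) (rel x) $ j *\<^sub>R (axis j 1, - axis j (1::real))) = 2 *\<^sub>R rotfield k x"
      unfolding sum_axis_pair by (simp add: rotfield_def)
    finally show "(\<Sum>j\<in>UNIV. m k j x * (nabla (\<psi> k) x \<bullet> (axis j 1, - axis j 1))) = 2 * rotD k (\<psi> k) x"
      by (simp only: inner_scaleR_right rotD_def)
  qed
  finally show "(\<Sum>j\<in>UNIV. nabla (c j) x \<bullet> (axis j 1, - axis j 1)) = 2 * (\<Sum>k\<in>UNIV. rotD k (\<psi> k) x)"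
    by (simp only: sum_distrib_left)
qed

lemma sqrt_tensor_integrable:
  assumes f: "prob_density f" and \<psi>: "C1c off_diagonal \<psi>"
  shows "integrable lborel (\<lambda>x. sqrt (tensor f x) * (nabla \<psi> x \<bullet> h))" "integrable lborel (\<lambda>x. sqrt (tensor f x) * rotD k \<psi> x)"
proof -
  obtain K where K: "compact K" "\<And>x. x \<notin> K \<Longrightarrow> nabla \<psi> x = 0" using C1c_support[OF \<psi>] by metis
  have c: "continuous_on UNIV (nabla \<psi>)" using \<psi> by (simp add: C1c_def)
  show "integrable lborel (\<lambda>x. sqrt (tensor f x) * (nabla \<psi> x \<bullet> h))"
    by (rule continuous_compact_integrable(2)[OF f continuous_on_inner[OF c continuous_on_const] K(1)]) (simp add: K(2))
  show "integrable lborel (\<lambda>x. sqrt (tensor f x) * rotD k \<psi> x)"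
    by (rule continuous_compact_integrable(2)[OF f continuous_on_rotD[OF \<psi>] K(1)]) (simp add: K(2) rotD_def)
qed

text \<open>Derivatives and coefficients are moved onto the test function, where
  \<open>landau_rotations\<close> regroups them; the 2 compensates the halves in
  \<open>rotfield\<close>.\<close>

lemma landau_dist_rotD:
  assumes f: "prob_density f" and \<phi>: "C1c off_diagonal \<phi>"
  shows "landau_dist \<gamma> f i \<phi> =
    - 2 * (\<Sum>k\<in>UNIV. \<integral>x. sqrt (tensor f x) * rotD k (\<lambda>x. cross3 (axis k 1) (rel x) $ i * (norm (rel x) powr (\<gamma>/2 - 1) * \<phi> x)) x \<partial>lborel)"
proof -
  define \<psi> where "\<psi> = (\<lambda>k x. cross3 (axis k 1) (rel x) $ i * (norm (rel x) powr (\<gamma>/2 - 1) * \<phi> x))"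
  define c where "c = (\<lambda>j x. norm (rel x) powr (1 + \<gamma>/2) * Proj (rel x) $ i $ j * \<phi> x)"
  have L: "C1c off_diagonal (\<psi> k)" "C1c off_diagonal (c j)"
    "(\<Sum>j\<in>UNIV. nabla (c j) x \<bullet> (axis j 1, - axis j 1)) = 2 * (\<Sum>k\<in>UNIV. rotD k (\<psi> k) x)" for k j x
    unfolding \<psi>_def c_def by (rule landau_rotations[OF \<phi>])+
  let ?e = "\<lambda>j::3. (axis j 1, - axis j 1) :: (real^3) \<times> (real^3)"
  have ss: "(\<lambda>(v, w). sqrt (f v * f w)) = (\<lambda>x. sqrt (tensor f x))" by (auto simp: tensor_def fun_eq_iff)
  have cc: "(\<lambda>x. (case x of (v, w) \<Rightarrow> norm (v - w) powr (1 + \<gamma>/2) * Proj (v - w) $ i $ j) * \<phi> x) = c j" for j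
    by (auto simp: c_def fun_eq_iff)
  have fd: "(\<lambda>x. frechet_derivative (c j) (at x) h) = (\<lambda>x. nabla (c j) x \<bullet> h)" for j h
    using L(2)[of j] frechet_derivative_nabla[of "c j"] unfolding C1c_def by blast
  note I = sqrt_tensor_integrable(1)[OF f L(2)]
  have "landau_dist \<gamma> f i \<phi> = (\<Sum>j\<in>UNIV. - (\<integral>x. sqrt (tensor f x) * (nabla (c j) x \<bullet> (axis j 1, 0)) \<partial>lborel)
      - - (\<integral>x. sqrt (tensor f x) * (nabla (c j) x \<bullet> (0, axis j 1)) \<partial>lborel))"
    unfolding landau_dist_def Let_def dist_mult_def dist_deriv_def dist_of_fun_def cc ss fd ..
  also have "\<dots> = (\<Sum>j\<in>UNIV. - (\<integral>x. sqrt (tensor f x) * (nabla (c j) x \<bullet> ?e j) \<partial>lborel))"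
  proof (rule sum.cong[OF refl])
    fix j :: 3
    have "?e j = (axis j 1, 0) - (0, axis j 1)" by simp
    then have "(\<integral>x. sqrt (tensor f x) * (nabla (c j) x \<bullet> ?e j) \<partial>lborel)
      = (\<integral>x. sqrt (tensor f x) * (nabla (c j) x \<bullet> (axis j 1, 0)) - sqrt (tensor f x) * (nabla (c j) x \<bullet> (0, axis j 1)) \<partial>lborel)"
      by (simp only: inner_diff_right right_diff_distrib)
    also have "\<dots> = (\<integral>x. sqrt (tensor f x) * (nabla (c j) x \<bullet> (axis j 1, 0)) \<partial>lborel) - (\<integral>x. sqrt (tensor f x) * (nabla (c j) x \<bullet> (0, axis j 1)) \<partial>lborel)"
      by (rule Bochner_Integration.integral_diff[OF I I])
    finally show "- (\<integral>x. sqrt (tensor f x) * (nabla (c j) x \<bullet> (axis j 1, 0)) \<partial>lborel)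
      - - (\<integral>x. sqrt (tensor f x) * (nabla (c j) x \<bullet> (0, axis j 1)) \<partial>lborel) = - (\<integral>x. sqrt (tensor f x) * (nabla (c j) x \<bullet> ?e j) \<partial>lborel)" by linarith
  qed
  also have "\<dots> = - (\<integral>x. (\<Sum>j\<in>UNIV. sqrt (tensor f x) * (nabla (c j) x \<bullet> ?e j)) \<partial>lborel)"
    by (subst Bochner_Integration.integral_sum) (auto simp: sum_negf intro: I)
  also have "\<dots> = - (\<integral>x. (\<Sum>k\<in>UNIV. 2 * (sqrt (tensor f x) * rotD k (\<psi> k) x)) \<partial>lborel)"
    by (simp only: sum_distrib_left[symmetric] L(3) mult.left_commute)
  also have "\<dots> = - (\<Sum>k\<in>UNIV. \<integral>x. 2 * (sqrt (tensor f x) * rotD k (\<psi> k) x) \<partial>lborel)"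
    by (subst Bochner_Integration.integral_sum) (auto intro!: sqrt_tensor_integrable(2)[OF f L(1)])
  also have "\<dots> = - 2 * (\<Sum>k\<in>UNIV. \<integral>x. sqrt (tensor f x) * rotD k (\<psi> k) x \<partial>lborel)"
    by (simp add: sum_distrib_left sum_negf)
  finally show ?thesis unfolding \<psi>_def .
qed

text \<open>The weight |v - w|^(-\<gamma>/2) that comes with u and the weight |v - w|^(\<gamma>/2 -
  1) of the projected gradient multiply to 1 / |v - w|, while the fields e_k x z weighted by u_k add
  up to u x z. A cross product with a vector of length at most one does not increase the norm,
  whence the inequality.\<close>

lemma landau_representation:
  assumes gamma: "- 4 \<le> \<gamma>" "\<gamma> < 0" and f: "prob_density f" and u[measurable]: "u \<in> borel_measurable borel"
    and ui: "integrable lborel (\<lambda>x. tensor f x * (norm (u x))\<^sup>2)"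
    and weak: "\<And>\<psi> j. C1c off_diagonal \<psi> \<Longrightarrow> (\<integral>x. tensor f x * (norm (rel x) powr (\<gamma>/2) * rotD j \<psi> x) \<partial>lborel) = - (\<integral>x. tensor f x * (u x $ j * \<psi> x) \<partial>lborel)"
  defines "H \<equiv> \<lambda>x. sqrt (tensor f x) *\<^sub>R cross3 (u x) (rel x /\<^sub>R norm (rel x))"
  shows "landau_L2_rep \<gamma> f H" "(\<integral>\<^sup>+x. ennreal ((norm (H x))\<^sup>2) \<partial>lborel) \<le> ennreal (\<integral>x. tensor f x * (norm (u x))\<^sup>2 \<partial>lborel)"
proof -
  note [measurable] = tensor_density(1)[OF f]
  note nn = tensor_density(2)[OF f]
  have "(\<lambda>p. cross3 (fst p) (snd p)) \<in> borel_measurable (borel :: ((real^3) \<times> (real^3)) measure)"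
    by (intro borel_measurable_continuous_onI continuous_on_cross continuous_intros)
  from measurable_compose[OF borel_measurable_Pair[of u borel "\<lambda>x. rel x /\<^sub>R norm (rel x)"] this]
  have [measurable]: "(\<lambda>x. cross3 (u x) (rel x /\<^sub>R norm (rel x))) \<in> borel_measurable borel" by simp
  have Hm: "H \<in> borel_measurable borel" unfolding H_def by measurable
  have Hle: "(norm (H x))\<^sup>2 \<le> tensor f x * (norm (u x))\<^sup>2" for x
  proof -
    have "norm (z /\<^sub>R norm z) \<le> 1" for z :: "real^3" by (cases "z = 0") simp_all
    from this[of "rel x"]
    have "norm (u x) * norm (rel x /\<^sub>R norm (rel x)) \<le> norm (u x) * 1" by (rule mult_left_mono) simp
    with norm_cross3_le[of "u x" "rel x /\<^sub>R norm (rel x)"]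
    have "norm (cross3 (u x) (rel x /\<^sub>R norm (rel x))) \<le> norm (u x)" by linarith
    then have "(norm (cross3 (u x) (rel x /\<^sub>R norm (rel x))))\<^sup>2 \<le> (norm (u x))\<^sup>2" by (rule power_mono) simp
    from mult_left_mono[OF this nn[of x]] show ?thesis
      unfolding H_def norm_scaleR power_mult_distrib using nn[of x] by simp
  qed
  show le: "(\<integral>\<^sup>+x. ennreal ((norm (H x))\<^sup>2) \<partial>lborel) \<le> ennreal (\<integral>x. tensor f x * (norm (u x))\<^sup>2 \<partial>lborel)"
    unfolding nn_integral_eq_integral[OF ui AE_I2, OF mult_nonneg_nonneg[OF nn zero_le_power2], symmetric]
    by (intro nn_integral_mono ennreal_leI Hle)
  have eq: "landau_dist \<gamma> f i \<phi> = dist_of_fun (\<lambda>x. H x $ i) \<phi>" if "test_function off_diagonal \<phi>" for i \<phi>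
  proof -
    have \<phi>: "C1c off_diagonal \<phi>" by (rule test_function_C1c[OF that])
    let ?\<psi> = "\<lambda>k x. cross3 (axis k 1) (rel x) $ i * (norm (rel x) powr (\<gamma>/2 - 1) * \<phi> x)"
    have C: "C1c off_diagonal (?\<psi> k)" for k by (rule landau_rotations(1)[OF \<phi>])
    let ?J = "\<lambda>k x. sqrt (tensor f x) * (u x $ k * (norm (rel x) powr (- \<gamma>/2) * ?\<psi> k x))"
    have J: "(\<integral>x. sqrt (tensor f x) * rotD k (?\<psi> k) x \<partial>lborel) = - (\<integral>x. ?J k x / 2 \<partial>lborel)" "integrable lborel (?J k)" for k
      by (rule rotD_sqrt_tensor[OF gamma f u ui weak C], assumption)+
    have "landau_dist \<gamma> f i \<phi> = (\<Sum>k\<in>UNIV. \<integral>x. ?J k x \<partial>lborel)"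
      unfolding landau_dist_rotD[OF f \<phi>] J(1) by (simp add: sum_negf sum_distrib_left)
    also have "\<dots> = (\<integral>x. (\<Sum>k\<in>UNIV. ?J k x) \<partial>lborel)"
      by (rule Bochner_Integration.integral_sum[symmetric]) (rule J(2))
    also have "\<dots> = (\<integral>x. H x $ i * \<phi> x \<partial>lborel)"
    proof (rule integral_cong_AE)
      show "(\<lambda>x. \<Sum>k\<in>UNIV. ?J k x) \<in> borel_measurable lborel"
        by (rule borel_measurable_integrable, rule Bochner_Integration.integrable_sum, rule J(2))
      have "(\<lambda>x. H x $ i) \<in> borel_measurable borel"
        by (rule measurable_compose[OF Hm borel_measurable_continuous_onI]) (rule continuous_on_component[OF continuous_on_id])
      then show "(\<lambda>x. H x $ i * \<phi> x) \<in> borel_measurable lborel" using C1c_measurable[OF \<phi>] by simp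
      show "AE x in lborel. (\<Sum>k\<in>UNIV. ?J k x) = H x $ i * \<phi> x"
        using AE_off_diagonal
      proof eventually_elim
        case (elim x)
        define r where "r = norm (rel x)"
        have r: "0 < r" using elim off_diagonal_iff[of x] by (simp add: r_def)
        have p: "r powr (- \<gamma>/2) * r powr (\<gamma>/2 - 1) = inverse r"
          using r powr_minus[of r 1] by (simp flip: powr_add)
        have "(\<Sum>k\<in>UNIV. ?J k x) = (\<Sum>k\<in>UNIV. u x $ k * cross3 (axis k 1) (rel x) $ i) * (sqrt (tensor f x) * (r powr (- \<gamma>/2) * r powr (\<gamma>/2 - 1)) * \<phi> x)"
          unfolding sum_distrib_right r_def by (intro sum.cong) (simp_all add: mult_ac)
        also have "\<dots> = H x $ i * \<phi> x"
          unfolding p cross_expansion[symmetric] by (simp add: H_def r_def cross_mult_right)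
        finally show ?case .
      qed
    qed
    finally show ?thesis by (simp add: dist_of_fun_def)
  qed
  show "landau_L2_rep \<gamma> f H"
    unfolding landau_L2_rep_def using Hm le eq by (auto intro: order.strict_trans1)
qed

text \<open>The Landau dissipation evaluates an arbitrarily chosen representative, so its value can
  be read off another one only once both agree almost everywhere. Componentwise this is the
  fundamental lemma, and the diagonal is a null set.\<close>

lemma landau_L2_rep_unique:
  assumes f: "prob_density f" and H: "landau_L2_rep \<gamma> f H" "landau_L2_rep \<gamma> f H'"
  shows "AE x in lborel. H x = H' x"
proof -
  have sq: "(\<lambda>x. A x $ i) \<in> borel_measurable borel" "integrable lborel (\<lambda>x. (A x $ i)\<^sup>2)"
    if A: "landau_L2_rep \<gamma> f A" for A i
  proof -
    have Am[measurable]: "A \<in> borel_measurable borel" using A by (simp add: landau_L2_rep_def)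
    show m[measurable]: "(\<lambda>x. A x $ i) \<in> borel_measurable borel"
      by (rule measurable_compose[OF Am borel_measurable_continuous_onI]) (rule continuous_on_component[OF continuous_on_id])
    have "integrable lborel (\<lambda>x. (norm (A x))\<^sup>2)"
      by (rule integrableI_nonneg) (use A in \<open>auto simp: landau_L2_rep_def\<close>)
    then show "integrable lborel (\<lambda>x. (A x $ i)\<^sup>2)"
    proof (rule Bochner_Integration.integrable_bound)
      show "AE x in lborel. norm ((A x $ i)\<^sup>2) \<le> norm ((norm (A x))\<^sup>2)"
        using power_mono[OF component_le_norm_cart abs_ge_zero, of _ i 2] by (intro AE_I2) simp
    qed measurable
  qed
  have bnd: "\<bar>a * b\<bar> \<le> a\<^sup>2 + b\<^sup>2" for a b :: real
    using sum_squares_bound[of "\<bar>a\<bar>" "\<bar>b\<bar>"] zero_le_power2[of a] zero_le_power2[of b] unfolding abs_mult power2_abs by linarith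
  have prod: "integrable lborel (\<lambda>x. A x $ i * \<psi> x)"
    if A: "landau_L2_rep \<gamma> f A" and \<psi>: "\<psi> \<in> borel_measurable borel" "integrable lborel (\<lambda>x. (\<psi> x)\<^sup>2)" for A i and \<psi> :: "_ \<Rightarrow> real"
  proof (rule Bochner_Integration.integrable_bound)
    show "integrable lborel (\<lambda>x. (A x $ i)\<^sup>2 + (\<psi> x)\<^sup>2)" using sq(2)[OF A] \<psi>(2) by simp
    show "(\<lambda>x. A x $ i * \<psi> x) \<in> borel_measurable lborel" using sq(1)[OF A] \<psi>(1) by simp
    show "AE x in lborel. norm (A x $ i * \<psi> x) \<le> norm ((A x $ i)\<^sup>2 + (\<psi> x)\<^sup>2)" using bnd by (intro AE_I2) simp
  qed
  have "AE x in lborel. H x $ i = H' x $ i" for i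
  proof -
    have "AE x in lborel. x \<in> off_diagonal \<longrightarrow> H x $ i - H' x $ i = 0"
    proof (rule fundamental_lemma[OF open_off_diagonal])
      fix a b :: "(real^3) \<times> (real^3)"
      have "integrable lborel (\<lambda>x. A x $ i * indicator (cbox a b) x)" if "landau_L2_rep \<gamma> f A" for A
      proof (rule prod[OF that])
        have "(indicator (cbox a b) x :: real)\<^sup>2 = indicator (cbox a b) x" for x by (simp add: indicator_def)
        then show "integrable lborel (\<lambda>x. (indicator (cbox a b) x :: real)\<^sup>2)"
          using emeasure_bounded_finite[OF bounded_cbox, of a b] by (simp only:) (rule integrable_real_indicator; simp)
      qed simp
      from Bochner_Integration.integrable_diff[OF this[OF H(1)] this[OF H(2)]]
      show "set_integrable lborel (cbox a b) (\<lambda>x. H x $ i - H' x $ i)"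
        unfolding set_integrable_def by (simp add: algebra_simps)
    next
      fix \<psi> :: "(real^3) \<times> (real^3) \<Rightarrow> real" assume t: "test_function off_diagonal \<psi>"
      have C: "C1c off_diagonal \<psi>" by (rule test_function_C1c[OF t])
      obtain K where K: "compact K" "\<And>x. x \<notin> K \<Longrightarrow> \<psi> x = 0" using C1c_support[OF C] by metis
      have i2: "integrable lborel (\<lambda>x. (\<psi> x)\<^sup>2)" by (rule continuous_compact_integrable(3)[OF f C1c_continuous[OF C] K])
      have "(\<integral>x. (H x $ i - H' x $ i) * \<psi> x \<partial>lborel) = (\<integral>x. H x $ i * \<psi> x \<partial>lborel) - (\<integral>x. H' x $ i * \<psi> x \<partial>lborel)"
        using prod[OF H(1) C1c_measurable[OF C] i2] prod[OF H(2) C1c_measurable[OF C] i2] by (simp add: left_diff_distrib)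
      also have "\<dots> = 0" using H t by (simp add: landau_L2_rep_def dist_of_fun_def)
      finally show "(\<integral>x. (H x $ i - H' x $ i) * \<psi> x \<partial>lborel) = 0" .
    qed
    with AE_off_diagonal show ?thesis by eventually_elim simp
  qed
  then have "AE x in lborel. \<forall>i. H x $ i = H' x $ i" by (simp add: AE_all_countable)
  then show ?thesis by eventually_elim (simp add: vec_eq_iff)
qed

lemma landau_dissipation_eq:
  assumes f: "prob_density f" and H: "landau_L2_rep \<gamma> f H"
  shows "landau_dissipation \<gamma> f = 2 * (\<integral>\<^sup>+ x. ennreal ((norm (H x))\<^sup>2) \<partial>lborel)"
proof -
  have ex: "\<exists>G. landau_L2_rep \<gamma> f G" using H by blast
  have "AE x in lborel. (SOME G. landau_L2_rep \<gamma> f G) x = H x"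
    by (rule landau_L2_rep_unique[OF f someI_ex[OF ex] H])
  then have "(\<integral>\<^sup>+ x. ennreal ((norm ((SOME G. landau_L2_rep \<gamma> f G) x))\<^sup>2) \<partial>lborel) = (\<integral>\<^sup>+ x. ennreal ((norm (H x))\<^sup>2) \<partial>lborel)"
    by (intro nn_integral_cong_AE, elim eventually_mono) simp
  then show ?thesis unfolding landau_dissipation_def using ex by simp
qed

theorem proposition6p1:
  fixes \<gamma> \<nu> c\<^sub>1 :: real
    and \<beta> :: "real \<Rightarrow> real"
    and F :: "real \<Rightarrow> real^3 \<Rightarrow> real"
    and f :: "real^3 \<Rightarrow> real"
  assumes gamma: "- 4 \<le> \<gamma>" "\<gamma> < 0"
    and beta_meas: "\<beta> \<in> borel_measurable borel"
    and beta_nonneg: "\<And>\<theta>. 0 \<le> \<beta> \<theta>"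
    and beta_supp: "closure {\<theta>. \<beta> \<theta> \<noteq> 0} \<subseteq> {0..pi/2}"
    and beta_bdd: "\<And>\<delta>. 0 < \<delta> \<Longrightarrow> bdd_above (\<beta> ` {\<delta>..pi/2})"
    and nu: "0 < \<nu>" "\<nu> < 2"
    and c1: "0 < c\<^sub>1"
    and beta_lower: "\<And>\<theta>. \<theta> \<in> {0<..pi/2} \<Longrightarrow> c\<^sub>1 * \<theta> powr (- 1 - \<nu>) \<le> \<beta> \<theta>"
    and beta_norm: "(\<integral>\<^sup>+ \<theta>\<in>{0..pi/2}. ennreal (\<theta>\<^sup>2 * \<beta> \<theta>) \<partial>lborel) = ennreal (8 / pi)"
    and dens_eps: "\<And>\<epsilon>. 0 < \<epsilon> \<Longrightarrow> prob_density (F \<epsilon>)"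
    and moment_bound: "(SUP \<epsilon>\<in>{0<..}. second_moment (F \<epsilon>)) < \<infinity>"
    and entropy_bound: "(SUP \<epsilon>\<in>{0<..}. H_functional (F \<epsilon>)) < \<infinity>"
    and dens: "prob_density f"
    and conv: "weak_star_conv F f (at_right 0)"
  shows "Liminf (at_right 0) (\<lambda>\<epsilon>. boltzmann_dissipation (collision_kernel \<gamma> \<beta> \<epsilon>) (F \<epsilon>))
           \<ge> landau_dissipation \<gamma> f"
proof -
  let ?L = "Liminf (at_right 0) (\<lambda>\<epsilon>. boltzmann_dissipation (collision_kernel \<gamma> \<beta> \<epsilon>) (F \<epsilon>))"
  show ?thesis
  \<comment> \<open>A finite lower limit is the real constant \<kappa> that bounds the dual
    functional for all test fields; an infinite one dominates everything.\<close>
  proof (cases "?L = \<infinity>")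
    case False
    then obtain \<kappa> where \<kappa>: "0 \<le> \<kappa>" "?L = ennreal \<kappa>" by (cases ?L) auto
    have bound: "- 4 * (\<integral>x. tensor f x * divergence \<gamma> b x \<partial>lborel) - 2 * (\<integral>x. tensor f x * (norm (b x))\<^sup>2 \<partial>lborel) \<le> \<kappa>"
      if "b \<in> test_fields" for b
      by (rule liminf_bound[OF beta_meas beta_nonneg beta_bdd beta_norm dens_eps dens conv \<kappa> that])
    obtain u where u: "u \<in> borel_measurable borel" "integrable lborel (\<lambda>x. tensor f x * (norm (u x))\<^sup>2)"
      "2 * (\<integral>x. tensor f x * (norm (u x))\<^sup>2 \<partial>lborel) \<le> \<kappa>"
      "\<And>\<psi> j. C1c off_diagonal \<psi> \<Longrightarrow> (\<integral>x. tensor f x * (norm (rel x) powr (\<gamma>/2) * rotD j \<psi> x) \<partial>lborel) = - (\<integral>x. tensor f x * (u x $ j * \<psi> x) \<partial>lborel)"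
      using logarithmic_gradient[OF dens bound] by blast
    define H where "H = (\<lambda>x. sqrt (tensor f x) *\<^sub>R cross3 (u x) (rel x /\<^sub>R norm (rel x)))"
    have rep: "landau_L2_rep \<gamma> f H"
      "(\<integral>\<^sup>+x. ennreal ((norm (H x))\<^sup>2) \<partial>lborel) \<le> ennreal (\<integral>x. tensor f x * (norm (u x))\<^sup>2 \<partial>lborel)"
      unfolding H_def by (rule landau_representation[OF gamma dens u(1,2,4)], assumption)+
    \<comment> \<open>The factor 2 in the Landau dissipation meets the bound \<kappa> / 2 on the
      squared norm of u, so no constant is lost.\<close>
    have "landau_dissipation \<gamma> f \<le> 2 * ennreal (\<integral>x. tensor f x * (norm (u x))\<^sup>2 \<partial>lborel)"
      unfolding landau_dissipation_eq[OF dens rep(1)] using rep(2) by (intro mult_left_mono) auto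
    also have "\<dots> = ennreal (2 * (\<integral>x. tensor f x * (norm (u x))\<^sup>2 \<partial>lborel))" by (simp add: ennreal_mult')
    also have "\<dots> \<le> ?L" unfolding \<kappa>(2) using u(3) by (rule ennreal_leI)
    finally show ?thesis .
  qed simp
qed

end
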